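(* Let $M$ be an $n$-dimensional smooth manifold, let $k\ge 1$, and let $S\in\mathfrak{X}(T^{2k-1}M)$ be a semispray of order $2k-1$. (i) $S$ is a Lagrangian semispray if and only if there exists a (locally defined) regular Lagrangian $L$ of order $k$ such that either one of the following two equivalent conditions is satisfied: $$\mathcal{L}_S\theta_L=dL,\qquad i_S\omega_L=d\mathcal{E}_L .$$ (ii) $S$ is a Lagrangian semispray if and only if there exists a (locally defined) semi-basic $1$-form $\theta$ of order $k$ on $T^{2k-1}M$ such that $\operatorname{rank}(d\theta)=2kn$ and the $1$-form $\mathcal{L}_S\theta$ is closed. In this case $\theta$ is the Poincar\'e-Cartan $1$-form of some locally defined regular Lagrangian $L$ of order $k$.
   Context: All objects are smooth. $M$ is a real $n$-dimensional smooth manifold. For $r\ge 1$, $T^rM=J^r_0M$ is the bundle of $r$-jets at $0$ of curves from neighbourhoods of $0\in\mathbb{R}$ to $M$, with induced local coordinates $(x^i,y^{(1)i},\dots,y^{(r)i})$, where $y^{(\alpha)i}(j^r_0c)=\frac{1}{\alpha!}\frac{d^\alpha (x^i\circ c)}{dt^\alpha}\big|_{t=0}$, and $y^{(0)i}:=x^i$, $T^0M=M$. The canonical submersions are $\pi^r_\alpha:T^rM\to T^\alpha M$; functions on $T^\alpha M$ are identified with their pull-backs to $T^rM$. $T^r_0M=\{y^{(1)}\ne 0\}\subset T^rM$. A curve $c$ in $M$, with $r$-jet lift $j^rc$ in $T^rM$, is regular if $j^rc$ takes values in $T^r_0M$. Tangent structure on $T^rM$: $J=\sum_{\alpha=1}^{r}\frac{\partial}{\partial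 y^{(\alpha)i}}\otimes dy^{(\alpha-1)i}$; $J^\alpha$ is its $\alpha$-fold composition. Liouville vector fields: $\mathbb{C}_\alpha=\sum_{\beta=1}^{r+1-\alpha}\beta\, y^{(\beta)i}\frac{\partial}{\partial y^{(\alpha+\beta-1)i}}$, $\alpha\in\{1,\dots,r\}$. For a function $f$, $d_{J^\alpha}f=df\circ J^\alpha$. A $1$-form on $T^rM$ is semi-basic of order $\alpha\in\{1,\dots,r\}$ if it is semi-basic with respect to $\pi^r_{\alpha-1}$, i.e. vanishes on $\operatorname{Ker}D\pi^r_{\alpha-1}=\operatorname{Im}J^\alpha$; locally it has the form $\sum_{\beta=0}^{\alpha-1}\theta_{(\beta)i}\,dy^{(\beta)i}$ with $\theta_{(\beta)i}$ functions on $T^rM$. A semispray of order $r$ is a vector field $S$ on $T^rM$ with $JS=\mathbb{C}_1$; locally $S=y^{(1)i}\frac{\partial}{\partial x^i}+2y^{(2)i}\frac{\partial}{\partial y^{(1)i}}+\dots+ry^{(r)i}\frac{\partial}{\partial y^{(r-1)i}}-(r+1)G^i\frac{\partial}{\partial y^{(r)i}}$. A regular curve $c$ is a geodesic of $S$ if $S\circ j^rc=(j^rc)'$; locally, $\frac{1}{(r+1)!}\frac{d^{r+1}x^i}{dt^{r+1}}+G^i\big(x,\frac{dx}{dt},\dots,\frac{1}{r!}\frac{d^rx}{dt^r}\big)=0$. A Lagrangian of order $k$ is a function $L$ on $T^kM$. With $J$, $\mathbb{C}_\alpha$ taken on $T^{2k-1}M$ and $S$ any semispray of order $2k-1$ (the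 result does not depend on the choice), its Poincar\'e-Cartan $1$-form and $2$-form and energy are $$\theta_L=\sum_{\alpha=1}^k\frac{(-1)^{\alpha-1}}{\alpha!}\mathcal{L}_S^{\alpha-1}d_{J^\alpha}L,\quad \omega_L=-d\theta_L,\quad \mathcal{E}_L=\sum_{\alpha=1}^k\frac{(-1)^{\alpha-1}}{\alpha!}\mathcal{L}_S^{\alpha-1}\mathbb{C}_\alpha(L)-L .$$ $L$ is regular if $\omega_L$ is a symplectic form on $T^{2k-1}M$ (equivalently, $\frac{\partial^2L}{\partial y^{(k)i}\partial y^{(k)j}}$ has rank $n$). A semispray $S$ of order $2k-1$ is called a Lagrangian semispray if its geodesics are solutions to the Euler-Lagrange equations $$\frac{\partial L}{\partial x^i}-\frac{1}{1!}\frac{d}{dt}\Big(\frac{\partial L}{\partial y^{(1)i}}\Big)+\dots+\frac{(-1)^k}{k!}\frac{d^k}{dt^k}\Big(\frac{\partial L}{\partial y^{(k)i}}\Big)=0$$ for some regular Lagrangian $L$ of order $k$, defined locally on some open domain in $T^kM$. "Locally defined" objects live on open domains, and the conditions involving them are understood on those domains.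
   Formalization: In the equivalence of (ii), θ is defined on the full preimage in T^{2k-1}M of an open subset of T^kM (for arbitrary open domains "if" fails when k ≥ 2); for θ on any open domain it is shown that locally θ = θ_L with L regular and the geodesics of S there solve its Euler-Lagrange equations. *)

theory Defs
  imports "HOL-Analysis.Analysis"
begin

text \<open>
  Coordinates are indexed by a finite set \<open>I\<close> of indices of some type; a coordinate tuple is a
  function that vanishes outside \<open>I\<close>. For \<open>M\<close> the index set is the finite type \<open>'n\<close> itself, with
  \<open>n = CARD('n)\<close>; for the jet bundle of order \<open>r\<close> it is \<open>{0..r} \<times> 'n\<close>, the index \<open>(\<alpha>, i)\<close> standing
  for the coordinate given by the \<open>\<alpha>\<close>-th derivative of \<open>x\<^sup>i\<close> divided by \<open>\<alpha>!\<close>. The topology on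
  coordinate tuples is the product topology, which on tuples supported in \<open>I\<close> is the Euclidean
  one.
\<close>

definition coord_space :: "'i set \<Rightarrow> ('i \<Rightarrow> real) set" where
  "coord_space I = {v. \<forall>a. a \<notin> I \<longrightarrow> v a = 0}"

definition pd :: "'i \<Rightarrow> (('i \<Rightarrow> real) \<Rightarrow> real) \<Rightarrow> ('i \<Rightarrow> real) \<Rightarrow> real" where
  "pd a f v = deriv (\<lambda>s. f (v(a := s))) (v a)"

text \<open>Smoothness (on a relatively open set \<open>V\<close> of \<open>coord_space I\<close>): all iterated partial
  derivatives exist and are continuous.\<close>

definition smooth_on :: "'i set \<Rightarrow> ('i \<Rightarrow> real) set \<Rightarrow> (('i \<Rightarrow> real) \<Rightarrow> real) \<Rightarrow> bool" where
  "smooth_on I V f \<longleftrightarrow>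
     (\<forall>as \<in> lists I. continuous_on V (foldr pd as f) \<and>
        (\<forall>a\<in>I. \<forall>v\<in>V. (\<lambda>s. foldr pd as f (v(a := s))) field_differentiable (at (v a))))"

datatype ('p, 'i) chart = Chart (cdom: "'p set") (coords: "'p \<Rightarrow> 'i \<Rightarrow> real")

definition param :: "('p, 'i) chart \<Rightarrow> ('i \<Rightarrow> real) \<Rightarrow> 'p" where
  "param \<kappa> = inv_into (cdom \<kappa>) (coords \<kappa>)"

definition open_set :: "'i set \<Rightarrow> ('p, 'i) chart set \<Rightarrow> 'p set \<Rightarrow> bool" where
  "open_set I \<A> W \<longleftrightarrow> W \<subseteq> \<Union> (cdom ` \<A>) \<and>
     (\<forall>\<kappa>\<in>\<A>. openin (top_of_set (coord_space I)) (coords \<kappa> ` (W \<inter> cdom \<kappa>)))"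

definition chart_smooth ::
  "'i set \<Rightarrow> ('p, 'i) chart \<Rightarrow> 'p set \<Rightarrow> ('p \<Rightarrow> real) \<Rightarrow> bool" where
  "chart_smooth I \<kappa> W f \<longleftrightarrow> smooth_on I (coords \<kappa> ` (W \<inter> cdom \<kappa>)) (f \<circ> param \<kappa>)"

definition smooth_function ::
  "'i set \<Rightarrow> ('p, 'i) chart set \<Rightarrow> 'p set \<Rightarrow> ('p \<Rightarrow> real) \<Rightarrow> bool" where
  "smooth_function I \<A> W f \<longleftrightarrow> (\<forall>\<kappa>\<in>\<A>. chart_smooth I \<kappa> W f)"

definition cpd :: "('p, 'i) chart \<Rightarrow> 'i \<Rightarrow> ('p \<Rightarrow> real) \<Rightarrow> 'p \<Rightarrow> real" where
  "cpd \<kappa> a f p = pd a (f \<circ> param \<kappa>) (coords \<kappa> p)"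

text \<open>
  Vector fields and forms are given classically, by their components in every chart of the atlas,
  subject to the usual transformation laws. The operations on them are given by their coordinate
  expressions in each chart. Scalars obtained from such operations are likewise
  recorded chart by chart.
\<close>

type_synonym ('p, 'i) scalars = "('p, 'i) chart \<Rightarrow> 'p \<Rightarrow> real"
type_synonym ('p, 'i) comps1 = "('p, 'i) chart \<Rightarrow> 'p \<Rightarrow> 'i \<Rightarrow> real"
type_synonym ('p, 'i) comps2 = "('p, 'i) chart \<Rightarrow> 'p \<Rightarrow> 'i \<Rightarrow> 'i \<Rightarrow> real"

definition vector_field ::
  "'i set \<Rightarrow> ('p, 'i) chart set \<Rightarrow> 'p set \<Rightarrow> ('p, 'i) comps1 \<Rightarrow> bool" where
  "vector_field I \<A> W X \<longleftrightarrow>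
     (\<forall>\<kappa>\<in>\<A>. \<forall>a\<in>I. chart_smooth I \<kappa> W (\<lambda>p. X \<kappa> p a)) \<and>
     (\<forall>\<kappa>\<in>\<A>. \<forall>\<kappa>'\<in>\<A>. \<forall>p \<in> W \<inter> cdom \<kappa> \<inter> cdom \<kappa>'. \<forall>b\<in>I.
        X \<kappa>' p b = (\<Sum>a\<in>I. X \<kappa> p a * cpd \<kappa> a (\<lambda>q. coords \<kappa>' q b) p))"

definition one_form ::
  "'i set \<Rightarrow> ('p, 'i) chart set \<Rightarrow> 'p set \<Rightarrow> ('p, 'i) comps1 \<Rightarrow> bool" where
  "one_form I \<A> W \<theta> \<longleftrightarrow>
     (\<forall>\<kappa>\<in>\<A>. \<forall>a\<in>I. chart_smooth I \<kappa> W (\<lambda>p. \<theta> \<kappa> p a)) \<and>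
     (\<forall>\<kappa>\<in>\<A>. \<forall>\<kappa>'\<in>\<A>. \<forall>p \<in> W \<inter> cdom \<kappa> \<inter> cdom \<kappa>'. \<forall>a\<in>I.
        \<theta> \<kappa> p a = (\<Sum>b\<in>I. \<theta> \<kappa>' p b * cpd \<kappa> a (\<lambda>q. coords \<kappa>' q b) p))"

definition two_form ::
  "'i set \<Rightarrow> ('p, 'i) chart set \<Rightarrow> 'p set \<Rightarrow> ('p, 'i) comps2 \<Rightarrow> bool" where
  "two_form I \<A> W \<omega> \<longleftrightarrow>
     (\<forall>\<kappa>\<in>\<A>. \<forall>a\<in>I. \<forall>b\<in>I. chart_smooth I \<kappa> W (\<lambda>p. \<omega> \<kappa> p a b)) \<and>
     (\<forall>\<kappa>\<in>\<A>. \<forall>p \<in> W \<inter> cdom \<kappa>. \<forall>a\<in>I. \<forall>b\<in>I. \<omega> \<kappa> p a b = - \<omega> \<kappa> p b a) \<and>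
     (\<forall>\<kappa>\<in>\<A>. \<forall>\<kappa>'\<in>\<A>. \<forall>p \<in> W \<inter> cdom \<kappa> \<inter> cdom \<kappa>'. \<forall>a\<in>I. \<forall>b\<in>I.
        \<omega> \<kappa> p a b = (\<Sum>c\<in>I. \<Sum>e\<in>I. \<omega> \<kappa>' p c e *
                      cpd \<kappa> a (\<lambda>q. coords \<kappa>' q c) p * cpd \<kappa> b (\<lambda>q. coords \<kappa>' q e) p))"

definition eq_on ::
  "'i set \<Rightarrow> ('p, 'i) chart set \<Rightarrow> 'p set \<Rightarrow> ('p, 'i) comps1 \<Rightarrow> ('p, 'i) comps1 \<Rightarrow> bool" where
  "eq_on I \<A> W \<theta> \<eta> \<longleftrightarrow> (\<forall>\<kappa>\<in>\<A>. \<forall>p \<in> W \<inter> cdom \<kappa>. \<forall>a\<in>I. \<theta> \<kappa> p a = \<eta> \<kappa> p a)"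

definition vf_app :: "'i set \<Rightarrow> ('p, 'i) comps1 \<Rightarrow> ('p, 'i) scalars \<Rightarrow> ('p, 'i) scalars" where
  "vf_app I X f = (\<lambda>\<kappa> p. \<Sum>a\<in>I. X \<kappa> p a * cpd \<kappa> a (f \<kappa>) p)"

definition ext_d0 :: "('p, 'i) scalars \<Rightarrow> ('p, 'i) comps1" where
  "ext_d0 f = (\<lambda>\<kappa> p a. cpd \<kappa> a (f \<kappa>) p)"

definition ext_d1 :: "('p, 'i) comps1 \<Rightarrow> ('p, 'i) comps2" where
  "ext_d1 \<theta> = (\<lambda>\<kappa> p a b. cpd \<kappa> a (\<lambda>q. \<theta> \<kappa> q b) p - cpd \<kappa> b (\<lambda>q. \<theta> \<kappa> q a) p)"

definition lie :: "'i set \<Rightarrow> ('p, 'i) comps1 \<Rightarrow> ('p, 'i) comps1 \<Rightarrow> ('p, 'i) comps1" where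
  "lie I X \<theta> = (\<lambda>\<kappa> p a. \<Sum>b\<in>I. X \<kappa> p b * cpd \<kappa> b (\<lambda>q. \<theta> \<kappa> q a) p
                              + \<theta> \<kappa> p b * cpd \<kappa> a (\<lambda>q. X \<kappa> q b) p)"

definition interior_prod :: "'i set \<Rightarrow> ('p, 'i) comps1 \<Rightarrow> ('p, 'i) comps2 \<Rightarrow> ('p, 'i) comps1" where
  "interior_prod I X \<omega> = (\<lambda>\<kappa> p a. \<Sum>b\<in>I. X \<kappa> p b * \<omega> \<kappa> p b a)"

definition closed1 ::
  "'i set \<Rightarrow> ('p, 'i) chart set \<Rightarrow> 'p set \<Rightarrow> ('p, 'i) comps1 \<Rightarrow> bool" where
  "closed1 I \<A> W \<eta> \<longleftrightarrow>
     (\<forall>\<kappa>\<in>\<A>. \<forall>p \<in> W \<inter> cdom \<kappa>. \<forall>a\<in>I. \<forall>b\<in>I. ext_d1 \<eta> \<kappa> p a b = 0)"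

definition closed2 ::
  "'i set \<Rightarrow> ('p, 'i) chart set \<Rightarrow> 'p set \<Rightarrow> ('p, 'i) comps2 \<Rightarrow> bool" where
  "closed2 I \<A> W \<omega> \<longleftrightarrow>
     (\<forall>\<kappa>\<in>\<A>. \<forall>p \<in> W \<inter> cdom \<kappa>. \<forall>a\<in>I. \<forall>b\<in>I. \<forall>c\<in>I.
        cpd \<kappa> a (\<lambda>q. \<omega> \<kappa> q b c) p + cpd \<kappa> b (\<lambda>q. \<omega> \<kappa> q c a) p
          + cpd \<kappa> c (\<lambda>q. \<omega> \<kappa> q a b) p = 0)"

definition matrix_rank :: "'i set \<Rightarrow> ('i \<Rightarrow> 'i \<Rightarrow> real) \<Rightarrow> nat" where
  "matrix_rank I m = Max (card ` {B. B \<subseteq> I \<and>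
     (\<forall>c. (\<forall>a\<in>I. (\<Sum>b\<in>B. c b * m b a) = 0) \<longrightarrow> (\<forall>b\<in>B. c b = 0))})"

definition has_rank ::
  "'i set \<Rightarrow> ('p, 'i) chart set \<Rightarrow> 'p set \<Rightarrow> ('p, 'i) comps2 \<Rightarrow> nat \<Rightarrow> bool" where
  "has_rank I \<A> W \<omega> m \<longleftrightarrow> (\<forall>\<kappa>\<in>\<A>. \<forall>p \<in> W \<inter> cdom \<kappa>. matrix_rank I (\<omega> \<kappa> p) = m)"

definition symplectic ::
  "'i set \<Rightarrow> ('p, 'i) chart set \<Rightarrow> 'p set \<Rightarrow> ('p, 'i) comps2 \<Rightarrow> bool" where
  "symplectic I \<A> W \<omega> \<longleftrightarrow> two_form I \<A> W \<omega> \<and> closed2 I \<A> W \<omega> \<and>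
     (\<forall>\<kappa>\<in>\<A>. \<forall>p \<in> W \<inter> cdom \<kappa>. \<forall>v.
        (\<forall>a\<in>I. (\<Sum>b\<in>I. v b * \<omega> \<kappa> p b a) = 0) \<longrightarrow> (\<forall>b\<in>I. v b = 0))"

text \<open>The manifold is the whole (Hausdorff, second countable) type \<open>'m\<close>; \<open>A\<close> need not be maximal.\<close>

definition smooth_manifold ::
  "('m::{t2_space,second_countable_topology}, 'n::finite) chart set \<Rightarrow> bool" where
  "smooth_manifold A \<longleftrightarrow>
     \<Union> (cdom ` A) = UNIV \<and>
     (\<forall>\<phi>\<in>A. open (cdom \<phi>) \<and> open (coords \<phi> ` cdom \<phi>) \<and>
        homeomorphism (cdom \<phi>) (coords \<phi> ` cdom \<phi>) (coords \<phi>) (param \<phi>)) \<and>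
     (\<forall>\<phi>\<in>A. \<forall>\<psi>\<in>A. \<forall>i. chart_smooth UNIV \<phi> (cdom \<psi>) (\<lambda>p. coords \<psi> p i))"

text \<open>Curves are total functions of which only the values on \<open>T\<close> matter.\<close>

definition smooth_curve ::
  "('m::topological_space, 'n) chart set \<Rightarrow> real set \<Rightarrow> (real \<Rightarrow> 'm) \<Rightarrow> bool" where
  "smooth_curve A T c \<longleftrightarrow> open T \<and> continuous_on T c \<and>
     (\<forall>\<phi>\<in>A. \<forall>t\<in>T. c t \<in> cdom \<phi> \<longrightarrow>
        (\<forall>i m. (deriv ^^ m) (\<lambda>s. coords \<phi> (c s) i) field_differentiable (at t)))"

definition smooth_near_0 :: "('m::topological_space, 'n) chart set \<Rightarrow> (real \<Rightarrow> 'm) \<Rightarrow> bool" where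
  "smooth_near_0 A c \<longleftrightarrow> (\<exists>T. 0 \<in> T \<and> smooth_curve A T c)"

type_synonym 'm jet = "(real \<Rightarrow> 'm) set"

definition same_jet ::
  "('m::topological_space, 'n) chart set \<Rightarrow> nat \<Rightarrow> (real \<Rightarrow> 'm) \<Rightarrow> (real \<Rightarrow> 'm) \<Rightarrow> bool" where
  "same_jet A r c c' \<longleftrightarrow> c 0 = c' 0 \<and>
     (\<forall>\<phi>\<in>A. c 0 \<in> cdom \<phi> \<longrightarrow> (\<forall>i. \<forall>\<alpha>\<le>r.
        (deriv ^^ \<alpha>) (\<lambda>s. coords \<phi> (c s) i) 0 = (deriv ^^ \<alpha>) (\<lambda>s. coords \<phi> (c' s) i) 0))"

definition jet ::
  "('m::topological_space, 'n) chart set \<Rightarrow> nat \<Rightarrow> (real \<Rightarrow> 'm) \<Rightarrow> 'm jet" where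
  "jet A r c = {c'. smooth_near_0 A c' \<and> same_jet A r c c'}"

definition TJ :: "('m::topological_space, 'n) chart set \<Rightarrow> nat \<Rightarrow> 'm jet set" where
  "TJ A r = jet A r ` {c. smooth_near_0 A c}"

definition jet_rep :: "'m jet \<Rightarrow> real \<Rightarrow> 'm" where
  "jet_rep j = (SOME c. c \<in> j)"

definition jet_proj ::
  "('m::topological_space, 'n) chart set \<Rightarrow> nat \<Rightarrow> 'm jet \<Rightarrow> 'm jet" where
  "jet_proj A \<alpha> j = jet A \<alpha> (jet_rep j)"

definition jet_idx :: "nat \<Rightarrow> (nat \<times> 'n::finite) set" where
  "jet_idx r = {0..r} \<times> UNIV"

definition jet_chart ::
  "('m::topological_space, 'n) chart set \<Rightarrow> nat \<Rightarrow> ('m, 'n) chart \<Rightarrow> ('m jet, nat \<times> 'n) chart" where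
  "jet_chart A r \<phi> = Chart {j \<in> TJ A r. jet_rep j 0 \<in> cdom \<phi>}
     (\<lambda>j (\<alpha>, i). if \<alpha> \<le> r then (deriv ^^ \<alpha>) (\<lambda>s. coords \<phi> (jet_rep j s) i) 0 / fact \<alpha> else 0)"

definition jet_atlas ::
  "('m::topological_space, 'n) chart set \<Rightarrow> nat \<Rightarrow> ('m jet, nat \<times> 'n) chart set" where
  "jet_atlas A r = jet_chart A r ` A"

definition jets_over ::
  "('m::topological_space, 'n) chart set \<Rightarrow> nat \<Rightarrow> nat \<Rightarrow> 'm jet set \<Rightarrow> 'm jet set" where
  "jets_over A r k U = {j \<in> TJ A r. jet_proj A k j \<in> U}"

definition slit ::
  "('m::topological_space, 'n) chart set \<Rightarrow> nat \<Rightarrow> 'm jet set" where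
  "slit A r = {j \<in> TJ A r. \<forall>\<kappa>\<in>jet_atlas A r. j \<in> cdom \<kappa> \<longrightarrow> (\<exists>i. coords \<kappa> j (1, i) \<noteq> 0)}"

definition jet_lift ::
  "('m::topological_space, 'n) chart set \<Rightarrow> nat \<Rightarrow> (real \<Rightarrow> 'm) \<Rightarrow> real \<Rightarrow> 'm jet" where
  "jet_lift A r c t = jet A r (\<lambda>s. c (t + s))"

text \<open>The tangent structure acting on the components of a tangent vector in any induced chart.\<close>

definition tangent_J :: "nat \<Rightarrow> (nat \<times> 'n \<Rightarrow> real) \<Rightarrow> nat \<times> 'n \<Rightarrow> real" where
  "tangent_J r v = (\<lambda>(\<alpha>, i). if 1 \<le> \<alpha> \<and> \<alpha> \<le> r then v (\<alpha> - 1, i) else 0)"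

text \<open>The component at \<open>(\<gamma>, i)\<close> is the coefficient with \<open>\<gamma> = \<alpha> + \<beta> - 1\<close>, that is
  \<open>\<beta> = \<gamma> + 1 - \<alpha>\<close>, where \<open>1 \<le> \<beta> \<le> r + 1 - \<alpha>\<close>.\<close>

definition liouville :: "nat \<Rightarrow> nat \<Rightarrow> ('p, nat \<times> 'n) comps1" where
  "liouville r \<alpha> = (\<lambda>\<kappa> p (\<gamma>, i).
     if \<alpha> \<le> \<gamma> \<and> \<gamma> \<le> r then real (\<gamma> + 1 - \<alpha>) * coords \<kappa> p (\<gamma> + 1 - \<alpha>, i) else 0)"

text \<open>The composition of a 1-form with the \<open>\<alpha>\<close>-th power of the tangent structure, evaluated on the
  coordinate vector fields.\<close>

definition comp_J :: "nat \<Rightarrow> nat \<Rightarrow> ('p, nat \<times> 'n::finite) comps1 \<Rightarrow> ('p, nat \<times> 'n) comps1" where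
  "comp_J r \<alpha> \<eta> = (\<lambda>\<kappa> p a.
     \<Sum>b\<in>jet_idx r. \<eta> \<kappa> p b * (tangent_J r ^^ \<alpha>) (\<lambda>c. if c = a then 1 else 0) b)"

definition semi_basic ::
  "('m::topological_space, 'n::finite) chart set \<Rightarrow> nat \<Rightarrow> nat \<Rightarrow> 'm jet set
     \<Rightarrow> ('m jet, nat \<times> 'n) comps1 \<Rightarrow> bool" where
  "semi_basic A r \<alpha> W \<theta> \<longleftrightarrow> one_form (jet_idx r) (jet_atlas A r) W \<theta> \<and>
     (\<forall>\<kappa>\<in>jet_atlas A r. \<forall>p \<in> W \<inter> cdom \<kappa>. \<forall>v.
        (\<Sum>b\<in>jet_idx r. \<theta> \<kappa> p b * (tangent_J r ^^ \<alpha>) v b) = 0)"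

definition semispray ::
  "('m::topological_space, 'n::finite) chart set \<Rightarrow> nat \<Rightarrow> ('m jet, nat \<times> 'n) comps1 \<Rightarrow> bool" where
  "semispray A r S \<longleftrightarrow> vector_field (jet_idx r) (jet_atlas A r) (TJ A r) S \<and>
     eq_on (jet_idx r) (jet_atlas A r) (TJ A r) (\<lambda>\<kappa> p. tangent_J r (S \<kappa> p)) (liouville r 1)"

definition geodesic ::
  "('m::topological_space, 'n::finite) chart set \<Rightarrow> nat \<Rightarrow> ('m jet, nat \<times> 'n) comps1
     \<Rightarrow> real set \<Rightarrow> (real \<Rightarrow> 'm) \<Rightarrow> bool" where
  "geodesic A r S T c \<longleftrightarrow> connected T \<and> smooth_curve A T c \<and> (\<forall>t\<in>T. jet_lift A r c t \<in> slit A r) \<and>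
     (\<forall>t\<in>T. \<forall>\<kappa>\<in>jet_atlas A r. jet_lift A r c t \<in> cdom \<kappa> \<longrightarrow> (\<forall>a\<in>jet_idx r.
        S \<kappa> (jet_lift A r c t) a = deriv (\<lambda>s. coords \<kappa> (jet_lift A r c s) a) t))"

definition pullback ::
  "('m::topological_space, 'n) chart set \<Rightarrow> nat \<Rightarrow> ('m jet \<Rightarrow> real) \<Rightarrow> ('m jet, nat \<times> 'n) scalars" where
  "pullback A k L = (\<lambda>\<kappa> p. L (jet_proj A k p))"

text \<open>In the next three definitions, and in that of regularity, \<open>S\<close> is an auxiliary
  semispray of order \<open>2 * k - 1\<close>, on the choice of which the result does not depend.\<close>

definition pc_one_form ::
  "('m::topological_space, 'n::finite) chart set \<Rightarrow> nat \<Rightarrow> ('m jet, nat \<times> 'n) comps1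
     \<Rightarrow> ('m jet \<Rightarrow> real) \<Rightarrow> ('m jet, nat \<times> 'n) comps1" where
  "pc_one_form A k S L = (\<lambda>\<kappa> p a. \<Sum>\<alpha>=1..k. (-1) ^ (\<alpha> - 1) / fact \<alpha> *
     (lie (jet_idx (2 * k - 1)) S ^^ (\<alpha> - 1))
       (comp_J (2 * k - 1) \<alpha> (ext_d0 (pullback A k L))) \<kappa> p a)"

definition pc_two_form ::
  "('m::topological_space, 'n::finite) chart set \<Rightarrow> nat \<Rightarrow> ('m jet, nat \<times> 'n) comps1
     \<Rightarrow> ('m jet \<Rightarrow> real) \<Rightarrow> ('m jet, nat \<times> 'n) comps2" where
  "pc_two_form A k S L = (\<lambda>\<kappa> p a b. - ext_d1 (pc_one_form A k S L) \<kappa> p a b)"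

definition pc_energy ::
  "('m::topological_space, 'n::finite) chart set \<Rightarrow> nat \<Rightarrow> ('m jet, nat \<times> 'n) comps1
     \<Rightarrow> ('m jet \<Rightarrow> real) \<Rightarrow> ('m jet, nat \<times> 'n) scalars" where
  "pc_energy A k S L = (\<lambda>\<kappa> p. (\<Sum>\<alpha>=1..k. (-1) ^ (\<alpha> - 1) / fact \<alpha> *
     (vf_app (jet_idx (2 * k - 1)) S ^^ (\<alpha> - 1))
       (vf_app (jet_idx (2 * k - 1)) (liouville (2 * k - 1) \<alpha>) (pullback A k L)) \<kappa> p)
     - pullback A k L \<kappa> p)"

text \<open>\<open>L\<close> is a regular Lagrangian of order \<open>k\<close> defined on the open domain \<open>U\<close>. Being locally
  defined includes that \<open>U\<close> is nonempty.\<close>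

definition regular_lagrangian ::
  "('m::topological_space, 'n::finite) chart set \<Rightarrow> nat \<Rightarrow> ('m jet, nat \<times> 'n) comps1
     \<Rightarrow> 'm jet set \<Rightarrow> ('m jet \<Rightarrow> real) \<Rightarrow> bool" where
  "regular_lagrangian A k S U L \<longleftrightarrow>
     open_set (jet_idx k) (jet_atlas A k) U \<and> U \<noteq> {} \<and>
     smooth_function (jet_idx k) (jet_atlas A k) U L \<and>
     symplectic (jet_idx (2 * k - 1)) (jet_atlas A (2 * k - 1)) (jets_over A (2 * k - 1) k U)
       (pc_two_form A k S L)"

definition euler_lagrange_at ::
  "('m::topological_space, 'n::finite) chart set \<Rightarrow> nat \<Rightarrow> ('m jet \<Rightarrow> real)
     \<Rightarrow> (real \<Rightarrow> 'm) \<Rightarrow> real \<Rightarrow> bool" where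
  "euler_lagrange_at A k L c t \<longleftrightarrow>
     (\<forall>\<kappa>\<in>jet_atlas A k. jet_lift A k c t \<in> cdom \<kappa> \<longrightarrow> (\<forall>i.
        (\<Sum>\<alpha>=0..k. (-1) ^ \<alpha> / fact \<alpha> *
           (deriv ^^ \<alpha>) (\<lambda>s. cpd \<kappa> (\<alpha>, i) L (jet_lift A k c s)) t) = 0))"

text \<open>\<open>W\<close> is the domain on which the condition is understood: the geodesics of \<open>S\<close>
  are solutions to the Euler-Lagrange equations of \<open>L\<close> as long as their lifts stay in the open set \<open>W\<close> of jets of order \<open>2 * k - 1\<close>.\<close>

definition geodesics_solve_EL ::
  "('m::topological_space, 'n::finite) chart set \<Rightarrow> nat \<Rightarrow> ('m jet, nat \<times> 'n) comps1
     \<Rightarrow> 'm jet set \<Rightarrow> ('m jet \<Rightarrow> real) \<Rightarrow> bool" where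
  "geodesics_solve_EL A k S W L \<longleftrightarrow>
     (\<forall>T c. geodesic A (2 * k - 1) S T c \<longrightarrow>
        (\<forall>t\<in>T. jet_lift A (2 * k - 1) c t \<in> W \<longrightarrow> euler_lagrange_at A k L c t))"

text \<open>A condition involving a Lagrangian with domain \<open>U\<close> is understood on all jets of order
  \<open>2 * k - 1\<close> that lie over \<open>U\<close>.\<close>

definition lagrangian_semispray ::
  "('m::topological_space, 'n::finite) chart set \<Rightarrow> nat \<Rightarrow> ('m jet, nat \<times> 'n) comps1 \<Rightarrow> bool" where
  "lagrangian_semispray A k S \<longleftrightarrow> semispray A (2 * k - 1) S \<and>
     (\<exists>U L. regular_lagrangian A k S U L \<and>
        geodesics_solve_EL A k S (jets_over A (2 * k - 1) k U) L)"

definition lagrangian_form ::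
  "('m::topological_space, 'n::finite) chart set \<Rightarrow> nat \<Rightarrow> ('m jet, nat \<times> 'n) comps1
     \<Rightarrow> 'm jet set \<Rightarrow> ('m jet, nat \<times> 'n) comps1 \<Rightarrow> bool" where
  "lagrangian_form A k S W \<theta> \<longleftrightarrow>
     semi_basic A (2 * k - 1) k W \<theta> \<and>
     has_rank (jet_idx (2 * k - 1)) (jet_atlas A (2 * k - 1)) W (ext_d1 \<theta>) (2 * k * CARD('n)) \<and>
     closed1 (jet_idx (2 * k - 1)) (jet_atlas A (2 * k - 1)) W (lie (jet_idx (2 * k - 1)) S \<theta>)"

end

theory Submission
  imports Defs
begin

text \<open>
  The theorem comes from an algebraic identity in a single induced chart. Let \<open>D\<close> be the
  derivative along the semispray \<open>S\<close>, and describe a form by its components \<open>\<eta> (\<delta>, i)\<close>. Since \<open>S\<close>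
  moves the coordinate \<open>(\<delta>, i)\<close> with velocity \<open>(\<delta> + 1) y(\<delta> + 1, i)\<close>, the Lie derivative of a form
  without top component has the components
  \<open>(\<Lambda> \<eta>) (\<delta>, i) = D (\<eta> (\<delta>, i)) + \<delta> \<eta> (\<delta> - 1, i)\<close>, while composition with the tangent structure is the
  shift \<open>(J \<eta>) (\<delta>, i) = \<eta> (\<delta> + 1, i)\<close>. These two operators satisfy the Heisenberg relation
  \<open>J \<Lambda> - \<Lambda> J = 1\<close>, hence \<open>J \<Lambda>^m = \<Lambda>^m J + m \<Lambda>^(m - 1)\<close> (\<open>shift_spray_lie_funpow\<close>), and therefore \<open>J\<close> applied to
  \<open>dL - \<L>\<^sub>S \<theta>\<^sub>L = \<Sum>\<^sub>\<alpha> (-1)\<^sup>\<alpha> / \<alpha>! \<Lambda>\<^sup>\<alpha> J\<^sup>\<alpha> dL\<close> telescopes to zero. So \<open>\<L>\<^sub>S \<theta>\<^sub>L\<close> and \<open>dL\<close> differ only in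
  the components along \<open>dx\<^sup>i\<close>, and there by \<open>E\<^sub>i = \<Sum>\<^sub>\<alpha> (-1)\<^sup>\<alpha> / \<alpha>! D\<^sup>\<alpha> (\<partial>L / \<partial>y(\<alpha>, i))\<close>
  (\<open>spray_lie_cartan\<close>): the equation \<open>\<L>\<^sub>S \<theta>\<^sub>L = dL\<close> says exactly that all \<open>E\<^sub>i\<close> vanish.

  The lift of a geodesic is an integral curve of \<open>S\<close>, so along it \<open>D\<close> becomes \<open>d/dt\<close> and \<open>E\<^sub>i\<close> becomes
  the left-hand side of the Euler-Lagrange equations. If all \<open>E\<^sub>i\<close> vanish then geodesics are solutions.
  For the converse there is a geodesic through every jet with \<open>y(1) \<noteq> 0\<close> (\<open>local_flow\<close>, by Picard
  iteration), and these jets are dense. The Hamiltonian form of the equation is Cartan's formula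
  together with \<open>i\<^sub>S \<theta>\<^sub>L = \<E>\<^sub>L + L\<close>. This is part (i).

  For part (ii), the equations \<open>(\<Lambda> \<theta>) (\<delta>, i) = \<partial>L / \<partial>y(\<delta>, i)\<close> for \<open>0 < \<delta> \<le> k\<close> determine a semi-basic form
  \<open>\<theta>\<close> of order \<open>k\<close> by descending recursion (\<open>cartan_form_unique\<close>). Given \<open>\<theta>\<close> with \<open>\<L>\<^sub>S \<theta>\<close> closed, the
  Poincare lemma yields a primitive of \<open>\<L>\<^sub>S \<theta>\<close> on a box. As \<open>\<L>\<^sub>S \<theta>\<close> has no components of order greater
  than \<open>k\<close>, the primitive is a Lagrangian \<open>L\<close> of order \<open>k\<close>, and uniqueness gives \<open>\<theta> = \<theta>\<^sub>L\<close>. Regularity of \<open>L\<close>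
  has to hold on whole fibres over its domain, while \<open>\<theta>\<close> may be given on a part of them only.
  It does, because the matrix of \<open>d\<theta>\<^sub>L\<close> is anti-triangular with nonzero multiples of the Hessian of \<open>L\<close>
  on the antidiagonal (\<open>cartan_form_nondeg_iff\<close>), and the Hessian depends on the jet of order \<open>k\<close> only.

  Finally, all operations have to be compatible with changes of induced charts. For the Lie and
  exterior derivatives this is the chain rule and the symmetry of second derivatives. For the tangent
  structure it is the fact that the Jacobian of such a change is a block Toeplitz matrix (\<open>prolong_toeplitz\<close>).
\<close>

section \<open>Smooth functions of finitely many coordinates\<close>

text \<open>Neighbourhoods of \<open>v\<close> within the tuples supported in \<open>I\<close>; for finite \<open>I\<close> they form a basis
  of the relative product topology (\<open>openin_coord_iff\<close>), which makes epsilon-delta arguments possible.\<close>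

definition cube :: "'i set \<Rightarrow> ('i \<Rightarrow> real) \<Rightarrow> real \<Rightarrow> ('i \<Rightarrow> real) set" where
  "cube I v d = {w \<in> coord_space I. \<forall>a\<in>I. \<bar>w a - v a\<bar> < d}"

lemma coord_space_upd: "v \<in> coord_space I \<Longrightarrow> a \<in> I \<Longrightarrow> v(a := s) \<in> coord_space I"
  by (auto simp: coord_space_def)

lemma continuous_on_coord: "continuous_on S (\<lambda>w::'i \<Rightarrow> real. w a)"
  by (rule continuous_on_subset[OF continuous_on_product_coordinates]) simp

lemma uniform_radius:
  assumes "finite I" "\<And>a. a \<in> I \<Longrightarrow> \<exists>d>0. P a d"
    and "\<And>a d d'. P a d \<Longrightarrow> 0 < d' \<Longrightarrow> d' \<le> d \<Longrightarrow> P a d'"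
  shows "\<exists>d>(0::real). \<forall>a\<in>I. P a d"
  using assms(1,2)
proof (induction I rule: finite_induct)
  case empty
  then show ?case by (auto intro: exI[of _ 1])
next
  case (insert x F)
  then obtain d where d: "d > 0" "\<forall>a\<in>F. P a d" by auto
  obtain e where e: "e > 0" "P x e" using insert.prems by auto
  have "P a (min d e)" if "a \<in> insert x F" for a
    using that d e assms(3)[of _ d "min d e"] assms(3)[of _ e "min d e"] by auto
  then show ?case using d e by (intro exI[of _ "min d e"]) auto
qed

text \<open>A basic open set of the product topology restricts finitely many coordinates. Those outside \<open>I\<close>
  vanish on \<open>coord_space I\<close>, and for those in the finite set \<open>I\<close> a common radius can be chosen.\<close>

lemma openin_coord_iff:
  assumes "finite I"
  shows "openin (top_of_set (coord_space I)) V \<longleftrightarrow>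
    V \<subseteq> coord_space I \<and> (\<forall>v\<in>V. \<exists>d>0. cube I v d \<subseteq> V)"
proof (intro iffI conjI ballI)
  assume o: "openin (top_of_set (coord_space I)) V"
  then show "V \<subseteq> coord_space I" by (simp add: openin_imp_subset)
  fix v assume v: "v \<in> V"
  obtain T where T: "open T" "V = coord_space I \<inter> T" using o by (auto simp: openin_open)
  then obtain X where X: "v \<in> (\<Pi>\<^sub>E i\<in>UNIV. X i)" "\<And>i. open (X i)" "(\<Pi>\<^sub>E i\<in>UNIV. X i) \<subseteq> T"
    using product_topology_open_contains_basis[of "\<lambda>_. euclidean" UNIV T v] v
    by (auto simp: open_fun_def)
  have "\<exists>d>0. \<forall>a\<in>I. ball (v a) d \<subseteq> X a"
    using assms
  proof (rule uniform_radius)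
    fix a show "\<exists>d>0. ball (v a) d \<subseteq> X a"
      using X(1) X(2)[of a] by (meson PiE_mem UNIV_I openE)
  qed (auto simp: subset_eq)
  then obtain d where d: "d > 0" "\<forall>a\<in>I. ball (v a) d \<subseteq> X a" by auto
  have "w \<in> V" if "w \<in> cube I v d" for w
  proof -
    have "w a \<in> X a" for a
    proof (cases "a \<in> I")
      case True
      then show ?thesis using that d by (auto simp: cube_def subset_eq dist_real_def abs_minus_commute)
    next
      case False
      then have "w a = v a" using that v T by (auto simp: cube_def coord_space_def)
      then show ?thesis using X(1) by auto
    qed
    then show ?thesis using X(3) T that by (auto simp: cube_def subset_eq)
  qed
  then show "\<exists>d>0. cube I v d \<subseteq> V" using d(1) by auto
next
  assume a: "V \<subseteq> coord_space I \<and> (\<forall>v\<in>V. \<exists>d>0. cube I v d \<subseteq> V)"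
  have op: "openin (top_of_set (coord_space I)) (cube I v d)" for v d
  proof -
    have "cube I v d = coord_space I \<inter> (\<Inter>a\<in>I. {w. \<bar>w a - v a\<bar> < d})"
      by (auto simp: cube_def)
    moreover have "open (\<Inter>a\<in>I. {w. \<bar>w a - v a\<bar> < d})"
      using assms by (intro open_INT ballI open_Collect_less continuous_intros continuous_on_coord) auto
    ultimately show ?thesis by (auto simp: openin_open)
  qed
  show "openin (top_of_set (coord_space I)) V"
  proof (subst openin_subopen, intro ballI)
    fix v assume "v \<in> V"
    then obtain d where "d > 0" "cube I v d \<subseteq> V" using a by auto
    then show "\<exists>T. openin (top_of_set (coord_space I)) T \<and> v \<in> T \<and> T \<subseteq> V"
      using op[of v d] a \<open>v \<in> V\<close> by (intro exI[of _ "cube I v d"]) (auto simp: cube_def)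
  qed
qed

lemma cube_mono: "d \<le> d' \<Longrightarrow> cube I v d \<subseteq> cube I v d'"
  by (auto simp: cube_def)

lemma cube_center: "v \<in> coord_space I \<Longrightarrow> d > 0 \<Longrightarrow> v \<in> cube I v d"
  by (auto simp: cube_def)

locale coord_domain =
  fixes I :: "'i set" and V :: "('i \<Rightarrow> real) set"
  assumes fin: "finite I" and opn: "openin (top_of_set (coord_space I)) V"
begin

lemma dom_coord: "v \<in> V \<Longrightarrow> v \<in> coord_space I"
  using opn openin_imp_subset by blast

lemma dom_cube: "v \<in> V \<Longrightarrow> \<exists>d>0. cube I v d \<subseteq> V"
  using opn openin_coord_iff[OF fin] by blast

lemma dom_upd:
  assumes "v \<in> V" "a \<in> I"
  shows "eventually (\<lambda>s. v(a := s) \<in> V) (nhds (v a))"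
proof -
  obtain d where d: "d > 0" "cube I v d \<subseteq> V" using dom_cube[OF assms(1)] by auto
  have "v(a := s) \<in> V" if "dist s (v a) < d" for s
    using that d assms dom_coord[OF assms(1)]
    by (auto simp: cube_def subset_eq coord_space_upd dist_real_def)
  then show ?thesis using d(1) unfolding eventually_nhds_metric by auto
qed

lemma cont_cube:
  assumes "continuous_on V f" "v \<in> V" "e > 0"
  shows "\<exists>d>0. cube I v d \<subseteq> V \<and> (\<forall>w\<in>cube I v d. \<bar>f w - f v\<bar> < (e::real))"
proof -
  have "openin (top_of_set V) (V \<inter> f -` ball (f v) e)"
    using assms(1) by (simp add: continuous_openin_preimage_gen)
  then have "openin (top_of_set (coord_space I)) (V \<inter> f -` ball (f v) e)"
    using opn openin_trans by blast
  moreover have "v \<in> V \<inter> f -` ball (f v) e" using assms by auto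
  ultimately obtain d where "d > 0" "cube I v d \<subseteq> V \<inter> f -` ball (f v) e"
    using openin_coord_iff[OF fin] by metis
  then show ?thesis
    by (intro exI[of _ d]) (auto simp: subset_eq dist_real_def abs_minus_commute)
qed

text \<open>Continuity of \<open>f\<close> itself is a consequence, \<open>C1_continuous\<close>.\<close>

definition C1 :: "(('i \<Rightarrow> real) \<Rightarrow> real) \<Rightarrow> bool" where
  "C1 f \<longleftrightarrow> (\<forall>a\<in>I. continuous_on V (pd a f) \<and>
     (\<forall>v\<in>V. ((\<lambda>s. f (v(a := s))) has_real_derivative pd a f v) (at (v a))))"

text \<open>The coordinates of \<open>v\<close> are replaced by those of \<open>w\<close> one at a time; by the mean value theorem each
  replacement contributes an error bounded by the oscillation of one partial derivative. This
  takes the place of Frechet differentiability, since the type of all tuples carries no norm.\<close>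

lemma C1_approx:
  assumes f: "C1 f" and v: "v \<in> V" and e: "e > 0"
  shows "\<exists>d>0. cube I v d \<subseteq> V \<and> (\<forall>w\<in>cube I v d.
    \<bar>f w - f v - (\<Sum>a\<in>I. pd a f v * (w a - v a))\<bar> \<le> e * (\<Sum>a\<in>I. \<bar>w a - v a\<bar>))"
proof -
  have "\<exists>d>0. \<forall>a\<in>I. cube I v d \<subseteq> V \<and> (\<forall>w\<in>cube I v d. \<bar>pd a f w - pd a f v\<bar> < e)"
  proof (rule uniform_radius[OF fin])
    fix a assume "a \<in> I"
    then show "\<exists>d>0. cube I v d \<subseteq> V \<and> (\<forall>w\<in>cube I v d. \<bar>pd a f w - pd a f v\<bar> < e)"
      using cont_cube f v e unfolding C1_def by blast
  qed (use cube_mono in blast)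
  then obtain d1 where d1: "d1 > 0" "\<And>a w. a \<in> I \<Longrightarrow> w \<in> cube I v d1 \<Longrightarrow> \<bar>pd a f w - pd a f v\<bar> < e"
    by auto
  obtain d2 where d2: "d2 > 0" "cube I v d2 \<subseteq> V" using dom_cube[OF v] by auto
  define d where "d = min d1 d2"
  have d: "d > 0" "cube I v d \<subseteq> V" "\<And>a w. a \<in> I \<Longrightarrow> w \<in> cube I v d \<Longrightarrow> \<bar>pd a f w - pd a f v\<bar> < e"
    using d1 d2 cube_mono[of d d1 I v] cube_mono[of d d2 I v] by (auto simp: d_def)
  have vI: "v \<in> coord_space I" by (rule dom_coord[OF v])
  have "\<bar>f w - f v - (\<Sum>a\<in>I. pd a f v * (w a - v a))\<bar> \<le> e * (\<Sum>a\<in>I. \<bar>w a - v a\<bar>)"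
    if w: "w \<in> cube I v d" for w
  proof -
    \<comment> \<open>The coordinates in \<open>B\<close> have already been replaced by those of \<open>w\<close>.\<close>
    define m where "m = (\<lambda>B a. if a \<in> B then w a else v a)"
    have mc: "m B \<in> cube I v d" for B
      using w vI d(1) by (auto simp: m_def cube_def coord_space_def)
    have "\<bar>f (m B) - f v - (\<Sum>a\<in>B. pd a f v * (w a - v a))\<bar> \<le> e * (\<Sum>a\<in>B. \<bar>w a - v a\<bar>)"
      if "B \<subseteq> I" for B
      using finite_subset[OF that fin] that
    proof (induction B rule: finite_induct)
      case empty
      then show ?case by (simp add: m_def)
    next
      case (insert a B)
      then have a: "a \<in> I" by auto
      define x where "x = m B"
      have xa: "x a = v a" using insert by (simp add: x_def m_def)
      have mi: "m (insert a B) = x(a := w a)" by (auto simp: m_def x_def)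
      have xv: "x(a := v a) = x" using xa by (metis fun_upd_triv)
      define S where "S = closed_segment (v a) (w a)"
      have seg: "x(a := s) \<in> cube I v d" if "s \<in> S" for s
      proof -
        have "\<bar>s - v a\<bar> \<le> \<bar>w a - v a\<bar>" using that unfolding S_def closed_segment_eq_real_ivl
          by (auto split: if_splits)
        then show ?thesis using mc[of B] a w by (auto simp: x_def cube_def coord_space_def)
      qed
      have "norm ((f (x(a := w a)) - pd a f v * w a) - (f (x(a := v a)) - pd a f v * v a))
          \<le> e * norm (w a - v a)"
      proof (rule field_differentiable_bound[where S = S
            and f' = "\<lambda>s. pd a f (x(a := s)) - pd a f v" and f = "\<lambda>s. f (x(a := s)) - pd a f v * s"])
        fix s assume s: "s \<in> S"
        have "x(a := s) \<in> V" using seg[OF s] d(2) by auto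
        then have "((\<lambda>s'. f (x(a := s'))) has_real_derivative pd a f (x(a := s))) (at s)"
          using f a unfolding C1_def by fastforce
        then show "((\<lambda>s. f (x(a := s)) - pd a f v * s) has_field_derivative
             (pd a f (x(a := s)) - pd a f v)) (at s within S)"
          by (auto intro!: derivative_eq_intros intro: has_field_derivative_at_within)
        show "norm (pd a f (x(a := s)) - pd a f v) \<le> e" using d(3)[OF a seg[OF s]] by simp
      qed (auto simp: S_def)
      then have "\<bar>f (m (insert a B)) - f x - pd a f v * (w a - v a)\<bar> \<le> e * \<bar>w a - v a\<bar>"
        unfolding mi xv by (simp add: algebra_simps)
      moreover have "\<bar>f x - f v - (\<Sum>a\<in>B. pd a f v * (w a - v a))\<bar> \<le> e * (\<Sum>a\<in>B. \<bar>w a - v a\<bar>)"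
        using insert by (simp add: x_def)
      ultimately show ?case using insert.hyps by (simp add: distrib_left)
    qed
    from this[of I] have "\<bar>f (m I) - f v - (\<Sum>a\<in>I. pd a f v * (w a - v a))\<bar> \<le> e * (\<Sum>a\<in>I. \<bar>w a - v a\<bar>)"
      by simp
    moreover have "m I = w" using w vI by (auto simp: m_def cube_def coord_space_def)
    ultimately show ?thesis by simp
  qed
  then show ?thesis using d by blast
qed

lemma C1_continuous:
  assumes f: "C1 f" shows "continuous_on V f"
  unfolding continuous_on_def
proof
  fix v assume v: "v \<in> V"
  obtain d where d: "d > 0" "cube I v d \<subseteq> V" "\<And>w. w \<in> cube I v d \<Longrightarrow>
    \<bar>f w - f v - (\<Sum>a\<in>I. pd a f v * (w a - v a))\<bar> \<le> 1 * (\<Sum>a\<in>I. \<bar>w a - v a\<bar>)"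
    using C1_approx[OF f v, of 1] by auto
  have cv: "((\<lambda>w. w a) \<longlongrightarrow> v a) (at v within V)" for a
    using continuous_on_coord[of V a] v unfolding continuous_on_def by blast
  have lim: "((\<lambda>w. \<bar>\<Sum>a\<in>I. pd a f v * (w a - v a)\<bar> + (\<Sum>a\<in>I. \<bar>w a - v a\<bar>)) \<longlongrightarrow> 
     \<bar>\<Sum>a\<in>I. pd a f v * (v a - v a)\<bar> + (\<Sum>a\<in>I. \<bar>v a - v a\<bar>)) (at v within V)"
    by (intro tendsto_intros cv)
  have "openin (top_of_set V) (cube I v d)"
  proof (rule openin_subset_trans[OF _ d(2) openin_imp_subset[OF opn]])
    show "openin (top_of_set (coord_space I)) (cube I v d)"
      unfolding openin_coord_iff[OF fin]
    proof (intro conjI ballI)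
      fix w assume w: "w \<in> cube I v d"
      have "\<exists>e>0. \<forall>a\<in>I. e + \<bar>w a - v a\<bar> \<le> d"
      proof (rule uniform_radius[OF fin])
        fix a assume "a \<in> I"
        then show "\<exists>e>0. e + \<bar>w a - v a\<bar> \<le> d"
          using w by (intro exI[of _ "d - \<bar>w a - v a\<bar>"]) (auto simp: cube_def)
      qed auto
      then obtain e where "e > 0" "\<forall>a\<in>I. e + \<bar>w a - v a\<bar> \<le> d" by auto
      then show "\<exists>e>0. cube I w e \<subseteq> cube I v d"
        by (intro exI[of _ e]) (force simp: cube_def)
    qed (auto simp: cube_def)
  qed
  then obtain T where "open T" "cube I v d = V \<inter> T" unfolding openin_open by blast
  then have "eventually (\<lambda>w. w \<in> cube I v d) (at v within V)"
    using cube_center[OF dom_coord[OF v] d(1)]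
    unfolding eventually_at_topological by (intro exI[of _ T]) auto
  then have ev: "eventually (\<lambda>w. \<bar>f w - f v\<bar> \<le>
     \<bar>\<Sum>a\<in>I. pd a f v * (w a - v a)\<bar> + (\<Sum>a\<in>I. \<bar>w a - v a\<bar>)) (at v within V)"
    by eventually_elim (use d(3) in fastforce)
  have "((\<lambda>w. f w - f v) \<longlongrightarrow> 0) (at v within V)"
    by (rule tendsto_rabs_zero_cancel, rule tendsto_sandwich[OF _ ev tendsto_const])
       (use lim in auto)
  then show "(f \<longlongrightarrow> f v) (at v within V)" by (simp add: LIM_zero_iff)
qed

text \<open>The error of the first order approximation, divided by \<open>s - t\<close>, tends to zero because the
  difference quotients of the coordinates of \<open>u\<close> stay bounded.\<close>

lemma chain_curve:
  assumes f: "C1 f" and v: "u t \<in> V"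
    and cs: "eventually (\<lambda>s. u s \<in> coord_space I) (at t within S)"
    and u': "\<And>a. a \<in> I \<Longrightarrow> ((\<lambda>s. u s a) has_real_derivative u' a) (at t within S)"
  shows "((\<lambda>s. f (u s)) has_real_derivative (\<Sum>a\<in>I. pd a f (u t) * u' a)) (at t within S)"
proof -
  define q where "q = (\<lambda>a s. (u s a - u t a) / (s - t))"
  have q: "(q a \<longlongrightarrow> u' a) (at t within S)" if "a \<in> I" for a
    using u'[OF that] unfolding has_field_derivative_iff q_def by simp
  define R where "R = (\<lambda>s. (f (u s) - f (u t)) / (s - t) - (\<Sum>a\<in>I. pd a f (u t) * q a s))"
  define M where "M = (\<Sum>a\<in>I. \<bar>u' a\<bar>) + 1"
  have M: "M > 0" unfolding M_def by (simp add: add_nonneg_pos sum_nonneg)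
  have "((\<lambda>s. \<Sum>a\<in>I. \<bar>q a s\<bar>) \<longlongrightarrow> (\<Sum>a\<in>I. \<bar>u' a\<bar>)) (at t within S)"
    by (intro tendsto_intros q)
  then have evM: "eventually (\<lambda>s. (\<Sum>a\<in>I. \<bar>q a s\<bar>) < M) (at t within S)"
    by (rule order_tendstoD) (simp add: M_def)
  have "(R \<longlongrightarrow> 0) (at t within S)"
  proof (rule tendstoI)
    fix e :: real assume e: "e > 0"
    obtain d where d: "d > 0" "\<And>w. w \<in> cube I (u t) d \<Longrightarrow>
      \<bar>f w - f (u t) - (\<Sum>a\<in>I. pd a f (u t) * (w a - u t a))\<bar> \<le> (e / M) * (\<Sum>a\<in>I. \<bar>w a - u t a\<bar>)"
      using C1_approx[OF f v, of "e / M"] e M by auto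
    have "eventually (\<lambda>s. \<bar>u s a - u t a\<bar> < d) (at t within S)" if "a \<in> I" for a
    proof -
      have "continuous (at t within S) (\<lambda>s. u s a)" using u'[OF that]
        by (meson DERIV_continuous)
      then show ?thesis using d(1) unfolding continuous_within tendsto_iff dist_real_def by blast
    qed
    then have "eventually (\<lambda>s. \<forall>a\<in>I. \<bar>u s a - u t a\<bar> < d) (at t within S)"
      using fin by (simp add: eventually_ball_finite_distrib)
    then show "eventually (\<lambda>s. dist (R s) 0 < e) (at t within S)"
      using cs evM eventually_neq_at_within[of t t S]
    proof eventually_elim
      case (elim s)
      then have "u s \<in> cube I (u t) d" by (auto simp: cube_def)
      note b = d(2)[OF this]
      have "\<bar>R s\<bar> = \<bar>f (u s) - f (u t) - (\<Sum>a\<in>I. pd a f (u t) * (u s a - u t a))\<bar> / \<bar>s - t\<bar>"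
      proof -
        have "R s = (f (u s) - f (u t) - (\<Sum>a\<in>I. pd a f (u t) * (u s a - u t a))) / (s - t)"
          unfolding R_def q_def diff_divide_distrib[of _ "sum _ _"] sum_divide_distrib by simp
        then show ?thesis by simp
      qed
      also have "\<dots> \<le> (e / M) * (\<Sum>a\<in>I. \<bar>u s a - u t a\<bar>) / \<bar>s - t\<bar>"
        using b by (rule divide_right_mono) simp
      also have "\<dots> = (e / M) * (\<Sum>a\<in>I. \<bar>q a s\<bar>)"
        unfolding q_def abs_divide sum_divide_distrib[symmetric] by simp
      also have "\<dots> < (e / M) * M" using elim(3) e M by (intro mult_strict_left_mono) auto
      finally show ?case using M by simp
    qed
  qed
  moreover have "((\<lambda>s. \<Sum>a\<in>I. pd a f (u t) * q a s) \<longlongrightarrow> (\<Sum>a\<in>I. pd a f (u t) * u' a)) (at t within S)"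
    by (intro tendsto_intros q)
  ultimately have "((\<lambda>s. R s + (\<Sum>a\<in>I. pd a f (u t) * q a s)) \<longlongrightarrow> 0 + (\<Sum>a\<in>I. pd a f (u t) * u' a)) (at t within S)"
    by (rule tendsto_add)
  then show ?thesis unfolding has_field_derivative_iff R_def by simp
qed

lemma pd_cong:
  assumes "v \<in> V" "a \<in> I" "\<And>w. w \<in> V \<Longrightarrow> f w = g w"
  shows "pd a f v = pd a g v"
  unfolding pd_def
proof (rule deriv_cong_ev[OF _ refl])
  show "eventually (\<lambda>s. f (v(a := s)) = g (v(a := s))) (nhds (v a))"
    using dom_upd[OF assms(1,2)] by eventually_elim (use assms(3) in auto)
qed

lemma partial_cong:
  assumes "v \<in> V" "a \<in> I" "\<And>w. w \<in> V \<Longrightarrow> f w = g w"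
  shows "((\<lambda>s. f (v(a := s))) has_real_derivative D) (at (v a)) \<longleftrightarrow>
    ((\<lambda>s. g (v(a := s))) has_real_derivative D) (at (v a))"
proof (rule DERIV_cong_ev[OF refl _ refl])
  show "eventually (\<lambda>s. f (v(a := s)) = g (v(a := s))) (nhds (v a))"
    using dom_upd[OF assms(1,2)] by eventually_elim (use assms(3) in auto)
qed

lemma pd_eqI: "((\<lambda>s. f (v(a := s))) has_real_derivative D) (at (v a)) \<Longrightarrow> pd a f v = D"
  unfolding pd_def by (rule DERIV_imp_deriv)

text \<open>Smoothness quantifies over all iterated partial derivatives; it suffices to find a class of
  functions that is closed under taking one.\<close>

lemma smooth_coinduct:
  assumes "P f" and step: "\<And>f a. P f \<Longrightarrow> a \<in> I \<Longrightarrow> P (pd a f)"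
    and "\<And>f. P f \<Longrightarrow> continuous_on V f"
    and "\<And>f a v. P f \<Longrightarrow> a \<in> I \<Longrightarrow> v \<in> V \<Longrightarrow> \<exists>D. ((\<lambda>s. f (v(a := s))) has_real_derivative D) (at (v a))"
  shows "smooth_on I V f"
proof -
  have "P (foldr pd as f)" if "as \<in> lists I" for as
    using that by (induction as) (auto intro: assms(1) step)
  then show ?thesis using assms(3,4) unfolding smooth_on_def field_differentiable_def by blast
qed

lemma smooth_continuous: "smooth_on I V f \<Longrightarrow> continuous_on V f"
  unfolding smooth_on_def by (metis foldr.simps(1) id_apply lists.Nil)

lemma smooth_partial:
  assumes "smooth_on I V f" "a \<in> I" "v \<in> V"
  shows "((\<lambda>s. f (v(a := s))) has_real_derivative pd a f v) (at (v a))"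
proof -
  have "(\<lambda>s. f (v(a := s))) field_differentiable (at (v a))"
    using assms unfolding smooth_on_def by (metis foldr.simps(1) id_apply lists.Nil)
  then show ?thesis unfolding pd_def by (simp add: DERIV_deriv_iff_field_differentiable)
qed

lemma smooth_partial_at:
  assumes "smooth_on I V f" "a \<in> I" "v(a := s) \<in> V"
  shows "((\<lambda>s. f (v(a := s))) has_real_derivative pd a f (v(a := s))) (at s)"
  using smooth_partial[OF assms] by simp

lemma smooth_pd:
  assumes "smooth_on I V f" "a \<in> I" shows "smooth_on I V (pd a f)"
  unfolding smooth_on_def
proof
  fix as assume "as \<in> lists I"
  then have "as @ [a] \<in> lists I" using assms by auto
  then have "continuous_on V (foldr pd (as @ [a]) f) \<and> (\<forall>aa\<in>I. \<forall>v\<in>V.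
    (\<lambda>s. foldr pd (as @ [a]) f (v(aa := s))) field_differentiable at (v aa))"
    using assms(1) unfolding smooth_on_def by blast
  then show "continuous_on V (foldr pd as (pd a f)) \<and> (\<forall>aa\<in>I. \<forall>v\<in>V.
    (\<lambda>s. foldr pd as (pd a f) (v(aa := s))) field_differentiable at (v aa))"
    by simp
qed

lemma smooth_C1: "smooth_on I V f \<Longrightarrow> C1 f"
  unfolding C1_def by (auto intro: smooth_partial smooth_continuous smooth_pd)

lemma smooth_cong:
  assumes "smooth_on I V f" "\<And>v. v \<in> V \<Longrightarrow> f v = g v"
  shows "smooth_on I V g"
proof (rule smooth_coinduct[where P = "\<lambda>g. \<exists>f. smooth_on I V f \<and> (\<forall>v\<in>V. f v = g v)"])
  show "\<exists>f. smooth_on I V f \<and> (\<forall>v\<in>V. f v = g v)" using assms by blast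
next
  fix g a assume "\<exists>f. smooth_on I V f \<and> (\<forall>v\<in>V. f v = g v)" and a: "a \<in> I"
  then obtain f where f: "smooth_on I V f" "\<forall>v\<in>V. f v = g v" by blast
  show "\<exists>f. smooth_on I V f \<and> (\<forall>v\<in>V. f v = pd a g v)"
    using smooth_pd[OF f(1) a] pd_cong[OF _ a, of _ f g] f(2) by (intro exI[of _ "pd a f"]) auto
next
  fix g assume "\<exists>f. smooth_on I V f \<and> (\<forall>v\<in>V. f v = g v)"
  then show "continuous_on V g" using smooth_continuous continuous_on_cong by metis
next
  fix g a v assume "\<exists>f. smooth_on I V f \<and> (\<forall>v\<in>V. f v = g v)" "a \<in> I" "v \<in> V"
  then show "\<exists>D. ((\<lambda>s. g (v(a := s))) has_real_derivative D) (at (v a))"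
    using smooth_partial partial_cong by metis
qed

section \<open>Algebras of smooth functions\<close>

text \<open>Partial derivatives of products are sums of products. So the algebra generated by a set of functions
  is a suitable class for coinduction as soon as it contains the derivatives of the generators.\<close>

inductive alg :: "(('i \<Rightarrow> real) \<Rightarrow> real) set \<Rightarrow> (('i \<Rightarrow> real) \<Rightarrow> real) \<Rightarrow> bool" for G where
  gen: "g \<in> G \<Longrightarrow> alg G g"
| const: "alg G (\<lambda>_. c)"
| add: "alg G f \<Longrightarrow> alg G g \<Longrightarrow> alg G (\<lambda>v. f v + g v)"
| mult: "alg G f \<Longrightarrow> alg G g \<Longrightarrow> alg G (\<lambda>v. f v * g v)"

lemma alg_sum: "finite B \<Longrightarrow> (\<And>b. b \<in> B \<Longrightarrow> alg G (f b)) \<Longrightarrow> alg G (\<lambda>v. \<Sum>b\<in>B. f b v)"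
  by (induction B rule: finite_induct) (auto intro: alg.intros)

text \<open>The class used for coinduction consists of the functions that agree on \<open>V\<close> with an element of the
  algebra, because the partial derivatives are only known there.\<close>

lemma alg_smooth:
  assumes G: "\<And>g a. g \<in> G \<Longrightarrow> continuous_on V g"
    and G': "\<And>g a. g \<in> G \<Longrightarrow> a \<in> I \<Longrightarrow> \<exists>g'. alg G g' \<and>
      (\<forall>v\<in>V. ((\<lambda>s. g (v(a := s))) has_real_derivative g' v) (at (v a)))"
    and f: "alg G f"
  shows "smooth_on I V f"
proof -
  have c: "continuous_on V f" if "alg G f" for f
    using that by induction (auto intro: continuous_intros G)
  have d: "\<exists>g'. alg G g' \<and> (\<forall>v\<in>V. ((\<lambda>s. f (v(a := s))) has_real_derivative g' v) (at (v a)))"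
    if "alg G f" "a \<in> I" for f a
    using that
  proof induction
    case (gen g)
    then show ?case using G' by blast
  next
    case (const c)
    then show ?case by (intro exI[of _ "\<lambda>_. 0"]) (auto intro: alg.const)
  next
    case (add f g)
    then obtain f' g' where "alg G f'" "alg G g'"
      "\<forall>v\<in>V. ((\<lambda>s. f (v(a := s))) has_real_derivative f' v) (at (v a))"
      "\<forall>v\<in>V. ((\<lambda>s. g (v(a := s))) has_real_derivative g' v) (at (v a))" by blast
    then show ?case by (intro exI[of _ "\<lambda>v. f' v + g' v"] conjI ballI alg.add DERIV_add) (assumption | erule bspec)+
  next
    case (mult f g)
    then obtain f' g' where fg: "alg G f'" "alg G g'"
      "\<forall>v\<in>V. ((\<lambda>s. f (v(a := s))) has_real_derivative f' v) (at (v a))"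
      "\<forall>v\<in>V. ((\<lambda>s. g (v(a := s))) has_real_derivative g' v) (at (v a))" by blast
    show ?case
    proof (intro exI[of _ "\<lambda>v. f' v * g v + g' v * f v"] conjI ballI)
      show "alg G (\<lambda>v. f' v * g v + g' v * f v)" using fg mult by (intro alg.add alg.mult)
      fix v assume "v \<in> V"
      then show "((\<lambda>s. f (v(a := s)) * g (v(a := s))) has_real_derivative f' v * g v + g' v * f v) (at (v a))"
        using DERIV_mult[of "\<lambda>s. f (v(a := s))" "f' v" "v a" UNIV "\<lambda>s. g (v(a := s))" "g' v"] fg
        by (simp add: mult.commute del: fun_upd_apply)
    qed
  qed
  show ?thesis
  proof (rule smooth_coinduct[where P = "\<lambda>f. \<exists>g. alg G g \<and> (\<forall>v\<in>V. f v = g v)"])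
    show "\<exists>g. alg G g \<and> (\<forall>v\<in>V. f v = g v)" using f by blast
  next
    fix f a assume "\<exists>g. alg G g \<and> (\<forall>v\<in>V. f v = g v)" and a: "a \<in> I"
    then obtain g where g: "alg G g" "\<forall>v\<in>V. f v = g v" by blast
    obtain g' where g': "alg G g'" "\<forall>v\<in>V. ((\<lambda>s. g (v(a := s))) has_real_derivative g' v) (at (v a))"
      using d[OF g(1) a] by blast
    show "\<exists>g. alg G g \<and> (\<forall>v\<in>V. pd a f v = g v)"
      using g' pd_cong[OF _ a, of _ f g] g(2) pd_eqI[of g] by (intro exI[of _ g']) auto
  next
    fix f assume "\<exists>g. alg G g \<and> (\<forall>v\<in>V. f v = g v)"
    then show "continuous_on V f" using c continuous_on_cong by metis
  next
    fix f a v assume "\<exists>g. alg G g \<and> (\<forall>v\<in>V. f v = g v)" "a \<in> I" "v \<in> V"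
    then show "\<exists>D. ((\<lambda>s. f (v(a := s))) has_real_derivative D) (at (v a))"
      using d partial_cong by metis
  qed
qed

lemma smooth_alg: "alg {f. smooth_on I V f} f \<Longrightarrow> smooth_on I V f"
proof (rule alg_smooth[where G = "{f. smooth_on I V f}"])
  fix g a assume "g \<in> {f. smooth_on I V f}" "a \<in> I"
  then show "\<exists>g'. alg {f. smooth_on I V f} g' \<and>
      (\<forall>v\<in>V. ((\<lambda>s. g (v(a := s))) has_real_derivative g' v) (at (v a)))"
    by (intro exI[of _ "pd a g"]) (auto intro: alg.gen smooth_pd smooth_partial)
qed (auto intro: smooth_continuous)

lemma smooth_const [intro]: "smooth_on I V (\<lambda>_. c)"
  by (rule smooth_alg) (rule alg.const)

lemma smooth_add [intro]: "smooth_on I V f \<Longrightarrow> smooth_on I V g \<Longrightarrow> smooth_on I V (\<lambda>v. f v + g v)"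
  by (rule smooth_alg) (auto intro: alg.intros)

lemma smooth_mult [intro]: "smooth_on I V f \<Longrightarrow> smooth_on I V g \<Longrightarrow> smooth_on I V (\<lambda>v. f v * g v)"
  by (rule smooth_alg) (auto intro: alg.intros)

lemma smooth_cmult [intro]: "smooth_on I V f \<Longrightarrow> smooth_on I V (\<lambda>v. c * f v)"
  by (rule smooth_mult[OF smooth_const])

lemma smooth_minus [intro]: "smooth_on I V f \<Longrightarrow> smooth_on I V (\<lambda>v. - f v)"
  using smooth_cmult[of f "-1"] by simp

lemma smooth_diff [intro]: "smooth_on I V f \<Longrightarrow> smooth_on I V g \<Longrightarrow> smooth_on I V (\<lambda>v. f v - g v)"
  using smooth_add[of f "\<lambda>v. - g v"] smooth_minus by simp

lemma smooth_sum [intro]: "(\<And>b. b \<in> B \<Longrightarrow> smooth_on I V (f b)) \<Longrightarrow> smooth_on I V (\<lambda>v. \<Sum>b\<in>B. f b v)"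
  by (induction B rule: infinite_finite_induct) auto

lemma pd_const [simp]: "pd a (\<lambda>_. c) v = 0"
  by (simp add: pd_def)

lemma pd_coord: "pd a (\<lambda>w. w b) v = (if a = b then 1 else 0)"
  by (cases "a = b") (auto simp: pd_def)

lemma smooth_coord [intro]: "smooth_on I V (\<lambda>v. v b)"
proof -
  let ?G = "{\<lambda>v::'i \<Rightarrow> real. v b}"
  show ?thesis
  proof (rule alg_smooth[where G = ?G])
    fix g a assume g: "g \<in> ?G"
    show "continuous_on V g" using g continuous_on_coord by auto
    show "\<exists>g'. alg ?G g' \<and> (\<forall>v\<in>V. ((\<lambda>s. g (v(a := s))) has_real_derivative g' v) (at (v a)))"
      using g by (intro exI[of _ "\<lambda>_. if a = b then 1 else 0"]) (auto intro: alg.const)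
  qed (auto intro: alg.gen)
qed

lemma pd_add:
  assumes "smooth_on I V f" "smooth_on I V g" "a \<in> I" "v \<in> V"
  shows "pd a (\<lambda>w. f w + g w) v = pd a f v + pd a g v"
  by (rule pd_eqI) (intro DERIV_add smooth_partial assms)

lemma pd_mult:
  assumes "smooth_on I V f" "smooth_on I V g" "a \<in> I" "v \<in> V"
  shows "pd a (\<lambda>w. f w * g w) v = pd a f v * g v + f v * pd a g v"
  using DERIV_mult[OF smooth_partial[OF assms(1,3,4)] smooth_partial[OF assms(2,3,4)]]
  by (intro pd_eqI) (auto simp: mult.commute)

lemma pd_cmult:
  assumes "smooth_on I V f" "a \<in> I" "v \<in> V"
  shows "pd a (\<lambda>w. c * f w) v = c * pd a f v"
  by (rule pd_eqI) (intro DERIV_cmult smooth_partial assms)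

lemma pd_minus:
  assumes "smooth_on I V f" "a \<in> I" "v \<in> V"
  shows "pd a (\<lambda>w. - f w) v = - pd a f v"
  by (rule pd_eqI) (intro DERIV_minus smooth_partial assms)

lemma pd_diff:
  assumes "smooth_on I V f" "smooth_on I V g" "a \<in> I" "v \<in> V"
  shows "pd a (\<lambda>w. f w - g w) v = pd a f v - pd a g v"
  by (rule pd_eqI) (intro DERIV_diff smooth_partial assms)

lemma pd_sum:
  assumes "\<And>b. b \<in> B \<Longrightarrow> smooth_on I V (f b)" "a \<in> I" "v \<in> V"
  shows "pd a (\<lambda>w. \<Sum>b\<in>B. f b w) v = (\<Sum>b\<in>B. pd a (f b) v)"
  using DERIV_sum[of B "\<lambda>s b. f b (v(a := s))"] smooth_partial assms
  by (intro pd_eqI) auto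

lemma pd_zero:
  assumes "\<And>w. w \<in> V \<Longrightarrow> f w = 0" "a \<in> I" "v \<in> V"
  shows "pd a f v = 0"
  using pd_cong[OF assms(3,2), of f "\<lambda>_. 0"] assms(1) by simp

text \<open>For primitives, which are constructed together with their partial derivatives.\<close>

lemma smooth_from_gradient:
  assumes "\<And>a. a \<in> I \<Longrightarrow> smooth_on I V (g a)"
    and "\<And>a v. a \<in> I \<Longrightarrow> v \<in> V \<Longrightarrow> ((\<lambda>s. f (v(a := s))) has_real_derivative g a v) (at (v a))"
  shows "smooth_on I V f"
proof -
  have p: "pd a f v = g a v" if "a \<in> I" "v \<in> V" for a v
    using assms(2)[OF that] by (rule pd_eqI)
  have C: "C1 f" unfolding C1_def
  proof (intro ballI conjI)
    fix a assume a: "a \<in> I"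
    show "continuous_on V (pd a f)"
      using smooth_continuous[OF assms(1)[OF a]] p[OF a] by (subst continuous_on_cong[OF refl]) auto
    fix v assume "v \<in> V"
    then show "((\<lambda>s. f (v(a := s))) has_real_derivative pd a f v) (at (v a))"
      using assms(2)[OF a] p[OF a] by simp
  qed
  show ?thesis
  proof (rule smooth_coinduct[where P = "\<lambda>h. h = f \<or> smooth_on I V h"])
    fix h a assume "h = f \<or> smooth_on I V h" "a \<in> I"
    then show "pd a h = f \<or> smooth_on I V (pd a h)"
      using smooth_pd smooth_cong[OF assms(1), of a "pd a f"] p by auto
  next
    fix h a v assume "h = f \<or> smooth_on I V h" "a \<in> I" "v \<in> V"
    then show "\<exists>D. ((\<lambda>s. h (v(a := s))) has_real_derivative D) (at (v a))"
      using assms(2) smooth_partial by blast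
  qed (auto intro: C1_continuous[OF C] smooth_continuous)
qed

end

context coord_domain begin

section \<open>Mixed derivatives, composition and the Poincare lemma\<close>

text \<open>The second difference over a small square equals \<open>h\<^sup>2\<close> times a mixed derivative at some point of the
  square, in either order of differentiation, by two applications of the mean value theorem. So the
  two mixed derivatives take a common value, at two points as close to \<open>v\<close> as desired.\<close>

lemma pd_commute:
  assumes f: "smooth_on I V f" and a: "a \<in> I" and b: "b \<in> I" and v: "v \<in> V"
  shows "pd a (pd b f) v = pd b (pd a f) v"
proof (cases "a = b")
  case ab: False
  have rect: "\<exists>\<xi>\<in>cube I v d. f (v(a := v a + h, b := v b + h)) - f (v(a := v a, b := v b + h))
      - (f (v(a := v a + h, b := v b)) - f (v(a := v a, b := v b))) = h * (h * pd b (pd a f) \<xi>)"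
    if a: "a \<in> I" and b: "b \<in> I" and ab: "a \<noteq> b" and d: "cube I v d \<subseteq> V" "d > 0" and h: "h = d / 2"
    for a b d h
  proof -
    have box: "v(a := s, b := t) \<in> cube I v d" if "v a \<le> s" "s \<le> v a + h" "v b \<le> t" "t \<le> v b + h" for s t
      using that a b ab h d(2) dom_coord[OF v] by (auto simp: cube_def coord_space_def)
    have box': "v(a := s, b := t) \<in> V" if "v a \<le> s" "s \<le> v a + h" "v b \<le> t" "t \<le> v b + h" for s t
      using box[OF that] d(1) by auto
    have h0: "h > 0" using h d by simp
    have Da: "((\<lambda>s. f (v(a := s, b := t))) has_real_derivative pd a f (v(a := s, b := t))) (at s)"
      if "v a \<le> s" "s \<le> v a + h" "v b \<le> t" "t \<le> v b + h" for s t
    proof -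
      have "v(a := s, b := t) = (v(b := t))(a := s)" for s using ab by auto
      then show ?thesis using smooth_partial_at[OF f a, of "v(b := t)" s] box'[OF that] by simp
    qed
    have Db: "((\<lambda>t. pd a f (v(a := s, b := t))) has_real_derivative pd b (pd a f) (v(a := s, b := t))) (at t)"
      if "v a \<le> s" "s \<le> v a + h" "v b \<le> t" "t \<le> v b + h" for s t
      using smooth_partial_at[OF smooth_pd[OF f a] b, of "v(a := s)" t] box'[OF that] by simp
    obtain s where s: "v a < s" "s < v a + h"
      "(f (v(a := v a + h, b := v b + h)) - f (v(a := v a + h, b := v b))) -
       (f (v(a := v a, b := v b + h)) - f (v(a := v a, b := v b)))
        = h * (pd a f (v(a := s, b := v b + h)) - pd a f (v(a := s, b := v b)))"
      using MVT2[of "v a" "v a + h" "\<lambda>s. f (v(a := s, b := v b + h)) - f (v(a := s, b := v b))"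
        "\<lambda>s. pd a f (v(a := s, b := v b + h)) - pd a f (v(a := s, b := v b))"] h0
        DERIV_diff[OF Da Da] by auto
    obtain t where t: "v b < t" "t < v b + h"
      "pd a f (v(a := s, b := v b + h)) - pd a f (v(a := s, b := v b)) = h * pd b (pd a f) (v(a := s, b := t))"
      using MVT2[of "v b" "v b + h" "\<lambda>t. pd a f (v(a := s, b := t))"
        "\<lambda>t. pd b (pd a f) (v(a := s, b := t))"] h0 s Db by auto
    show ?thesis using s t box[of s t]
      by (intro bexI[of _ "v(a := s, b := t)"]) (auto simp: algebra_simps)
  qed
  show ?thesis
  proof (rule ccontr)
    assume ne: "\<not> ?thesis"
    define e where "e = \<bar>pd a (pd b f) v - pd b (pd a f) v\<bar> / 2"
    have e: "e > 0" using ne by (simp add: e_def)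
    obtain d1 where d1: "d1 > 0" "cube I v d1 \<subseteq> V"
      "\<And>w. w \<in> cube I v d1 \<Longrightarrow> \<bar>pd a (pd b f) w - pd a (pd b f) v\<bar> < e"
      using cont_cube[OF smooth_continuous[OF smooth_pd[OF smooth_pd[OF f b] a]] v e] by auto
    obtain d2 where d2: "d2 > 0" "cube I v d2 \<subseteq> V"
      "\<And>w. w \<in> cube I v d2 \<Longrightarrow> \<bar>pd b (pd a f) w - pd b (pd a f) v\<bar> < e"
      using cont_cube[OF smooth_continuous[OF smooth_pd[OF smooth_pd[OF f a] b]] v e] by auto
    define d where "d = min d1 d2"
    have d: "d > 0" "cube I v d \<subseteq> cube I v d1" "cube I v d \<subseteq> cube I v d2" "cube I v d \<subseteq> V"
      using d1 d2 cube_mono[of d d1 I v] cube_mono[of d d2 I v] by (auto simp: d_def)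
    define h where "h = d / 2"
    obtain x where x: "x \<in> cube I v d" "f (v(a := v a + h, b := v b + h)) - f (v(a := v a, b := v b + h))
      - (f (v(a := v a + h, b := v b)) - f (v(a := v a, b := v b))) = h * (h * pd b (pd a f) x)"
      using rect[OF a b ab d(4,1) h_def] by auto
    obtain y where y: "y \<in> cube I v d" "f (v(b := v b + h, a := v a + h)) - f (v(b := v b, a := v a + h))
      - (f (v(b := v b + h, a := v a)) - f (v(b := v b, a := v a))) = h * (h * pd a (pd b f) y)"
      using rect[OF b a _ d(4,1) h_def] ab by auto
    have tw: "v(b := t, a := s) = v(a := s, b := t)" for s t using ab by auto
    have "h * (h * pd b (pd a f) x) = h * (h * pd a (pd b f) y)"
      using x(2) y(2) unfolding tw by linarith
    then have "pd b (pd a f) x = pd a (pd b f) y" using d(1) by (simp add: h_def)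
    moreover have "\<bar>pd b (pd a f) x - pd b (pd a f) v\<bar> < e" "\<bar>pd a (pd b f) y - pd a (pd b f) v\<bar> < e"
      using x(1) y(1) d d1(3) d2(3) by auto
    ultimately show False unfolding e_def by (simp add: abs_if split: if_splits)
  qed
qed simp

lemma partial_compose:
  assumes J: "coord_domain J V'" and h: "coord_domain.C1 J V' h"
    and m: "\<And>v. v \<in> V \<Longrightarrow> \<Phi> v \<in> V'"
    and \<Phi>: "\<And>b. b \<in> J \<Longrightarrow> smooth_on I V (\<lambda>v. \<Phi> v b)"
    and a: "a \<in> I" and v: "v \<in> V"
  shows "((\<lambda>s. h (\<Phi> (v(a := s)))) has_real_derivative
    (\<Sum>b\<in>J. pd b h (\<Phi> v) * pd a (\<lambda>v. \<Phi> v b) v)) (at (v a))"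
proof -
  interpret B: coord_domain J V' by (rule J)
  have "eventually (\<lambda>s. \<Phi> (v(a := s)) \<in> coord_space J) (at (v a))"
    using dom_upd[OF v a] unfolding eventually_at_filter
    by eventually_elim (use m B.dom_coord in blast)
  then show ?thesis
    using B.chain_curve[OF h, of "\<lambda>s. \<Phi> (v(a := s))" "v a" UNIV "\<lambda>b. pd a (\<lambda>v. \<Phi> v b) v"]
      m[OF v] smooth_partial[OF \<Phi> a v] by simp
qed

lemma continuous_compose:
  assumes J: "coord_domain J V'" and h: "continuous_on V' (h :: _ \<Rightarrow> real)"
    and m: "\<And>v. v \<in> V \<Longrightarrow> \<Phi> v \<in> V'"
    and \<Phi>: "\<And>b. b \<in> J \<Longrightarrow> continuous_on V (\<lambda>v. \<Phi> v b)"
  shows "continuous_on V (\<lambda>v. h (\<Phi> v))"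
proof (rule continuous_on_compose2[OF h])
  interpret B: coord_domain J V' by (rule J)
  show "continuous_on V \<Phi>"
  proof (rule continuous_on_coordinatewise_then_product)
    fix b
    show "continuous_on V (\<lambda>v. \<Phi> v b)"
    proof (cases "b \<in> J")
      case False
      then have "\<Phi> v b = 0" if "v \<in> V" for v
        using B.dom_coord[OF m[OF that]] by (simp add: coord_space_def)
      then show ?thesis by (subst continuous_on_cong[OF refl, of _ _ "\<lambda>_. 0"]) auto
    qed (rule \<Phi>)
  qed
qed (use m in auto)

text \<open>The algebra generated by the functions \<open>h \<circ> \<Phi>\<close> and the smooth functions contains the partial
  derivatives of its generators, by the chain rule.\<close>

lemma smooth_compose:
  assumes J: "coord_domain J V'" and h: "smooth_on J V' h"
    and m: "\<And>v. v \<in> V \<Longrightarrow> \<Phi> v \<in> V'"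
    and \<Phi>: "\<And>b. b \<in> J \<Longrightarrow> smooth_on I V (\<lambda>v. \<Phi> v b)"
  shows "smooth_on I V (\<lambda>v. h (\<Phi> v))"
proof -
  interpret B: coord_domain J V' by (rule J)
  define G where "G = {f. smooth_on I V f} \<union> {\<lambda>v. h (\<Phi> v) | h. smooth_on J V' h}"
  show ?thesis
  proof (rule alg_smooth[where G = G])
    fix g a assume "g \<in> G"
    then consider "smooth_on I V g" | h where "smooth_on J V' h" "g = (\<lambda>v. h (\<Phi> v))"
      unfolding G_def by blast
    then show "continuous_on V g"
    proof cases
      case 2
      then show ?thesis
        using continuous_compose[OF J B.smooth_continuous m \<Phi>[THEN smooth_continuous]] by simp
    qed (rule smooth_continuous)
  next
    fix g a assume g: "g \<in> G" and a: "a \<in> I"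
    show "\<exists>g'. alg G g' \<and> (\<forall>v\<in>V. ((\<lambda>s. g (v(a := s))) has_real_derivative g' v) (at (v a)))"
    proof (cases "smooth_on I V g")
      case True
      then show ?thesis using smooth_pd[OF _ a] smooth_partial[OF _ a]
        by (intro exI[of _ "pd a g"]) (auto simp: G_def intro!: alg.gen)
    next
      case False
      then obtain h where h: "smooth_on J V' h" "g = (\<lambda>v. h (\<Phi> v))" using g by (auto simp: G_def)
      show ?thesis
      proof (intro exI[of _ "\<lambda>v. \<Sum>b\<in>J. pd b h (\<Phi> v) * pd a (\<lambda>v. \<Phi> v b) v"] conjI ballI)
        show "alg G (\<lambda>v. \<Sum>b\<in>J. pd b h (\<Phi> v) * pd a (\<lambda>v. \<Phi> v b) v)"
        proof (intro alg_sum[OF B.fin] alg.mult alg.gen)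
          fix b assume b: "b \<in> J"
          show "(\<lambda>v. pd b h (\<Phi> v)) \<in> G" using B.smooth_pd[OF h(1) b] by (auto simp: G_def)
          show "pd a (\<lambda>v. \<Phi> v b) \<in> G" using smooth_pd[OF \<Phi>[OF b] a] by (auto simp: G_def)
        qed
        fix v assume "v \<in> V"
        then show "((\<lambda>s. g (v(a := s))) has_real_derivative
          (\<Sum>b\<in>J. pd b h (\<Phi> v) * pd a (\<lambda>v. \<Phi> v b) v)) (at (v a))"
          unfolding h(2) using partial_compose[OF J B.smooth_C1[OF h(1)] m \<Phi> a] by blast
      qed
    qed
  next
    show "alg G (\<lambda>v. h (\<Phi> v))" using h by (intro alg.gen) (auto simp: G_def)
  qed
qed

lemma pd_compose:
  assumes J: "coord_domain J V'" and h: "smooth_on J V' h"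
    and m: "\<And>v. v \<in> V \<Longrightarrow> \<Phi> v \<in> V'"
    and \<Phi>: "\<And>b. b \<in> J \<Longrightarrow> smooth_on I V (\<lambda>v. \<Phi> v b)"
    and a: "a \<in> I" and v: "v \<in> V"
  shows "pd a (\<lambda>v. h (\<Phi> v)) v = (\<Sum>b\<in>J. pd b h (\<Phi> v) * pd a (\<lambda>v. \<Phi> v b) v)"
  using partial_compose[OF J coord_domain.smooth_C1[OF J h] m \<Phi> a v] by (rule pd_eqI)

text \<open>The Poincare lemma on a domain that is star-shaped about \<open>p\<close>. With \<open>\<gamma>(t) = p + t (v - p)\<close>, the
  primitive is \<open>\<integral>\<^sub>0\<^sup>1 \<Sum>\<^sub>a (v\<^sub>a - p\<^sub>a) \<eta>\<^sub>a(\<gamma>(t)) dt\<close>. Differentiating under the integral and using closedness, the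
  integrand of its \<open>b\<close>-th partial derivative is the derivative of \<open>t \<eta>\<^sub>b(\<gamma>(t))\<close>.\<close>

lemma closed_imp_exact:
  assumes star: "\<And>v t. v \<in> V \<Longrightarrow> 0 \<le> t \<Longrightarrow> t \<le> 1 \<Longrightarrow> (\<lambda>a. p a + t * (v a - p a)) \<in> V"
    and sm: "\<And>a. a \<in> I \<Longrightarrow> smooth_on I V (\<eta> a)"
    and cl: "\<And>a b v. a \<in> I \<Longrightarrow> b \<in> I \<Longrightarrow> v \<in> V \<Longrightarrow> pd a (\<eta> b) v = pd b (\<eta> a) v"
  shows "\<exists>P. smooth_on I V P \<and> (\<forall>a\<in>I. \<forall>v\<in>V. pd a P v = \<eta> a v)"
proof -
  define seg where "seg = (\<lambda>v t a. p a + t * (v a - p a))"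
  define P where "P = (\<lambda>v. integral (cbox 0 1) (\<lambda>t. \<Sum>a\<in>I. (v a - p a) * \<eta> a (seg v t)))"
  have segV: "seg v t \<in> V" if "v \<in> V" "0 \<le> t" "t \<le> 1" for v t
    using star[OF that] by (simp add: seg_def)
  have D: "((\<lambda>s. P (v(b := s))) has_real_derivative \<eta> b v) (at (v b))" if b: "b \<in> I" and v: "v \<in> V" for b v
  proof -
    obtain d where d: "d > 0" "cube I v d \<subseteq> V" using dom_cube[OF v] by auto
    define U where "U = ball (v b) d"
    have UV: "v(b := s) \<in> V" if "s \<in> U" for s
      using that d b dom_coord[OF v]
      by (auto simp: U_def cube_def subset_eq coord_space_upd dist_real_def abs_minus_commute)
    define fx where "fx = (\<lambda>s t. \<eta> b (seg (v(b := s)) t) +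
       (\<Sum>a\<in>I. ((v(b := s)) a - p a) * (t * pd b (\<eta> a) (seg (v(b := s)) t))))"
    have dseg: "((\<lambda>s. \<eta> a (seg (v(b := s)) t)) has_real_derivative t * pd b (\<eta> a) (seg (v(b := s)) t)) (at s within U)"
      if a: "a \<in> I" and s: "s \<in> U" and t: "t \<in> cbox 0 1" for a s t
    proof -
      have "((\<lambda>s. \<eta> a (seg (v(b := s)) t)) has_real_derivative
         (\<Sum>c\<in>I. pd c (\<eta> a) (seg (v(b := s)) t) * (if c = b then t else 0))) (at s within U)"
      proof (rule chain_curve[OF smooth_C1[OF sm[OF a]]])
        show "seg (v(b := s)) t \<in> V" using segV UV[OF s] t by auto
        show "eventually (\<lambda>s. seg (v(b := s)) t \<in> coord_space I) (at s within U)"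
          unfolding eventually_at using segV[OF UV] t dom_coord by (intro exI[of _ 1]) auto
        fix c show "((\<lambda>s. seg (v(b := s)) t c) has_real_derivative (if c = b then t else 0)) (at s within U)"
          by (cases "c = b") (auto simp: seg_def intro!: derivative_eq_intros)
      qed
      also have "(\<Sum>c\<in>I. pd c (\<eta> a) (seg (v(b := s)) t) * (if c = b then t else 0)) = t * pd b (\<eta> a) (seg (v(b := s)) t)"
        using b fin by (simp add: if_distrib[where f = "\<lambda>x. _ * x"] sum.delta cong: if_cong)
      finally show ?thesis .
    qed
    have "((\<lambda>s. integral (cbox 0 1) (\<lambda>t. \<Sum>a\<in>I. ((v(b := s)) a - p a) * \<eta> a (seg (v(b := s)) t)))
      has_field_derivative integral (cbox 0 1) (fx (v b))) (at (v b) within U)"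
    proof (rule leibniz_rule_field_derivative)
      fix s and t :: real assume s: "s \<in> U" and t: "t \<in> cbox 0 1"
      have "((\<lambda>s. \<Sum>a\<in>I. ((v(b := s)) a - p a) * \<eta> a (seg (v(b := s)) t)) has_field_derivative
         (\<Sum>a\<in>I. (if a = b then 1 else 0) * \<eta> a (seg (v(b := s)) t) +
            t * pd b (\<eta> a) (seg (v(b := s)) t) * ((v(b := s)) a - p a))) (at s within U)"
      proof (intro DERIV_sum DERIV_mult dseg[OF _ s t])
        fix a show "((\<lambda>s. (v(b := s)) a - p a) has_real_derivative (if a = b then 1 else 0)) (at s within U)"
          by (cases "a = b") (auto intro!: derivative_eq_intros)
      qed
      also have "(\<Sum>a\<in>I. (if a = b then 1 else 0) * \<eta> a (seg (v(b := s)) t) +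
            t * pd b (\<eta> a) (seg (v(b := s)) t) * ((v(b := s)) a - p a)) = fx s t"
        using b fin unfolding fx_def sum.distrib
        by (simp add: if_distrib[where f = "\<lambda>x. x * _"] sum.delta algebra_simps cong: if_cong)
      finally show "((\<lambda>s. \<Sum>a\<in>I. ((v(b := s)) a - p a) * \<eta> a (seg (v(b := s)) t)) has_field_derivative fx s t) (at s within U)" .
    next
      fix s assume s: "s \<in> U"
      have c: "continuous_on (cbox 0 1) (\<lambda>t. \<eta> a (seg (v(b := s)) t))" if "a \<in> I" for a
      proof (rule continuous_on_compose2[OF smooth_continuous[OF sm[OF that]]])
        show "continuous_on (cbox 0 1) (seg (v(b := s)))"
          unfolding seg_def by (intro continuous_intros)
      qed (use segV[OF UV[OF s]] in auto)
      show "(\<lambda>t. \<Sum>a\<in>I. ((v(b := s)) a - p a) * \<eta> a (seg (v(b := s)) t)) integrable_on cbox 0 1"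
        by (intro integrable_continuous continuous_intros c)
    next
      have cb: "continuous_on (U \<times> cbox 0 1) (\<lambda>(s, t). (v(b := s)) a)" for a
        by (cases "a = b") (auto simp: split_beta intro!: continuous_intros)
      have c: "continuous_on (U \<times> cbox 0 1) (\<lambda>(s, t). f (seg (v(b := s)) t))" if "smooth_on I V f" for f
        unfolding split_beta
      proof (rule continuous_on_compose2[OF smooth_continuous[OF that]])
        show "continuous_on (U \<times> cbox 0 1) (\<lambda>x. seg (v(b := fst x)) (snd x))"
          unfolding seg_def by (intro continuous_intros cb[unfolded split_beta])
      qed (use segV UV in auto)
      note c' = c[unfolded split_beta] cb[unfolded split_beta]
      show "continuous_on (U \<times> cbox 0 1) (\<lambda>(s, t). fx s t)"
        unfolding fx_def split_beta using b
        by (intro continuous_intros c' sm smooth_pd) auto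
    qed (use d in \<open>auto simp: U_def\<close>)
    then have 1: "((\<lambda>s. P (v(b := s))) has_real_derivative integral (cbox 0 1) (fx (v b))) (at (v b))"
      unfolding P_def using d(1) by (simp add: U_def at_within_open[of _ "ball (v b) d"])
    have "(fx (v b) has_integral (1 * \<eta> b (seg v 1) - 0 * \<eta> b (seg v 0))) {0..1}"
    proof (rule fundamental_theorem_of_calculus)
      fix t :: real assume t: "t \<in> {0..1}"
      have "((\<lambda>t. \<eta> b (seg v t)) has_real_derivative (\<Sum>a\<in>I. pd a (\<eta> b) (seg v t) * (v a - p a))) (at t within {0..1})"
      proof (rule chain_curve[OF smooth_C1[OF sm[OF b]]])
        show "seg v t \<in> V" using segV[OF v] t by auto
        show "eventually (\<lambda>s. seg v s \<in> coord_space I) (at t within {0..1})"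
          unfolding eventually_at using segV[OF v] dom_coord by (intro exI[of _ 1]) auto
        fix c show "((\<lambda>s. seg v s c) has_real_derivative v c - p c) (at t within {0..1})"
          unfolding seg_def by (auto intro!: derivative_eq_intros)
      qed
      then have "((\<lambda>t. t * \<eta> b (seg v t)) has_real_derivative
          (1 * \<eta> b (seg v t) + (\<Sum>a\<in>I. pd a (\<eta> b) (seg v t) * (v a - p a)) * t)) (at t within {0..1})"
        by (intro DERIV_mult) (auto intro!: derivative_eq_intros)
      also have "1 * \<eta> b (seg v t) + (\<Sum>a\<in>I. pd a (\<eta> b) (seg v t) * (v a - p a)) * t = fx (v b) t"
        using cl[OF b _ segV[OF v]] t
        by (simp add: fx_def sum_distrib_left mult_ac fun_upd_triv del: fun_upd_apply cong: sum.cong)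
      finally show "((\<lambda>t. t * \<eta> b (seg v t)) has_vector_derivative fx (v b) t) (at t within {0..1})"
        by (simp add: has_real_derivative_iff_has_vector_derivative)
    qed simp
    moreover have "seg v 1 = v" by (auto simp: seg_def)
    ultimately have "integral (cbox 0 1) (fx (v b)) = \<eta> b v" by (simp add: integral_unique)
    then show ?thesis using 1 by simp
  qed
  have "smooth_on I V P" by (rule smooth_from_gradient[OF sm D])
  moreover have "pd a P v = \<eta> a v" if "a \<in> I" "v \<in> V" for a v
    using D[OF that] by (rule pd_eqI)
  ultimately show ?thesis by blast
qed

end

section \<open>Forms in coordinates and their transformation\<close>

text \<open>The coordinate expressions of the derivative along a vector field and of the Lie derivative of a
  1-form, for components that are functions of the coordinate tuple.\<close>

definition deriv_along :: "'i set \<Rightarrow> (('i \<Rightarrow> real) \<Rightarrow> 'i \<Rightarrow> real) \<Rightarrow> (('i \<Rightarrow> real) \<Rightarrow> real) \<Rightarrow> ('i \<Rightarrow> real) \<Rightarrow> real" where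
  "deriv_along I X f v = (\<Sum>b\<in>I. X v b * pd b f v)"

definition coord_lie :: "'i set \<Rightarrow> (('i \<Rightarrow> real) \<Rightarrow> 'i \<Rightarrow> real) \<Rightarrow> (('i \<Rightarrow> real) \<Rightarrow> 'i \<Rightarrow> real) \<Rightarrow> ('i \<Rightarrow> real) \<Rightarrow> 'i \<Rightarrow> real" where
  "coord_lie I X \<theta> v a = (\<Sum>b\<in>I. X v b * pd b (\<lambda>w. \<theta> w a) v + \<theta> v b * pd a (\<lambda>w. X w b) v)"

context coord_domain begin

lemma deriv_along_cong: "v \<in> V \<Longrightarrow> (\<And>w. w \<in> V \<Longrightarrow> f w = g w) \<Longrightarrow> deriv_along I X f v = deriv_along I X g v"
  unfolding deriv_along_def by (intro sum.cong refl arg_cong2[where f = times] pd_cong) auto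

lemma coord_lie_cong:
  assumes "v \<in> V" "a \<in> I" "\<And>w b. w \<in> V \<Longrightarrow> b \<in> I \<Longrightarrow> \<theta> w b = \<eta> w b"
  shows "coord_lie I X \<theta> v a = coord_lie I X \<eta> v a"
  unfolding coord_lie_def
proof (intro sum.cong refl)
  fix b assume b: "b \<in> I"
  have "pd b (\<lambda>w. \<theta> w a) v = pd b (\<lambda>w. \<eta> w a) v"
    by (rule pd_cong[OF assms(1) b]) (use assms in auto)
  then show "X v b * pd b (\<lambda>w. \<theta> w a) v + \<theta> v b * pd a (\<lambda>w. X w b) v =
    X v b * pd b (\<lambda>w. \<eta> w a) v + \<eta> v b * pd a (\<lambda>w. X w b) v"
    using assms b by simp
qed

text \<open>In the terms of the Lie derivative that differentiate \<open>X\<close>, exchanging the two summation indices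
  turns the expression into the product rule.\<close>

lemma contraction_lie:
  assumes X: "\<And>b. b \<in> I \<Longrightarrow> smooth_on I V (\<lambda>v. X v b)"
    and \<theta>: "\<And>b. b \<in> I \<Longrightarrow> smooth_on I V (\<lambda>v. \<theta> v b)" and v: "v \<in> V"
  shows "(\<Sum>a\<in>I. X v a * coord_lie I X \<theta> v a) = deriv_along I X (\<lambda>w. \<Sum>a\<in>I. X w a * \<theta> w a) v"
proof -
  have "deriv_along I X (\<lambda>w. \<Sum>a\<in>I. X w a * \<theta> w a) v =
     (\<Sum>b\<in>I. X v b * (\<Sum>a\<in>I. pd b (\<lambda>w. X w a) v * \<theta> v a + X v a * pd b (\<lambda>w. \<theta> w a) v))"
    unfolding deriv_along_def
  proof (intro sum.cong refl arg_cong2[where f = times])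
    fix b assume b: "b \<in> I"
    have "pd b (\<lambda>w. \<Sum>a\<in>I. X w a * \<theta> w a) v = (\<Sum>a\<in>I. pd b (\<lambda>w. X w a * \<theta> w a) v)"
      by (rule pd_sum[OF _ b v]) (intro smooth_mult X \<theta>)
    then show "pd b (\<lambda>w. \<Sum>a\<in>I. X w a * \<theta> w a) v =
      (\<Sum>a\<in>I. pd b (\<lambda>w. X w a) v * \<theta> v a + X v a * pd b (\<lambda>w. \<theta> w a) v)"
      using pd_mult[OF X \<theta> b v] by simp
  qed
  also have "\<dots> = (\<Sum>a\<in>I. X v a * (\<Sum>b\<in>I. \<theta> v b * pd a (\<lambda>w. X w b) v)) +
      (\<Sum>b\<in>I. \<Sum>a\<in>I. X v b * (X v a * pd b (\<lambda>w. \<theta> w a) v))"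
    by (simp add: distrib_left sum.distrib sum_distrib_left mult_ac)
  also have "(\<Sum>b\<in>I. \<Sum>a\<in>I. X v b * (X v a * pd b (\<lambda>w. \<theta> w a) v)) =
      (\<Sum>a\<in>I. X v a * (\<Sum>b\<in>I. X v b * pd b (\<lambda>w. \<theta> w a) v))"
    by (subst sum.swap) (simp add: sum_distrib_left mult_ac)
  finally show ?thesis
    unfolding coord_lie_def by (simp add: sum.distrib distrib_left)
qed

lemma cartan:
  assumes X: "\<And>b. b \<in> I \<Longrightarrow> smooth_on I V (\<lambda>v. X v b)"
    and \<theta>: "\<And>b. b \<in> I \<Longrightarrow> smooth_on I V (\<lambda>v. \<theta> v b)" and v: "v \<in> V" and a: "a \<in> I"
  shows "(\<Sum>b\<in>I. X v b * (pd b (\<lambda>w. \<theta> w a) v - pd a (\<lambda>w. \<theta> w b) v)) =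
    coord_lie I X \<theta> v a - pd a (\<lambda>w. \<Sum>b\<in>I. X w b * \<theta> w b) v"
proof -
  have "pd a (\<lambda>w. \<Sum>b\<in>I. X w b * \<theta> w b) v = (\<Sum>b\<in>I. pd a (\<lambda>w. X w b * \<theta> w b) v)"
    by (rule pd_sum[OF _ a v]) (intro smooth_mult X \<theta>)
  also have "\<dots> = (\<Sum>b\<in>I. pd a (\<lambda>w. X w b) v * \<theta> v b + X v b * pd a (\<lambda>w. \<theta> w b) v)"
    using pd_mult[OF X \<theta> a v] by simp
  finally show ?thesis
    unfolding coord_lie_def by (simp add: sum_subtractf[symmetric] algebra_simps)
qed

end

text \<open>The change from coordinates on \<open>V\<close> to coordinates on \<open>V'\<close>; the lemmas say that the coordinate
  expressions of the operations on forms are compatible with it.\<close>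

locale coord_change = src: coord_domain I V + tgt: coord_domain I' V'
  for I :: "'i set" and V and I' :: "'j set" and V' +
  fixes \<Phi> :: "('i \<Rightarrow> real) \<Rightarrow> 'j \<Rightarrow> real"
  assumes map: "\<And>v. v \<in> V \<Longrightarrow> \<Phi> v \<in> V'"
    and comp_smooth: "\<And>b. b \<in> I' \<Longrightarrow> smooth_on I V (\<lambda>v. \<Phi> v b)"
begin

lemmas tgt_dom = tgt.coord_domain_axioms

lemma smooth_pull: "smooth_on I' V' h \<Longrightarrow> smooth_on I V (\<lambda>v. h (\<Phi> v))"
  using src.smooth_compose[OF tgt_dom _ map comp_smooth] by blast

lemma pd_pull: "smooth_on I' V' h \<Longrightarrow> a \<in> I \<Longrightarrow> v \<in> V \<Longrightarrow>
  pd a (\<lambda>v. h (\<Phi> v)) v = (\<Sum>b\<in>I'. pd b h (\<Phi> v) * pd a (\<lambda>v. \<Phi> v b) v)"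
  using src.pd_compose[OF tgt_dom _ map comp_smooth] by blast

text \<open>The second sum is the obstruction to the partial derivatives of the components being tensorial. It
  is symmetric in \<open>a\<close> and \<open>b\<close>, so that it cancels in the exterior derivative.\<close>

lemma pd_covector:
  assumes \<theta>': "\<And>c. c \<in> I' \<Longrightarrow> smooth_on I' V' (\<lambda>v. \<theta>' v c)"
    and \<theta>: "\<And>v. v \<in> V \<Longrightarrow> \<theta> v a = (\<Sum>c\<in>I'. \<theta>' (\<Phi> v) c * pd a (\<lambda>w. \<Phi> w c) v)"
    and a: "a \<in> I" and b: "b \<in> I" and v: "v \<in> V"
  shows "pd b (\<lambda>w. \<theta> w a) v = (\<Sum>c\<in>I'. \<Sum>e\<in>I'. pd e (\<lambda>w. \<theta>' w c) (\<Phi> v) *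
      pd b (\<lambda>w. \<Phi> w e) v * pd a (\<lambda>w. \<Phi> w c) v)
    + (\<Sum>c\<in>I'. \<theta>' (\<Phi> v) c * pd b (pd a (\<lambda>w. \<Phi> w c)) v)"
proof -
  have "pd b (\<lambda>w. \<theta> w a) v = pd b (\<lambda>v. \<Sum>c\<in>I'. \<theta>' (\<Phi> v) c * pd a (\<lambda>w. \<Phi> w c) v) v"
    by (rule src.pd_cong[OF v b \<theta>])
  also have "\<dots> = (\<Sum>c\<in>I'. pd b (\<lambda>v. \<theta>' (\<Phi> v) c * pd a (\<lambda>w. \<Phi> w c) v) v)"
    by (rule src.pd_sum[OF _ b v]) (intro src.smooth_mult smooth_pull \<theta>' src.smooth_pd comp_smooth a)
  also have "\<dots> = (\<Sum>c\<in>I'. pd b (\<lambda>v. \<theta>' (\<Phi> v) c) v * pd a (\<lambda>w. \<Phi> w c) v +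
      \<theta>' (\<Phi> v) c * pd b (pd a (\<lambda>w. \<Phi> w c)) v)"
    using src.pd_mult[OF smooth_pull[OF \<theta>'] src.smooth_pd[OF comp_smooth a] b v] by simp
  also have "\<dots> = (\<Sum>c\<in>I'. (\<Sum>e\<in>I'. pd e (\<lambda>w. \<theta>' w c) (\<Phi> v) * pd b (\<lambda>w. \<Phi> w e) v) * pd a (\<lambda>w. \<Phi> w c) v +
      \<theta>' (\<Phi> v) c * pd b (pd a (\<lambda>w. \<Phi> w c)) v)"
    using pd_pull[OF \<theta>' b v] by simp
  finally show ?thesis by (simp add: sum.distrib sum_distrib_right)
qed

lemma ext_d_natural:
  assumes \<theta>': "\<And>c. c \<in> I' \<Longrightarrow> smooth_on I' V' (\<lambda>v. \<theta>' v c)"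
    and \<theta>: "\<And>v a. v \<in> V \<Longrightarrow> a \<in> I \<Longrightarrow> \<theta> v a = (\<Sum>c\<in>I'. \<theta>' (\<Phi> v) c * pd a (\<lambda>w. \<Phi> w c) v)"
    and a: "a \<in> I" and b: "b \<in> I" and v: "v \<in> V"
  shows "pd a (\<lambda>w. \<theta> w b) v - pd b (\<lambda>w. \<theta> w a) v = (\<Sum>c\<in>I'. \<Sum>e\<in>I'.
    (pd c (\<lambda>w. \<theta>' w e) (\<Phi> v) - pd e (\<lambda>w. \<theta>' w c) (\<Phi> v)) * pd a (\<lambda>w. \<Phi> w c) v * pd b (\<lambda>w. \<Phi> w e) v)"
proof -
  have sym: "(\<Sum>c\<in>I'. \<theta>' (\<Phi> v) c * pd b (pd a (\<lambda>w. \<Phi> w c)) v) =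
      (\<Sum>c\<in>I'. \<theta>' (\<Phi> v) c * pd a (pd b (\<lambda>w. \<Phi> w c)) v)"
    using src.pd_commute[OF comp_smooth a b v] by simp
  have sw: "(\<Sum>c\<in>I'. \<Sum>e\<in>I'. pd e (\<lambda>w. \<theta>' w c) (\<Phi> v) * pd a (\<lambda>w. \<Phi> w e) v * pd b (\<lambda>w. \<Phi> w c) v)
    = (\<Sum>c\<in>I'. \<Sum>e\<in>I'. pd c (\<lambda>w. \<theta>' w e) (\<Phi> v) * pd a (\<lambda>w. \<Phi> w c) v * pd b (\<lambda>w. \<Phi> w e) v)"
    by (rule sum.swap)
  show ?thesis
    unfolding pd_covector[of \<theta>' \<theta>, OF \<theta>' \<theta>[OF _ a] a b v, simplified]
      pd_covector[of \<theta>' \<theta>, OF \<theta>' \<theta>[OF _ b] b a v, simplified] sym sw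
    by (simp add: sum_subtractf[symmetric] left_diff_distrib right_diff_distrib mult_ac)
qed

text \<open>The second derivatives of \<open>\<Phi>\<close> that arise from differentiating the components of \<open>\<theta>\<close> are those that
  arise from differentiating the transformation law of the vector field.\<close>

lemma lie_natural:
  assumes \<theta>': "\<And>c. c \<in> I' \<Longrightarrow> smooth_on I' V' (\<lambda>v. \<theta>' v c)"
    and X': "\<And>c. c \<in> I' \<Longrightarrow> smooth_on I' V' (\<lambda>v. X' v c)"
    and X: "\<And>c. c \<in> I \<Longrightarrow> smooth_on I V (\<lambda>v. X v c)"
    and \<theta>: "\<And>v a. v \<in> V \<Longrightarrow> a \<in> I \<Longrightarrow> \<theta> v a = (\<Sum>c\<in>I'. \<theta>' (\<Phi> v) c * pd a (\<lambda>w. \<Phi> w c) v)"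
    and XX': "\<And>v c. v \<in> V \<Longrightarrow> c \<in> I' \<Longrightarrow> X' (\<Phi> v) c = (\<Sum>b\<in>I. X v b * pd b (\<lambda>w. \<Phi> w c) v)"
    and a: "a \<in> I" and v: "v \<in> V"
  shows "coord_lie I X \<theta> v a = (\<Sum>c\<in>I'. coord_lie I' X' \<theta>' (\<Phi> v) c * pd a (\<lambda>w. \<Phi> w c) v)"
proof -
  have 1: "pd a (\<lambda>w. X' (\<Phi> w) c) v = (\<Sum>b\<in>I. pd a (\<lambda>w. X w b) v * pd b (\<lambda>w. \<Phi> w c) v
       + X v b * pd a (pd b (\<lambda>w. \<Phi> w c)) v)" if c: "c \<in> I'" for c
  proof -
    have "pd a (\<lambda>w. X' (\<Phi> w) c) v = pd a (\<lambda>w. \<Sum>b\<in>I. X w b * pd b (\<lambda>w. \<Phi> w c) w) v"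
      by (rule src.pd_cong[OF v a XX'[OF _ c]])
    also have "\<dots> = (\<Sum>b\<in>I. pd a (\<lambda>w. X w b * pd b (\<lambda>w. \<Phi> w c) w) v)"
      by (rule src.pd_sum[OF _ a v]) (intro src.smooth_mult X src.smooth_pd comp_smooth c)
    also have "\<dots> = (\<Sum>b\<in>I. pd a (\<lambda>w. X w b) v * pd b (\<lambda>w. \<Phi> w c) v
       + X v b * pd a (pd b (\<lambda>w. \<Phi> w c)) v)"
      using src.pd_mult[OF X src.smooth_pd[OF comp_smooth[OF c]] a v] by simp
    finally show ?thesis .
  qed
  have 2: "pd a (\<lambda>w. X' (\<Phi> w) c) v = (\<Sum>e\<in>I'. pd e (\<lambda>w. X' w c) (\<Phi> v) * pd a (\<lambda>w. \<Phi> w e) v)"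
    if c: "c \<in> I'" for c by (rule pd_pull[OF X'[OF c] a v])
  have A: "(\<Sum>b\<in>I. X v b * pd b (\<lambda>w. \<theta> w a) v) =
     (\<Sum>c\<in>I'. (\<Sum>e\<in>I'. X' (\<Phi> v) e * pd e (\<lambda>w. \<theta>' w c) (\<Phi> v)) * pd a (\<lambda>w. \<Phi> w c) v)
     + (\<Sum>c\<in>I'. \<theta>' (\<Phi> v) c * (\<Sum>b\<in>I. X v b * pd a (pd b (\<lambda>w. \<Phi> w c)) v))"
  proof -
    have "(\<Sum>b\<in>I. X v b * pd b (\<lambda>w. \<theta> w a) v) =
      (\<Sum>b\<in>I. (\<Sum>c\<in>I'. \<Sum>e\<in>I'. X v b * (pd e (\<lambda>w. \<theta>' w c) (\<Phi> v) *
      pd b (\<lambda>w. \<Phi> w e) v * pd a (\<lambda>w. \<Phi> w c) v))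
    + (\<Sum>c\<in>I'. X v b * (\<theta>' (\<Phi> v) c * pd a (pd b (\<lambda>w. \<Phi> w c)) v)))"
      using pd_covector[of \<theta>' \<theta>, OF \<theta>' \<theta>[OF _ a] a _ v] src.pd_commute[OF comp_smooth a _ v]
      by (simp add: distrib_left sum_distrib_left)
    also have "\<dots> = (\<Sum>c\<in>I'. \<Sum>e\<in>I'. \<Sum>b\<in>I. X v b * (pd e (\<lambda>w. \<theta>' w c) (\<Phi> v) *
      pd b (\<lambda>w. \<Phi> w e) v * pd a (\<lambda>w. \<Phi> w c) v))
    + (\<Sum>c\<in>I'. \<Sum>b\<in>I. X v b * (\<theta>' (\<Phi> v) c * pd a (pd b (\<lambda>w. \<Phi> w c)) v))"
    proof -
      have sw: "(\<Sum>b\<in>I. \<Sum>c\<in>I'. \<Sum>e\<in>I'. f b c e) = (\<Sum>c\<in>I'. \<Sum>e\<in>I'. \<Sum>b\<in>I. f b c e)" for f :: "_ \<Rightarrow> _ \<Rightarrow> _ \<Rightarrow> real"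
        by (subst sum.swap, intro sum.cong refl, rule sum.swap)
      have sw': "(\<Sum>b\<in>I. \<Sum>c\<in>I'. f b c) = (\<Sum>c\<in>I'. \<Sum>b\<in>I. f b c)" for f :: "_ \<Rightarrow> _ \<Rightarrow> real"
        by (rule sum.swap)
      show ?thesis unfolding sum.distrib sw sw' ..
    qed
    finally show ?thesis
      using XX'[OF v] by (simp add: sum_distrib_left sum_distrib_right mult_ac)
  qed
  have B: "(\<Sum>b\<in>I. \<theta> v b * pd a (\<lambda>w. X w b) v) =
     (\<Sum>c\<in>I'. \<theta>' (\<Phi> v) c * (\<Sum>b\<in>I. pd a (\<lambda>w. X w b) v * pd b (\<lambda>w. \<Phi> w c) v))"
  proof -
    have "(\<Sum>b\<in>I. \<theta> v b * pd a (\<lambda>w. X w b) v) =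
       (\<Sum>b\<in>I. \<Sum>c\<in>I'. \<theta>' (\<Phi> v) c * pd b (\<lambda>w. \<Phi> w c) v * pd a (\<lambda>w. X w b) v)"
      using \<theta>[OF v] by (simp add: sum_distrib_right)
    also have "\<dots> = (\<Sum>c\<in>I'. \<Sum>b\<in>I. \<theta>' (\<Phi> v) c * pd b (\<lambda>w. \<Phi> w c) v * pd a (\<lambda>w. X w b) v)"
      by (rule sum.swap)
    finally show ?thesis by (simp add: sum_distrib_left mult_ac)
  qed
  \<comment> \<open>The second sum of \<open>A\<close> and the sum of \<open>B\<close> combine by the differentiated transformation law of \<open>X\<close>.\<close>
  have C: "(\<Sum>c\<in>I'. \<theta>' (\<Phi> v) c * (\<Sum>b\<in>I. X v b * pd a (pd b (\<lambda>w. \<Phi> w c)) v))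
     + (\<Sum>c\<in>I'. \<theta>' (\<Phi> v) c * (\<Sum>b\<in>I. pd a (\<lambda>w. X w b) v * pd b (\<lambda>w. \<Phi> w c) v))
     = (\<Sum>c\<in>I'. \<theta>' (\<Phi> v) c * pd a (\<lambda>w. X' (\<Phi> w) c) v)"
    using 1 by (simp add: sum.distrib distrib_left)
  have E: "(\<Sum>c\<in>I'. \<theta>' (\<Phi> v) c * pd a (\<lambda>w. X' (\<Phi> w) c) v) =
     (\<Sum>c\<in>I'. (\<Sum>e\<in>I'. \<theta>' (\<Phi> v) e * pd c (\<lambda>w. X' w e) (\<Phi> v)) * pd a (\<lambda>w. \<Phi> w c) v)"
  proof -
    have "(\<Sum>c\<in>I'. \<theta>' (\<Phi> v) c * pd a (\<lambda>w. X' (\<Phi> w) c) v) =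
      (\<Sum>c\<in>I'. \<Sum>e\<in>I'. \<theta>' (\<Phi> v) c * (pd e (\<lambda>w. X' w c) (\<Phi> v) * pd a (\<lambda>w. \<Phi> w e) v))"
      using 2 by (simp add: sum_distrib_left)
    also have "\<dots> = (\<Sum>e\<in>I'. \<Sum>c\<in>I'. \<theta>' (\<Phi> v) c * (pd e (\<lambda>w. X' w c) (\<Phi> v) * pd a (\<lambda>w. \<Phi> w e) v))"
      by (rule sum.swap)
    finally show ?thesis by (simp add: sum_distrib_left sum_distrib_right mult_ac)
  qed
  show ?thesis
    unfolding coord_lie_def sum.distrib distrib_right using A B C E by linarith
qed

end

section \<open>The algebra of a semispray\<close>

lemma finite_jet_idx: "finite (jet_idx r :: (nat \<times> 'n::finite) set)"
  by (simp add: jet_idx_def)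

lemma mem_jet_idx [simp]: "(\<delta>, i) \<in> jet_idx r \<longleftrightarrow> \<delta> \<le> r"
  by (auto simp: jet_idx_def)

lemma sum_jet_idx: "(\<Sum>b\<in>jet_idx r. f b) = (\<Sum>\<delta>=0..r. \<Sum>i\<in>UNIV. f (\<delta>, i))"
  unfolding jet_idx_def by (simp add: sum.cartesian_product)

text \<open>\<open>X\<close> stands for the components of a semispray in an induced chart with coordinate domain \<open>V\<close>.\<close>

locale spray_domain = coord_domain "jet_idx r" V for r :: nat and V :: "(nat \<times> 'n::finite \<Rightarrow> real) set" +
  fixes X :: "(nat \<times> 'n \<Rightarrow> real) \<Rightarrow> nat \<times> 'n \<Rightarrow> real"
  assumes X_smooth: "\<And>b. b \<in> jet_idx r \<Longrightarrow> smooth_on (jet_idx r) V (\<lambda>v. X v b)"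
    and X_spray: "\<And>v \<delta> i. v \<in> V \<Longrightarrow> \<delta> < r \<Longrightarrow> X v (\<delta>, i) = real (Suc \<delta>) * v (Suc \<delta>, i)"
begin

abbreviation "I \<equiv> jet_idx r"
abbreviation "D \<equiv> deriv_along I X"
abbreviation "sm \<equiv> smooth_on I V"

lemma D_smooth [intro]: "sm f \<Longrightarrow> sm (D f)"
  unfolding deriv_along_def by (intro smooth_sum smooth_mult X_smooth smooth_pd)

lemma D_funpow_smooth: "sm f \<Longrightarrow> sm ((D ^^ m) f)"
  by (induction m) auto

lemma D_add: "sm f \<Longrightarrow> sm g \<Longrightarrow> v \<in> V \<Longrightarrow> D (\<lambda>w. f w + g w) v = D f v + D g v"
  unfolding deriv_along_def by (simp add: pd_add distrib_left sum.distrib)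

lemma D_cmult: "sm f \<Longrightarrow> v \<in> V \<Longrightarrow> D (\<lambda>w. c * f w) v = c * D f v"
  unfolding deriv_along_def by (simp add: pd_cmult sum_distrib_left mult_ac)

lemma D_sum: "(\<And>b. b \<in> B \<Longrightarrow> sm (f b)) \<Longrightarrow> v \<in> V \<Longrightarrow> D (\<lambda>w. \<Sum>b\<in>B. f b w) v = (\<Sum>b\<in>B. D (f b) v)"
  unfolding deriv_along_def using pd_sum[of B f]
  by (subst sum.swap) (simp add: sum_distrib_left)

lemma D_zero: "(\<And>w. w \<in> V \<Longrightarrow> f w = 0) \<Longrightarrow> v \<in> V \<Longrightarrow> D f v = 0"
  unfolding deriv_along_def by (intro sum.neutral ballI) (simp add: pd_zero)

text \<open>The only component of \<open>X\<close> of order less than \<open>r\<close> that depends on the coordinate \<open>(\<gamma>, j)\<close> is the one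
  of index \<open>(\<gamma> - 1, j)\<close>, namely \<open>\<gamma> y(\<gamma>, j)\<close>. The components of order \<open>r\<close>, which are arbitrary, are
  excluded by the hypothesis on \<open>z\<close>. For \<open>\<gamma> = 0\<close> the right-hand side is zero, whatever \<open>\<gamma> - 1\<close> is.\<close>

lemma sum_pd_X:
  assumes z: "\<And>l. z (r, l) = 0" and \<gamma>: "\<gamma> \<le> r" and v: "v \<in> V"
  shows "(\<Sum>b\<in>I. z b * pd (\<gamma>, j) (\<lambda>w. X w b) v) = real \<gamma> * z (\<gamma> - 1, j)"
proof -
  have "(\<Sum>b\<in>I. z b * pd (\<gamma>, j) (\<lambda>w. X w b) v) = (\<Sum>b\<in>I. if b = (\<gamma> - 1, j) then real \<gamma> * z b else 0)"
  proof (intro sum.cong refl)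
    fix b :: "nat \<times> 'n" assume b: "b \<in> I"
    obtain \<delta> l where bl: "b = (\<delta>, l)" by force
    show "z b * pd (\<gamma>, j) (\<lambda>w. X w b) v = (if b = (\<gamma> - 1, j) then real \<gamma> * z b else 0)"
    proof (cases "\<delta> = r")
      case True
      then show ?thesis using z bl \<gamma> by auto
    next
      case False
      then have \<delta>: "\<delta> < r" using b bl by auto
      have "pd (\<gamma>, j) (\<lambda>w. X w b) v = pd (\<gamma>, j) (\<lambda>w. real (Suc \<delta>) * w (Suc \<delta>, l)) v"
        by (rule pd_cong[OF v]) (use \<gamma> X_spray \<delta> bl in auto)
      also have "\<dots> = real (Suc \<delta>) * pd (\<gamma>, j) (\<lambda>w. w (Suc \<delta>, l)) v"
        using \<gamma> v by (intro pd_cmult) auto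
      also have "\<dots> = (if \<gamma> = Suc \<delta> \<and> j = l then real (Suc \<delta>) else 0)"
        by (simp add: pd_coord)
      finally show ?thesis using bl by (cases \<gamma>) auto
    qed
  qed
  also have "\<dots> = real \<gamma> * z (\<gamma> - 1, j)"
    using \<gamma> by (subst sum.delta[OF fin]) auto
  finally show ?thesis .
qed

text \<open>The commutation relation from which the structure of the Jacobians (\<open>prolong_toeplitz\<close>) and the
  triangular shape of \<open>d\<theta>\<^sub>L\<close> (\<open>cartan_form_top\<close>) are derived.\<close>

lemma pd_D:
  assumes f: "sm f" and z: "\<And>w l. w \<in> V \<Longrightarrow> pd (r, l) f w = 0" and \<gamma>: "\<gamma> \<le> r" and v: "v \<in> V"
  shows "pd (\<gamma>, j) (D f) v = D (pd (\<gamma>, j) f) v + real \<gamma> * pd (\<gamma> - 1, j) f v"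
proof -
  have a: "(\<gamma>, j) \<in> I" using \<gamma> by simp
  have "pd (\<gamma>, j) (D f) v = pd (\<gamma>, j) (\<lambda>v. \<Sum>b\<in>I. X v b * pd b f v) v"
    by (simp add: deriv_along_def[abs_def])
  also have "\<dots> = (\<Sum>b\<in>I. pd (\<gamma>, j) (\<lambda>v. X v b * pd b f v) v)"
    by (rule pd_sum[OF _ a v]) (intro smooth_mult X_smooth smooth_pd f)
  also have "\<dots> = (\<Sum>b\<in>I. pd b f v * pd (\<gamma>, j) (\<lambda>w. X w b) v + X v b * pd b (pd (\<gamma>, j) f) v)"
    using pd_mult[OF X_smooth smooth_pd[OF f] a v] pd_commute[OF f a _ v]
    by (simp add: mult.commute)
  also have "\<dots> = real \<gamma> * pd (\<gamma> - 1, j) f v + D (pd (\<gamma>, j) f) v"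
    unfolding sum.distrib deriv_along_def
    using sum_pd_X[of "\<lambda>b. pd b f v", OF z[OF v] \<gamma> v] by simp
  finally show ?thesis by simp
qed

text \<open>By \<open>coord_lie_eq\<close> this is the Lie derivative along \<open>X\<close> of a form whose components of order \<open>r\<close> vanish.
  Defining it for all orders \<open>\<delta>\<close>, also beyond \<open>r\<close>, frees the algebra of the operators from
  boundary cases. For \<open>\<delta> = 0\<close> the second term vanishes.\<close>

definition spray_lie :: "((nat \<times> 'n \<Rightarrow> real) \<Rightarrow> nat \<times> 'n \<Rightarrow> real) \<Rightarrow> (nat \<times> 'n \<Rightarrow> real) \<Rightarrow> nat \<times> 'n \<Rightarrow> real" where
  "spray_lie \<eta> v a = D (\<lambda>w. \<eta> w a) v + real (fst a) * \<eta> v (fst a - 1, snd a)"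

text \<open>Composition with the \<open>\<alpha>\<close>-th power of the tangent structure, for components that vanish beyond the
  order of the jets.\<close>

definition shift :: "nat \<Rightarrow> ((nat \<times> 'n \<Rightarrow> real) \<Rightarrow> nat \<times> 'n \<Rightarrow> real) \<Rightarrow> (nat \<times> 'n \<Rightarrow> real) \<Rightarrow> nat \<times> 'n \<Rightarrow> real" where
  "shift \<alpha> \<eta> v a = \<eta> v (fst a + \<alpha>, snd a)"

definition smooth_form :: "((nat \<times> 'n \<Rightarrow> real) \<Rightarrow> nat \<times> 'n \<Rightarrow> real) \<Rightarrow> bool" where
  "smooth_form \<eta> \<longleftrightarrow> (\<forall>a. sm (\<lambda>v. \<eta> v a))"

definition order_le :: "nat \<Rightarrow> ((nat \<times> 'n \<Rightarrow> real) \<Rightarrow> nat \<times> 'n \<Rightarrow> real) \<Rightarrow> bool" where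
  "order_le m \<eta> \<longleftrightarrow> (\<forall>v\<in>V. \<forall>\<delta>>m. \<forall>i. \<eta> v (\<delta>, i) = 0)"

lemma smooth_form_spray_lie: "smooth_form \<eta> \<Longrightarrow> smooth_form (spray_lie \<eta>)"
  unfolding smooth_form_def spray_lie_def by (auto intro!: smooth_add smooth_cmult)

lemma smooth_form_spray_lie_funpow: "smooth_form \<eta> \<Longrightarrow> smooth_form ((spray_lie ^^ m) \<eta>)"
  by (induction m) (auto intro: smooth_form_spray_lie)

lemma smooth_form_shift: "smooth_form \<eta> \<Longrightarrow> smooth_form (shift \<alpha> \<eta>)"
  unfolding smooth_form_def shift_def by auto

lemma shift_shift: "shift \<alpha> (shift \<beta> \<eta>) = shift (\<beta> + \<alpha>) \<eta>"
  by (auto simp: shift_def fun_eq_iff ac_simps)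

lemma order_le_shift: "order_le m \<eta> \<Longrightarrow> order_le (m - \<alpha>) (shift \<alpha> \<eta>)"
  unfolding order_le_def shift_def by auto

lemma order_le_spray_lie: "order_le m \<eta> \<Longrightarrow> order_le (Suc m) (spray_lie \<eta>)"
  unfolding order_le_def spray_lie_def by (auto intro!: D_zero)

lemma order_le_spray_lie_funpow: "order_le m \<eta> \<Longrightarrow> order_le (m + j) ((spray_lie ^^ j) \<eta>)"
  by (induction j) (auto dest: order_le_spray_lie)

lemma coord_lie_eq:
  assumes "order_le m \<eta>" "m < r" "v \<in> V" "a \<in> I"
  shows "coord_lie I X \<eta> v a = spray_lie \<eta> v a"
proof -
  have "(\<Sum>b\<in>I. \<eta> v b * pd (fst a, snd a) (\<lambda>w. X w b) v) = real (fst a) * \<eta> v (fst a - 1, snd a)"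
    using assms by (intro sum_pd_X) (auto simp: order_le_def jet_idx_def)
  then show ?thesis unfolding coord_lie_def spray_lie_def deriv_along_def sum.distrib by simp
qed

lemma coord_lie_funpow_eq:
  assumes "order_le m \<eta>" "m + j \<le> r" "v \<in> V" "a \<in> I"
  shows "(coord_lie I X ^^ j) \<eta> v a = (spray_lie ^^ j) \<eta> v a"
  using assms(2-)
proof (induction j arbitrary: v a)
  case (Suc j)
  have "(coord_lie I X ^^ Suc j) \<eta> v a = coord_lie I X ((spray_lie ^^ j) \<eta>) v a"
    unfolding funpow.simps comp_apply
    by (rule coord_lie_cong) (use Suc in auto)
  also have "\<dots> = spray_lie ((spray_lie ^^ j) \<eta>) v a"
    by (rule coord_lie_eq[OF order_le_spray_lie_funpow[OF assms(1)]]) (use Suc in auto)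
  finally show ?case by simp
qed simp

text \<open>The relation \<open>J \<Lambda>^m = \<Lambda>^m J + m \<Lambda>^(m - 1)\<close>. For \<open>m = 1\<close> it is \<open>(\<delta> + 1) - \<delta> = 1\<close>; the induction step uses
  the induction hypothesis both for \<open>\<delta>\<close> and for \<open>\<delta> - 1\<close>.\<close>

lemma shift_spray_lie_funpow:
  assumes "smooth_form \<xi>" "v \<in> V"
  shows "(spray_lie ^^ m) \<xi> v (Suc \<delta>, i) =
    (spray_lie ^^ m) (shift 1 \<xi>) v (\<delta>, i) + real m * (spray_lie ^^ (m - 1)) \<xi> v (\<delta>, i)"
  using assms(2)
proof (induction m arbitrary: v \<delta>)
  case 0
  then show ?case by (simp add: shift_def)
next
  case (Suc m)
  note S = smooth_form_spray_lie_funpow[OF assms(1)] smooth_form_spray_lie_funpow[OF smooth_form_shift[OF assms(1)]]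
  have "D (\<lambda>w. (spray_lie ^^ m) \<xi> w (Suc \<delta>, i)) v =
    D (\<lambda>w. (spray_lie ^^ m) (shift 1 \<xi>) w (\<delta>, i) + real m * (spray_lie ^^ (m - 1)) \<xi> w (\<delta>, i)) v"
    by (rule deriv_along_cong) (use Suc in auto)
  also have "\<dots> = D (\<lambda>w. (spray_lie ^^ m) (shift 1 \<xi>) w (\<delta>, i)) v + D (\<lambda>w. real m * (spray_lie ^^ (m - 1)) \<xi> w (\<delta>, i)) v"
    using S Suc.prems unfolding smooth_form_def by (intro D_add smooth_cmult) auto
  also have "\<dots> = D (\<lambda>w. (spray_lie ^^ m) (shift 1 \<xi>) w (\<delta>, i)) v + real m * D (\<lambda>w. (spray_lie ^^ (m - 1)) \<xi> w (\<delta>, i)) v"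
    using S Suc.prems unfolding smooth_form_def by (subst D_cmult) auto
  finally have 1: "(spray_lie ^^ Suc m) \<xi> v (Suc \<delta>, i) = D (\<lambda>w. (spray_lie ^^ m) (shift 1 \<xi>) w (\<delta>, i)) v
     + real m * D (\<lambda>w. (spray_lie ^^ (m - 1)) \<xi> w (\<delta>, i)) v + real (Suc \<delta>) * (spray_lie ^^ m) \<xi> v (\<delta>, i)"
    by (simp add: spray_lie_def)
  have 2: "(spray_lie ^^ Suc m) (shift 1 \<xi>) v (\<delta>, i) = D (\<lambda>w. (spray_lie ^^ m) (shift 1 \<xi>) w (\<delta>, i)) v
     + real \<delta> * (spray_lie ^^ m) (shift 1 \<xi>) v (\<delta> - 1, i)"
    by (simp add: spray_lie_def)
  have 3: "real m * (spray_lie ^^ m) \<xi> v (\<delta>, i) = real m * D (\<lambda>w. (spray_lie ^^ (m - 1)) \<xi> w (\<delta>, i)) v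
     + real m * (real \<delta> * (spray_lie ^^ (m - 1)) \<xi> v (\<delta> - 1, i))"
    by (cases m) (auto simp: spray_lie_def distrib_left)
  have 4: "real \<delta> * (spray_lie ^^ m) \<xi> v (\<delta>, i) = real \<delta> * (spray_lie ^^ m) (shift 1 \<xi>) v (\<delta> - 1, i)
      + real \<delta> * (real m * (spray_lie ^^ (m - 1)) \<xi> v (\<delta> - 1, i))"
    using Suc.IH[OF Suc.prems, of "\<delta> - 1"] by (cases \<delta>) (auto simp: distrib_left)
  have "real m * (real \<delta> * (spray_lie ^^ (m - 1)) \<xi> v (\<delta> - 1, i)) = real \<delta> * (real m * (spray_lie ^^ (m - 1)) \<xi> v (\<delta> - 1, i))"
    by simp
  then show ?case using 1 2 3 4 by (simp add: distrib_right)
qed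

text \<open>Applied to the components \<open>\<xi>\<close> of \<open>dL\<close> this gives the Poincare-Cartan form of \<open>L\<close>, and \<open>euler_expr\<close> the
  functions \<open>E\<^sub>i\<close>.\<close>

definition cartan_form :: "nat \<Rightarrow> ((nat \<times> 'n \<Rightarrow> real) \<Rightarrow> nat \<times> 'n \<Rightarrow> real) \<Rightarrow> (nat \<times> 'n \<Rightarrow> real) \<Rightarrow> nat \<times> 'n \<Rightarrow> real" where
  "cartan_form k \<xi> v a = (\<Sum>\<alpha>=1..k. (-1) ^ (\<alpha> - 1) / fact \<alpha> * (spray_lie ^^ (\<alpha> - 1)) (shift \<alpha> \<xi>) v a)"

definition euler_expr :: "nat \<Rightarrow> ((nat \<times> 'n \<Rightarrow> real) \<Rightarrow> nat \<times> 'n \<Rightarrow> real) \<Rightarrow> 'n \<Rightarrow> (nat \<times> 'n \<Rightarrow> real) \<Rightarrow> real" where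
  "euler_expr k \<xi> i v = (\<Sum>\<alpha>=0..k. (-1) ^ \<alpha> / fact \<alpha> * (D ^^ \<alpha>) (\<lambda>w. \<xi> w (\<alpha>, i)) v)"

lemma smooth_form_cartan: "smooth_form \<xi> \<Longrightarrow> smooth_form (cartan_form k \<xi>)"
  using smooth_form_spray_lie_funpow[OF smooth_form_shift, of \<xi>] unfolding smooth_form_def cartan_form_def
  by (intro allI smooth_sum smooth_cmult) auto

lemma euler_expr_smooth: "smooth_form \<xi> \<Longrightarrow> sm (euler_expr k \<xi> i)"
  unfolding smooth_form_def euler_expr_def by (intro smooth_sum smooth_cmult D_funpow_smooth) auto

lemma cartan_high_zero:
  assumes "order_le k \<xi>" "v \<in> V" "\<delta> \<ge> k" shows "cartan_form k \<xi> v (\<delta>, i) = 0"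
  unfolding cartan_form_def
proof (intro sum.neutral ballI)
  fix \<alpha> assume \<alpha>: "\<alpha> \<in> {1..k}"
  have "order_le (k - \<alpha> + (\<alpha> - 1)) ((spray_lie ^^ (\<alpha> - 1)) (shift \<alpha> \<xi>))"
    by (intro order_le_spray_lie_funpow order_le_shift assms)
  then show "(-1) ^ (\<alpha> - 1) / fact \<alpha> * (spray_lie ^^ (\<alpha> - 1)) (shift \<alpha> \<xi>) v (\<delta>, i) = 0"
    using \<alpha> assms unfolding order_le_def by auto
qed

lemma spray_lie_funpow_zero: "(\<lambda>w. (spray_lie ^^ m) \<xi> w (0, i)) = (D ^^ m) (\<lambda>w. \<xi> w (0, i))"
proof (induction m)
  case (Suc m)
  then show ?case by (auto simp: spray_lie_def fun_eq_iff)
qed simp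

text \<open>With \<open>T = \<Sum>\<^sub>\<alpha> (-1)\<^sup>\<alpha> / \<alpha>! \<Lambda>\<^sup>\<alpha> J\<^sup>\<alpha> \<xi>\<close>, summed over \<open>0 \<le> \<alpha> \<le> k\<close>, the definition of \<open>cartan_form\<close> gives
  \<open>\<Lambda> (cartan_form k \<xi>) = \<xi> - T\<close>. By the relation between the operators \<open>J T\<close> telescopes to a multiple of
  \<open>\<Lambda>\<^sup>k J^(k + 1) \<xi>\<close>, which is zero because \<open>\<xi>\<close> has no components of order greater than \<open>k\<close>. So only the
  components of order 0 of \<open>T\<close> remain, and on these \<open>\<Lambda>\<close> acts as \<open>D\<close>.\<close>

lemma spray_lie_cartan:
  assumes \<xi>: "smooth_form \<xi>" "order_le k \<xi>" and v: "v \<in> V"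
  shows "spray_lie (cartan_form k \<xi>) v (\<delta>, i) = \<xi> v (\<delta>, i) - (if \<delta> = 0 then euler_expr k \<xi> i v else 0)"
proof -
  define T where "T = (\<lambda>a. \<Sum>\<alpha>=0..k. (-1) ^ \<alpha> / fact \<alpha> * (spray_lie ^^ \<alpha>) (shift \<alpha> \<xi>) v a)"
  define P where "P = (\<lambda>\<alpha>. (-1) ^ (\<alpha> - 1) / fact \<alpha> :: real)"
  have "spray_lie (cartan_form k \<xi>) v a = \<xi> v a - T a" for a
  proof -
    have S: "sm (\<lambda>v. (spray_lie ^^ (\<alpha> - 1)) (shift \<alpha> \<xi>) v a)" for \<alpha>
      using smooth_form_spray_lie_funpow[OF smooth_form_shift[OF \<xi>(1)]] unfolding smooth_form_def by blast
    have "D (\<lambda>w. cartan_form k \<xi> w a) v = (\<Sum>\<alpha>=1..k. D (\<lambda>w. P \<alpha> * (spray_lie ^^ (\<alpha> - 1)) (shift \<alpha> \<xi>) w a) v)"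
      unfolding cartan_form_def P_def by (rule D_sum[OF _ v]) (intro smooth_cmult S)
    also have "\<dots> = (\<Sum>\<alpha>=1..k. P \<alpha> * D (\<lambda>w. (spray_lie ^^ (\<alpha> - 1)) (shift \<alpha> \<xi>) w a) v)"
      using D_cmult[OF S v] by simp
    finally have "spray_lie (cartan_form k \<xi>) v a = (\<Sum>\<alpha>=1..k. P \<alpha> * spray_lie ((spray_lie ^^ (\<alpha> - 1)) (shift \<alpha> \<xi>)) v a)"
      unfolding spray_lie_def[of "cartan_form k \<xi>"] spray_lie_def[of "(spray_lie ^^ _) _"] cartan_form_def P_def[symmetric]
      by (simp only: sum_distrib_left sum.distrib distrib_left mult_ac P_def)
    also have "\<dots> = (\<Sum>\<alpha>=1..k. - ((-1) ^ \<alpha> / fact \<alpha> * (spray_lie ^^ \<alpha>) (shift \<alpha> \<xi>) v a))"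
    proof (intro sum.cong refl)
      fix \<alpha> assume "\<alpha> \<in> {1..k}"
      then obtain \<beta> where "\<alpha> = Suc \<beta>" by (cases \<alpha>) auto
      then show "P \<alpha> * spray_lie ((spray_lie ^^ (\<alpha> - 1)) (shift \<alpha> \<xi>)) v a = - ((-1) ^ \<alpha> / fact \<alpha> * (spray_lie ^^ \<alpha>) (shift \<alpha> \<xi>) v a)"
        by (simp add: P_def)
    qed
    also have "\<dots> = \<xi> v a - T a"
      unfolding T_def by (subst sum.atLeast_Suc_atMost[of 0]) (auto simp: sum_negf shift_def)
    finally show ?thesis .
  qed
  moreover have "T (0, i) = euler_expr k \<xi> i v"
  proof -
    have "(spray_lie ^^ \<alpha>) (shift \<alpha> \<xi>) v (0, i) = (D ^^ \<alpha>) (\<lambda>w. \<xi> w (\<alpha>, i)) v" for \<alpha>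
      using fun_cong[OF spray_lie_funpow_zero[of \<alpha> "shift \<alpha> \<xi>" i], of v] by (simp add: shift_def)
    then show ?thesis by (simp add: T_def euler_expr_def)
  qed
  moreover have "T (Suc \<delta>, i) = 0" for \<delta>
  proof -
    define A where "A = (\<lambda>\<alpha>. (spray_lie ^^ \<alpha>) (shift (Suc \<alpha>) \<xi>) v (\<delta>, i))"
    have "(spray_lie ^^ \<alpha>) (shift \<alpha> \<xi>) v (Suc \<delta>, i) = A \<alpha> + real \<alpha> * A (\<alpha> - 1)" for \<alpha>
      using shift_spray_lie_funpow[OF smooth_form_shift[OF \<xi>(1)] v, of \<alpha> \<alpha> \<delta> i]
      by (cases \<alpha>) (auto simp: A_def shift_shift)
    then have "T (Suc \<delta>, i) = (\<Sum>\<alpha>=0..k. (-1) ^ \<alpha> / fact \<alpha> * (A \<alpha> + real \<alpha> * A (\<alpha> - 1)))"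
      by (simp add: T_def)
    also have "\<dots> = (-1) ^ k / fact k * A k"
    proof (induction k)
      case (Suc k)
      have "(-1) ^ Suc k / fact (Suc k) * (real (Suc k) * A k) = - ((-1) ^ k / fact k * A k)"
        by (simp add: field_simps del: of_nat_Suc)
      then show ?case using Suc by (simp add: distrib_left)
    qed simp
    also have "A k = 0"
    proof -
      have "(spray_lie ^^ m) (shift (Suc k) \<xi>) w (\<delta>, i) = 0" if "w \<in> V" for m w \<delta>
        using that
      proof (induction m arbitrary: w \<delta>)
        case 0
        then show ?case using \<xi>(2) by (auto simp: shift_def order_le_def)
      next
        case (Suc m)
        then show ?case by (auto simp: spray_lie_def intro: D_zero)
      qed
      then show ?thesis using v by (simp add: A_def)
    qed
    finally show ?thesis by simp
  qed
  ultimately show ?thesis by (cases \<delta>) auto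
qed

text \<open>The component \<open>(\<delta> + 1, i)\<close> of the equation determines \<open>\<theta> (\<delta>, i)\<close> from \<open>\<theta> (\<delta> + 1, i)\<close>, so the equations
  can be solved downwards from \<open>\<theta> (k, i) = 0\<close>. Both forms are solutions.\<close>

lemma cartan_form_unique:
  assumes \<xi>: "smooth_form \<xi>" "order_le k \<xi>"
    and z: "\<And>v \<delta> i. v \<in> V \<Longrightarrow> \<delta> \<ge> k \<Longrightarrow> \<theta> v (\<delta>, i) = 0"
    and L: "\<And>v \<delta> i. v \<in> V \<Longrightarrow> 0 < \<delta> \<Longrightarrow> \<delta> \<le> k \<Longrightarrow> spray_lie \<theta> v (\<delta>, i) = \<xi> v (\<delta>, i)"
    and v: "v \<in> V"
  shows "\<theta> v (\<delta>, i) = cartan_form k \<xi> v (\<delta>, i)"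
proof -
  have "\<theta> v (\<delta>, i) = cartan_form k \<xi> v (\<delta>, i)" if "v \<in> V" "\<delta> \<ge> k - m" for m \<delta> v
    using that
  proof (induction m arbitrary: v \<delta>)
    case 0
    then show ?case using z cartan_high_zero[OF \<xi>(2)] by simp
  next
    case (Suc m)
    show ?case
    proof (cases "k - m \<le> \<delta>")
      case True
      then show ?thesis using Suc by auto
    next
      case False
      then have lt: "Suc \<delta> \<le> k" "Suc \<delta> \<ge> k - m" using Suc.prems by auto
      have "spray_lie \<theta> v (Suc \<delta>, i) = spray_lie (cartan_form k \<xi>) v (Suc \<delta>, i)"
        using L[OF Suc.prems(1), of "Suc \<delta>" i] lt spray_lie_cartan[OF \<xi> Suc.prems(1)] by simp
      moreover have "D (\<lambda>w. \<theta> w (Suc \<delta>, i)) v = D (\<lambda>w. cartan_form k \<xi> w (Suc \<delta>, i)) v"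
        by (rule deriv_along_cong[OF Suc.prems(1)]) (use Suc.IH lt in auto)
      ultimately show ?thesis by (simp add: spray_lie_def del: of_nat_Suc)
    qed
  qed
  from this[of v k \<delta>] show ?thesis using v by simp
qed

end

section \<open>Prolongations, integral curves and regularity in coordinates\<close>

text \<open>Row vectors on the left: this is the convention of \<open>matrix_rank\<close> and \<open>symplectic\<close>.\<close>

definition nondeg :: "'i set \<Rightarrow> ('i \<Rightarrow> 'i \<Rightarrow> real) \<Rightarrow> bool" where
  "nondeg I m \<longleftrightarrow> (\<forall>u. (\<forall>a\<in>I. (\<Sum>b\<in>I. u b * m b a) = 0) \<longrightarrow> (\<forall>b\<in>I. u b = 0))"

context spray_domain begin

context
  fixes Y :: "nat \<Rightarrow> (nat \<times> 'n \<Rightarrow> real) \<Rightarrow> real"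
  assumes Y: "\<And>\<alpha>. \<alpha> \<le> r \<Longrightarrow> sm (Y \<alpha>)"
    and rec: "\<And>\<alpha> v. \<alpha> < r \<Longrightarrow> v \<in> V \<Longrightarrow> real (Suc \<alpha>) * Y (Suc \<alpha>) v = D (Y \<alpha>) v"
    and Y0: "\<And>\<delta> i v. 0 < \<delta> \<Longrightarrow> \<delta> \<le> r \<Longrightarrow> v \<in> V \<Longrightarrow> pd (\<delta>, i) (Y 0) v = 0"
begin

lemma prolong_pd_Suc:
  assumes "\<alpha> < r" "\<beta> \<le> r" "v \<in> V" "\<And>w l. w \<in> V \<Longrightarrow> pd (r, l) (Y \<alpha>) w = 0"
  shows "real (Suc \<alpha>) * pd (\<beta>, i) (Y (Suc \<alpha>)) v =
    D (pd (\<beta>, i) (Y \<alpha>)) v + real \<beta> * pd (\<beta> - 1, i) (Y \<alpha>) v"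
proof -
  have "real (Suc \<alpha>) * pd (\<beta>, i) (Y (Suc \<alpha>)) v = pd (\<beta>, i) (\<lambda>v. real (Suc \<alpha>) * Y (Suc \<alpha>) v) v"
    using assms Y by (intro pd_cmult[symmetric]) auto
  also have "\<dots> = pd (\<beta>, i) (D (Y \<alpha>)) v"
    by (rule pd_cong) (use assms rec in auto)
  also have "\<dots> = D (pd (\<beta>, i) (Y \<alpha>)) v + real \<beta> * pd (\<beta> - 1, i) (Y \<alpha>) v"
    using assms Y by (intro pd_D) auto
  finally show ?thesis .
qed

lemma prolong_upper: "\<alpha> < \<beta> \<Longrightarrow> \<beta> \<le> r \<Longrightarrow> v \<in> V \<Longrightarrow> pd (\<beta>, i) (Y \<alpha>) v = 0"
proof (induction \<alpha> arbitrary: \<beta> v i)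
  case 0
  then show ?case using Y0 by simp
next
  case (Suc \<alpha>)
  have "real (Suc \<alpha>) * pd (\<beta>, i) (Y (Suc \<alpha>)) v =
    D (pd (\<beta>, i) (Y \<alpha>)) v + real \<beta> * pd (\<beta> - 1, i) (Y \<alpha>) v"
    by (rule prolong_pd_Suc) (use Suc in auto)
  also have "\<dots> = 0" using Suc by (auto intro!: D_zero)
  finally show ?case by (simp del: of_nat_Suc)
qed

text \<open>The Jacobian of a prolongation depends only on the difference of the orders. By \<open>prolong_pd_Suc\<close> for
  \<open>Y (\<alpha> + 1)\<close> at order \<open>\<beta> + 1\<close> and for \<open>Y \<alpha>\<close> at order \<open>\<beta>\<close>, two equations are obtained that contain the same
  term \<open>D (\<partial> (Y \<alpha>) / \<partial>y(\<beta>, i))\<close>, by the induction hypothesis. Eliminating it gives the claim.\<close>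

lemma prolong_toeplitz:
  "\<alpha> < r \<Longrightarrow> \<beta> < r \<Longrightarrow> v \<in> V \<Longrightarrow> pd (Suc \<beta>, i) (Y (Suc \<alpha>)) v = pd (\<beta>, i) (Y \<alpha>) v"
proof (induction \<alpha> arbitrary: \<beta> v)
  case 0
  have "real (Suc 0) * pd (Suc \<beta>, i) (Y (Suc 0)) v =
    D (pd (Suc \<beta>, i) (Y 0)) v + real (Suc \<beta>) * pd (Suc \<beta> - 1, i) (Y 0) v"
    by (rule prolong_pd_Suc) (use 0 prolong_upper in auto)
  also have "D (pd (Suc \<beta>, i) (Y 0)) v = 0" using 0 Y0 by (intro D_zero) auto
  finally show ?case using 0 Y0[of \<beta> v i] by (cases \<beta>) auto
next
  case (Suc \<alpha>)
  have "real (Suc (Suc \<alpha>)) * pd (Suc \<beta>, i) (Y (Suc (Suc \<alpha>))) v =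
    D (pd (Suc \<beta>, i) (Y (Suc \<alpha>))) v + real (Suc \<beta>) * pd (\<beta>, i) (Y (Suc \<alpha>)) v"
    using Suc.prems prolong_upper by (subst prolong_pd_Suc) auto
  also have "D (pd (Suc \<beta>, i) (Y (Suc \<alpha>))) v = D (pd (\<beta>, i) (Y \<alpha>)) v"
    by (rule deriv_along_cong) (use Suc in auto)
  also have "\<dots> = real (Suc \<alpha>) * pd (\<beta>, i) (Y (Suc \<alpha>)) v - real \<beta> * pd (\<beta> - 1, i) (Y \<alpha>) v"
    using Suc.prems prolong_upper by (subst prolong_pd_Suc) auto
  also have "real \<beta> * pd (\<beta> - 1, i) (Y \<alpha>) v = real \<beta> * pd (\<beta>, i) (Y (Suc \<alpha>)) v"
    using Suc.IH[of "\<beta> - 1" v] Suc.prems by (cases \<beta>) auto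
  finally have "real (Suc (Suc \<alpha>)) * pd (Suc \<beta>, i) (Y (Suc (Suc \<alpha>))) v =
     real (Suc (Suc \<alpha>)) * pd (\<beta>, i) (Y (Suc \<alpha>)) v"
    by (simp add: algebra_simps)
  then show ?case by (simp del: of_nat_Suc)
qed

end

text \<open>A curve need not follow \<open>X\<close> in the coordinates of order \<open>r\<close> if \<open>f\<close> does not depend on them to first
  order. This covers the jet lift of an arbitrary curve.\<close>

lemma curve_partial_chain:
  assumes f: "sm f" and v: "u t \<in> V" and ev: "eventually (\<lambda>s. u s \<in> coord_space I) (at t)"
    and u: "\<And>\<delta> i. \<delta> < r \<Longrightarrow> ((\<lambda>s. u s (\<delta>, i)) has_real_derivative X (u t) (\<delta>, i)) (at t)"
    and top: "\<And>i. ((\<lambda>s. u s (r, i)) has_real_derivative w i) (at t)"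
    and z: "\<And>i. pd (r, i) f (u t) = 0"
  shows "((\<lambda>s. f (u s)) has_real_derivative D f (u t)) (at t)"
proof -
  define u' where "u' = (\<lambda>a. if fst a = r then w (snd a) else X (u t) a)"
  have "((\<lambda>s. f (u s)) has_real_derivative (\<Sum>a\<in>I. pd a f (u t) * u' a)) (at t)"
  proof (rule chain_curve[OF smooth_C1[OF f], of u t, OF v ev])
    fix a :: "nat \<times> 'n" assume a: "a \<in> I"
    obtain \<delta> i where ai: "a = (\<delta>, i)" by force
    show "((\<lambda>s. u s a) has_real_derivative u' a) (at t)"
      using u[of \<delta> i] top[of i] a unfolding ai u'_def by auto
  qed
  also have "(\<Sum>a\<in>I. pd a f (u t) * u' a) = D f (u t)"
    unfolding deriv_along_def u'_def by (intro sum.cong) (auto simp: z)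
  finally show ?thesis .
qed

lemma integral_curve_deriv:
  assumes T: "open T" and uV: "\<And>t. t \<in> T \<Longrightarrow> u t \<in> V"
    and u: "\<And>t a. t \<in> T \<Longrightarrow> a \<in> I \<Longrightarrow> ((\<lambda>s. u s a) has_real_derivative X (u t) a) (at t)"
    and f: "sm f" and t: "t \<in> T"
  shows "((\<lambda>s. f (u s)) has_real_derivative D f (u t)) (at t)"
proof -
  have "eventually (\<lambda>s. u s \<in> coord_space I) (at t)"
    using eventually_at_topological T t uV dom_coord by blast
  then have "((\<lambda>s. f (u s)) has_real_derivative (\<Sum>a\<in>I. pd a f (u t) * X (u t) a)) (at t)"
    by (rule chain_curve[OF smooth_C1[OF f], of u t, OF uV[OF t]]) (use u t in auto)
  then show ?thesis by (simp add: deriv_along_def mult.commute)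
qed

text \<open>Along an integral curve \<open>D\<close> is the derivative with respect to the parameter.\<close>

lemma integral_curve_funpow_deriv:
  assumes T: "open T" and uV: "\<And>t. t \<in> T \<Longrightarrow> u t \<in> V"
    and u: "\<And>t a. t \<in> T \<Longrightarrow> a \<in> I \<Longrightarrow> ((\<lambda>s. u s a) has_real_derivative X (u t) a) (at t)"
    and f: "sm f" and t: "t \<in> T"
  shows "(deriv ^^ m) (\<lambda>s. f (u s)) t = (D ^^ m) f (u t)"
  using t
proof (induction m arbitrary: t)
  case (Suc m)
  have "eventually (\<lambda>s. (deriv ^^ m) (\<lambda>s. f (u s)) s = (D ^^ m) f (u s)) (nhds t)"
    using eventually_nhds_in_open[OF T Suc.prems] by eventually_elim (use Suc.IH in auto)
  then have "(deriv ^^ Suc m) (\<lambda>s. f (u s)) t = deriv (\<lambda>s. (D ^^ m) f (u s)) t"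
    by (auto intro: deriv_cong_ev)
  also have "\<dots> = D ((D ^^ m) f) (u t)"
    by (intro DERIV_imp_deriv integral_curve_deriv[OF T uV u D_funpow_smooth[OF f] Suc.prems])
  finally show ?case by simp
qed simp

lemma integral_curve_differentiable:
  assumes T: "open T" and uV: "\<And>t. t \<in> T \<Longrightarrow> u t \<in> V"
    and u: "\<And>t a. t \<in> T \<Longrightarrow> a \<in> I \<Longrightarrow> ((\<lambda>s. u s a) has_real_derivative X (u t) a) (at t)"
    and f: "sm f" and t: "t \<in> T"
  shows "(deriv ^^ m) (\<lambda>s. f (u s)) field_differentiable (at t)"
proof -
  have "eventually (\<lambda>s. (deriv ^^ m) (\<lambda>s. f (u s)) s = (D ^^ m) f (u s)) (nhds t)"
    using eventually_nhds_in_open[OF T t]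
    by eventually_elim (rule integral_curve_funpow_deriv[OF T uV u f])
  then have "((deriv ^^ m) (\<lambda>s. f (u s)) has_real_derivative D ((D ^^ m) f) (u t)) (at t)"
    using integral_curve_deriv[OF T uV u D_funpow_smooth[OF f] t, of m]
    by (subst DERIV_cong_ev[OF refl _ refl]) auto
  then show ?thesis unfolding field_differentiable_def by blast
qed

text \<open>The component of \<open>X\<close> of order \<open>\<gamma> - \<alpha>\<close> is the component of order \<open>\<gamma>\<close> of the \<open>\<alpha>\<close>-th Liouville field: the
  identity \<open>J\<^sup>\<alpha> S = C\<^sub>\<alpha>\<close>. Terms with \<open>\<delta> + \<alpha> > r\<close> vanish since \<open>k \<le> r\<close>.\<close>

lemma contraction_shift:
  assumes \<xi>: "order_le k \<xi>" "k \<le> r" and \<alpha>: "1 \<le> \<alpha>" and v: "v \<in> V"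
  shows "(\<Sum>a\<in>I. X v a * shift \<alpha> \<xi> v a) =
    (\<Sum>a\<in>I. (if \<alpha> \<le> fst a then real (fst a + 1 - \<alpha>) * v (fst a + 1 - \<alpha>, snd a) else 0) * \<xi> v a)"
proof -
  define g where "g = (\<lambda>\<gamma>. \<Sum>i\<in>UNIV. real (\<gamma> + 1 - \<alpha>) * v (\<gamma> + 1 - \<alpha>, i) * \<xi> v (\<gamma>, i))"
  have z: "\<xi> v (\<delta>, i) = 0" if "\<delta> > r" for \<delta> i using \<xi> v that by (auto simp: order_le_def)
  have L: "(\<Sum>a\<in>I. X v a * shift \<alpha> \<xi> v a) = (\<Sum>\<delta>\<in>{0..r}. if \<delta> + \<alpha> \<le> r then g (\<delta> + \<alpha>) else 0)"
    unfolding sum_jet_idx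
  proof (intro sum.cong refl)
    fix \<delta> show "(\<Sum>i\<in>UNIV. X v (\<delta>, i) * shift \<alpha> \<xi> v (\<delta>, i)) = (if \<delta> + \<alpha> \<le> r then g (\<delta> + \<alpha>) else 0)"
      using z[of "\<delta> + \<alpha>"] \<alpha> X_spray[OF v, of \<delta>] by (auto simp: shift_def g_def)
  qed
  have R: "(\<Sum>a\<in>I. (if \<alpha> \<le> fst a then real (fst a + 1 - \<alpha>) * v (fst a + 1 - \<alpha>, snd a) else 0) * \<xi> v a)
     = (\<Sum>\<gamma>\<in>{0..r}. if \<alpha> \<le> \<gamma> then g \<gamma> else 0)"
    unfolding sum_jet_idx by (intro sum.cong refl) (auto simp: g_def)
  show ?thesis
  proof (cases "\<alpha> \<le> r")
    case True
    have "(\<Sum>\<delta>\<in>{0..r}. if \<delta> + \<alpha> \<le> r then g (\<delta> + \<alpha>) else 0) = (\<Sum>\<delta>\<in>{0..r-\<alpha>}. g (\<delta> + \<alpha>))"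
      using True by (intro sum.mono_neutral_cong_right) auto
    also have "\<dots> = (\<Sum>\<gamma>\<in>{0+\<alpha>..(r-\<alpha>)+\<alpha>}. g \<gamma>)"
      by (rule sum.shift_bounds_cl_nat_ivl[symmetric])
    also have "\<dots> = (\<Sum>\<gamma>\<in>{0..r}. if \<alpha> \<le> \<gamma> then g \<gamma> else 0)"
      using True by (intro sum.mono_neutral_cong_left) auto
    finally show ?thesis using L R by simp
  next
    case False
    have "(\<Sum>\<delta>\<in>{0..r}. if \<delta> + \<alpha> \<le> r then g (\<delta> + \<alpha>) else 0) = 0"
      "(\<Sum>\<gamma>\<in>{0..r}. if \<alpha> \<le> \<gamma> then g \<gamma> else 0) = 0"
      using False by (auto intro!: sum.neutral)
    then show ?thesis using L R by simp
  qed
qed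

text \<open>The components of \<open>df\<close> up to order \<open>k\<close>, continued by zero: the operators above act on components
  of every order.\<close>

definition grad :: "nat \<Rightarrow> ((nat \<times> 'n \<Rightarrow> real) \<Rightarrow> real) \<Rightarrow> (nat \<times> 'n \<Rightarrow> real) \<Rightarrow> nat \<times> 'n \<Rightarrow> real" where
  "grad k f v a = (if fst a \<le> k then pd a f v else 0)"

lemma smooth_form_grad: "sm f \<Longrightarrow> k \<le> r \<Longrightarrow> smooth_form (grad k f)"
  unfolding smooth_form_def
proof
  fix a assume "sm f" "k \<le> r"
  then show "sm (\<lambda>v. grad k f v a)"
    by (cases "fst a \<le> k"; cases a) (auto simp: grad_def intro!: smooth_pd)
qed

lemma order_le_grad: "order_le k (grad k f)"
  by (auto simp: order_le_def grad_def)

context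
  fixes k f
  assumes r: "r = 2 * k - 1" and k: "1 \<le> k" and f: "sm f"
    and f_dep: "\<And>\<gamma> j v. k < \<gamma> \<Longrightarrow> \<gamma> \<le> r \<Longrightarrow> v \<in> V \<Longrightarrow> pd (\<gamma>, j) f v = 0"
begin

lemma k_le_order: "k \<le> r" using r k by simp

lemma cartan_form_rec:
  assumes "v \<in> V"
  shows "cartan_form k (grad k f) v (\<beta>, i) = (grad k f v (Suc \<beta>, i) - D (\<lambda>w. cartan_form k (grad k f) w (Suc \<beta>, i)) v) / real (Suc \<beta>)"
  using spray_lie_cartan[OF smooth_form_grad[OF f k_le_order] order_le_grad assms, of "Suc \<beta>" i]
  by (simp add: spray_lie_def field_simps del: of_nat_Suc)

text \<open>By \<open>cartan_form_rec\<close> each step down in \<open>\<beta>\<close> applies \<open>D\<close> once more, which raises the highest order of a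
  coordinate on which the component depends by one and multiplies the derivative with respect to that
  coordinate by a nonzero number (\<open>pd_D\<close>). The start is the component \<open>(\<partial>f / \<partial>y(k, i)) / k\<close> of order \<open>k - 1\<close>.\<close>

lemma cartan_form_top:
  "m < k \<Longrightarrow> (\<forall>\<gamma> j i. \<forall>v\<in>V. k + m < \<gamma> \<longrightarrow> \<gamma> \<le> r \<longrightarrow> pd (\<gamma>, j) (\<lambda>w. cartan_form k (grad k f) w (k - 1 - m, i)) v = 0) \<and>
    (\<exists>c\<noteq>0. \<forall>j i. \<forall>v\<in>V. pd (k + m, j) (\<lambda>w. cartan_form k (grad k f) w (k - 1 - m, i)) v = c * pd (k, j) (pd (k, i) f) v)"
proof (induction m)
  case 0
  have eq: "cartan_form k (grad k f) v (k - 1, i) = (1 / real k) * pd (k, i) f v" if "v \<in> V" for v i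
  proof -
    have "D (\<lambda>w. cartan_form k (grad k f) w (k, i)) v = 0"
      using cartan_high_zero[OF order_le_grad] by (intro D_zero that) auto
    then show ?thesis using cartan_form_rec[OF that, of "k - 1" i] k by (simp add: grad_def)
  qed
  have p: "pd (\<gamma>, j) (\<lambda>w. cartan_form k (grad k f) w (k - 1, i)) v = (1 / real k) * pd (\<gamma>, j) (pd (k, i) f) v"
    if "v \<in> V" "\<gamma> \<le> r" for v i \<gamma> j
  proof -
    have "pd (\<gamma>, j) (\<lambda>w. cartan_form k (grad k f) w (k - 1, i)) v = pd (\<gamma>, j) (\<lambda>w. (1 / real k) * pd (k, i) f w) v"
      by (rule pd_cong) (use that eq in auto)
    also have "\<dots> = (1 / real k) * pd (\<gamma>, j) (pd (k, i) f) v"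
      using that k_le_order by (intro pd_cmult smooth_pd f) auto
    finally show ?thesis .
  qed
  have z: "pd (\<gamma>, j) (pd (k, i) f) v = 0" if "v \<in> V" "k < \<gamma>" "\<gamma> \<le> r" for v i \<gamma> j
    using pd_commute[OF f, of "(\<gamma>, j)" "(k, i)" v] that k_le_order
      pd_zero[of "pd (\<gamma>, j) f" "(k, i)" v] f_dep by simp
  show ?case
    using p z k k_le_order by (auto intro!: exI[of _ "1 / real k"])
next
  case (Suc m)
  define \<beta> where "\<beta> = k - 1 - Suc m"
  have \<beta>: "Suc \<beta> = k - 1 - m" "Suc \<beta> < k" using Suc.prems by (auto simp: \<beta>_def)
  let ?\<theta> = "cartan_form k (grad k f)"
  obtain c where c: "c \<noteq> 0" and IH1: "\<And>\<gamma> j i v. v \<in> V \<Longrightarrow> k + m < \<gamma> \<Longrightarrow> \<gamma> \<le> r \<Longrightarrow> pd (\<gamma>, j) (\<lambda>w. ?\<theta> w (Suc \<beta>, i)) v = 0"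
    and IH2: "\<And>j i v. v \<in> V \<Longrightarrow> pd (k + m, j) (\<lambda>w. ?\<theta> w (Suc \<beta>, i)) v = c * pd (k, j) (pd (k, i) f) v"
    using Suc unfolding \<beta>(1)[symmetric] by auto
  have scf: "sm (\<lambda>w. ?\<theta> w a)" for a using smooth_form_cartan[OF smooth_form_grad[OF f k_le_order]] unfolding smooth_form_def by blast
  have p: "pd (\<gamma>, j) (\<lambda>w. ?\<theta> w (\<beta>, i)) v = - (real \<gamma> / real (Suc \<beta>)) * pd (\<gamma> - 1, j) (\<lambda>w. ?\<theta> w (Suc \<beta>, i)) v"
    if v: "v \<in> V" and \<gamma>: "k + m < \<gamma>" "\<gamma> \<le> r" for v \<gamma> j i
  proof -
    have a: "(\<gamma>, j) \<in> I" using \<gamma> by simp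
    have b: "(Suc \<beta>, i) \<in> I" using \<beta> k_le_order by simp
    have "pd (\<gamma>, j) (\<lambda>w. ?\<theta> w (\<beta>, i)) v =
       pd (\<gamma>, j) (\<lambda>v. (1 / real (Suc \<beta>)) * (pd (Suc \<beta>, i) f v - D (\<lambda>w. ?\<theta> w (Suc \<beta>, i)) v)) v"
    proof (rule pd_cong[OF v a])
      fix w assume "w \<in> V"
      then show "?\<theta> w (\<beta>, i) = (1 / real (Suc \<beta>)) * (pd (Suc \<beta>, i) f w - D (\<lambda>w. ?\<theta> w (Suc \<beta>, i)) w)"
        using cartan_form_rec[of w \<beta> i] \<beta>(2) by (simp add: grad_def del: of_nat_Suc)
    qed
    also have "\<dots> = (1 / real (Suc \<beta>)) * pd (\<gamma>, j) (\<lambda>v. pd (Suc \<beta>, i) f v - D (\<lambda>w. ?\<theta> w (Suc \<beta>, i)) v) v"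
      by (intro pd_cmult smooth_diff smooth_pd D_smooth f scf a b v)
    also have "pd (\<gamma>, j) (\<lambda>v. pd (Suc \<beta>, i) f v - D (\<lambda>w. ?\<theta> w (Suc \<beta>, i)) v) v =
       pd (\<gamma>, j) (pd (Suc \<beta>, i) f) v - pd (\<gamma>, j) (D (\<lambda>w. ?\<theta> w (Suc \<beta>, i))) v"
      by (intro pd_diff smooth_pd D_smooth f scf a b v)
    also have "pd (\<gamma>, j) (pd (Suc \<beta>, i) f) v = 0"
      unfolding pd_commute[OF f a b v] by (rule pd_zero[OF _ b v]) (use f_dep \<gamma> in auto)
    also have "pd (\<gamma>, j) (D (\<lambda>w. ?\<theta> w (Suc \<beta>, i))) v =
       D (pd (\<gamma>, j) (\<lambda>w. ?\<theta> w (Suc \<beta>, i))) v + real \<gamma> * pd (\<gamma> - 1, j) (\<lambda>w. ?\<theta> w (Suc \<beta>, i)) v"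
      using IH1[of _ r] \<gamma> by (intro pd_D scf v) auto
    also have "D (pd (\<gamma>, j) (\<lambda>w. ?\<theta> w (Suc \<beta>, i))) v = 0"
      using IH1[of _ \<gamma> j] \<gamma> by (intro D_zero v) auto
    finally show ?thesis by simp
  qed
  show ?case unfolding \<beta>_def[symmetric]
  proof (intro conjI allI ballI impI)
    fix \<gamma> j i v assume "v \<in> V" "k + Suc m < \<gamma>" "\<gamma> \<le> r"
    then show "pd (\<gamma>, j) (\<lambda>w. ?\<theta> w (\<beta>, i)) v = 0" using p IH1[of v "\<gamma> - 1"] by simp
  next
    show "\<exists>c\<noteq>0. \<forall>j i. \<forall>v\<in>V. pd (k + Suc m, j) (\<lambda>w. ?\<theta> w (\<beta>, i)) v = c * pd (k, j) (pd (k, i) f) v"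
      using p[of _ "k + Suc m"] IH2 c Suc.prems r
      by (intro exI[of _ "- (real (k + Suc m) / real (Suc \<beta>)) * c"]) (auto simp del: of_nat_Suc)
  qed
qed

text \<open>The block of the matrix at orders \<open>(\<beta>, \<gamma>)\<close> vanishes for \<open>\<beta> + \<gamma> > r\<close> and is a nonzero multiple of the
  Hessian for \<open>\<beta> + \<gamma> = r\<close>. So a vector annihilated by the matrix is found to be zero block by block if the
  Hessian is nondegenerate. Conversely, a null vector of the Hessian, placed in the block of order
  \<open>r\<close>, is a null vector of the matrix.\<close>

lemma cartan_form_nondeg_iff:
  assumes v: "v \<in> V"
  shows "nondeg I (\<lambda>b a. pd b (\<lambda>w. cartan_form k (grad k f) w a) v - pd a (\<lambda>w. cartan_form k (grad k f) w b) v) \<longleftrightarrow>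
    nondeg UNIV (\<lambda>i j. pd (k, i) (pd (k, j) f) v)"
proof -
  let ?\<theta> = "cartan_form k (grad k f)"
  define \<Omega> where "\<Omega> = (\<lambda>b a. pd b (\<lambda>w. ?\<theta> w a) v - pd a (\<lambda>w. ?\<theta> w b) v)"
  define H where "H = (\<lambda>i j. pd (k, i) (pd (k, j) f) v)"
  have Hsym: "H i j = H j i" for i j
    unfolding H_def using k_le_order by (intro pd_commute[OF f _ _ v]) auto
  have low: "pd (\<gamma>, j) (\<lambda>w. ?\<theta> w (\<beta>, i)) v = 0" if "r < \<gamma> + \<beta>" "\<gamma> \<le> r" for \<gamma> \<beta> i j
  proof (cases "\<beta> < k")
    case True
    then have "k - 1 - (k - 1 - \<beta>) = \<beta>" by simp
    then show ?thesis using cartan_form_top[of "k - 1 - \<beta>"] that True v r by simp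
  next
    case False
    then show ?thesis using cartan_high_zero[OF order_le_grad] that v by (intro pd_zero) auto
  qed
  have anti: "\<exists>c\<noteq>0. \<forall>j i. pd (\<gamma>, j) (\<lambda>w. ?\<theta> w (\<beta>, i)) v = c * H i j" if "\<gamma> + \<beta> = r" "\<beta> < k" for \<gamma> \<beta>
  proof -
    have e: "k - 1 - (k - 1 - \<beta>) = \<beta>" "k + (k - 1 - \<beta>) = \<gamma>" "k - 1 - \<beta> < k" using that r by auto
    obtain c where "c \<noteq> 0" "\<And>j i. pd (\<gamma>, j) (\<lambda>w. ?\<theta> w (\<beta>, i)) v = c * H j i"
      using cartan_form_top[OF e(3), unfolded e(1,2)] v unfolding H_def by blast
    then show ?thesis using Hsym by metis
  qed
  have zero: "pd (\<gamma>, j) (\<lambda>w. ?\<theta> w (\<beta>, i)) v = 0" if "k \<le> \<beta>" "\<gamma> \<le> r" for \<gamma> \<beta> i j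
    using cartan_high_zero[OF order_le_grad] that v by (intro pd_zero) auto
  have \<Omega>0: "\<Omega> (\<beta>, i) (\<gamma>, j) = 0" if "r < \<beta> + \<gamma>" "\<beta> \<le> r" "\<gamma> \<le> r" for \<beta> \<gamma> i j
    using low[of \<beta> \<gamma>] low[of \<gamma> \<beta>] that by (simp add: \<Omega>_def)
  have \<Omega>1: "\<exists>c\<noteq>0. \<forall>i j. \<Omega> (\<beta>, i) (\<gamma>, j) = c * H i j" if "\<beta> + \<gamma> = r" for \<beta> \<gamma>
  proof (cases "\<beta> < k")
    case True
    then obtain c where c: "c \<noteq> 0" "\<And>i j. pd (\<gamma>, j) (\<lambda>w. ?\<theta> w (\<beta>, i)) v = c * H i j"
      using anti[of \<gamma> \<beta>] \<open>\<beta> + \<gamma> = r\<close> by (auto simp: add.commute)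
    have "k \<le> \<gamma>" using True that r by simp
    then show ?thesis using c zero[of \<gamma> \<beta>] that
      by (intro exI[of _ "-c"]) (auto simp: \<Omega>_def)
  next
    case False
    then have "\<gamma> < k" using that r k by simp
    then obtain c where c: "c \<noteq> 0" "\<And>i j. pd (\<beta>, j) (\<lambda>w. ?\<theta> w (\<gamma>, i)) v = c * H i j"
      using anti[of \<beta> \<gamma>, OF \<open>\<beta> + \<gamma> = r\<close>] by blast
    then show ?thesis using zero[of \<beta> \<gamma>] that False Hsym
      by (intro exI[of _ c]) (auto simp: \<Omega>_def)
  qed
  have "nondeg I \<Omega> \<longleftrightarrow> nondeg UNIV H"
  proof
    assume N: "nondeg I \<Omega>"
    show "nondeg UNIV H" unfolding nondeg_def
    proof (intro allI impI ballI)
      fix w i assume w: "\<forall>j\<in>UNIV. (\<Sum>i\<in>UNIV. w i * H i j) = 0"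
      define u where "u = (\<lambda>b. if fst b = r then w (snd b) else 0)"
      have "(\<Sum>b\<in>I. u b * \<Omega> b a) = 0" if a: "a \<in> I" for a
      proof -
        obtain \<gamma> j where aj: "a = (\<gamma>, j)" by force
        have "(\<Sum>b\<in>I. u b * \<Omega> b a) = (\<Sum>\<delta>\<in>{0..r}. if \<delta> = r then \<Sum>i\<in>UNIV. w i * \<Omega> (r, i) a else 0)"
          unfolding sum_jet_idx by (intro sum.cong refl) (auto simp: u_def)
        also have "\<dots> = (\<Sum>i\<in>UNIV. w i * \<Omega> (r, i) a)" by simp
        also have "\<dots> = 0"
        proof (cases "\<gamma> = 0")
          case True
          then obtain c where "\<And>i j. \<Omega> (r, i) (\<gamma>, j) = c * H i j" using \<Omega>1[of r \<gamma>] by auto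
          then have "(\<Sum>i\<in>UNIV. w i * \<Omega> (r, i) a) = c * (\<Sum>i\<in>UNIV. w i * H i j)"
            by (simp add: aj sum_distrib_left mult_ac)
          then show ?thesis using w by simp
        next
          case False
          then show ?thesis using \<Omega>0[of r \<gamma>] a by (simp add: aj)
        qed
        finally show ?thesis .
      qed
      then have "u (r, i) = 0" using N unfolding nondeg_def by auto
      then show "w i = 0" by (simp add: u_def)
    qed
  next
    assume N: "nondeg UNIV H"
    show "nondeg I \<Omega>" unfolding nondeg_def
    proof (intro allI impI ballI)
      fix u and b :: "nat \<times> 'n" assume u: "\<forall>a\<in>I. (\<Sum>b\<in>I. u b * \<Omega> b a) = 0" and b: "b \<in> I"
      have "\<beta> \<le> r \<Longrightarrow> \<forall>i. u (\<beta>, i) = 0" for \<beta>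
      proof (induction \<beta> rule: less_induct)
        case (less \<beta>)
        obtain c where c: "c \<noteq> 0" "\<And>i j. \<Omega> (\<beta>, i) (r - \<beta>, j) = c * H i j"
          using \<Omega>1[of \<beta> "r - \<beta>"] less.prems by auto
        have "(\<Sum>i\<in>UNIV. u (\<beta>, i) * H i j) = 0" for j
        proof -
          have "0 = (\<Sum>b\<in>I. u b * \<Omega> b (r - \<beta>, j))" using u by simp
          also have "\<dots> = (\<Sum>\<delta>\<in>{0..r}. if \<delta> = \<beta> then \<Sum>i\<in>UNIV. u (\<beta>, i) * \<Omega> (\<beta>, i) (r - \<beta>, j) else 0)"
            unfolding sum_jet_idx
          proof (intro sum.cong refl)
            fix \<delta> assume \<delta>: "\<delta> \<in> {0..r}"
            show "(\<Sum>i\<in>UNIV. u (\<delta>, i) * \<Omega> (\<delta>, i) (r - \<beta>, j)) =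
              (if \<delta> = \<beta> then \<Sum>i\<in>UNIV. u (\<beta>, i) * \<Omega> (\<beta>, i) (r - \<beta>, j) else 0)"
              using less.IH[of \<delta>] \<Omega>0[of \<delta> "r - \<beta>"] \<delta> less.prems
              by (cases \<delta> \<beta> rule: linorder_cases) auto
          qed
          also have "\<dots> = c * (\<Sum>i\<in>UNIV. u (\<beta>, i) * H i j)"
            using less.prems c by (simp add: sum_distrib_left mult_ac)
          finally show ?thesis using c by simp
        qed
        then show ?case using N[unfolded nondeg_def, rule_format, of "\<lambda>i. u (\<beta>, i)"] by auto
      qed
      then show "u b = 0" using b by (cases b) auto
    qed
  qed
  then show ?thesis unfolding \<Omega>_def H_def .
qed

end

end

section \<open>Existence of integral curves\<close>

lemma uniform_bound:
  assumes "finite I" "\<And>a. a \<in> I \<Longrightarrow> compact C \<and> continuous_on C (g a :: _ \<Rightarrow> real)"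
  shows "\<exists>M>0. \<forall>a\<in>I. \<forall>w\<in>C. \<bar>g a w\<bar> \<le> M"
  using assms
proof (induction I rule: finite_induct)
  case empty
  then show ?case by (auto intro: exI[of _ 1])
next
  case (insert x F)
  then obtain M where M: "M > 0" "\<forall>a\<in>F. \<forall>w\<in>C. \<bar>g a w\<bar> \<le> M" by auto
  have "bounded (g x ` C)" using insert.prems by (auto intro!: compact_imp_bounded compact_continuous_image)
  then obtain B where B: "\<forall>w\<in>C. \<bar>g x w\<bar> \<le> B" by (auto simp: bounded_iff)
  show ?case using M B by (intro exI[of _ "max M B"]) (auto simp: le_max_iff_disj)
qed

text \<open>A primitive with value 0 at 0 on both sides of 0, written with integrals from the left end point.\<close>

lemma primitive_from_zero:
  fixes g :: "real \<Rightarrow> real"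
  assumes g: "continuous_on {-h..h} g" and h: "h > 0"
  defines "\<Phi> \<equiv> \<lambda>t. integral {-h..t} g - integral {-h..0} g"
  shows "\<And>t. t \<in> {-h..h} \<Longrightarrow> (\<Phi> has_real_derivative g t) (at t within {-h..h})"
    and "\<Phi> 0 = 0"
proof -
  fix t assume t: "t \<in> {-h..h}"
  show "(\<Phi> has_real_derivative g t) (at t within {-h..h})"
    using integral_has_real_derivative[OF g t] unfolding \<Phi>_def
    by (auto intro!: derivative_eq_intros)
qed (simp add: \<Phi>_def)

lemma small_derivative_bound:
  assumes "\<And>t. t \<in> {-h..h} \<Longrightarrow> (f has_real_derivative f' t) (at t within {-h..h})"
    and "\<And>t. t \<in> {-h..h} \<Longrightarrow> \<bar>f' t\<bar> \<le> B" and "f 0 = 0" "t \<in> {-h..h}" "B \<ge> 0"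
  shows "\<bar>f t\<bar> \<le> B * h"
proof -
  have "norm (f t - f 0) \<le> B * norm (t - 0)"
    by (rule field_differentiable_bound[where S = "{-h..h}" and f' = f']) (use assms in auto)
  also have "\<dots> \<le> B * h" using assms by (intro mult_left_mono) auto
  finally show ?thesis using assms by simp
qed

context coord_domain begin

lemma compact_closed_cube:
  "compact {w \<in> coord_space I. \<forall>a\<in>I. \<bar>w a - p a\<bar> \<le> d}"
proof -
  have "{w \<in> coord_space I. \<forall>a\<in>I. \<bar>w a - p a\<bar> \<le> d} = (\<Pi>\<^sub>E a\<in>UNIV. if a \<in> I then {p a - d..p a + d} else {0})"
    (is "?A = ?B")
  proof (intro set_eqI iffI)
    fix w assume "w \<in> ?A"
    then show "w \<in> ?B" by (auto simp: coord_space_def abs_le_iff algebra_simps)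
  next
    fix w assume w: "w \<in> ?B"
    have "w a \<in> (if a \<in> I then {p a - d..p a + d} else {0})" for a
      using w by (rule PiE_mem) simp
    then have "(a \<in> I \<longrightarrow> p a - d \<le> w a \<and> w a \<le> p a + d) \<and> (a \<notin> I \<longrightarrow> w a = 0)" for a
      by (metis atLeastAtMost_iff singletonD)
    then show "w \<in> ?A" unfolding coord_space_def abs_le_iff by (auto simp: algebra_simps)
  qed
  moreover have "compactin (product_topology (\<lambda>_. euclidean) UNIV) (\<Pi>\<^sub>E a\<in>UNIV. if a \<in> I then {p a - d..p a + d} else {0})"
    unfolding compactin_PiE by auto
  ultimately show ?thesis by (simp add: euclidean_product_topology)
qed

text \<open>Picard iteration on a closed cube \<open>C\<close> around \<open>p\<close>. With bounds \<open>M\<close> of the components of \<open>X\<close> and \<open>K\<close> of their partial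
  derivatives, the interval \<open>[-h, h]\<close> is so short that the iterates stay in \<open>C\<close> (\<open>M h \<le> d\<close>) and the
  iteration contracts distances by the factor \<open>1/2\<close> (\<open>K n h \<le> 1/2\<close>, with \<open>n\<close> the number of coordinates).
  The limit is taken coordinate by coordinate, by the Weierstrass test.\<close>

theorem local_flow:
  assumes X: "\<And>a. a \<in> I \<Longrightarrow> smooth_on I V (\<lambda>v. X v a)" and p: "p \<in> V"
  shows "\<exists>h>0. \<exists>u. u 0 = p \<and> (\<forall>t\<in>{-h<..<h}. u t \<in> V \<and>
    (\<forall>a\<in>I. ((\<lambda>s. u s a) has_real_derivative X (u t) a) (at t)))"
proof -
  obtain d0 where d0: "d0 > 0" "cube I p d0 \<subseteq> V" using dom_cube[OF p] by auto
  define d where "d = d0 / 2"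
  define C where "C = {w \<in> coord_space I. \<forall>a\<in>I. \<bar>w a - p a\<bar> \<le> d}"
  have d: "d > 0" and CV: "C \<subseteq> V" using d0 by (force simp: d_def C_def cube_def)+
  have pC: "p \<in> C" using d dom_coord[OF p] by (auto simp: C_def)
  have Cc: "compact C" unfolding C_def by (rule compact_closed_cube)
  have cX: "continuous_on C (\<lambda>v. X v a)" if "a \<in> I" for a
    using continuous_on_subset[OF smooth_continuous[OF X[OF that]] CV] .
  have cpX: "continuous_on C (pd b (\<lambda>v. X v a))" if "a \<in> I" "b \<in> I" for a b
    using continuous_on_subset[OF smooth_continuous[OF smooth_pd[OF X]] CV] that by blast
  obtain M where M: "M > 0" "\<And>a w. a \<in> I \<Longrightarrow> w \<in> C \<Longrightarrow> \<bar>X w a\<bar> \<le> M"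
    using uniform_bound[OF fin, of C "\<lambda>a v. X v a"] Cc cX by auto
  obtain K where K: "K > 0" "\<And>a b w. a \<in> I \<Longrightarrow> b \<in> I \<Longrightarrow> w \<in> C \<Longrightarrow> \<bar>pd b (\<lambda>v. X v a) w\<bar> \<le> K"
    using uniform_bound[of "I \<times> I" C "\<lambda>(a, b). pd b (\<lambda>v. X v a)"] fin Cc cpX by auto
  have lip: "\<bar>X w a - X w' a\<bar> \<le> K * (\<Sum>b\<in>I. \<bar>w b - w' b\<bar>)"
    if a: "a \<in> I" and w: "w \<in> C" and w': "w' \<in> C" for a w w'
  proof -
    define seg where "seg = (\<lambda>s::real. \<lambda>b. w' b + s * (w b - w' b))"
    have segC: "seg s \<in> C" if s: "s \<in> {0..1}" for s
    proof -
      have "\<bar>seg s b - p b\<bar> \<le> d" if b: "b \<in> I" for b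
      proof -
        have "\<bar>seg s b - p b\<bar> = \<bar>(1 - s) * (w' b - p b) + s * (w b - p b)\<bar>"
          by (simp add: seg_def algebra_simps)
        also have "\<dots> \<le> (1 - s) * \<bar>w' b - p b\<bar> + s * \<bar>w b - p b\<bar>"
          using s abs_triangle_ineq[of "(1 - s) * (w' b - p b)" "s * (w b - p b)"]
          by (simp add: abs_mult)
        also have "\<dots> \<le> (1 - s) * d + s * d"
          using s w w' b by (intro add_mono mult_left_mono) (auto simp: C_def)
        finally show ?thesis by (simp add: algebra_simps)
      qed
      then show ?thesis using w w' by (auto simp: C_def coord_space_def seg_def)
    qed
    have "norm (X (seg 1) a - X (seg 0) a) \<le> (K * (\<Sum>b\<in>I. \<bar>w b - w' b\<bar>)) * norm (1 - 0 :: real)"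
    proof (rule field_differentiable_bound[where S = "{0..1}"
          and f' = "\<lambda>s. \<Sum>b\<in>I. pd b (\<lambda>v. X v a) (seg s) * (w b - w' b)"])
      fix s :: real assume s: "s \<in> {0..1}"
      show "((\<lambda>s. X (seg s) a) has_field_derivative (\<Sum>b\<in>I. pd b (\<lambda>v. X v a) (seg s) * (w b - w' b))) (at s within {0..1})"
      proof (rule chain_curve[OF smooth_C1[OF X[OF a]], of seg s])
        show "seg s \<in> V" using segC[OF s] CV by auto
        show "eventually (\<lambda>s. seg s \<in> coord_space I) (at s within {0..1})"
          unfolding eventually_at using segC by (intro exI[of _ 1]) (auto simp: C_def)
        show "((\<lambda>s. seg s b) has_real_derivative w b - w' b) (at s within {0..1})" for b
          unfolding seg_def by (auto intro!: derivative_eq_intros)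
      qed
      show "norm (\<Sum>b\<in>I. pd b (\<lambda>v. X v a) (seg s) * (w b - w' b)) \<le> K * (\<Sum>b\<in>I. \<bar>w b - w' b\<bar>)"
        unfolding sum_distrib_left real_norm_def
        by (rule order_trans[OF sum_abs], rule sum_mono)
           (use K(2)[OF a _ segC[OF s]] in \<open>auto simp: abs_mult intro!: mult_right_mono\<close>)
    qed auto
    moreover have "seg 1 = w" "seg 0 = w'" by (auto simp: seg_def)
    ultimately show ?thesis by simp
  qed
  define n where "n = real (card I)"
  define h where "h = min (d / M) (1 / (2 * K * (n + 1)))"
  have n: "n \<ge> 0" by (simp add: n_def)
  have h: "h > 0" using d M K n by (simp add: h_def)
  have hM: "M * h \<le> d" using M(1) by (simp add: h_def min_def field_simps)
  have hK: "K * n * h \<le> 1 / 2"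
  proof -
    have "K * n * h \<le> K * (n + 1) * (1 / (2 * K * (n + 1)))"
      using K(1) n h by (intro mult_mono) (auto simp: h_def)
    also have "\<dots> = (K * (n + 1)) / ((K * (n + 1)) * 2)" by (simp add: mult_ac)
    also have "\<dots> = 1 / 2" using K(1) n by (subst nonzero_divide_mult_cancel_left) auto
    finally show ?thesis .
  qed
  let ?J = "{-h..h}"
  define \<Phi> where "\<Phi> = (\<lambda>(g :: real \<Rightarrow> real) t. integral {-h..t} g - integral {-h..0} g)"
  \<comment> \<open>The Picard iterates. Outside \<open>I\<close> they are zero, like all elements of \<open>coord_space I\<close>.\<close>
  define U where "U = rec_nat (\<lambda>t. p) (\<lambda>_ w t a. if a \<in> I then p a + \<Phi> (\<lambda>s. X (w s) a) t else 0)"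
  have U0: "U 0 t = p" for t by (simp add: U_def)
  have US: "U (Suc m) t a = (if a \<in> I then p a + \<Phi> (\<lambda>s. X (U m s) a) t else 0)" for m t a
    by (simp add: U_def)
  have step: "(\<forall>t\<in>?J. q t \<in> C) \<Longrightarrow> continuous_on ?J q \<Longrightarrow> a \<in> I \<Longrightarrow>
     continuous_on ?J (\<lambda>s. X (q s) a)" for q a
    by (rule continuous_on_compose2[OF cX]) auto
  have \<Phi>D: "(\<Phi> g has_real_derivative g t) (at t within ?J)" if "continuous_on ?J g" "t \<in> ?J" for g t
    unfolding \<Phi>_def by (rule primitive_from_zero(1)[OF that(1) h that(2)])
  have \<Phi>0: "\<Phi> g 0 = 0" for g by (simp add: \<Phi>_def)
  have inv: "(\<forall>t\<in>?J. U m t \<in> C) \<and> continuous_on ?J (U m)" for m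
  proof (induction m)
    case 0
    then show ?case using pC U0 by (simp add: U_def)
  next
    case (Suc m)
    have "\<bar>\<Phi> (\<lambda>s. X (U m s) a) t\<bar> \<le> M * h" if "a \<in> I" "t \<in> ?J" for a t
    proof (rule small_derivative_bound[where f = "\<Phi> (\<lambda>s. X (U m s) a)" and f' = "\<lambda>t. X (U m t) a"])
      fix s assume s: "s \<in> ?J"
      show "(\<Phi> (\<lambda>s. X (U m s) a) has_real_derivative X (U m s) a) (at s within ?J)"
        using \<Phi>D[OF step[of "U m" a] s] Suc that by blast
      show "\<bar>X (U m s) a\<bar> \<le> M" using M(2) Suc that s by blast
    qed (use that M \<Phi>0 in auto)
    then have "\<forall>t\<in>?J. U (Suc m) t \<in> C"
      using hM US by (fastforce simp: C_def coord_space_def)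
    moreover have "continuous_on ?J (U (Suc m))"
    proof (rule continuous_on_coordinatewise_then_product)
      fix a
      show "continuous_on ?J (\<lambda>t. U (Suc m) t a)"
      proof (cases "a \<in> I")
        case True
        have "continuous_on ?J (\<Phi> (\<lambda>s. X (U m s) a))"
          by (rule DERIV_continuous_on, rule \<Phi>D[OF step[OF _ _ True]]) (use Suc in auto)
        then have "continuous_on ?J (\<lambda>t. p a + \<Phi> (\<lambda>s. X (U m s) a) t)"
          by (rule continuous_on_add[OF continuous_on_const])
        moreover have "(\<lambda>t. U (Suc m) t a) = (\<lambda>t. p a + \<Phi> (\<lambda>s. X (U m s) a) t)"
          using True by (simp only: US if_True)
        ultimately show ?thesis by metis
      next
        case False
        then have "(\<lambda>t. U (Suc m) t a) = (\<lambda>t. 0)" by (simp only: US if_False)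
        then show ?thesis by (metis continuous_on_const)
      qed
    qed
    ultimately show ?case by blast
  qed
  \<comment> \<open>One step of the iteration halves the distance of two curves.\<close>
  have diff: "\<bar>\<Phi> (\<lambda>s. X (q s) a) t - \<Phi> (\<lambda>s. X (q' s) a) t\<bar> \<le> e / 2"
    if q: "\<forall>t\<in>?J. q t \<in> C" "continuous_on ?J q" and q': "\<forall>t\<in>?J. q' t \<in> C" "continuous_on ?J q'"
      and a: "a \<in> I" and t: "t \<in> ?J" and e: "\<And>s b. s \<in> ?J \<Longrightarrow> b \<in> I \<Longrightarrow> \<bar>q s b - q' s b\<bar> \<le> e" "e \<ge> 0"
    for q q' a t e
  proof -
    have "\<bar>\<Phi> (\<lambda>s. X (q s) a) t - \<Phi> (\<lambda>s. X (q' s) a) t\<bar> \<le> (K * (n * e)) * h"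
    proof (rule small_derivative_bound[where f = "\<lambda>t. \<Phi> (\<lambda>s. X (q s) a) t - \<Phi> (\<lambda>s. X (q' s) a) t"
          and f' = "\<lambda>t. X (q t) a - X (q' t) a"])
      fix s assume s: "s \<in> ?J"
      show "((\<lambda>t. \<Phi> (\<lambda>s. X (q s) a) t - \<Phi> (\<lambda>s. X (q' s) a) t) has_real_derivative X (q s) a - X (q' s) a) (at s within ?J)"
        by (intro DERIV_diff \<Phi>D step s a q q')
      have "\<bar>X (q s) a - X (q' s) a\<bar> \<le> K * (\<Sum>b\<in>I. \<bar>q s b - q' s b\<bar>)"
        by (rule lip) (use a q q' s in auto)
      also have "\<dots> \<le> K * (\<Sum>b\<in>I. e)" using K e s by (intro mult_left_mono sum_mono) auto
      finally show "\<bar>X (q s) a - X (q' s) a\<bar> \<le> K * (n * e)" by (simp add: n_def)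
    qed (use \<Phi>0 t K n e in auto)
    also have "\<dots> = (K * n * h) * e" by simp
    also have "\<dots> \<le> (1 / 2) * e" using hK e by (intro mult_right_mono) auto
    finally show ?thesis by simp
  qed
  have cauchy: "\<bar>U (Suc m) t a - U m t a\<bar> \<le> d * (1 / 2) ^ m" if "a \<in> I" "t \<in> ?J" for m t a
    using that
  proof (induction m arbitrary: t a)
    case 0
    then show ?case using inv[of 1] U0 by (auto simp: C_def)
  next
    case (Suc m)
    have "\<bar>\<Phi> (\<lambda>s. X (U (Suc m) s) a) t - \<Phi> (\<lambda>s. X (U m s) a) t\<bar> \<le> (d * (1 / 2) ^ m) / 2"
      by (rule diff) (use inv Suc d in auto)
    then show ?case using Suc.prems US[of "Suc m"] US[of m] by simp
  qed
  define u where "u = (\<lambda>t a. if a \<in> I then p a + (\<Sum>m. U (Suc m) t a - U m t a) else 0)"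
  have ul: "uniform_limit ?J (\<lambda>m t. U m t a) (\<lambda>t. u t a) sequentially" if a: "a \<in> I" for a
  proof -
    have "uniform_limit ?J (\<lambda>N t. \<Sum>m<N. U (Suc m) t a - U m t a) (\<lambda>t. \<Sum>m. U (Suc m) t a - U m t a) sequentially"
      by (rule Weierstrass_m_test[where M = "\<lambda>m. d * (1 / 2) ^ m"])
         (use cauchy[OF a] in \<open>auto intro!: summable_mult summable_geometric\<close>)
    then have "uniform_limit ?J (\<lambda>N t. p a + (\<Sum>m<N. U (Suc m) t a - U m t a)) (\<lambda>t. p a + (\<Sum>m. U (Suc m) t a - U m t a)) sequentially"
      by (intro uniform_limit_intros)
    moreover have "(\<Sum>m<N. U (Suc m) t a - U m t a) = U N t a - p a" for N t
      by (subst sum_lessThan_telescope) (simp add: U0)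
    ultimately show ?thesis using a by (simp add: u_def)
  qed
  have pointwise: "(\<lambda>m. U m t a) \<longlonglongrightarrow> u t a" if "a \<in> I" "t \<in> ?J" for t a
    using tendsto_uniform_limitI[OF ul[OF that(1)] that(2)] .
  have uC: "u t \<in> C" if t: "t \<in> ?J" for t
  proof -
    have "\<bar>u t a - p a\<bar> \<le> d" if a: "a \<in> I" for a
    proof (rule LIMSEQ_le_const2)
      show "(\<lambda>m. \<bar>U m t a - p a\<bar>) \<longlonglongrightarrow> \<bar>u t a - p a\<bar>" by (intro tendsto_intros pointwise a t)
      show "\<exists>N. \<forall>m\<ge>N. \<bar>U m t a - p a\<bar> \<le> d" using inv t a by (auto simp: C_def)
    qed
    then show ?thesis by (auto simp: C_def coord_space_def u_def)
  qed
  have uc: "continuous_on ?J u"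
  proof (rule continuous_on_coordinatewise_then_product)
    fix a show "continuous_on ?J (\<lambda>t. u t a)"
    proof (cases "a \<in> I")
      case True
      have "continuous_on ?J (\<lambda>t. U m t a)" for m
        using inv by (blast intro: continuous_on_product_then_coordinatewise)
      then show ?thesis
        by (intro uniform_limit_theorem[OF _ ul[OF True]] always_eventually) auto
    qed (simp add: u_def)
  qed
  have eq: "u t a = p a + \<Phi> (\<lambda>s. X (u s) a) t" if a: "a \<in> I" and t: "t \<in> ?J" for a t
  proof (rule LIMSEQ_unique)
    show "(\<lambda>m. U (Suc m) t a) \<longlonglongrightarrow> u t a" using pointwise[OF a t] by (rule LIMSEQ_Suc)
    have "(\<lambda>m. \<Phi> (\<lambda>s. X (U m s) a) t) \<longlonglongrightarrow> \<Phi> (\<lambda>s. X (u s) a) t"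
    proof (rule tendstoI)
      fix e :: real assume e: "e > 0"
      have "eventually (\<lambda>m. \<forall>b\<in>I. \<forall>s\<in>?J. dist (U m s b) (u s b) < e) sequentially"
        using fin ul e by (simp add: eventually_ball_finite_distrib uniform_limit_iff)
      then show "eventually (\<lambda>m. dist (\<Phi> (\<lambda>s. X (U m s) a) t) (\<Phi> (\<lambda>s. X (u s) a) t) < e) sequentially"
      proof eventually_elim
        case (elim m)
        have "\<bar>\<Phi> (\<lambda>s. X (U m s) a) t - \<Phi> (\<lambda>s. X (u s) a) t\<bar> \<le> e / 2"
        proof (rule diff[OF _ _ _ _ a t])
          show "\<bar>U m s b - u s b\<bar> \<le> e" if "s \<in> ?J" "b \<in> I" for s b
            using elim that by (auto simp: dist_real_def intro: less_imp_le)
        qed (use inv[of m] uC uc e in auto)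
        then show ?case using e by (simp add: dist_real_def)
      qed
    qed
    then show "(\<lambda>m. U (Suc m) t a) \<longlonglongrightarrow> p a + \<Phi> (\<lambda>s. X (u s) a) t"
      unfolding US using a by (auto intro!: tendsto_intros)
  qed
  have u0: "u 0 = p"
  proof
    fix a show "u 0 a = p a"
      using eq[of a 0] h \<Phi>0 dom_coord[OF p] by (cases "a \<in> I") (auto simp: u_def coord_space_def)
  qed
  have "u t \<in> V \<and> (\<forall>a\<in>I. ((\<lambda>s. u s a) has_real_derivative X (u t) a) (at t))" if t: "t \<in> {-h<..<h}" for t
  proof (intro conjI ballI)
    show "u t \<in> V" using uC[of t] t CV by auto
    fix a assume a: "a \<in> I"
    have "((\<lambda>s. p a + \<Phi> (\<lambda>s. X (u s) a) s) has_real_derivative 0 + X (u t) a) (at t within ?J)"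
      by (intro DERIV_add DERIV_const \<Phi>D step) (use uC uc a t in auto)
    then have "((\<lambda>s. u s a) has_real_derivative X (u t) a) (at t within ?J)"
      by (rule has_field_derivative_transform_within[where d = 1, OF _ zero_less_one, THEN DERIV_cong])
         (use eq[OF a] t in auto)
    moreover have "at t within ?J = at t" using t by (intro at_within_interior) auto
    ultimately show "((\<lambda>s. u s a) has_real_derivative X (u t) a) (at t)" by simp
  qed
  then show ?thesis using h u0 by blast
qed

end

section \<open>Jets of curves in coordinates\<close>

definition base :: "(nat \<times> 'n \<Rightarrow> real) \<Rightarrow> 'n \<Rightarrow> real" where
  "base v i = v (0, i)"

text \<open>The coordinate tuples of jets of order \<open>r\<close> whose base point has coordinates in \<open>U\<close>.\<close>

definition over :: "nat \<Rightarrow> ('n::finite \<Rightarrow> real) set \<Rightarrow> (nat \<times> 'n \<Rightarrow> real) set" where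
  "over r U = {v \<in> coord_space (jet_idx r). base v \<in> U}"

text \<open>The components of the semispray with \<open>G\<^sup>i = 0\<close> in one chart. It gives the total derivative of
  functions of order less than \<open>r\<close> and has polynomial curves as geodesics.\<close>

definition flat :: "nat \<Rightarrow> (nat \<times> 'n \<Rightarrow> real) \<Rightarrow> nat \<times> 'n \<Rightarrow> real" where
  "flat r v a = (if fst a < r then real (Suc (fst a)) * v (Suc (fst a), snd a) else 0)"

lemma coord_domain_over:
  assumes "open U" shows "coord_domain (jet_idx r) (over r U)"
proof
  have "continuous_on UNIV (base :: (nat \<times> 'n \<Rightarrow> real) \<Rightarrow> 'n \<Rightarrow> real)"
    unfolding base_def by (intro continuous_on_coordinatewise_then_product continuous_on_coord)
  then have "open (base -` U)" using continuous_open_preimage[OF _ open_UNIV assms] by (metis Int_UNIV_left)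
  moreover have "over r U = coord_space (jet_idx r) \<inter> base -` U" by (auto simp: over_def)
  ultimately show "openin (top_of_set (coord_space (jet_idx r))) (over r U)"
    by (auto simp: openin_open)
qed (rule finite_jet_idx)

lemma coord_domain_UNIV: "open U \<Longrightarrow> coord_domain (UNIV :: 'n::finite set) U"
  by unfold_locales (auto simp: coord_space_def)

lemma spray_domain_flat:
  fixes V :: "(nat \<times> 'n::finite \<Rightarrow> real) set"
  assumes "coord_domain (jet_idx r) V"
  shows "spray_domain r V (flat r)"
proof -
  interpret coord_domain "jet_idx r" V by fact
  show ?thesis
  proof
    fix b :: "nat \<times> 'n"
    show "smooth_on (jet_idx r) V (\<lambda>v. flat r v b)"
      by (cases "fst b < r") (auto simp: flat_def)
  qed (auto simp: flat_def)
qed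

text \<open>The \<open>\<alpha>\<close>-th Taylor coefficient of \<open>F \<circ> x\<close> as a function of the Taylor coefficients of \<open>x\<close>
  (\<open>curve_jet_compose\<close>). For \<open>\<alpha> > r\<close> the value has no such meaning.\<close>

definition prolong :: "nat \<Rightarrow> (('n::finite \<Rightarrow> real) \<Rightarrow> real) \<Rightarrow> nat \<Rightarrow> (nat \<times> 'n \<Rightarrow> real) \<Rightarrow> real" where
  "prolong r F \<alpha> v = (deriv_along (jet_idx r) (flat r) ^^ \<alpha>) (\<lambda>v. F (base v)) v / fact \<alpha>"

context
  fixes r :: nat and U :: "('n::finite \<Rightarrow> real) set" and F
  assumes U: "open U" and F: "smooth_on UNIV U F"
begin

interpretation spray_domain r "over r U" "flat r"
  by (intro spray_domain_flat coord_domain_over U)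

lemma smooth_base: "sm (\<lambda>v. F (base v))"
  by (rule smooth_compose[OF coord_domain_UNIV[OF U] F]) (auto simp: over_def base_def intro: smooth_coord[unfolded over_def])

lemma prolong_smooth: "sm (prolong r F \<alpha>)"
  using smooth_cmult[OF D_funpow_smooth[OF smooth_base], of "1 / fact \<alpha>" \<alpha>]
  by (simp add: prolong_def[abs_def])

lemma prolong_Suc: "v \<in> over r U \<Longrightarrow> real (Suc \<alpha>) * prolong r F (Suc \<alpha>) v = D (prolong r F \<alpha>) v"
  using D_cmult[OF D_funpow_smooth[OF smooth_base], of v "1 / fact \<alpha>" \<alpha>]
  by (simp add: prolong_def[abs_def] field_simps del: of_nat_Suc)

lemma prolong_0: "0 < \<delta> \<Longrightarrow> pd (\<delta>, i) (prolong r F 0) v = 0"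
proof -
  assume "0 < \<delta>"
  then have "base (v((\<delta>, i) := s)) = base v" for s by (auto simp: base_def)
  then show ?thesis by (simp add: pd_def prolong_def)
qed

lemma prolong_pd_upper: "\<alpha> < \<beta> \<Longrightarrow> \<beta> \<le> r \<Longrightarrow> v \<in> over r U \<Longrightarrow> pd (\<beta>, i) (prolong r F \<alpha>) v = 0"
  by (rule prolong_upper[OF prolong_smooth prolong_Suc prolong_0])

lemma prolong_pd_shift: "\<alpha> < r \<Longrightarrow> \<beta> < r \<Longrightarrow> v \<in> over r U \<Longrightarrow>
    pd (Suc \<beta>, i) (prolong r F (Suc \<alpha>)) v = pd (\<beta>, i) (prolong r F \<alpha>) v"
  by (rule prolong_toeplitz[OF prolong_smooth prolong_Suc prolong_0])

end

text \<open>The coordinates of the jet lift of a curve \<open>x\<close> in a coordinate domain of the manifold.\<close>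

definition curve_jet :: "nat \<Rightarrow> (real \<Rightarrow> 'n \<Rightarrow> real) \<Rightarrow> real \<Rightarrow> nat \<times> 'n \<Rightarrow> real" where
  "curve_jet r x t a = (if fst a \<le> r then (deriv ^^ fst a) (\<lambda>s. x s (snd a)) t / fact (fst a) else 0)"

lemma curve_jet_coord: "curve_jet r x t \<in> coord_space (jet_idx r)"
  by (auto simp: curve_jet_def coord_space_def jet_idx_def)

lemma base_curve_jet [simp]: "base (curve_jet r x t) = x t"
  by (auto simp: base_def curve_jet_def)

lemma curve_jet_deriv:
  assumes "\<And>m. (deriv ^^ m) (\<lambda>s. x s i) field_differentiable (at t)" "\<delta> \<le> r"
  shows "((\<lambda>s. curve_jet r x s (\<delta>, i)) has_real_derivative (deriv ^^ Suc \<delta>) (\<lambda>s. x s i) t / fact \<delta>) (at t)"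
  using assms(1)[of \<delta>] assms(2)
  by (auto simp: curve_jet_def DERIV_deriv_iff_field_differentiable intro!: DERIV_cdivide)

text \<open>The chain rule of higher order: the total derivative of \<open>prolong r F \<alpha>\<close> is \<open>\<alpha> + 1\<close> times
  \<open>prolong r F (\<alpha> + 1)\<close>. For \<open>\<alpha> < r\<close> these functions do not depend on the coordinates of order \<open>r\<close>, so that the
  derivative of the latter along the curve does not matter.\<close>

lemma curve_jet_compose:
  fixes U :: "('n::finite \<Rightarrow> real) set"
  assumes U: "open U" and F: "smooth_on UNIV U F" and T: "open T"
    and x: "\<And>t. t \<in> T \<Longrightarrow> x t \<in> U"
    and xd: "\<And>t i m. t \<in> T \<Longrightarrow> (deriv ^^ m) (\<lambda>s. x s i) field_differentiable (at t)"
    and "t \<in> T" "\<alpha> \<le> r"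
  shows "(deriv ^^ \<alpha>) (\<lambda>s. F (x s)) t = fact \<alpha> * prolong r F \<alpha> (curve_jet r x t) \<and>
    (\<alpha> < r \<longrightarrow> (deriv ^^ \<alpha>) (\<lambda>s. F (x s)) field_differentiable (at t))"
proof -
  interpret spray_domain r "over r U" "flat r"
    by (intro spray_domain_flat coord_domain_over U)
  let ?u = "curve_jet r x"
  have d: "((\<lambda>s. prolong r F \<alpha> (?u s)) has_real_derivative real (Suc \<alpha>) * prolong r F (Suc \<alpha>) (?u t)) (at t)"
    if t: "t \<in> T" and \<alpha>: "\<alpha> < r" for t \<alpha>
  proof -
    have ut: "?u t \<in> over r U" using x[OF t] curve_jet_coord by (auto simp: over_def)
    have "((\<lambda>s. prolong r F \<alpha> (?u s)) has_real_derivative D (prolong r F \<alpha>) (?u t)) (at t)"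
    proof (rule curve_partial_chain[where w = "\<lambda>i. (deriv ^^ Suc r) (\<lambda>s. x s i) t / fact r"])
      fix \<delta> i assume \<delta>: "\<delta> < r"
      show "((\<lambda>s. ?u s (\<delta>, i)) has_real_derivative flat r (?u t) (\<delta>, i)) (at t)"
        using curve_jet_deriv[OF xd[OF t], where r = r and \<delta> = \<delta> and i = i] \<delta>
        by (simp add: flat_def curve_jet_def del: of_nat_Suc)
    next
      fix i show "((\<lambda>s. ?u s (r, i)) has_real_derivative (deriv ^^ Suc r) (\<lambda>s. x s i) t / fact r) (at t)"
        using curve_jet_deriv[OF xd[OF t], where r = r and \<delta> = r and i = i] by simp
    qed (use ut curve_jet_coord prolong_smooth[OF U F] prolong_pd_upper[OF U F \<alpha>] in \<open>auto intro: always_eventually\<close>)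
    then show ?thesis using prolong_Suc[OF U F ut] by simp
  qed
  have eq: "(deriv ^^ \<alpha>) (\<lambda>s. F (x s)) t = fact \<alpha> * prolong r F \<alpha> (?u t)" if "t \<in> T" "\<alpha> \<le> r" for t \<alpha>
    using that
  proof (induction \<alpha> arbitrary: t)
    case 0
    then show ?case by (simp add: prolong_def)
  next
    case (Suc \<alpha>)
    have "eventually (\<lambda>s. (deriv ^^ \<alpha>) (\<lambda>s. F (x s)) s = fact \<alpha> * prolong r F \<alpha> (?u s)) (nhds t)"
      using eventually_nhds_in_open[OF T Suc.prems(1)] by eventually_elim (use Suc in auto)
    then have "(deriv ^^ Suc \<alpha>) (\<lambda>s. F (x s)) t = deriv (\<lambda>s. fact \<alpha> * prolong r F \<alpha> (?u s)) t"
      by (auto intro: deriv_cong_ev)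
    also have "\<dots> = fact \<alpha> * (real (Suc \<alpha>) * prolong r F (Suc \<alpha>) (?u t))"
      using Suc.prems by (intro DERIV_imp_deriv DERIV_cmult d) auto
    finally show ?case by (simp add: mult_ac)
  qed
  have "(deriv ^^ \<alpha>) (\<lambda>s. F (x s)) field_differentiable (at t)" if \<alpha>: "\<alpha> < r"
  proof -
    have "eventually (\<lambda>s. (deriv ^^ \<alpha>) (\<lambda>s. F (x s)) s = fact \<alpha> * prolong r F \<alpha> (?u s)) (nhds t)"
      using eventually_nhds_in_open[OF T assms(6)] by eventually_elim (use eq assms(7) in auto)
    then have "((deriv ^^ \<alpha>) (\<lambda>s. F (x s)) has_real_derivative fact \<alpha> * (real (Suc \<alpha>) * prolong r F (Suc \<alpha>) (?u t))) (at t)"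
      using DERIV_cmult[OF d[OF assms(6) \<alpha>], of "fact \<alpha>"] by (subst DERIV_cong_ev[OF refl _ refl]) auto
    then show ?thesis unfolding field_differentiable_def by blast
  qed
  then show ?thesis using eq assms by blast
qed

text \<open>The components of \<open>X\<close> of order less than \<open>r\<close> say that the coordinates of order \<open>\<delta> + 1\<close> are the
  derivatives of those of order \<open>\<delta>\<close>, divided by \<open>\<delta> + 1\<close>.\<close>

lemma (in spray_domain) integral_curve_jet:
  assumes T: "open T" and uV: "\<And>t. t \<in> T \<Longrightarrow> u t \<in> V"
    and u: "\<And>t a. t \<in> T \<Longrightarrow> a \<in> I \<Longrightarrow> ((\<lambda>s. u s a) has_real_derivative X (u t) a) (at t)"
    and t: "t \<in> T"
  shows "curve_jet r (\<lambda>s. base (u s)) t = u t"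
    and "(deriv ^^ m) (\<lambda>s. base (u s) i) field_differentiable (at t)"
proof -
  show "(deriv ^^ m) (\<lambda>s. base (u s) i) field_differentiable (at t)"
    using integral_curve_differentiable[OF T uV u smooth_coord t, of m "(0, i)"] by (simp add: base_def)
  have *: "(deriv ^^ \<delta>) (\<lambda>s. base (u s) i) t = fact \<delta> * u t (\<delta>, i)" if "\<delta> \<le> r" "t \<in> T" for \<delta> i t
    using that
  proof (induction \<delta> arbitrary: t)
    case 0
    then show ?case by (simp add: base_def)
  next
    case (Suc \<delta>)
    have "eventually (\<lambda>s. (deriv ^^ \<delta>) (\<lambda>s. base (u s) i) s = fact \<delta> * u s (\<delta>, i)) (nhds t)"
      using eventually_nhds_in_open[OF T Suc.prems(2)] by eventually_elim (use Suc in auto)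
    then have "(deriv ^^ Suc \<delta>) (\<lambda>s. base (u s) i) t = deriv (\<lambda>s. fact \<delta> * u s (\<delta>, i)) t"
      by (auto intro: deriv_cong_ev)
    also have "\<dots> = fact \<delta> * X (u t) (\<delta>, i)"
      using Suc.prems by (intro DERIV_imp_deriv DERIV_cmult u) auto
    finally show ?case using X_spray[OF uV[OF Suc.prems(2)], of \<delta> i] Suc.prems by (simp add: mult_ac)
  qed
  show "curve_jet r (\<lambda>s. base (u s)) t = u t"
  proof
    fix a :: "nat \<times> 'n"
    obtain \<delta> i where a: "a = (\<delta>, i)" by force
    show "curve_jet r (\<lambda>s. base (u s)) t a = u t a"
      using *[of \<delta> t i] t dom_coord[OF uV[OF t]] by (auto simp: a curve_jet_def coord_space_def)
  qed
qed

section \<open>Induced charts of jet bundles\<close>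

locale mfd =
  fixes A :: "('m::{t2_space,second_countable_topology}, 'n::finite) chart set"
  assumes mfd: "smooth_manifold A"
begin

lemma chart_ex: "\<exists>\<phi>\<in>A. p \<in> cdom \<phi>"
  using mfd unfolding smooth_manifold_def by (metis UN_E UNIV_I)

definition img :: "('m, 'n) chart \<Rightarrow> ('n \<Rightarrow> real) set" where
  "img \<phi> = coords \<phi> ` cdom \<phi>"

text \<open>The part of the coordinate domain of \<open>\<phi>\<close> that \<open>\<psi>\<close> covers as well.\<close>

definition ovl :: "('m, 'n) chart \<Rightarrow> ('m, 'n) chart \<Rightarrow> ('n \<Rightarrow> real) set" where
  "ovl \<phi> \<psi> = coords \<phi> ` (cdom \<psi> \<inter> cdom \<phi>)"

context fixes \<phi> assumes \<phi>: "\<phi> \<in> A" begin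

lemma chart_homeomorphism: "homeomorphism (cdom \<phi>) (img \<phi>) (coords \<phi>) (param \<phi>)"
  and open_cdom: "open (cdom \<phi>)" and open_img: "open (img \<phi>)"
  using mfd \<phi> unfolding smooth_manifold_def img_def by blast+

lemma param_coords: "p \<in> cdom \<phi> \<Longrightarrow> param \<phi> (coords \<phi> p) = p"
  using chart_homeomorphism by (auto simp: homeomorphism_def)

lemma coords_param: "v \<in> img \<phi> \<Longrightarrow> coords \<phi> (param \<phi> v) = v"
  using chart_homeomorphism by (auto simp: homeomorphism_def)

lemma param_in: "v \<in> img \<phi> \<Longrightarrow> param \<phi> v \<in> cdom \<phi>"
  using chart_homeomorphism by (auto simp: homeomorphism_def)

lemma coords_in: "p \<in> cdom \<phi> \<Longrightarrow> coords \<phi> p \<in> img \<phi>"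
  by (auto simp: img_def)

lemma coords_inj: "p \<in> cdom \<phi> \<Longrightarrow> q \<in> cdom \<phi> \<Longrightarrow> coords \<phi> p = coords \<phi> q \<Longrightarrow> p = q"
  using param_coords by metis

lemma continuous_param: "continuous_on (img \<phi>) (param \<phi>)"
  using chart_homeomorphism by (auto simp: homeomorphism_def)

lemma ovl_iff: "v \<in> ovl \<phi> \<psi> \<longleftrightarrow> v \<in> img \<phi> \<and> param \<phi> v \<in> cdom \<psi>"
  unfolding ovl_def img_def using param_coords by auto

lemma coords_ovl: "p \<in> cdom \<phi> \<Longrightarrow> coords \<phi> p \<in> ovl \<phi> \<psi> \<longleftrightarrow> p \<in> cdom \<psi>"
  using ovl_iff coords_in param_coords by simp

context fixes \<psi> assumes \<psi>: "\<psi> \<in> A" begin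

lemma open_ovl: "open (ovl \<phi> \<psi>)"
proof -
  have "open (cdom \<psi>)" using mfd \<psi> unfolding smooth_manifold_def by blast
  then have "open (img \<phi> \<inter> param \<phi> -` cdom \<psi>)"
    using continuous_param open_img by (intro continuous_open_preimage) auto
  also have "img \<phi> \<inter> param \<phi> -` cdom \<psi> = ovl \<phi> \<psi>" using ovl_iff by auto
  finally show ?thesis .
qed

lemma transition_smooth: "smooth_on UNIV (ovl \<phi> \<psi>) (\<lambda>v. coords \<psi> (param \<phi> v) j)"
  using mfd \<phi> \<psi> unfolding smooth_manifold_def chart_smooth_def ovl_def comp_def by blast

end
end

definition jet_transition :: "nat \<Rightarrow> ('m, 'n) chart \<Rightarrow> ('m, 'n) chart \<Rightarrow> (nat \<times> 'n \<Rightarrow> real) \<Rightarrow> nat \<times> 'n \<Rightarrow> real" where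
  "jet_transition r \<phi> \<psi> v a = (if fst a \<le> r then prolong r (\<lambda>v. coords \<psi> (param \<phi> v) (snd a)) (fst a) v else 0)"

lemma curve_jet_transition:
  assumes \<phi>: "\<phi> \<in> A" and \<psi>: "\<psi> \<in> A" and T: "open T" and c: "\<And>t. t \<in> T \<Longrightarrow> c t \<in> cdom \<phi> \<inter> cdom \<psi>"
    and d: "\<And>t i m. t \<in> T \<Longrightarrow> (deriv ^^ m) (\<lambda>s. coords \<phi> (c s) i) field_differentiable (at t)"
    and t: "t \<in> T"
  shows "curve_jet r (\<lambda>s. coords \<psi> (c s)) t = jet_transition r \<phi> \<psi> (curve_jet r (\<lambda>s. coords \<phi> (c s)) t)"
    and "(deriv ^^ m) (\<lambda>s. coords \<psi> (c s) i) field_differentiable (at t)"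
proof -
  have ev: "eventually (\<lambda>s. coords \<psi> (c s) j = coords \<psi> (param \<phi> (coords \<phi> (c s))) j) (nhds t)" if "t \<in> T" for j t
    using eventually_nhds_in_open[OF T that] by eventually_elim (use c param_coords[OF \<phi>] in auto)
  have x: "coords \<phi> (c t) \<in> ovl \<phi> \<psi>" if "t \<in> T" for t
    using c[OF that] coords_ovl[OF \<phi>] by auto
  note cc = curve_jet_compose[OF open_ovl[OF \<phi> \<psi>] transition_smooth[OF \<phi> \<psi>] T x d]
  show "curve_jet r (\<lambda>s. coords \<psi> (c s)) t = jet_transition r \<phi> \<psi> (curve_jet r (\<lambda>s. coords \<phi> (c s)) t)"
  proof
    fix a :: "nat \<times> 'n"
    have "fst a \<le> r \<Longrightarrow> (deriv ^^ fst a) (\<lambda>s. coords \<psi> (c s) (snd a)) t =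
       fact (fst a) * prolong r (\<lambda>v. coords \<psi> (param \<phi> v) (snd a)) (fst a) (curve_jet r (\<lambda>s. coords \<phi> (c s)) t)"
      using cc[OF _ _ t] higher_deriv_cong_ev[OF ev[OF t] refl] by metis
    then show "curve_jet r (\<lambda>s. coords \<psi> (c s)) t a = jet_transition r \<phi> \<psi> (curve_jet r (\<lambda>s. coords \<phi> (c s)) t) a"
      by (auto simp: jet_transition_def curve_jet_def)
  qed
  have "(deriv ^^ m) (\<lambda>s. coords \<psi> (param \<phi> (coords \<phi> (c s))) i) field_differentiable (at t)"
    using cc[OF _ _ t, where r = "Suc m" and \<alpha> = m] by auto
  moreover have "eventually (\<lambda>s. (deriv ^^ m) (\<lambda>s. coords \<psi> (c s) i) s =
      (deriv ^^ m) (\<lambda>s. coords \<psi> (param \<phi> (coords \<phi> (c s))) i) s) (nhds t)"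
    using eventually_nhds_in_open[OF T t] by eventually_elim (rule higher_deriv_cong_ev[OF ev refl])
  ultimately show "(deriv ^^ m) (\<lambda>s. coords \<psi> (c s) i) field_differentiable (at t)"
    unfolding field_differentiable_def using DERIV_cong_ev[OF refl _ refl] by metis
qed

lemma curve_preimage_open:
  assumes "smooth_curve A T c" "\<phi> \<in> A"
  shows "open (T \<inter> c -` cdom \<phi>)"
  using assms open_cdom by (intro continuous_open_preimage) (auto simp: smooth_curve_def)

lemma smooth_curve_differentiable:
  "smooth_curve A T c \<Longrightarrow> \<phi> \<in> A \<Longrightarrow> t \<in> T \<Longrightarrow> c t \<in> cdom \<phi> \<Longrightarrow>
    (deriv ^^ m) (\<lambda>s. coords \<phi> (c s) i) field_differentiable (at t)"
  by (auto simp: smooth_curve_def)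

abbreviation cjet :: "nat \<Rightarrow> ('m, 'n) chart \<Rightarrow> (real \<Rightarrow> 'm) \<Rightarrow> real \<Rightarrow> nat \<times> 'n \<Rightarrow> real" where
  "cjet r \<phi> c t \<equiv> curve_jet r (\<lambda>s. coords \<phi> (c s)) t"

lemma smooth_curve_jet_transition:
  assumes "smooth_curve A T c" "\<phi> \<in> A" "\<psi> \<in> A" "t \<in> T" "c t \<in> cdom \<phi>" "c t \<in> cdom \<psi>"
  shows "cjet r \<psi> c t = jet_transition r \<phi> \<psi> (cjet r \<phi> c t)"
proof (rule curve_jet_transition(1)[OF assms(2,3)])
  show "open ((T \<inter> c -` cdom \<phi>) \<inter> (T \<inter> c -` cdom \<psi>))"
    by (intro open_Int curve_preimage_open[OF assms(1)] assms(2,3))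
qed (use assms smooth_curve_differentiable in auto)

text \<open>Equality of jets can be tested in a single chart, by the chain rule of higher order.\<close>

lemma same_jet_iff:
  assumes c: "smooth_near_0 A c" and c': "smooth_near_0 A c'" and \<phi>: "\<phi> \<in> A" and d: "c 0 \<in> cdom \<phi>" "c' 0 \<in> cdom \<phi>"
  shows "same_jet A r c c' \<longleftrightarrow> cjet r \<phi> c 0 = cjet r \<phi> c' 0"
proof
  assume s: "same_jet A r c c'"
  show "cjet r \<phi> c 0 = cjet r \<phi> c' 0"
    using s d \<phi> unfolding same_jet_def curve_jet_def by (intro ext) auto
next
  assume eq: "cjet r \<phi> c 0 = cjet r \<phi> c' 0"
  obtain T T' where T: "0 \<in> T" "smooth_curve A T c" "0 \<in> T'" "smooth_curve A T' c'"
    using c c' by (auto simp: smooth_near_0_def)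
  have c0: "c 0 = c' 0"
    using coords_inj[OF \<phi> d] arg_cong[OF eq, of base] by simp
  have "(deriv ^^ \<alpha>) (\<lambda>s. coords \<psi> (c s) i) 0 = (deriv ^^ \<alpha>) (\<lambda>s. coords \<psi> (c' s) i) 0"
    if \<psi>: "\<psi> \<in> A" "c 0 \<in> cdom \<psi>" and \<alpha>: "\<alpha> \<le> r" for \<psi> i \<alpha>
  proof -
    have "cjet r \<psi> c 0 (\<alpha>, i) = cjet r \<psi> c' 0 (\<alpha>, i)"
      using smooth_curve_jet_transition[OF T(2) \<phi> \<psi>(1) T(1)] smooth_curve_jet_transition[OF T(4) \<phi> \<psi>(1) T(3)] d \<psi> eq c0 by simp
    then show ?thesis using \<alpha> by (simp add: curve_jet_def)
  qed
  then show "same_jet A r c c'" using c0 by (auto simp: same_jet_def)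
qed

lemma same_jet_equiv:
  "same_jet A r c c" "same_jet A r c c' \<Longrightarrow> same_jet A r c' c"
  "same_jet A r c c' \<Longrightarrow> same_jet A r c' c'' \<Longrightarrow> same_jet A r c c''"
  "k \<le> r \<Longrightarrow> same_jet A r c c' \<Longrightarrow> same_jet A k c c'"
  by (auto simp: same_jet_def)

lemma jet_eq: "same_jet A r c c' \<Longrightarrow> jet A r c = jet A r c'"
  unfolding jet_def using same_jet_equiv by blast

lemma jet_eq_iff: "smooth_near_0 A c' \<Longrightarrow> jet A r c = jet A r c' \<longleftrightarrow> same_jet A r c c'"
  using jet_eq same_jet_equiv(1,2) unfolding jet_def by blast

lemma jet_rep:
  assumes "j \<in> TJ A r"
  shows "smooth_near_0 A (jet_rep j)" "jet A r (jet_rep j) = j"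
proof -
  obtain c where c: "smooth_near_0 A c" "j = jet A r c" using assms by (auto simp: TJ_def)
  then have "c \<in> j" by (simp add: jet_def same_jet_equiv(1))
  then have "jet_rep j \<in> j" unfolding jet_rep_def by (rule someI[of "\<lambda>c. c \<in> j"])
  then have s: "smooth_near_0 A (jet_rep j)" "same_jet A r c (jet_rep j)" using c by (auto simp: jet_def)
  show "smooth_near_0 A (jet_rep j)" by (rule s(1))
  show "jet A r (jet_rep j) = j" by (rule trans[OF jet_eq[OF s(2), symmetric] c(2)[symmetric]])
qed

lemma jet_in: "smooth_near_0 A c \<Longrightarrow> jet A r c \<in> TJ A r"
  by (auto simp: TJ_def)

lemma same_jet_rep: "smooth_near_0 A c \<Longrightarrow> same_jet A r c (jet_rep (jet A r c))"
  using jet_rep[OF jet_in, of c r] jet_eq_iff by metis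

lemma cdom_jet_chart: "cdom (jet_chart A r \<phi>) = {j \<in> TJ A r. jet_rep j 0 \<in> cdom \<phi>}"
  by (simp add: jet_chart_def)

lemma coords_jet_chart: "coords (jet_chart A r \<phi>) j = cjet r \<phi> (jet_rep j) 0"
  by (auto simp: jet_chart_def curve_jet_def fun_eq_iff)

lemma jet_cdom_iff: "smooth_near_0 A c \<Longrightarrow> jet A r c \<in> cdom (jet_chart A r \<phi>) \<longleftrightarrow> c 0 \<in> cdom \<phi>"
  using same_jet_rep[of c r] jet_in by (auto simp: cdom_jet_chart same_jet_def)

lemma coords_jet:
  assumes "smooth_near_0 A c" "\<phi> \<in> A" "c 0 \<in> cdom \<phi>"
  shows "coords (jet_chart A r \<phi>) (jet A r c) = cjet r \<phi> c 0"
proof -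
  have s: "same_jet A r c (jet_rep (jet A r c))" using same_jet_rep assms by blast
  then have "jet_rep (jet A r c) 0 \<in> cdom \<phi>" using assms(3) by (simp add: same_jet_def)
  then have "cjet r \<phi> c 0 = cjet r \<phi> (jet_rep (jet A r c)) 0"
    using same_jet_iff[OF assms(1) jet_rep(1)[OF jet_in[OF assms(1)]] assms(2,3)] s by blast
  then show ?thesis by (simp add: coords_jet_chart)
qed

lemma coords_jet_in:
  assumes "p \<in> cdom (jet_chart A r \<phi>)"
  shows "coords (jet_chart A r \<phi>) p \<in> over r (img \<phi>)"
  using assms curve_jet_coord by (auto simp: coords_jet_chart over_def cdom_jet_chart img_def)

lemma coords_jet_inj:
  assumes \<phi>: "\<phi> \<in> A" and p: "p \<in> cdom (jet_chart A r \<phi>)" "q \<in> cdom (jet_chart A r \<phi>)"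
    and eq: "coords (jet_chart A r \<phi>) p = coords (jet_chart A r \<phi>) q"
  shows "p = q"
proof -
  have "same_jet A r (jet_rep p) (jet_rep q)"
    using same_jet_iff[of "jet_rep p" "jet_rep q" \<phi> r, OF jet_rep(1)[of p r] jet_rep(1)[of q r] \<phi>] p eq
    by (simp add: cdom_jet_chart coords_jet_chart)
  from jet_eq[OF this] show ?thesis using jet_rep(2) p by (simp add: cdom_jet_chart)
qed

lemma param_coords_jet:
  assumes "\<phi> \<in> A" "p \<in> cdom (jet_chart A r \<phi>)"
  shows "param (jet_chart A r \<phi>) (coords (jet_chart A r \<phi>) p) = p"
  unfolding param_def using coords_jet_inj[OF assms(1)] assms(2)
  by (intro inv_into_f_f) (auto simp: inj_on_def)

text \<open>Smoothness of a curve has to be known in all charts, but the chain rule of higher order transfers it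
  from one.\<close>

lemma param_curve_smooth:
  assumes \<phi>: "\<phi> \<in> A" and T: "open T" and x: "\<And>t. t \<in> T \<Longrightarrow> x t \<in> img \<phi>"
    and d: "\<And>t i m. t \<in> T \<Longrightarrow> (deriv ^^ m) (\<lambda>s. x s i) field_differentiable (at t)"
  shows "smooth_curve A T (\<lambda>s. param \<phi> (x s))"
    and "t \<in> T \<Longrightarrow> cjet r \<phi> (\<lambda>s. param \<phi> (x s)) t = curve_jet r x t"
proof -
  have ev: "eventually (\<lambda>s. coords \<phi> (param \<phi> (x s)) j = x s j) (nhds t)" if "t \<in> T" for j t
    using eventually_nhds_in_open[OF T that] by eventually_elim (use x coords_param[OF \<phi>] in auto)
  have d': "(deriv ^^ m) (\<lambda>s. coords \<phi> (param \<phi> (x s)) i) field_differentiable (at t)" if t: "t \<in> T" for t i m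
  proof -
    have "eventually (\<lambda>s. (deriv ^^ m) (\<lambda>s. coords \<phi> (param \<phi> (x s)) i) s = (deriv ^^ m) (\<lambda>s. x s i) s) (nhds t)"
      using eventually_nhds_in_open[OF T t] by eventually_elim (rule higher_deriv_cong_ev[OF ev refl])
    then show ?thesis using d[OF t, of m i]
      unfolding field_differentiable_def using DERIV_cong_ev[OF refl _ refl] by metis
  qed
  have "continuous_on T x"
  proof (rule continuous_on_coordinatewise_then_product)
    fix i show "continuous_on T (\<lambda>s. x s i)"
      using d[of _ 0 i] by (intro continuous_at_imp_continuous_on ballI field_differentiable_imp_continuous_at) auto
  qed
  then have c: "continuous_on T (\<lambda>s. param \<phi> (x s))"
    using x by (intro continuous_on_compose2[OF continuous_param[OF \<phi>]]) auto
  show "smooth_curve A T (\<lambda>s. param \<phi> (x s))"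
    unfolding smooth_curve_def
  proof (intro conjI ballI impI allI T c)
    fix \<psi> t i m assume \<psi>: "\<psi> \<in> A" and t: "t \<in> T" "param \<phi> (x t) \<in> cdom \<psi>"
    have "open (T \<inter> (\<lambda>s. param \<phi> (x s)) -` cdom \<psi>)"
      using c T open_cdom[OF \<psi>] by (rule continuous_open_preimage)
    from curve_jet_transition(2)[OF \<phi> \<psi> this, of "\<lambda>s. param \<phi> (x s)"]
    show "(deriv ^^ m) (\<lambda>s. coords \<psi> (param \<phi> (x s)) i) field_differentiable at t"
      using x param_in[OF \<phi>] d' t by auto
  qed
  assume t: "t \<in> T"
  show "cjet r \<phi> (\<lambda>s. param \<phi> (x s)) t = curve_jet r x t"
    unfolding curve_jet_def using higher_deriv_cong_ev[OF ev[OF t] refl] by auto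
qed

text \<open>Solves the differential equation in one chart and reads the solution as a curve in the manifold.
  It yields jets with prescribed coordinates (for \<open>flat\<close>) as well as geodesics.\<close>

lemma spray_curve:
  assumes \<phi>: "\<phi> \<in> A" and X: "spray_domain r V X" and V: "V \<subseteq> over r (img \<phi>)" and v: "v \<in> V"
  shows "\<exists>h>0. \<exists>u c. smooth_curve A {-h<..<h} c \<and> u 0 = v \<and> (\<forall>t\<in>{-h<..<h}. c t \<in> cdom \<phi> \<and> u t \<in> V \<and>
    cjet r \<phi> c t = u t \<and> (\<forall>a\<in>jet_idx r. ((\<lambda>s. u s a) has_real_derivative X (u t) a) (at t)))"
proof -
  interpret spray_domain r V X by (rule X)
  obtain h u where h: "h > 0" "u 0 = v" "\<And>t. t \<in> {-h<..<h} \<Longrightarrow> u t \<in> V"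
    "\<And>t a. t \<in> {-h<..<h} \<Longrightarrow> a \<in> I \<Longrightarrow> ((\<lambda>s. u s a) has_real_derivative X (u t) a) (at t)"
    using local_flow[of X, OF X_smooth v] by blast
  have b: "base (u t) \<in> img \<phi>" if "t \<in> {-h<..<h}" for t
    using h(3)[OF that] V by (auto simp: over_def)
  note j = integral_curve_jet[OF open_greaterThanLessThan h(3,4)]
  note p = param_curve_smooth[OF \<phi> open_greaterThanLessThan b j(2)]
  show ?thesis
    using p j(1) h b param_in[OF \<phi>]
    by (intro exI[of _ h] conjI exI[of _ u] exI[of _ "\<lambda>s. param \<phi> (base (u s))"]) auto
qed

text \<open>A geodesic of the flat semispray with the given initial jet represents a jet with the given
  coordinates.\<close>

lemma coords_jet_image:
  assumes \<phi>: "\<phi> \<in> A"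
  shows "coords (jet_chart A r \<phi>) ` cdom (jet_chart A r \<phi>) = over r (img \<phi>)"
proof (intro equalityI subsetI)
  fix v assume v: "v \<in> over r (img \<phi>)"
  obtain h u c where h: "h > 0" "smooth_curve A {-h<..<h} c" "u 0 = v"
    "\<forall>t\<in>{-h<..<h}. c t \<in> cdom \<phi> \<and> cjet r \<phi> c t = u t"
    using spray_curve[OF \<phi> spray_domain_flat[OF coord_domain_over[OF open_img[OF \<phi>]]] order_refl v] by blast
  have c: "smooth_near_0 A c" unfolding smooth_near_0_def using h by (intro exI[of _ "{-h<..<h}"]) auto
  have "v = coords (jet_chart A r \<phi>) (jet A r c)" using coords_jet[OF c \<phi>] h by auto
  moreover have "jet A r c \<in> cdom (jet_chart A r \<phi>)" using jet_cdom_iff[OF c] h by auto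
  ultimately show "v \<in> coords (jet_chart A r \<phi>) ` cdom (jet_chart A r \<phi>)" by blast
qed (use coords_jet_in in auto)

lemma coords_param_jet:
  assumes "\<phi> \<in> A" "v \<in> over r (img \<phi>)"
  shows "coords (jet_chart A r \<phi>) (param (jet_chart A r \<phi>) v) = v"
    "param (jet_chart A r \<phi>) v \<in> cdom (jet_chart A r \<phi>)"
  unfolding param_def using assms coords_jet_image[OF assms(1), of r]
  by (auto intro!: f_inv_into_f inv_into_into)

lemma coords_jet_transition:
  assumes "\<phi> \<in> A" "\<psi> \<in> A" "p \<in> cdom (jet_chart A r \<phi>)" "p \<in> cdom (jet_chart A r \<psi>)"
  shows "coords (jet_chart A r \<psi>) p = jet_transition r \<phi> \<psi> (coords (jet_chart A r \<phi>) p)"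
proof -
  obtain T where "0 \<in> T" "smooth_curve A T (jet_rep p)"
    using jet_rep(1)[of p r] assms by (auto simp: cdom_jet_chart smooth_near_0_def)
  then show ?thesis
    using smooth_curve_jet_transition[of T "jet_rep p" \<phi> \<psi> 0 r] assms by (simp add: coords_jet_chart cdom_jet_chart)
qed

lemma jet_transition_smooth:
  assumes "\<phi> \<in> A" "\<psi> \<in> A"
  shows "smooth_on (jet_idx r) (over r (ovl \<phi> \<psi>)) (\<lambda>v. jet_transition r \<phi> \<psi> v b)"
proof -
  interpret coord_domain "jet_idx r" "over r (ovl \<phi> \<psi>)"
    by (intro coord_domain_over open_ovl assms)
  show ?thesis
    by (cases "fst b \<le> r")
       (auto simp: jet_transition_def intro!: prolong_smooth open_ovl transition_smooth assms)
qed

section \<open>Lifts of curves and projections of jets\<close>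

lemma lift_near_0:
  assumes "smooth_curve A T c" "t \<in> T"
  shows "smooth_near_0 A (\<lambda>s. c (t + s))"
  unfolding smooth_near_0_def
proof (intro exI conjI)
  let ?T = "(\<lambda>s. t + s) -` T"
  show "0 \<in> ?T" using assms by simp
  have T: "open ?T" "continuous_on T c" using assms by (auto simp: smooth_curve_def intro!: open_vimage continuous_intros)
  show "smooth_curve A ?T (\<lambda>s. c (t + s))"
    unfolding smooth_curve_def
  proof (intro conjI ballI impI allI T(1))
    show "continuous_on ?T (\<lambda>s. c (t + s))"
      by (rule continuous_on_compose2[OF T(2)]) (auto intro!: continuous_intros)
    fix \<phi> s i m assume \<phi>: "\<phi> \<in> A" and s: "s \<in> ?T" "c (t + s) \<in> cdom \<phi>"
    have e: "(deriv ^^ m) (\<lambda>s. coords \<phi> (c (t + s)) i) = (\<lambda>s'. (deriv ^^ m) (\<lambda>s. coords \<phi> (c s) i) (t + s'))"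
    proof
      fix s' show "(deriv ^^ m) (\<lambda>s. coords \<phi> (c (t + s)) i) s' = (deriv ^^ m) (\<lambda>s. coords \<phi> (c s) i) (t + s')"
      unfolding higher_deriv_shift_0[of m _ s'] higher_deriv_shift_0[of m _ "t + s'"]
      by (simp add: comp_def add.assoc)
    qed
    have "(deriv ^^ m) (\<lambda>s. coords \<phi> (c s) i) field_differentiable (at (t + s))"
      using assms \<phi> s by (auto simp: smooth_curve_def)
    then show "(deriv ^^ m) (\<lambda>s. coords \<phi> (c (t + s)) i) field_differentiable (at s)"
      unfolding field_differentiable_def e by (simp add: DERIV_shift add.commute[of t])
  qed
qed

context
  fixes T c t assumes c: "smooth_curve A T c" and t: "t \<in> T"
begin

lemma lift_in_TJ: "jet_lift A r c t \<in> TJ A r"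
  unfolding jet_lift_def by (intro jet_in lift_near_0[OF c t])

lemma lift_cdom: "jet_lift A r c t \<in> cdom (jet_chart A r \<phi>) \<longleftrightarrow> c t \<in> cdom \<phi>"
  unfolding jet_lift_def using jet_cdom_iff[OF lift_near_0[OF c t]] by simp

lemma lift_coords:
  assumes "\<phi> \<in> A" "c t \<in> cdom \<phi>"
  shows "coords (jet_chart A r \<phi>) (jet_lift A r c t) = cjet r \<phi> c t"
proof -
  have "(deriv ^^ m) (\<lambda>s. coords \<phi> (c (t + s)) i) 0 = (deriv ^^ m) (\<lambda>s. coords \<phi> (c s) i) t" for m i
    unfolding higher_deriv_shift_0[of m _ t] by (simp add: comp_def)
  then show ?thesis
    unfolding jet_lift_def using coords_jet[OF lift_near_0[OF c t] assms(1)] assms(2)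
    by (simp add: curve_jet_def fun_eq_iff)
qed

lemma proj_lift: "k \<le> r \<Longrightarrow> jet_proj A k (jet_lift A r c t) = jet_lift A k c t"
  unfolding jet_lift_def jet_proj_def
  using same_jet_rep[OF lift_near_0[OF c t], of r] same_jet_equiv(4) jet_eq by metis

end

text \<open>The coordinate expression of the projection from jets of order \<open>r\<close> to jets of order \<open>k\<close>.\<close>

definition trunc :: "nat \<Rightarrow> (nat \<times> 'n \<Rightarrow> real) \<Rightarrow> nat \<times> 'n \<Rightarrow> real" where
  "trunc k v a = (if fst a \<le> k then v a else 0)"

lemma base_trunc [simp]: "base (trunc k v) = base v"
  by (auto simp: base_def trunc_def)

lemma trunc_over: "v \<in> over r U \<Longrightarrow> trunc k v \<in> over k U"
  by (auto simp: over_def trunc_def coord_space_def jet_idx_def)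

lemma proj_cdom:
  assumes "p \<in> TJ A r"
  shows "jet_proj A k p \<in> cdom (jet_chart A k \<phi>) \<longleftrightarrow> p \<in> cdom (jet_chart A r \<phi>)"
  unfolding jet_proj_def using jet_cdom_iff[OF jet_rep(1)[OF assms]] assms by (simp add: cdom_jet_chart)

lemma proj_coords:
  assumes "\<phi> \<in> A" "p \<in> cdom (jet_chart A r \<phi>)" "k \<le> r"
  shows "coords (jet_chart A k \<phi>) (jet_proj A k p) = trunc k (coords (jet_chart A r \<phi>) p)"
proof -
  have p: "p \<in> TJ A r" "jet_rep p 0 \<in> cdom \<phi>" using assms by (auto simp: cdom_jet_chart)
  show ?thesis
    unfolding jet_proj_def coords_jet[OF jet_rep(1)[OF p(1)] assms(1) p(2)]
    unfolding coords_jet_chart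
    using assms(3) by (auto simp: curve_jet_def trunc_def fun_eq_iff)
qed

lemma proj_param:
  assumes "\<phi> \<in> A" "v \<in> over r (img \<phi>)" "k \<le> r"
  shows "jet_proj A k (param (jet_chart A r \<phi>) v) = param (jet_chart A k \<phi>) (trunc k v)"
proof -
  note c = coords_param_jet[OF assms(1,2)]
  have "jet_proj A k (param (jet_chart A r \<phi>) v) \<in> cdom (jet_chart A k \<phi>)"
    using c(2) proj_cdom[of _ r] by (auto simp: cdom_jet_chart)
  from param_coords_jet[OF assms(1) this] show ?thesis
    using proj_coords[OF assms(1) c(2) assms(3)] c(1) by simp
qed

lemma TJ_chart: "p \<in> TJ A r \<Longrightarrow> \<exists>\<phi>\<in>A. p \<in> cdom (jet_chart A r \<phi>)"
  using chart_ex by (auto simp: cdom_jet_chart)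

lemma proj_surj:
  assumes "q \<in> TJ A k" "k \<le> r"
  shows "\<exists>p\<in>TJ A r. jet_proj A k p = q"
proof (intro bexI)
  note c = jet_rep[OF assms(1)]
  show "jet A r (jet_rep q) \<in> TJ A r" by (rule jet_in[OF c(1)])
  show "jet_proj A k (jet A r (jet_rep q)) = q"
    unfolding jet_proj_def using same_jet_rep[OF c(1), of r] same_jet_equiv(4)[OF assms(2)] jet_eq c(2) by metis
qed

end

section \<open>Forms on jet bundles\<close>

lemma smooth_on_subset: "smooth_on I V f \<Longrightarrow> V' \<subseteq> V \<Longrightarrow> smooth_on I V' f"
  unfolding smooth_on_def using continuous_on_subset by blast

lemma tangent_J_funpow:
  "fst b \<le> r \<Longrightarrow> (tangent_J r ^^ \<alpha>) v b = (if \<alpha> \<le> fst b then v (fst b - \<alpha>, snd b) else 0)"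
  by (induction \<alpha> arbitrary: b) (auto simp: tangent_J_def split: prod.splits)

lemma comp_J_eq:
  "comp_J r \<alpha> \<eta> \<kappa> p (\<delta>, i) = (if \<delta> + \<alpha> \<le> r then \<eta> \<kappa> p (\<delta> + \<alpha>, i) else 0)"
proof -
  have "comp_J r \<alpha> \<eta> \<kappa> p (\<delta>, i) = (\<Sum>b\<in>jet_idx r. if b = (\<delta> + \<alpha>, i) then \<eta> \<kappa> p b else 0)"
    unfolding comp_J_def
  proof (intro sum.cong refl)
    fix b :: "nat \<times> 'b" assume "b \<in> jet_idx r"
    then have "fst b \<le> r" by (auto simp: jet_idx_def)
    then show "\<eta> \<kappa> p b * (tangent_J r ^^ \<alpha>) (\<lambda>c. if c = (\<delta>, i) then 1 else 0) b =
      (if b = (\<delta> + \<alpha>, i) then \<eta> \<kappa> p b else 0)"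
      by (cases b) (auto simp: tangent_J_funpow)
  qed
  also have "\<dots> = (if \<delta> + \<alpha> \<le> r then \<eta> \<kappa> p (\<delta> + \<alpha>, i) else 0)"
    by (simp add: sum.delta finite_jet_idx)
  finally show ?thesis .
qed

context mfd begin

abbreviation ch :: "nat \<Rightarrow> ('m, 'n) chart \<Rightarrow> ('m jet, nat \<times> 'n) chart" where
  "ch \<equiv> jet_chart A"

definition chart_dom :: "nat \<Rightarrow> ('m, 'n) chart \<Rightarrow> 'm jet set \<Rightarrow> (nat \<times> 'n \<Rightarrow> real) set" where
  "chart_dom r \<phi> W = coords (ch r \<phi>) ` (W \<inter> cdom (ch r \<phi>))"

text \<open>The components of \<open>\<theta>\<close> in the chart induced by \<open>\<phi>\<close>, as functions of the coordinates.\<close>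

definition loc :: "nat \<Rightarrow> ('m, 'n) chart \<Rightarrow> ('m jet, nat \<times> 'n) comps1 \<Rightarrow> (nat \<times> 'n \<Rightarrow> real) \<Rightarrow> nat \<times> 'n \<Rightarrow> real" where
  "loc r \<phi> \<theta> v = \<theta> (ch r \<phi>) (param (ch r \<phi>) v)"

lemma chart_dom_iff: "\<phi> \<in> A \<Longrightarrow> v \<in> chart_dom r \<phi> W \<longleftrightarrow> v \<in> over r (img \<phi>) \<and> param (ch r \<phi>) v \<in> W"
  unfolding chart_dom_def
proof (intro iffI)
  assume \<phi>: "\<phi> \<in> A" and "v \<in> coords (ch r \<phi>) ` (W \<inter> cdom (ch r \<phi>))"
  then obtain p where p: "p \<in> W" "p \<in> cdom (ch r \<phi>)" "v = coords (ch r \<phi>) p" by blast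
  then show "v \<in> over r (img \<phi>) \<and> param (ch r \<phi>) v \<in> W"
    using coords_jet_in[OF p(2)] param_coords_jet[OF \<phi> p(2)] by simp
next
  assume \<phi>: "\<phi> \<in> A" and v: "v \<in> over r (img \<phi>) \<and> param (ch r \<phi>) v \<in> W"
  then show "v \<in> coords (ch r \<phi>) ` (W \<inter> cdom (ch r \<phi>))"
    using coords_param_jet[OF \<phi>, of v r] by (intro image_eqI[of _ _ "param (ch r \<phi>) v"]) auto
qed

lemma chart_dom_over: "\<phi> \<in> A \<Longrightarrow> chart_dom r \<phi> W \<subseteq> over r (img \<phi>)"
  using chart_dom_iff by blast

lemma chart_dom_mono: "W \<subseteq> W' \<Longrightarrow> chart_dom r \<phi> W \<subseteq> chart_dom r \<phi> W'"
  unfolding chart_dom_def by blast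

lemma coords_in_chart_dom:
  assumes "p \<in> W" "p \<in> cdom (ch r \<phi>)" shows "coords (ch r \<phi>) p \<in> chart_dom r \<phi> W"
  unfolding chart_dom_def using assms by auto

lemma ball_chart:
  assumes \<phi>: "\<phi> \<in> A"
  shows "(\<forall>p \<in> W \<inter> cdom (ch r \<phi>). P p) \<longleftrightarrow> (\<forall>v\<in>chart_dom r \<phi> W. P (param (ch r \<phi>) v))"
proof (intro iffI ballI)
  fix v assume a: "\<forall>p \<in> W \<inter> cdom (ch r \<phi>). P p" and v: "v \<in> chart_dom r \<phi> W"
  then show "P (param (ch r \<phi>) v)" using coords_param_jet[OF \<phi>, of v r] v unfolding chart_dom_iff[OF \<phi>] by blast
next
  fix p assume a: "\<forall>v\<in>chart_dom r \<phi> W. P (param (ch r \<phi>) v)" and p: "p \<in> W \<inter> cdom (ch r \<phi>)"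
  then have "P (param (ch r \<phi>) (coords (ch r \<phi>) p))" using coords_in_chart_dom by blast
  then show "P p" using param_coords_jet[OF \<phi>] p by simp
qed

lemma chart_dom_overlap:
  assumes \<phi>: "\<phi> \<in> A" and \<psi>: "\<psi> \<in> A"
  shows "chart_dom r \<phi> (W \<inter> cdom (ch r \<psi>)) = chart_dom r \<phi> W \<inter> over r (ovl \<phi> \<psi>)"
proof -
  have "param (ch r \<phi>) v \<in> cdom (ch r \<psi>) \<longleftrightarrow> base v \<in> ovl \<phi> \<psi>" if v: "v \<in> over r (img \<phi>)" for v
  proof -
    let ?p = "param (ch r \<phi>) v"
    have p: "?p \<in> cdom (ch r \<phi>)" "coords (ch r \<phi>) ?p = v" using coords_param_jet[OF \<phi> v] by auto
    have "base v = coords \<phi> (jet_rep ?p 0)"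
      using p(2) unfolding coords_jet_chart by (metis base_curve_jet)
    then show ?thesis using p(1) coords_ovl[OF \<phi>] by (simp add: cdom_jet_chart)
  qed
  then show ?thesis using chart_dom_iff[OF \<phi>] by (auto simp: over_def)
qed

lemma open_set_iff: "open_set (jet_idx r) (jet_atlas A r) W \<longleftrightarrow>
  W \<subseteq> TJ A r \<and> (\<forall>\<phi>\<in>A. coord_domain (jet_idx r) (chart_dom r \<phi> W))"
proof -
  have "\<Union> (cdom ` jet_atlas A r) = TJ A r"
    unfolding jet_atlas_def using TJ_chart by (auto simp: cdom_jet_chart)
  then show ?thesis
    unfolding open_set_def coord_domain_def chart_dom_def using finite_jet_idx by (auto simp: jet_atlas_def)
qed

lemma ball_atlas: "(\<forall>\<kappa>\<in>jet_atlas A r. P \<kappa>) \<longleftrightarrow> (\<forall>\<phi>\<in>A. P (ch r \<phi>))"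
  by (auto simp: jet_atlas_def)

lemma chart_smooth_iff: "chart_smooth (jet_idx r) (ch r \<phi>) W f \<longleftrightarrow>
   smooth_on (jet_idx r) (chart_dom r \<phi> W) (\<lambda>v. f (param (ch r \<phi>) v))"
  by (simp add: chart_smooth_def chart_dom_def comp_def)

lemma cpd_param:
  assumes "\<phi> \<in> A" "v \<in> over r (img \<phi>)"
  shows "cpd (ch r \<phi>) a f (param (ch r \<phi>) v) = pd a (\<lambda>w. f (param (ch r \<phi>) w)) v"
  using coords_param_jet[OF assms] by (simp add: cpd_def comp_def)

lemma jet_transition_param:
  assumes \<phi>: "\<phi> \<in> A" and \<psi>: "\<psi> \<in> A" and v: "v \<in> over r (ovl \<phi> \<psi>)"
  shows "coords (ch r \<psi>) (param (ch r \<phi>) v) = jet_transition r \<phi> \<psi> v"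
    "jet_transition r \<phi> \<psi> v \<in> over r (ovl \<psi> \<phi>)" "param (ch r \<psi>) (jet_transition r \<phi> \<psi> v) = param (ch r \<phi>) v"
proof -
  let ?p = "param (ch r \<phi>) v"
  have vi: "v \<in> over r (img \<phi>)" using v ovl_iff[OF \<phi>] by (auto simp: over_def)
  have p: "?p \<in> cdom (ch r \<phi>)" "coords (ch r \<phi>) ?p = v" using coords_param_jet[OF \<phi> vi] by auto
  have "v \<in> chart_dom r \<phi> (UNIV \<inter> cdom (ch r \<psi>))"
    unfolding chart_dom_overlap[OF \<phi> \<psi>] using v vi chart_dom_iff[OF \<phi>] by auto
  then have q: "?p \<in> cdom (ch r \<psi>)" using chart_dom_iff[OF \<phi>] by auto
  show 1: "coords (ch r \<psi>) ?p = jet_transition r \<phi> \<psi> v" using coords_jet_transition[OF \<phi> \<psi> p(1) q] p(2) by simp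
  show "param (ch r \<psi>) (jet_transition r \<phi> \<psi> v) = ?p" unfolding 1[symmetric] by (rule param_coords_jet[OF \<psi> q])
  have "jet_transition r \<phi> \<psi> v \<in> chart_dom r \<psi> (UNIV \<inter> cdom (ch r \<phi>))"
    unfolding 1[symmetric] using coords_in_chart_dom[OF _ q] p by auto
  then show "jet_transition r \<phi> \<psi> v \<in> over r (ovl \<psi> \<phi>)" unfolding chart_dom_overlap[OF \<psi> \<phi>] by simp
qed

lemma cpd_coords:
  assumes \<phi>: "\<phi> \<in> A" and \<psi>: "\<psi> \<in> A" and v: "v \<in> over r (ovl \<phi> \<psi>)" and a: "a \<in> jet_idx r"
  shows "cpd (ch r \<phi>) a (\<lambda>q. coords (ch r \<psi>) q b) (param (ch r \<phi>) v) = pd a (\<lambda>w. jet_transition r \<phi> \<psi> w b) v"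
proof -
  interpret coord_domain "jet_idx r" "over r (ovl \<phi> \<psi>)"
    by (intro coord_domain_over open_ovl \<phi> \<psi>)
  have vi: "v \<in> over r (img \<phi>)" using v ovl_iff[OF \<phi>] by (auto simp: over_def)
  show ?thesis unfolding cpd_param[OF \<phi> vi]
    by (rule pd_cong[OF v a]) (use jet_transition_param[OF \<phi> \<psi>] in auto)
qed

lemma coord_change_jet_transition:
  assumes W: "open_set (jet_idx r) (jet_atlas A r) W" and \<phi>: "\<phi> \<in> A" and \<psi>: "\<psi> \<in> A"
  shows "coord_change (jet_idx r) (chart_dom r \<phi> (W \<inter> cdom (ch r \<psi>))) (jet_idx r) (chart_dom r \<psi> (W \<inter> cdom (ch r \<phi>))) (jet_transition r \<phi> \<psi>)"
proof -
  have dom: "coord_domain (jet_idx r) (chart_dom r \<phi> (W \<inter> cdom (ch r \<psi>)))" if "\<phi> \<in> A" "\<psi> \<in> A" for \<phi> \<psi>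
    using W that coord_domain_over[OF open_ovl[OF that], of r]
    unfolding chart_dom_overlap[OF that] open_set_iff coord_domain_def by auto
  interpret a: coord_domain "jet_idx r" "chart_dom r \<phi> (W \<inter> cdom (ch r \<psi>))" by (rule dom[OF \<phi> \<psi>])
  interpret b: coord_domain "jet_idx r" "chart_dom r \<psi> (W \<inter> cdom (ch r \<phi>))" by (rule dom[OF \<psi> \<phi>])
  show ?thesis
  proof
    fix v assume "v \<in> chart_dom r \<phi> (W \<inter> cdom (ch r \<psi>))"
    then have v: "v \<in> chart_dom r \<phi> W" "v \<in> over r (ovl \<phi> \<psi>)" unfolding chart_dom_overlap[OF \<phi> \<psi>] by auto
    have w: "param (ch r \<phi>) v \<in> W" using v(1) by (simp add: chart_dom_iff[OF \<phi>])
    note t = jet_transition_param(2,3)[OF \<phi> \<psi> v(2)]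
    have "jet_transition r \<phi> \<psi> v \<in> over r (img \<psi>)" using t(1) by (simp add: over_def ovl_iff[OF \<psi>])
    then show "jet_transition r \<phi> \<psi> v \<in> chart_dom r \<psi> (W \<inter> cdom (ch r \<phi>))"
      unfolding chart_dom_overlap[OF \<psi> \<phi>] using t w by (simp add: chart_dom_iff[OF \<psi>])
  next
    fix b :: "nat \<times> 'n"
    show "smooth_on (jet_idx r) (chart_dom r \<phi> (W \<inter> cdom (ch r \<psi>))) (\<lambda>v. jet_transition r \<phi> \<psi> v b)"
      by (rule smooth_on_subset[OF jet_transition_smooth[OF \<phi> \<psi>]]) (simp add: chart_dom_overlap[OF \<phi> \<psi>])
  qed
qed

definition local_smooth :: "nat \<Rightarrow> 'm jet set \<Rightarrow> ('m jet, nat \<times> 'n) comps1 \<Rightarrow> bool" where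
  "local_smooth r W \<theta> \<longleftrightarrow> (\<forall>\<phi>\<in>A. \<forall>a\<in>jet_idx r. smooth_on (jet_idx r) (chart_dom r \<phi> W) (\<lambda>v. loc r \<phi> \<theta> v a))"

definition covector_law :: "nat \<Rightarrow> 'm jet set \<Rightarrow> ('m jet, nat \<times> 'n) comps1 \<Rightarrow> bool" where
  "covector_law r W \<theta> \<longleftrightarrow> (\<forall>\<phi>\<in>A. \<forall>\<psi>\<in>A. \<forall>v\<in>chart_dom r \<phi> (W \<inter> cdom (ch r \<psi>)). \<forall>a\<in>jet_idx r.
     loc r \<phi> \<theta> v a = (\<Sum>b\<in>jet_idx r. loc r \<psi> \<theta> (jet_transition r \<phi> \<psi> v) b * pd a (\<lambda>w. jet_transition r \<phi> \<psi> w b) v))"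

definition vector_law :: "nat \<Rightarrow> 'm jet set \<Rightarrow> ('m jet, nat \<times> 'n) comps1 \<Rightarrow> bool" where
  "vector_law r W X \<longleftrightarrow> (\<forall>\<phi>\<in>A. \<forall>\<psi>\<in>A. \<forall>v\<in>chart_dom r \<phi> (W \<inter> cdom (ch r \<psi>)). \<forall>b\<in>jet_idx r.
     loc r \<psi> X (jet_transition r \<phi> \<psi> v) b = (\<Sum>a\<in>jet_idx r. loc r \<phi> X v a * pd a (\<lambda>w. jet_transition r \<phi> \<psi> w b) v))"

lemma ball_overlap:
  assumes \<phi>: "\<phi> \<in> A"
  shows "(\<forall>p \<in> W \<inter> cdom (ch r \<phi>) \<inter> cdom (ch r \<psi>). P p) \<longleftrightarrow>
    (\<forall>v\<in>chart_dom r \<phi> (W \<inter> cdom (ch r \<psi>)). P (param (ch r \<phi>) v))"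
proof -
  have "W \<inter> cdom (ch r \<phi>) \<inter> cdom (ch r \<psi>) = (W \<inter> cdom (ch r \<psi>)) \<inter> cdom (ch r \<phi>)" by blast
  then show ?thesis using ball_chart[OF \<phi>] by simp
qed

lemma one_form_iff: "one_form (jet_idx r) (jet_atlas A r) W \<theta> \<longleftrightarrow> local_smooth r W \<theta> \<and> covector_law r W \<theta>"
  unfolding one_form_def local_smooth_def covector_law_def ball_atlas chart_smooth_iff loc_def
proof (rule arg_cong2[where f = conj, OF refl], intro ball_cong refl)
  fix \<phi> \<psi> assume \<phi>: "\<phi> \<in> A" and \<psi>: "\<psi> \<in> A"
  show "(\<forall>p\<in>W \<inter> cdom (ch r \<phi>) \<inter> cdom (ch r \<psi>). \<forall>a\<in>jet_idx r.
      \<theta> (ch r \<phi>) p a = (\<Sum>b\<in>jet_idx r. \<theta> (ch r \<psi>) p b * cpd (ch r \<phi>) a (\<lambda>q. coords (ch r \<psi>) q b) p)) \<longleftrightarrow>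
    (\<forall>v\<in>chart_dom r \<phi> (W \<inter> cdom (ch r \<psi>)). \<forall>a\<in>jet_idx r. \<theta> (ch r \<phi>) (param (ch r \<phi>) v) a =
      (\<Sum>b\<in>jet_idx r. \<theta> (ch r \<psi>) (param (ch r \<psi>) (jet_transition r \<phi> \<psi> v)) b * pd a (\<lambda>w. jet_transition r \<phi> \<psi> w b) v))"
    unfolding ball_overlap[OF \<phi>]
    by (intro ball_cong refl) (simp add: chart_dom_overlap[OF \<phi> \<psi>] jet_transition_param[OF \<phi> \<psi>] cpd_coords[OF \<phi> \<psi>])
qed

lemma vector_field_iff: "vector_field (jet_idx r) (jet_atlas A r) W X \<longleftrightarrow> local_smooth r W X \<and> vector_law r W X"
  unfolding vector_field_def local_smooth_def vector_law_def ball_atlas chart_smooth_iff loc_def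
proof (rule arg_cong2[where f = conj, OF refl], intro ball_cong refl)
  fix \<phi> \<psi> assume \<phi>: "\<phi> \<in> A" and \<psi>: "\<psi> \<in> A"
  show "(\<forall>p\<in>W \<inter> cdom (ch r \<phi>) \<inter> cdom (ch r \<psi>). \<forall>b\<in>jet_idx r.
      X (ch r \<psi>) p b = (\<Sum>a\<in>jet_idx r. X (ch r \<phi>) p a * cpd (ch r \<phi>) a (\<lambda>q. coords (ch r \<psi>) q b) p)) \<longleftrightarrow>
    (\<forall>v\<in>chart_dom r \<phi> (W \<inter> cdom (ch r \<psi>)). \<forall>b\<in>jet_idx r. X (ch r \<psi>) (param (ch r \<psi>) (jet_transition r \<phi> \<psi> v)) b =
      (\<Sum>a\<in>jet_idx r. X (ch r \<phi>) (param (ch r \<phi>) v) a * pd a (\<lambda>w. jet_transition r \<phi> \<psi> w b) v))"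
    unfolding ball_overlap[OF \<phi>]
    by (intro ball_cong refl) (simp add: chart_dom_overlap[OF \<phi> \<psi>] jet_transition_param[OF \<phi> \<psi>] cpd_coords[OF \<phi> \<psi>])
qed

lemma local_smooth_mono: "local_smooth r W \<theta> \<Longrightarrow> W' \<subseteq> W \<Longrightarrow> local_smooth r W' \<theta>"
  unfolding local_smooth_def using smooth_on_subset[OF _ chart_dom_mono] by blast

lemma local_smooth_restrict:
  "local_smooth r W \<theta> \<Longrightarrow> \<phi> \<in> A \<Longrightarrow> a \<in> jet_idx r \<Longrightarrow>
    smooth_on (jet_idx r) (chart_dom r \<phi> (W \<inter> Z)) (\<lambda>v. loc r \<phi> \<theta> v a)"
  unfolding local_smooth_def using smooth_on_subset[OF _ chart_dom_mono[of "W \<inter> Z" W]] by simp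

lemma vector_law_mono:
  assumes X: "vector_law r W X" and sub: "W' \<subseteq> W" shows "vector_law r W' X"
  unfolding vector_law_def
proof (intro ballI)
  fix \<phi> \<psi> v and b :: "nat \<times> 'n"
  assume "\<phi> \<in> A" "\<psi> \<in> A" "v \<in> chart_dom r \<phi> (W' \<inter> cdom (ch r \<psi>))" "b \<in> jet_idx r"
  moreover have "chart_dom r \<phi> (W' \<inter> cdom (ch r \<psi>)) \<subseteq> chart_dom r \<phi> (W \<inter> cdom (ch r \<psi>))"
    using sub by (intro chart_dom_mono) auto
  ultimately show "loc r \<psi> X (jet_transition r \<phi> \<psi> v) b = (\<Sum>a\<in>jet_idx r. loc r \<phi> X v a * pd a (\<lambda>w. jet_transition r \<phi> \<psi> w b) v)"
    using X unfolding vector_law_def by (simp add: subset_iff)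
qed

lemma loc_lie:
  assumes "\<phi> \<in> A" "v \<in> over r (img \<phi>)"
  shows "loc r \<phi> (lie I S \<theta>) v a = coord_lie I (loc r \<phi> S) (loc r \<phi> \<theta>) v a"
  unfolding loc_def lie_def coord_lie_def cpd_param[OF assms] by (simp add: loc_def)

context
  fixes r :: nat and W :: "'m jet set"
  assumes W: "open_set (jet_idx r) (jet_atlas A r) W"
begin

lemma coord_domain_chart_dom: "\<phi> \<in> A \<Longrightarrow> coord_domain (jet_idx r) (chart_dom r \<phi> W)"
  using W open_set_iff by blast

lemma one_form_cong:
  assumes \<theta>: "one_form (jet_idx r) (jet_atlas A r) W \<theta>"
    and eq: "\<And>\<phi> v a. \<phi> \<in> A \<Longrightarrow> v \<in> chart_dom r \<phi> W \<Longrightarrow> a \<in> jet_idx r \<Longrightarrow> loc r \<phi> \<theta> v a = loc r \<phi> \<eta> v a"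
  shows "one_form (jet_idx r) (jet_atlas A r) W \<eta>"
  unfolding one_form_iff
proof
  show "local_smooth r W \<eta>"
    unfolding local_smooth_def
  proof (intro ballI)
    fix \<phi> and a :: "nat \<times> 'n" assume \<phi>: "\<phi> \<in> A" and a: "a \<in> jet_idx r"
    have "smooth_on (jet_idx r) (chart_dom r \<phi> W) (\<lambda>v. loc r \<phi> \<theta> v a)"
      using \<theta> \<phi> a unfolding one_form_iff local_smooth_def by blast
    then show "smooth_on (jet_idx r) (chart_dom r \<phi> W) (\<lambda>v. loc r \<phi> \<eta> v a)"
      by (rule coord_domain.smooth_cong[OF coord_domain_chart_dom[OF \<phi>]]) (rule eq[OF \<phi> _ a])
  qed
  show "covector_law r W \<eta>"
    unfolding covector_law_def
  proof (intro ballI)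
    fix \<phi> \<psi> v and a :: "nat \<times> 'n" assume \<phi>: "\<phi> \<in> A" and \<psi>: "\<psi> \<in> A" and v: "v \<in> chart_dom r \<phi> (W \<inter> cdom (ch r \<psi>))" and a: "a \<in> jet_idx r"
    have "v \<in> chart_dom r \<phi> W" using v by (simp add: chart_dom_overlap[OF \<phi> \<psi>])
    moreover have "jet_transition r \<phi> \<psi> v \<in> chart_dom r \<psi> W"
      using coord_change.map[OF coord_change_jet_transition[OF W \<phi> \<psi>] v] by (simp add: chart_dom_overlap[OF \<psi> \<phi>])
    moreover have "loc r \<phi> \<theta> v a = (\<Sum>b\<in>jet_idx r. loc r \<psi> \<theta> (jet_transition r \<phi> \<psi> v) b * pd a (\<lambda>w. jet_transition r \<phi> \<psi> w b) v)"
      using \<theta> \<phi> \<psi> v a unfolding one_form_iff covector_law_def by blast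
    ultimately show "loc r \<phi> \<eta> v a = (\<Sum>b\<in>jet_idx r. loc r \<psi> \<eta> (jet_transition r \<phi> \<psi> v) b * pd a (\<lambda>w. jet_transition r \<phi> \<psi> w b) v)"
      using eq \<phi> \<psi> a by simp
  qed
qed

text \<open>Components of the Lie derivative transform correctly by \<open>lie_natural\<close>, whose hypothesis on the
  vector field is its transformation law.\<close>

lemma one_form_lie:
  assumes \<theta>: "one_form (jet_idx r) (jet_atlas A r) W \<theta>"
    and X: "vector_field (jet_idx r) (jet_atlas A r) W X"
  shows "one_form (jet_idx r) (jet_atlas A r) W (lie (jet_idx r) X \<theta>)"
  unfolding one_form_iff
proof
  have sm: "local_smooth r W \<theta>" "local_smooth r W X" using \<theta> X by (auto simp: one_form_iff vector_field_iff)
  show "local_smooth r W (lie (jet_idx r) X \<theta>)"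
    unfolding local_smooth_def
  proof (intro ballI)
    fix \<phi> and a :: "nat \<times> 'n" assume \<phi>: "\<phi> \<in> A" and a: "a \<in> jet_idx r"
    interpret coord_domain "jet_idx r" "chart_dom r \<phi> W" by (rule coord_domain_chart_dom[OF \<phi>])
    have "smooth_on (jet_idx r) (chart_dom r \<phi> W) (\<lambda>v. coord_lie (jet_idx r) (loc r \<phi> X) (loc r \<phi> \<theta>) v a)"
      unfolding coord_lie_def using sm \<phi> a unfolding local_smooth_def
      by (intro smooth_sum smooth_add smooth_mult smooth_pd) auto
    then show "smooth_on (jet_idx r) (chart_dom r \<phi> W) (\<lambda>v. loc r \<phi> (lie (jet_idx r) X \<theta>) v a)"
      by (rule smooth_cong) (simp add: loc_lie[OF \<phi> chart_dom_over[OF \<phi>, THEN subsetD]])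
  qed
  show "covector_law r W (lie (jet_idx r) X \<theta>)"
    unfolding covector_law_def
  proof (intro ballI)
    fix \<phi> \<psi> v and a :: "nat \<times> 'n" assume \<phi>: "\<phi> \<in> A" and \<psi>: "\<psi> \<in> A" and v: "v \<in> chart_dom r \<phi> (W \<inter> cdom (ch r \<psi>))" and a: "a \<in> jet_idx r"
    interpret coord_change "jet_idx r" "chart_dom r \<phi> (W \<inter> cdom (ch r \<psi>))" "jet_idx r" "chart_dom r \<psi> (W \<inter> cdom (ch r \<phi>))" "jet_transition r \<phi> \<psi>"
      by (rule coord_change_jet_transition[OF W \<phi> \<psi>])
    have "coord_lie (jet_idx r) (loc r \<phi> X) (loc r \<phi> \<theta>) v a =
      (\<Sum>c\<in>jet_idx r. coord_lie (jet_idx r) (loc r \<psi> X) (loc r \<psi> \<theta>) (jet_transition r \<phi> \<psi> v) c * pd a (\<lambda>w. jet_transition r \<phi> \<psi> w c) v)"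
    proof (rule lie_natural[OF _ _ _ _ _ a v])
      fix c :: "nat \<times> 'n" assume c: "c \<in> jet_idx r"
      show "smooth_on (jet_idx r) (chart_dom r \<psi> (W \<inter> cdom (ch r \<phi>))) (\<lambda>v. loc r \<psi> \<theta> v c)"
        "smooth_on (jet_idx r) (chart_dom r \<psi> (W \<inter> cdom (ch r \<phi>))) (\<lambda>v. loc r \<psi> X v c)"
        "smooth_on (jet_idx r) (chart_dom r \<phi> (W \<inter> cdom (ch r \<psi>))) (\<lambda>v. loc r \<phi> X v c)"
        using local_smooth_restrict sm \<phi> \<psi> c by auto
    qed (use \<theta> X \<phi> \<psi> in \<open>auto simp: one_form_iff vector_field_iff covector_law_def vector_law_def\<close>)
    moreover have "v \<in> over r (img \<phi>)" "jet_transition r \<phi> \<psi> v \<in> over r (img \<psi>)"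
      using v map[OF v] chart_dom_over[OF \<phi>, THEN subsetD] chart_dom_over[OF \<psi>, THEN subsetD] by simp_all
    ultimately show "loc r \<phi> (lie (jet_idx r) X \<theta>) v a =
      (\<Sum>b\<in>jet_idx r. loc r \<psi> (lie (jet_idx r) X \<theta>) (jet_transition r \<phi> \<psi> v) b * pd a (\<lambda>w. jet_transition r \<phi> \<psi> w b) v)"
      by (simp add: loc_lie[OF \<phi>] loc_lie[OF \<psi>])
  qed
qed

text \<open>In the transformation law of \<open>\<theta>\<close> at order \<open>\<delta> + 1\<close>, the summand of order 0 vanishes since the base
  coordinates do not depend on the coordinates of order \<open>\<delta> + 1\<close>. The remaining ones, with both orders
  lowered by one, form the law for the composition at order \<open>\<delta>\<close>, because the Jacobian is a block
  Toeplitz matrix.\<close>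

lemma one_form_comp_J_1:
  assumes \<theta>: "one_form (jet_idx r) (jet_atlas A r) W \<theta>"
  shows "one_form (jet_idx r) (jet_atlas A r) W (comp_J r 1 \<theta>)"
  unfolding one_form_iff
proof
  have loc_J: "loc r \<phi> (comp_J r 1 \<theta>) v (\<delta>, i) = (if \<delta> < r then loc r \<phi> \<theta> v (Suc \<delta>, i) else 0)" for \<phi> v \<delta> i
    by (simp add: loc_def comp_J_eq)
  show "local_smooth r W (comp_J r 1 \<theta>)"
    unfolding local_smooth_def
  proof (intro ballI)
    fix \<phi> and a :: "nat \<times> 'n" assume \<phi>: "\<phi> \<in> A" and a: "a \<in> jet_idx r"
    interpret coord_domain "jet_idx r" "chart_dom r \<phi> W" by (rule coord_domain_chart_dom[OF \<phi>])
    obtain \<delta> i where ai: "a = (\<delta>, i)" by force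
    show "smooth_on (jet_idx r) (chart_dom r \<phi> W) (\<lambda>v. loc r \<phi> (comp_J r 1 \<theta>) v a)"
      unfolding ai loc_J using \<theta> \<phi> by (cases "\<delta> < r") (auto simp: one_form_iff local_smooth_def)
  qed
  show "covector_law r W (comp_J r 1 \<theta>)"
    unfolding covector_law_def
  proof (intro ballI)
    fix \<phi> \<psi> v and a :: "nat \<times> 'n" assume \<phi>: "\<phi> \<in> A" and \<psi>: "\<psi> \<in> A" and v: "v \<in> chart_dom r \<phi> (W \<inter> cdom (ch r \<psi>))" and a: "a \<in> jet_idx r"
    obtain \<delta> i where ai: "a = (\<delta>, i)" and \<delta>: "\<delta> \<le> r" using a by (cases a) auto
    have vo: "v \<in> over r (ovl \<phi> \<psi>)" using v by (simp add: chart_dom_overlap[OF \<phi> \<psi>])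
    define P where "P = (\<lambda>\<gamma> i \<beta> j. pd (\<gamma>, i) (\<lambda>w. jet_transition r \<phi> \<psi> w (\<beta>, j)) v)"
    have P: "P \<gamma> i \<beta> j = pd (\<gamma>, i) (prolong r (\<lambda>v. coords \<psi> (param \<phi> v) j) \<beta>) v" if "\<beta> \<le> r" for \<gamma> i \<beta> j
      unfolding P_def jet_transition_def using that by simp
    have up: "P \<gamma> i \<beta> j = 0" if "\<beta> < \<gamma>" "\<gamma> \<le> r" for \<gamma> i \<beta> j
      using P that prolong_pd_upper[OF open_ovl[OF \<phi> \<psi>] transition_smooth[OF \<phi> \<psi>] _ _ vo] by auto
    have sh: "P (Suc \<gamma>) i (Suc \<beta>) j = P \<gamma> i \<beta> j" if "\<beta> < r" "\<gamma> < r" for \<gamma> i \<beta> j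
      using P that prolong_pd_shift[OF open_ovl[OF \<phi> \<psi>] transition_smooth[OF \<phi> \<psi>] _ _ vo] by auto
    define t where "t = loc r \<psi> \<theta> (jet_transition r \<phi> \<psi> v)"
    have law: "loc r \<phi> \<theta> v (\<gamma>, i) = (\<Sum>\<beta>=0..r. \<Sum>j\<in>UNIV. t (\<beta>, j) * P \<gamma> i \<beta> j)" if "\<gamma> \<le> r" for \<gamma> i
      using \<theta> \<phi> \<psi> v that unfolding one_form_iff covector_law_def t_def P_def
      by (simp add: sum_jet_idx)
    have "(\<Sum>b\<in>jet_idx r. loc r \<psi> (comp_J r 1 \<theta>) (jet_transition r \<phi> \<psi> v) b * pd a (\<lambda>w. jet_transition r \<phi> \<psi> w b) v) =
      (\<Sum>\<beta>=0..r. if \<beta> < r then \<Sum>j\<in>UNIV. t (Suc \<beta>, j) * P \<delta> i \<beta> j else 0)"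
      unfolding sum_jet_idx loc_J t_def P_def ai by (intro sum.cong refl) auto
    also have "\<dots> = (\<Sum>\<beta><r. \<Sum>j\<in>UNIV. t (Suc \<beta>, j) * P \<delta> i \<beta> j)"
      by (intro sum.mono_neutral_cong_right) auto
    also have "\<dots> = loc r \<phi> (comp_J r 1 \<theta>) v a"
    proof (cases "\<delta> < r")
      case True
      have "(\<Sum>\<beta><r. \<Sum>j\<in>UNIV. t (Suc \<beta>, j) * P \<delta> i \<beta> j) = (\<Sum>\<beta><r. \<Sum>j\<in>UNIV. t (Suc \<beta>, j) * P (Suc \<delta>) i (Suc \<beta>) j)"
        using sh True by simp
      also have "\<dots> = (\<Sum>\<beta><Suc r. \<Sum>j\<in>UNIV. t (\<beta>, j) * P (Suc \<delta>) i \<beta> j)"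
        using up[of 0 "Suc \<delta>"] True by (subst sum.lessThan_Suc_shift) simp
      also have "\<dots> = loc r \<phi> (comp_J r 1 \<theta>) v a"
        unfolding ai loc_J using True law[of "Suc \<delta>" i] by (simp add: lessThan_Suc_atMost atLeast0AtMost)
      finally show ?thesis .
    next
      case False
      then show ?thesis using up \<delta> unfolding ai loc_J by simp
    qed
    finally show "loc r \<phi> (comp_J r 1 \<theta>) v a =
      (\<Sum>b\<in>jet_idx r. loc r \<psi> (comp_J r 1 \<theta>) (jet_transition r \<phi> \<psi> v) b * pd a (\<lambda>w. jet_transition r \<phi> \<psi> w b) v)" ..
  qed
qed

lemma one_form_comp_J:
  assumes \<theta>: "one_form (jet_idx r) (jet_atlas A r) W \<theta>"
  shows "one_form (jet_idx r) (jet_atlas A r) W (comp_J r \<alpha> \<theta>)"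
proof (induction \<alpha>)
  case 0
  show ?case by (rule one_form_cong[OF \<theta>]) (auto simp: loc_def jet_idx_def comp_J_eq)
next
  case (Suc \<alpha>)
  show ?case
    by (rule one_form_cong[OF one_form_comp_J_1[OF Suc]]) (auto simp: loc_def jet_idx_def comp_J_eq)
qed

lemma one_form_sum:
  assumes "\<And>\<alpha>. \<alpha> \<in> B \<Longrightarrow> one_form (jet_idx r) (jet_atlas A r) W (\<theta> \<alpha>)"
  shows "one_form (jet_idx r) (jet_atlas A r) W (\<lambda>\<kappa> p a. \<Sum>\<alpha>\<in>B. c \<alpha> * \<theta> \<alpha> \<kappa> p a)"
  unfolding one_form_iff
proof
  show "local_smooth r W (\<lambda>\<kappa> p a. \<Sum>\<alpha>\<in>B. c \<alpha> * \<theta> \<alpha> \<kappa> p a)"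
    unfolding local_smooth_def
  proof (intro ballI)
    fix \<phi> and a :: "nat \<times> 'n" assume \<phi>: "\<phi> \<in> A" and a: "a \<in> jet_idx r"
    interpret coord_domain "jet_idx r" "chart_dom r \<phi> W" by (rule coord_domain_chart_dom[OF \<phi>])
    show "smooth_on (jet_idx r) (chart_dom r \<phi> W) (\<lambda>v. loc r \<phi> (\<lambda>\<kappa> p a. \<Sum>\<alpha>\<in>B. c \<alpha> * \<theta> \<alpha> \<kappa> p a) v a)"
      unfolding loc_def using assms \<phi> a
      by (intro smooth_sum smooth_cmult) (auto simp: one_form_iff local_smooth_def loc_def)
  qed
  have "covector_law r W (\<theta> \<alpha>)" if "\<alpha> \<in> B" for \<alpha> using assms that by (simp add: one_form_iff)
  then show "covector_law r W (\<lambda>\<kappa> p a. \<Sum>\<alpha>\<in>B. c \<alpha> * \<theta> \<alpha> \<kappa> p a)"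
    unfolding covector_law_def loc_def sum_distrib_right by (subst sum.swap) (simp add: sum_distrib_left mult_ac)
qed

lemma one_form_ext_d0:
  assumes f: "\<And>\<phi>. \<phi> \<in> A \<Longrightarrow> smooth_on (jet_idx r) (chart_dom r \<phi> W) (\<lambda>v. f (param (ch r \<phi>) v))"
  shows "one_form (jet_idx r) (jet_atlas A r) W (ext_d0 (\<lambda>\<kappa>. f))"
  unfolding one_form_iff
proof
  have L: "loc r \<phi> (ext_d0 (\<lambda>\<kappa>. f)) v a = pd a (\<lambda>v. f (param (ch r \<phi>) v)) v"
    if "\<phi> \<in> A" "v \<in> over r (img \<phi>)" for \<phi> v a
    unfolding loc_def ext_d0_def cpd_param[OF that] ..
  show "local_smooth r W (ext_d0 (\<lambda>\<kappa>. f))"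
    unfolding local_smooth_def
  proof (intro ballI)
    fix \<phi> and a :: "nat \<times> 'n" assume \<phi>: "\<phi> \<in> A" and a: "a \<in> jet_idx r"
    interpret coord_domain "jet_idx r" "chart_dom r \<phi> W" by (rule coord_domain_chart_dom[OF \<phi>])
    show "smooth_on (jet_idx r) (chart_dom r \<phi> W) (\<lambda>v. loc r \<phi> (ext_d0 (\<lambda>\<kappa>. f)) v a)"
      by (rule smooth_cong[OF smooth_pd[OF f[OF \<phi>] a]]) (simp_all add: L[OF \<phi> chart_dom_over[OF \<phi>, THEN subsetD]])
  qed
  show "covector_law r W (ext_d0 (\<lambda>\<kappa>. f))"
    unfolding covector_law_def
  proof (intro ballI)
    fix \<phi> \<psi> v and a :: "nat \<times> 'n" assume \<phi>: "\<phi> \<in> A" and \<psi>: "\<psi> \<in> A" and v: "v \<in> chart_dom r \<phi> (W \<inter> cdom (ch r \<psi>))" and a: "a \<in> jet_idx r"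
    interpret coord_change "jet_idx r" "chart_dom r \<phi> (W \<inter> cdom (ch r \<psi>))" "jet_idx r" "chart_dom r \<psi> (W \<inter> cdom (ch r \<phi>))" "jet_transition r \<phi> \<psi>"
      by (rule coord_change_jet_transition[OF W \<phi> \<psi>])
    have "pd a (\<lambda>v. f (param (ch r \<phi>) v)) v = pd a (\<lambda>v. f (param (ch r \<psi>) (jet_transition r \<phi> \<psi> v))) v"
      by (rule src.pd_cong[OF v a]) (use jet_transition_param[OF \<phi> \<psi>] in \<open>simp add: chart_dom_overlap[OF \<phi> \<psi>]\<close>)
    also have "\<dots> = (\<Sum>b\<in>jet_idx r. pd b (\<lambda>v. f (param (ch r \<psi>) v)) (jet_transition r \<phi> \<psi> v) * pd a (\<lambda>v. jet_transition r \<phi> \<psi> v b) v)"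
    proof (rule pd_pull[OF _ a v])
      show "smooth_on (jet_idx r) (chart_dom r \<psi> (W \<inter> cdom (ch r \<phi>))) (\<lambda>v. f (param (ch r \<psi>) v))"
        by (rule smooth_on_subset[OF f[OF \<psi>]]) (auto intro: chart_dom_mono[THEN subsetD])
    qed
    finally show "loc r \<phi> (ext_d0 (\<lambda>\<kappa>. f)) v a =
      (\<Sum>b\<in>jet_idx r. loc r \<psi> (ext_d0 (\<lambda>\<kappa>. f)) (jet_transition r \<phi> \<psi> v) b * pd a (\<lambda>w. jet_transition r \<phi> \<psi> w b) v)"
      using L \<phi> \<psi> v map[OF v] chart_dom_over[OF \<phi>] chart_dom_over[OF \<psi>] by (simp add: subset_iff)
  qed
qed

lemma two_form_ext_d1:
  assumes \<theta>: "one_form (jet_idx r) (jet_atlas A r) W \<theta>"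
  shows "two_form (jet_idx r) (jet_atlas A r) W (\<lambda>\<kappa> p a b. - ext_d1 \<theta> \<kappa> p a b)"
    and "closed2 (jet_idx r) (jet_atlas A r) W (\<lambda>\<kappa> p a b. - ext_d1 \<theta> \<kappa> p a b)"
proof -
  let ?d = "\<lambda>\<phi> v a b. pd a (\<lambda>w. loc r \<phi> \<theta> w b) v - pd b (\<lambda>w. loc r \<phi> \<theta> w a) v"
  have L: "ext_d1 \<theta> (ch r \<phi>) (param (ch r \<phi>) v) a b = ?d \<phi> v a b"
    if "\<phi> \<in> A" "v \<in> over r (img \<phi>)" for \<phi> v a b
    unfolding ext_d1_def cpd_param[OF that] loc_def ..
  have sm: "smooth_on (jet_idx r) (chart_dom r \<phi> W) (\<lambda>v. loc r \<phi> \<theta> v a)" if "\<phi> \<in> A" "a \<in> jet_idx r" for \<phi> a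
    using \<theta> that by (simp add: one_form_iff local_smooth_def)
  show "two_form (jet_idx r) (jet_atlas A r) W (\<lambda>\<kappa> p a b. - ext_d1 \<theta> \<kappa> p a b)"
    unfolding two_form_def ball_atlas chart_smooth_iff
  proof (intro conjI ballI)
    fix \<phi> and a b :: "nat \<times> 'n" assume \<phi>: "\<phi> \<in> A" and a: "a \<in> jet_idx r" and b: "b \<in> jet_idx r"
    interpret coord_domain "jet_idx r" "chart_dom r \<phi> W" by (rule coord_domain_chart_dom[OF \<phi>])
    have "smooth_on (jet_idx r) (chart_dom r \<phi> W) (\<lambda>v. - ?d \<phi> v a b)"
      by (intro smooth_minus smooth_diff smooth_pd sm \<phi> a b)
    then show "smooth_on (jet_idx r) (chart_dom r \<phi> W) (\<lambda>v. - ext_d1 \<theta> (ch r \<phi>) (param (ch r \<phi>) v) a b)"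
      by (rule smooth_cong) (simp_all add: L[OF \<phi> chart_dom_over[OF \<phi>, THEN subsetD]])
  next
    fix \<phi> p and a b :: "nat \<times> 'n"
    show "- ext_d1 \<theta> (ch r \<phi>) p a b = - (- ext_d1 \<theta> (ch r \<phi>) p b a)" by (simp add: ext_d1_def)
  next
    fix \<phi> \<psi> p and a b :: "nat \<times> 'n"
    assume \<phi>: "\<phi> \<in> A" and \<psi>: "\<psi> \<in> A" and p: "p \<in> W \<inter> cdom (ch r \<phi>) \<inter> cdom (ch r \<psi>)" and a: "a \<in> jet_idx r" and b: "b \<in> jet_idx r"
    define v where "v = coords (ch r \<phi>) p"
    have pv: "p = param (ch r \<phi>) v" using p param_coords_jet[OF \<phi>] by (simp add: v_def)
    have v: "v \<in> chart_dom r \<phi> (W \<inter> cdom (ch r \<psi>))" unfolding v_def using p by (intro coords_in_chart_dom) auto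
    interpret coord_change "jet_idx r" "chart_dom r \<phi> (W \<inter> cdom (ch r \<psi>))" "jet_idx r" "chart_dom r \<psi> (W \<inter> cdom (ch r \<phi>))" "jet_transition r \<phi> \<psi>"
      by (rule coord_change_jet_transition[OF W \<phi> \<psi>])
    have vo: "v \<in> over r (ovl \<phi> \<psi>)" using v by (simp add: chart_dom_overlap[OF \<phi> \<psi>])
    have vi: "v \<in> over r (img \<phi>)" "jet_transition r \<phi> \<psi> v \<in> over r (img \<psi>)"
      using v map[OF v] chart_dom_over[OF \<phi>, THEN subsetD] chart_dom_over[OF \<psi>, THEN subsetD] by simp_all
    have "?d \<phi> v a b = (\<Sum>c\<in>jet_idx r. \<Sum>e\<in>jet_idx r. ?d \<psi> (jet_transition r \<phi> \<psi> v) c e *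
       pd a (\<lambda>w. jet_transition r \<phi> \<psi> w c) v * pd b (\<lambda>w. jet_transition r \<phi> \<psi> w e) v)"
    proof (rule ext_d_natural[OF _ _ a b v])
      fix c :: "nat \<times> 'n" assume c: "c \<in> jet_idx r"
      show "smooth_on (jet_idx r) (chart_dom r \<psi> (W \<inter> cdom (ch r \<phi>))) (\<lambda>v. loc r \<psi> \<theta> v c)"
        by (rule smooth_on_subset[OF sm[OF \<psi> c]]) (auto intro: chart_dom_mono[THEN subsetD])
    qed (use \<theta> \<phi> \<psi> in \<open>auto simp: one_form_iff covector_law_def\<close>)
    then show "- ext_d1 \<theta> (ch r \<phi>) p a b = (\<Sum>c\<in>jet_idx r. \<Sum>e\<in>jet_idx r. - ext_d1 \<theta> (ch r \<psi>) p c e *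
       cpd (ch r \<phi>) a (\<lambda>q. coords (ch r \<psi>) q c) p * cpd (ch r \<phi>) b (\<lambda>q. coords (ch r \<psi>) q e) p)"
      unfolding pv mult_minus_left sum_negf using L[OF \<phi> vi(1)] L[OF \<psi> vi(2)] jet_transition_param(3)[OF \<phi> \<psi> vo]
        cpd_coords[OF \<phi> \<psi> vo] a b by simp
  qed
  show "closed2 (jet_idx r) (jet_atlas A r) W (\<lambda>\<kappa> p a b. - ext_d1 \<theta> \<kappa> p a b)"
    unfolding closed2_def ball_atlas
  proof (intro ballI)
    fix \<phi> p and a b c :: "nat \<times> 'n" assume \<phi>: "\<phi> \<in> A" and p: "p \<in> W \<inter> cdom (ch r \<phi>)"
      and a: "a \<in> jet_idx r" and b: "b \<in> jet_idx r" and c: "c \<in> jet_idx r"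
    interpret coord_domain "jet_idx r" "chart_dom r \<phi> W" by (rule coord_domain_chart_dom[OF \<phi>])
    define v where "v = coords (ch r \<phi>) p"
    have pv: "p = param (ch r \<phi>) v" using p param_coords_jet[OF \<phi>] by (simp add: v_def)
    have v: "v \<in> chart_dom r \<phi> W" unfolding v_def using p by (intro coords_in_chart_dom) auto
    then have vi: "v \<in> over r (img \<phi>)" using chart_dom_over[OF \<phi>] by auto
    have "cpd (ch r \<phi>) a (\<lambda>q. - ext_d1 \<theta> (ch r \<phi>) q b c) p =
       - (pd a (pd b (\<lambda>w. loc r \<phi> \<theta> w c)) v - pd a (pd c (\<lambda>w. loc r \<phi> \<theta> w b)) v)"
      if a: "a \<in> jet_idx r" and b: "b \<in> jet_idx r" and c: "c \<in> jet_idx r" for a b c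
    proof -
      have "cpd (ch r \<phi>) a (\<lambda>q. - ext_d1 \<theta> (ch r \<phi>) q b c) p = pd a (\<lambda>w. - ?d \<phi> w b c) v"
        unfolding pv cpd_param[OF \<phi> vi]
        by (rule pd_cong[OF v a]) (simp_all add: L[OF \<phi> chart_dom_over[OF \<phi>, THEN subsetD]])
      then show ?thesis using sm[OF \<phi>] a b c v by (simp add: pd_minus pd_diff smooth_pd smooth_diff)
    qed
    then show "cpd (ch r \<phi>) a (\<lambda>q. - ext_d1 \<theta> (ch r \<phi>) q b c) p +
      cpd (ch r \<phi>) b (\<lambda>q. - ext_d1 \<theta> (ch r \<phi>) q c a) p + cpd (ch r \<phi>) c (\<lambda>q. - ext_d1 \<theta> (ch r \<phi>) q a b) p = 0"
      using a b c pd_commute[OF sm[OF \<phi> a] b c v] pd_commute[OF sm[OF \<phi> b] a c v] pd_commute[OF sm[OF \<phi> c] a b v]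
      by simp
  qed
qed

end

end

section \<open>The Poincare-Cartan form in induced charts\<close>

lemma nondeg_uminus: "nondeg I (\<lambda>b a. - m b a) \<longleftrightarrow> nondeg I m"
  unfolding nondeg_def by (simp add: sum_negf)

lemma nondeg_cong:
  assumes "\<And>a b. a \<in> I \<Longrightarrow> b \<in> I \<Longrightarrow> m b a = m' b a"
  shows "nondeg I m \<longleftrightarrow> nondeg I m'"
proof -
  have "(\<forall>a\<in>I. (\<Sum>b\<in>I. u b * m b a) = 0) \<longleftrightarrow> (\<forall>a\<in>I. (\<Sum>b\<in>I. u b * m' b a) = 0)" for u
    using assms by (intro ball_cong refl) simp
  then show ?thesis unfolding nondeg_def by simp
qed

text \<open>The maximum in the definition of the rank is attained, and the only set of \<open>card I\<close> rows is \<open>I\<close>.\<close>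

lemma matrix_rank_full:
  assumes "finite I"
  shows "matrix_rank I m = card I \<longleftrightarrow> nondeg I m"
proof -
  define F where "F = {B. B \<subseteq> I \<and> (\<forall>c. (\<forall>a\<in>I. (\<Sum>b\<in>B. c b * m b a) = 0) \<longrightarrow> (\<forall>b\<in>B. c b = 0))}"
  have F: "finite F" "{} \<in> F" using assms by (auto simp: F_def intro: finite_subset[of _ "Pow I"])
  have I: "I \<in> F \<longleftrightarrow> nondeg I m" by (simp add: F_def nondeg_def)
  have rank: "matrix_rank I m = Max (card ` F)" by (simp add: matrix_rank_def F_def)
  show ?thesis
  proof
    assume "matrix_rank I m = card I"
    moreover have "Max (card ` F) \<in> card ` F" using F by (intro Max_in) auto
    ultimately obtain B where "B \<in> F" "card B = card I" using rank by auto
    moreover from this have "B = I" using assms by (intro card_subset_eq) (auto simp: F_def)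
    ultimately show "nondeg I m" using I by simp
  next
    assume "nondeg I m"
    then have "Max (card ` F) = card I" using F I assms
      by (intro Max_eqI) (auto simp: F_def intro: card_mono)
    then show "matrix_rank I m = card I" using rank by simp
  qed
qed

text \<open>Contraction with \<open>X\<close> intertwines the Lie derivative of forms and the derivative of functions
  (\<open>contraction_lie\<close>).\<close>

lemma (in spray_domain) contraction_spray_lie_funpow:
  assumes \<eta>: "smooth_form \<eta>" "order_le m \<eta>"
  shows "m + j \<le> r \<Longrightarrow> v \<in> V \<Longrightarrow>
    (\<Sum>a\<in>I. X v a * (spray_lie ^^ j) \<eta> v a) = (D ^^ j) (\<lambda>w. \<Sum>a\<in>I. X w a * \<eta> w a) v"
proof (induction j arbitrary: v)
  case (Suc j)
  have "(\<Sum>a\<in>I. X v a * (spray_lie ^^ Suc j) \<eta> v a) = (\<Sum>a\<in>I. X v a * coord_lie I X ((spray_lie ^^ j) \<eta>) v a)"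
    using coord_lie_eq[OF order_le_spray_lie_funpow[OF \<eta>(2)]] Suc.prems by simp
  also have "\<dots> = D (\<lambda>w. \<Sum>a\<in>I. X w a * (spray_lie ^^ j) \<eta> w a) v"
    using smooth_form_spray_lie_funpow[OF \<eta>(1)] X_smooth Suc.prems by (intro contraction_lie) (auto simp: smooth_form_def)
  also have "\<dots> = D ((D ^^ j) (\<lambda>w. \<Sum>a\<in>I. X w a * \<eta> w a)) v"
    by (rule deriv_along_cong) (use Suc in auto)
  finally show ?case by simp
qed simp

text \<open>The order \<open>2 k - 1\<close> has a name of its own, since it occurs in almost every statement below.\<close>

locale mfd_spray = mfd A for A :: "('m::{t2_space,second_countable_topology}, 'n::finite) chart set" +
  fixes k :: nat and S :: "('m jet, nat \<times> 'n) comps1" and r :: nat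
  assumes k: "1 \<le> k" and r_def: "r = 2 * k - 1" and S: "semispray A r S"
begin

abbreviation "Ir \<equiv> jet_idx r :: (nat \<times> 'n) set"
abbreviation "Ar \<equiv> jet_atlas A r"
abbreviation "Ik \<equiv> jet_idx k :: (nat \<times> 'n) set"
abbreviation "Ak \<equiv> jet_atlas A k"

lemma k_le_r: "k \<le> r" and k_less_r: "k - 1 < r" using k r_def by auto

lemma S_law: "local_smooth r (TJ A r) S" "vector_law r (TJ A r) S"
  using S unfolding semispray_def vector_field_iff by auto

lemma S_vector_field: "open_set Ir Ar W \<Longrightarrow> vector_field Ir Ar W S"
  using local_smooth_mono[OF S_law(1)] vector_law_mono[OF S_law(2)]
  by (simp add: vector_field_iff open_set_iff)

lemma spray: assumes W: "open_set Ir Ar W" and \<phi>: "\<phi> \<in> A"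
  shows "spray_domain r (chart_dom r \<phi> W) (loc r \<phi> S)"
proof -
  interpret coord_domain Ir "chart_dom r \<phi> W" by (rule coord_domain_chart_dom[OF W \<phi>])
  show ?thesis
  proof
    fix b :: "nat \<times> 'n" assume "b \<in> Ir"
    then show "smooth_on Ir (chart_dom r \<phi> W) (\<lambda>v. loc r \<phi> S v b)"
      using local_smooth_mono[OF S_law(1), of W] W \<phi> unfolding open_set_iff local_smooth_def by auto
  next
    fix v \<delta> i assume v: "v \<in> chart_dom r \<phi> W" and \<delta>: "\<delta> < r"
    have vo: "v \<in> over r (img \<phi>)" using v chart_dom_over[OF \<phi>] by auto
    note c = coords_param_jet[OF \<phi> vo]
    have "tangent_J r (S (ch r \<phi>) (param (ch r \<phi>) v)) (Suc \<delta>, i) = liouville r 1 (ch r \<phi>) (param (ch r \<phi>) v) (Suc \<delta>, i)"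
      using S \<phi> c(2) \<delta> unfolding semispray_def eq_on_def by (auto simp: jet_atlas_def cdom_jet_chart)
    then show "loc r \<phi> S v (\<delta>, i) = real (Suc \<delta>) * v (Suc \<delta>, i)"
      using \<delta> c(1) by (simp add: tangent_J_def liouville_def loc_def)
  qed
qed

text \<open>The Lagrangian as a function of the coordinates of jets of order \<open>r\<close>, in the chart induced by \<open>\<phi>\<close>.\<close>

definition Lc :: "('m jet \<Rightarrow> real) \<Rightarrow> ('m, 'n) chart \<Rightarrow> (nat \<times> 'n \<Rightarrow> real) \<Rightarrow> real" where
  "Lc L \<phi> v = L (param (ch k \<phi>) (trunc k v))"

lemma pullback_loc:
  "\<phi> \<in> A \<Longrightarrow> v \<in> over r (img \<phi>) \<Longrightarrow> pullback A k L \<kappa> (param (ch r \<phi>) v) = Lc L \<phi> v"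
  unfolding pullback_def Lc_def using proj_param[OF _ _ k_le_r] by simp

lemma pd_trunc: "fst a \<le> k \<Longrightarrow> pd a (\<lambda>v. g (trunc k v)) = (\<lambda>v. pd a g (trunc k v))"
proof
  fix v assume a: "fst a \<le> k"
  have "trunc k (v(a := s)) = (trunc k v)(a := s)" for s using a by (auto simp: trunc_def fun_eq_iff)
  then show "pd a (\<lambda>v. g (trunc k v)) v = pd a g (trunc k v)" using a by (simp add: pd_def trunc_def)
qed

lemma pd_Lc_zero: "k < \<gamma> \<Longrightarrow> pd (\<gamma>, j) (Lc L \<phi>) v = 0"
proof -
  assume "k < \<gamma>"
  then have "trunc k (v((\<gamma>, j) := s)) = trunc k v" for s by (auto simp: trunc_def)
  then show ?thesis by (simp add: pd_def Lc_def)
qed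

lemma chart_dom_jets_over:
  assumes "\<phi> \<in> A"
  shows "chart_dom r \<phi> (jets_over A r k U) = {v \<in> over r (img \<phi>). trunc k v \<in> chart_dom k \<phi> U}"
proof -
  have "v \<in> over r (img \<phi>) \<Longrightarrow> param (ch r \<phi>) v \<in> jets_over A r k U \<longleftrightarrow> trunc k v \<in> chart_dom k \<phi> U" for v
    using coords_param_jet(2)[OF assms, of v r] proj_param[OF assms _ k_le_r, of v]
      chart_dom_iff[OF assms, of "trunc k v" k U] trunc_over[of v r "img \<phi>" k]
    by (auto simp: jets_over_def cdom_jet_chart)
  then show ?thesis using chart_dom_iff[OF assms] by auto
qed

lemma open_jets_over:
  assumes U: "open_set Ik Ak U"
  shows "open_set Ir Ar (jets_over A r k U)"
  unfolding open_set_iff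
proof (intro conjI ballI)
  fix \<phi> assume \<phi>: "\<phi> \<in> A"
  interpret o: coord_domain Ir "over r (img \<phi>)" by (intro coord_domain_over open_img \<phi>)
  interpret K: coord_domain Ik "chart_dom k \<phi> U" using U \<phi> by (simp add: open_set_iff)
  show "coord_domain Ir (chart_dom r \<phi> (jets_over A r k U))"
  proof
    show "openin (top_of_set (coord_space Ir)) (chart_dom r \<phi> (jets_over A r k U))"
      unfolding openin_coord_iff[OF finite_jet_idx] chart_dom_jets_over[OF \<phi>]
    proof (intro conjI ballI)
      fix v assume v: "v \<in> {v \<in> over r (img \<phi>). trunc k v \<in> chart_dom k \<phi> U}"
      obtain d1 where d1: "d1 > 0" "cube Ir v d1 \<subseteq> over r (img \<phi>)" using o.dom_cube v by auto
      obtain d2 where d2: "d2 > 0" "cube Ik (trunc k v) d2 \<subseteq> chart_dom k \<phi> U" using K.dom_cube v by auto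
      have "trunc k w \<in> cube Ik (trunc k v) d2" if "w \<in> cube Ir v (min d1 d2)" for w
        using that k_le_r unfolding cube_def coord_space_def by (auto simp: trunc_def jet_idx_def)
      then show "\<exists>d>0. cube Ir v d \<subseteq> {v \<in> over r (img \<phi>). trunc k v \<in> chart_dom k \<phi> U}"
        using d1 d2 cube_mono[of "min d1 d2" d1 Ir v] by (intro exI[of _ "min d1 d2"]) auto
    qed (auto simp: over_def)
  qed (rule finite_jet_idx)
qed (auto simp: jets_over_def)

abbreviation chart_cartan :: "('m jet \<Rightarrow> real) \<Rightarrow> ('m, 'n) chart \<Rightarrow> (nat \<times> 'n \<Rightarrow> real) \<Rightarrow> nat \<times> 'n \<Rightarrow> real" where
  "chart_cartan L \<phi> \<equiv> spray_domain.cartan_form r (loc r \<phi> S) k (spray_domain.grad k (Lc L \<phi>))"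

abbreviation chart_euler :: "('m jet \<Rightarrow> real) \<Rightarrow> ('m, 'n) chart \<Rightarrow> 'n \<Rightarrow> (nat \<times> 'n \<Rightarrow> real) \<Rightarrow> real" where
  "chart_euler L \<phi> \<equiv> spray_domain.euler_expr r (loc r \<phi> S) k (spray_domain.grad k (Lc L \<phi>))"

definition hess :: "('m jet \<Rightarrow> real) \<Rightarrow> ('m, 'n) chart \<Rightarrow> (nat \<times> 'n \<Rightarrow> real) \<Rightarrow> 'n \<Rightarrow> 'n \<Rightarrow> real" where
  "hess L \<phi> w i j = pd (k, i) (pd (k, j) (\<lambda>v. L (param (ch k \<phi>) v))) w"

lemma hess_Lc: "pd (k, i) (pd (k, j) (Lc L \<phi>)) v = hess L \<phi> (trunc k v) i j"
proof -
  have "pd (k, j) (Lc L \<phi>) = (\<lambda>v. pd (k, j) (\<lambda>v. L (param (ch k \<phi>) v)) (trunc k v))"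
    using pd_trunc[of "(k, j)" "\<lambda>v. L (param (ch k \<phi>) v)"] by (simp add: Lc_def[abs_def])
  then show ?thesis
    using fun_cong[OF pd_trunc[of "(k, i)" "pd (k, j) (\<lambda>v. L (param (ch k \<phi>) v))"]] by (simp add: hess_def)
qed

context
  fixes W :: "'m jet set" and U :: "'m jet set" and L :: "'m jet \<Rightarrow> real"
  assumes W: "open_set Ir Ar W" and sub: "W \<subseteq> jets_over A r k U"
    and U: "open_set Ik Ak U" and L: "smooth_function Ik Ak U L"
begin

lemma Lc_smooth: assumes \<phi>: "\<phi> \<in> A" shows "smooth_on Ir (chart_dom r \<phi> W) (Lc L \<phi>)"
proof -
  interpret coord_domain Ir "chart_dom r \<phi> W" by (rule coord_domain_chart_dom[OF W \<phi>])
  have m: "chart_dom r \<phi> W \<subseteq> chart_dom r \<phi> (jets_over A r k U)" by (rule chart_dom_mono[OF sub])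
  have "smooth_on Ir (chart_dom r \<phi> W) (\<lambda>v. L (param (ch k \<phi>) (trunc k v)))"
  proof (rule smooth_compose[where h = "\<lambda>v. L (param (ch k \<phi>) v)" and \<Phi> = "trunc k"])
    show "coord_domain Ik (chart_dom k \<phi> U)" using U \<phi> by (simp add: open_set_iff)
    show "smooth_on Ik (chart_dom k \<phi> U) (\<lambda>v. L (param (ch k \<phi>) v))"
      using L \<phi> unfolding smooth_function_def ball_atlas chart_smooth_iff by blast
    fix b :: "nat \<times> 'n"
    show "smooth_on Ir (chart_dom r \<phi> W) (\<lambda>v. trunc k v b)"
      unfolding trunc_def by (cases "fst b \<le> k") auto
  next
    fix v assume "v \<in> chart_dom r \<phi> W"
    then show "trunc k v \<in> chart_dom k \<phi> U" using m by (auto simp: chart_dom_jets_over[OF \<phi>])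
  qed
  then show ?thesis by (simp add: Lc_def[abs_def])
qed

lemma pullback_one_form: "one_form Ir Ar W (ext_d0 (pullback A k L))"
  unfolding pullback_def
proof (rule one_form_ext_d0[OF W])
  fix \<phi> assume \<phi>: "\<phi> \<in> A"
  interpret coord_domain Ir "chart_dom r \<phi> W" by (rule coord_domain_chart_dom[OF W \<phi>])
  show "smooth_on Ir (chart_dom r \<phi> W) (\<lambda>v. L (jet_proj A k (param (ch r \<phi>) v)))"
    by (rule smooth_cong[OF Lc_smooth[OF \<phi>]])
       (simp add: Lc_def proj_param[OF \<phi> chart_dom_over[OF \<phi>, THEN subsetD] k_le_r])
qed

text \<open>The Poincare-Cartan form is built from \<open>dL\<close> by operations that are natural under changes of induced
  charts.\<close>

lemma pc_is_one_form: "one_form Ir Ar W (pc_one_form A k S L)"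
proof -
  have pow: "one_form Ir Ar W ((lie Ir S ^^ m) \<theta>)" if "one_form Ir Ar W \<theta>" for m \<theta>
    using that one_form_lie[OF W _ S_vector_field[OF W]] by (induction m) auto
  show ?thesis
    unfolding pc_one_form_def r_def[symmetric]
    by (intro one_form_sum[OF W] pow one_form_comp_J[OF W] pullback_one_form)
qed

context
  fixes \<phi> assumes \<phi>: "\<phi> \<in> A"
begin

interpretation spray_domain r "chart_dom r \<phi> W" "loc r \<phi> S" by (rule spray[OF W \<phi>])

lemma in_over: "v \<in> chart_dom r \<phi> W \<Longrightarrow> v \<in> over r (img \<phi>)"
  using chart_dom_over[OF \<phi>] by auto

lemma grad_Lc: "smooth_form (grad k (Lc L \<phi>))" "order_le k (grad k (Lc L \<phi>))"
  using smooth_form_grad[OF Lc_smooth[OF \<phi>] k_le_r] order_le_grad by auto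

lemma loc_pullback: 
  assumes "v \<in> chart_dom r \<phi> W" "a \<in> Ir"
  shows "loc r \<phi> (ext_d0 (pullback A k L)) v a = pd a (Lc L \<phi>) v"
  unfolding loc_def ext_d0_def cpd_param[OF \<phi> in_over[OF assms(1)]]
  by (rule pd_cong[OF assms]) (simp add: pullback_loc[OF \<phi> in_over])

lemma grad_eq: "fst a \<le> r \<Longrightarrow> grad k (Lc L \<phi>) v a = pd a (Lc L \<phi>) v"
  using pd_Lc_zero[of "fst a" "snd a"] by (simp add: grad_def)

lemma loc_comp_J:
  assumes v: "v \<in> chart_dom r \<phi> W" and a: "a \<in> Ir"
  shows "loc r \<phi> (comp_J r \<alpha> (ext_d0 (pullback A k L))) v a = shift \<alpha> (grad k (Lc L \<phi>)) v a"
proof -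
  obtain \<delta> i where ai: "a = (\<delta>, i)" by force
  show ?thesis
    using loc_pullback[OF v, of "(\<delta> + \<alpha>, i)"] grad_eq[of "(\<delta> + \<alpha>, i)" v] k_le_r
    by (auto simp: ai loc_def comp_J_eq shift_def grad_def)
qed

lemma loc_lie_funpow:
  assumes "v \<in> chart_dom r \<phi> W" "a \<in> Ir"
  shows "loc r \<phi> ((lie Ir S ^^ m) \<theta>) v a = (coord_lie Ir (loc r \<phi> S) ^^ m) (loc r \<phi> \<theta>) v a"
  using assms
proof (induction m arbitrary: v a)
  case (Suc m)
  have "loc r \<phi> ((lie Ir S ^^ Suc m) \<theta>) v a = coord_lie Ir (loc r \<phi> S) (loc r \<phi> ((lie Ir S ^^ m) \<theta>)) v a"
    using loc_lie[OF \<phi> in_over[OF Suc.prems(1)]] by simp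
  also have "\<dots> = coord_lie Ir (loc r \<phi> S) ((coord_lie Ir (loc r \<phi> S) ^^ m) (loc r \<phi> \<theta>)) v a"
    by (rule coord_lie_cong) (use Suc in auto)
  finally show ?case by simp
qed simp

lemma coord_lie_funpow_cong:
  assumes "v \<in> chart_dom r \<phi> W" "a \<in> Ir" "\<And>w b. w \<in> chart_dom r \<phi> W \<Longrightarrow> b \<in> Ir \<Longrightarrow> \<theta> w b = \<eta> w b"
  shows "(coord_lie Ir (loc r \<phi> S) ^^ m) \<theta> v a = (coord_lie Ir (loc r \<phi> S) ^^ m) \<eta> v a"
  using assms(1,2)
proof (induction m arbitrary: v a)
  case (Suc m)
  show ?case unfolding funpow.simps comp_apply by (rule coord_lie_cong) (use Suc in auto)
qed (simp add: assms(3))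

lemma pc_loc:
  assumes v: "v \<in> chart_dom r \<phi> W" and a: "a \<in> Ir"
  shows "loc r \<phi> (pc_one_form A k S L) v a = chart_cartan L \<phi> v a"
proof -
  have "loc r \<phi> (pc_one_form A k S L) v a = (\<Sum>\<alpha>=1..k. (-1) ^ (\<alpha> - 1) / fact \<alpha> *
     loc r \<phi> ((lie Ir S ^^ (\<alpha> - 1)) (comp_J r \<alpha> (ext_d0 (pullback A k L)))) v a)"
    by (simp add: loc_def pc_one_form_def r_def)
  also have "\<dots> = (\<Sum>\<alpha>=1..k. (-1) ^ (\<alpha> - 1) / fact \<alpha> * (spray_lie ^^ (\<alpha> - 1)) (shift \<alpha> (grad k (Lc L \<phi>))) v a)"
  proof (intro sum.cong refl arg_cong2[where f = times])
    fix \<alpha> assume \<alpha>: "\<alpha> \<in> {1..k}"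
    have "loc r \<phi> ((lie Ir S ^^ (\<alpha> - 1)) (comp_J r \<alpha> (ext_d0 (pullback A k L)))) v a =
      (coord_lie Ir (loc r \<phi> S) ^^ (\<alpha> - 1)) (shift \<alpha> (grad k (Lc L \<phi>))) v a"
      unfolding loc_lie_funpow[OF v a] by (rule coord_lie_funpow_cong[OF v a loc_comp_J])
    also have "\<dots> = (spray_lie ^^ (\<alpha> - 1)) (shift \<alpha> (grad k (Lc L \<phi>))) v a"
      by (rule coord_lie_funpow_eq[OF order_le_shift[OF order_le_grad] _ v a]) (use \<alpha> k_le_r in auto)
    finally show "loc r \<phi> ((lie Ir S ^^ (\<alpha> - 1)) (comp_J r \<alpha> (ext_d0 (pullback A k L)))) v a =
      (spray_lie ^^ (\<alpha> - 1)) (shift \<alpha> (grad k (Lc L \<phi>))) v a" .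
  qed
  finally show ?thesis by (simp add: cartan_form_def)
qed

lemma lie_pc_loc:
  assumes v: "v \<in> chart_dom r \<phi> W" and a: "a \<in> Ir"
  shows "loc r \<phi> (lie Ir S (pc_one_form A k S L)) v a =
    loc r \<phi> (ext_d0 (pullback A k L)) v a - (if fst a = 0 then chart_euler L \<phi> (snd a) v else 0)"
proof -
  have "loc r \<phi> (lie Ir S (pc_one_form A k S L)) v a = coord_lie Ir (loc r \<phi> S) (chart_cartan L \<phi>) v a"
    unfolding loc_lie[OF \<phi> in_over[OF v]] by (rule coord_lie_cong[OF v a pc_loc])
  also have "\<dots> = spray_lie (chart_cartan L \<phi>) v a"
  proof (rule coord_lie_eq[OF _ k_less_r v a])
    show "order_le (k - 1) (chart_cartan L \<phi>)"
      using cartan_high_zero[OF grad_Lc(2)] unfolding order_le_def by auto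
  qed
  also have "\<dots> = grad k (Lc L \<phi>) v a - (if fst a = 0 then chart_euler L \<phi> (snd a) v else 0)"
    using spray_lie_cartan[OF grad_Lc v, of "fst a" "snd a"] by simp
  also have "grad k (Lc L \<phi>) v a = loc r \<phi> (ext_d0 (pullback A k L)) v a"
    using loc_pullback[OF v a] a by (auto simp: grad_eq jet_idx_def)
  finally show ?thesis .
qed

lemma lie_pc_loc_eq_iff:
  assumes v: "v \<in> chart_dom r \<phi> W"
  shows "(\<forall>a\<in>Ir. loc r \<phi> (lie Ir S (pc_one_form A k S L)) v a = loc r \<phi> (ext_d0 (pullback A k L)) v a)
    \<longleftrightarrow> (\<forall>i. chart_euler L \<phi> i v = 0)"
  using lie_pc_loc[OF v] by (auto simp: jet_idx_def split: if_splits)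

lemma vf_app_loc:
  assumes "v \<in> over r (img \<phi>)"
  shows "vf_app Ir X f (ch r \<phi>) (param (ch r \<phi>) v) = deriv_along Ir (loc r \<phi> X) (\<lambda>w. f (ch r \<phi>) (param (ch r \<phi>) w)) v"
  unfolding vf_app_def deriv_along_def cpd_param[OF \<phi> assms] by (simp add: loc_def)

lemma vf_app_funpow_loc:
  assumes "v \<in> chart_dom r \<phi> W"
  shows "(vf_app Ir S ^^ m) f (ch r \<phi>) (param (ch r \<phi>) v) = (D ^^ m) (\<lambda>w. f (ch r \<phi>) (param (ch r \<phi>) w)) v"
  using assms
proof (induction m arbitrary: v)
  case (Suc m)
  show ?case unfolding funpow.simps comp_apply vf_app_loc[OF in_over[OF Suc.prems]]
    by (rule deriv_along_cong) (use Suc in auto)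
qed simp

lemma D_funpow_cong:
  assumes "v \<in> chart_dom r \<phi> W" "\<And>w. w \<in> chart_dom r \<phi> W \<Longrightarrow> f w = g w"
  shows "(D ^^ m) f v = (D ^^ m) g v"
  using assms(1)
proof (induction m arbitrary: v)
  case (Suc m)
  show ?case unfolding funpow.simps comp_apply by (rule deriv_along_cong) (use Suc in auto)
qed (simp add: assms(2))

text \<open>The identity \<open>i\<^sub>S \<theta>\<^sub>L = \<E>\<^sub>L + L\<close>. It holds term by term, since \<open>i\<^sub>S (\<Lambda>^(\<alpha> - 1) J\<^sup>\<alpha> dL) = D^(\<alpha> - 1) (i\<^sub>S J\<^sup>\<alpha> dL)\<close> and
  \<open>i\<^sub>S J\<^sup>\<alpha> dL\<close> is the derivative of \<open>L\<close> along the \<open>\<alpha>\<close>-th Liouville field.\<close>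

lemma energy_loc:
  assumes v: "v \<in> chart_dom r \<phi> W"
  shows "pc_energy A k S L (ch r \<phi>) (param (ch r \<phi>) v) = (\<Sum>a\<in>Ir. loc r \<phi> S v a * chart_cartan L \<phi> v a) - Lc L \<phi> v"
proof -
  let ?\<xi> = "grad k (Lc L \<phi>)"
  have base: "vf_app Ir (liouville r \<alpha>) (pullback A k L) (ch r \<phi>) (param (ch r \<phi>) w) =
     (\<Sum>a\<in>Ir. loc r \<phi> S w a * shift \<alpha> ?\<xi> w a)" if w: "w \<in> chart_dom r \<phi> W" and \<alpha>: "1 \<le> \<alpha>" for w \<alpha>
    unfolding contraction_shift[OF grad_Lc(2) k_le_r \<alpha> w] vf_app_def
  proof (intro sum.cong refl)
    fix a :: "nat \<times> 'n" assume a: "a \<in> Ir"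
    have "cpd (ch r \<phi>) a (pullback A k L (ch r \<phi>)) (param (ch r \<phi>) w) = ?\<xi> w a"
      using loc_pullback[OF w a] a by (auto simp: grad_eq jet_idx_def loc_def ext_d0_def)
    then show "liouville r \<alpha> (ch r \<phi>) (param (ch r \<phi>) w) a * cpd (ch r \<phi>) a (pullback A k L (ch r \<phi>)) (param (ch r \<phi>) w) =
      (if \<alpha> \<le> fst a then real (fst a + 1 - \<alpha>) * w (fst a + 1 - \<alpha>, snd a) else 0) * ?\<xi> w a"
      using a coords_param_jet(1)[OF \<phi> in_over[OF w]] by (auto simp: liouville_def jet_idx_def)
  qed
  have "(\<Sum>a\<in>Ir. loc r \<phi> S v a * chart_cartan L \<phi> v a) =
    (\<Sum>\<alpha>=1..k. (-1) ^ (\<alpha> - 1) / fact \<alpha> * (\<Sum>a\<in>Ir. loc r \<phi> S v a * (spray_lie ^^ (\<alpha> - 1)) (shift \<alpha> ?\<xi>) v a))"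
    unfolding cartan_form_def sum_distrib_left by (subst sum.swap) (simp add: mult_ac)
  also have "\<dots> = (\<Sum>\<alpha>=1..k. (-1) ^ (\<alpha> - 1) / fact \<alpha> * (vf_app Ir S ^^ (\<alpha> - 1))
     (vf_app Ir (liouville r \<alpha>) (pullback A k L)) (ch r \<phi>) (param (ch r \<phi>) v))"
  proof (intro sum.cong refl arg_cong2[where f = times])
    fix \<alpha> assume \<alpha>: "\<alpha> \<in> {1..k}"
    have "(\<Sum>a\<in>Ir. loc r \<phi> S v a * (spray_lie ^^ (\<alpha> - 1)) (shift \<alpha> ?\<xi>) v a) =
      (D ^^ (\<alpha> - 1)) (\<lambda>w. \<Sum>a\<in>Ir. loc r \<phi> S w a * shift \<alpha> ?\<xi> w a) v"
      by (rule contraction_spray_lie_funpow[OF smooth_form_shift[OF grad_Lc(1)] order_le_shift[OF grad_Lc(2)] _ v])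
         (use \<alpha> k_le_r in auto)
    also have "\<dots> = (D ^^ (\<alpha> - 1)) (\<lambda>w. vf_app Ir (liouville r \<alpha>) (pullback A k L) (ch r \<phi>) (param (ch r \<phi>) w)) v"
      by (rule D_funpow_cong[OF v]) (use base \<alpha> in auto)
    finally show "(\<Sum>a\<in>Ir. loc r \<phi> S v a * (spray_lie ^^ (\<alpha> - 1)) (shift \<alpha> ?\<xi>) v a) =
      (vf_app Ir S ^^ (\<alpha> - 1)) (vf_app Ir (liouville r \<alpha>) (pullback A k L)) (ch r \<phi>) (param (ch r \<phi>) v)"
      using vf_app_funpow_loc[OF v] by simp
  qed
  finally show ?thesis
    using pullback_loc[OF \<phi> in_over[OF v]] by (simp add: pc_energy_def r_def)
qed

lemma two_form_loc:
  assumes v: "v \<in> chart_dom r \<phi> W" and a: "a \<in> Ir" and b: "b \<in> Ir"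
  shows "pc_two_form A k S L (ch r \<phi>) (param (ch r \<phi>) v) b a =
    - (pd b (\<lambda>w. chart_cartan L \<phi> w a) v - pd a (\<lambda>w. chart_cartan L \<phi> w b) v)"
proof -
  have "cpd (ch r \<phi>) b (\<lambda>q. pc_one_form A k S L (ch r \<phi>) q a) (param (ch r \<phi>) v) = pd b (\<lambda>w. chart_cartan L \<phi> w a) v"
    if "a \<in> Ir" "b \<in> Ir" for a b
    unfolding cpd_param[OF \<phi> in_over[OF v]]
    by (rule pd_cong[OF v that(2)]) (use pc_loc that in \<open>simp add: loc_def\<close>)
  then show ?thesis using a b by (simp add: pc_two_form_def ext_d1_def)
qed

text \<open>By Cartan's formula \<open>i\<^sub>S \<omega>\<^sub>L - d\<E>\<^sub>L = - \<L>\<^sub>S \<theta>\<^sub>L + d(i\<^sub>S \<theta>\<^sub>L) - d\<E>\<^sub>L = - \<L>\<^sub>S \<theta>\<^sub>L + dL\<close>.\<close>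

lemma interior_loc_iff:
  assumes v: "v \<in> chart_dom r \<phi> W" and a: "a \<in> Ir"
  shows "loc r \<phi> (interior_prod Ir S (pc_two_form A k S L)) v a = loc r \<phi> (ext_d0 (pc_energy A k S L)) v a
    \<longleftrightarrow> loc r \<phi> (lie Ir S (pc_one_form A k S L)) v a = loc r \<phi> (ext_d0 (pullback A k L)) v a"
proof -
  have scf: "sm (\<lambda>w. chart_cartan L \<phi> w b)" for b using smooth_form_cartan[OF grad_Lc(1)] unfolding smooth_form_def by blast
  have "loc r \<phi> (interior_prod Ir S (pc_two_form A k S L)) v a =
    - (\<Sum>b\<in>Ir. loc r \<phi> S v b * (pd b (\<lambda>w. chart_cartan L \<phi> w a) v - pd a (\<lambda>w. chart_cartan L \<phi> w b) v))"
  proof -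
    have "loc r \<phi> (interior_prod Ir S (pc_two_form A k S L)) v a =
      (\<Sum>b\<in>Ir. loc r \<phi> S v b * pc_two_form A k S L (ch r \<phi>) (param (ch r \<phi>) v) b a)"
      by (simp add: loc_def interior_prod_def)
    also have "\<dots> = (\<Sum>b\<in>Ir. - (loc r \<phi> S v b * (pd b (\<lambda>w. chart_cartan L \<phi> w a) v - pd a (\<lambda>w. chart_cartan L \<phi> w b) v)))"
      by (intro sum.cong refl) (simp only: two_form_loc[OF v a] mult_minus_right)
    finally show ?thesis by (simp only: sum_negf)
  qed
  also have "\<dots> = pd a (\<lambda>w. \<Sum>b\<in>Ir. loc r \<phi> S w b * chart_cartan L \<phi> w b) v - coord_lie Ir (loc r \<phi> S) (chart_cartan L \<phi>) v a"
    using cartan[of "loc r \<phi> S" "chart_cartan L \<phi>", OF X_smooth scf v a] by simp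
  also have "coord_lie Ir (loc r \<phi> S) (chart_cartan L \<phi>) v a = loc r \<phi> (lie Ir S (pc_one_form A k S L)) v a"
    unfolding loc_lie[OF \<phi> in_over[OF v]] by (rule coord_lie_cong[OF v a pc_loc[symmetric]])
  finally have 1: "loc r \<phi> (interior_prod Ir S (pc_two_form A k S L)) v a =
    pd a (\<lambda>w. \<Sum>b\<in>Ir. loc r \<phi> S w b * chart_cartan L \<phi> w b) v - loc r \<phi> (lie Ir S (pc_one_form A k S L)) v a" .
  have "loc r \<phi> (ext_d0 (pc_energy A k S L)) v a =
    pd a (\<lambda>w. (\<Sum>b\<in>Ir. loc r \<phi> S w b * chart_cartan L \<phi> w b) - Lc L \<phi> w) v"
  proof -
    have "loc r \<phi> (ext_d0 (pc_energy A k S L)) v a =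
       pd a (\<lambda>w. pc_energy A k S L (ch r \<phi>) (param (ch r \<phi>) w)) v"
      unfolding cpd_param[OF \<phi> in_over[OF v], symmetric] by (simp add: loc_def ext_d0_def)
    also have "\<dots> = pd a (\<lambda>w. (\<Sum>b\<in>Ir. loc r \<phi> S w b * chart_cartan L \<phi> w b) - Lc L \<phi> w) v"
      by (rule pd_cong[OF v a energy_loc])
    finally show ?thesis .
  qed
  also have "\<dots> = pd a (\<lambda>w. \<Sum>b\<in>Ir. loc r \<phi> S w b * chart_cartan L \<phi> w b) v - pd a (Lc L \<phi>) v"
    by (rule pd_diff[OF _ Lc_smooth[OF \<phi>] a v]) (intro smooth_sum smooth_mult X_smooth scf)
  finally show ?thesis using 1 loc_pullback[OF v a] by auto
qed

lemma nondeg_loc_iff: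
  assumes v: "v \<in> chart_dom r \<phi> W"
  shows "nondeg Ir (pc_two_form A k S L (ch r \<phi>) (param (ch r \<phi>) v)) \<longleftrightarrow> nondeg UNIV (hess L \<phi> (trunc k v))"
proof -
  have "nondeg Ir (pc_two_form A k S L (ch r \<phi>) (param (ch r \<phi>) v)) \<longleftrightarrow>
    nondeg Ir (\<lambda>b a. - (pd b (\<lambda>w. chart_cartan L \<phi> w a) v - pd a (\<lambda>w. chart_cartan L \<phi> w b) v))"
    by (rule nondeg_cong) (rule two_form_loc[OF v])
  also have "\<dots> \<longleftrightarrow> nondeg UNIV (\<lambda>i j. pd (k, i) (pd (k, j) (Lc L \<phi>)) v)"
    unfolding nondeg_uminus
    by (rule cartan_form_nondeg_iff[OF r_def k Lc_smooth[OF \<phi>] _ v]) (rule pd_Lc_zero)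
  finally show ?thesis unfolding hess_Lc .
qed

end

lemma eq_on_loc: "eq_on Ir Ar W \<theta> \<eta> \<longleftrightarrow> (\<forall>\<phi>\<in>A. \<forall>v\<in>chart_dom r \<phi> W. \<forall>a\<in>Ir. loc r \<phi> \<theta> v a = loc r \<phi> \<eta> v a)"
  unfolding eq_on_def ball_atlas loc_def by (intro ball_cong refl ball_chart)

lemma lie_equation_iff:
  "eq_on Ir Ar W (lie Ir S (pc_one_form A k S L)) (ext_d0 (pullback A k L)) \<longleftrightarrow>
    (\<forall>\<phi>\<in>A. \<forall>v\<in>chart_dom r \<phi> W. \<forall>i. chart_euler L \<phi> i v = 0)"
  unfolding eq_on_loc by (intro ball_cong refl lie_pc_loc_eq_iff)

lemma hamilton_equation_iff:
  "eq_on Ir Ar W (interior_prod Ir S (pc_two_form A k S L)) (ext_d0 (pc_energy A k S L)) \<longleftrightarrow>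
   eq_on Ir Ar W (lie Ir S (pc_one_form A k S L)) (ext_d0 (pullback A k L))"
  unfolding eq_on_loc by (intro ball_cong refl interior_loc_iff)

text \<open>That \<open>\<omega>\<^sub>L\<close> is a closed 2-form is automatic, as it is the exterior derivative of a 1-form.\<close>

lemma symplectic_iff:
  "symplectic Ir Ar W (pc_two_form A k S L) \<longleftrightarrow> (\<forall>\<phi>\<in>A. \<forall>v\<in>chart_dom r \<phi> W. nondeg UNIV (hess L \<phi> (trunc k v)))"
proof -
  have "two_form Ir Ar W (pc_two_form A k S L)" "closed2 Ir Ar W (pc_two_form A k S L)"
    using two_form_ext_d1[OF W pc_is_one_form] by (simp_all add: pc_two_form_def[abs_def])
  then have "symplectic Ir Ar W (pc_two_form A k S L) \<longleftrightarrow>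
    (\<forall>\<phi>\<in>A. \<forall>p\<in>W \<inter> cdom (ch r \<phi>). nondeg Ir (pc_two_form A k S L (ch r \<phi>) p))"
    unfolding symplectic_def ball_atlas nondeg_def by simp
  also have "\<dots> \<longleftrightarrow> (\<forall>\<phi>\<in>A. \<forall>v\<in>chart_dom r \<phi> W. nondeg UNIV (hess L \<phi> (trunc k v)))"
    by (intro ball_cong refl, subst ball_chart) (auto simp: nondeg_loc_iff)
  finally show ?thesis .
qed

end

lemma card_Ir: "card Ir = 2 * k * CARD('n)"
  using k by (simp add: jet_idx_def card_cartesian_product r_def)

lemma has_rank_iff:
  "has_rank Ir Ar W (ext_d1 \<theta>) (2 * k * CARD('n)) \<longleftrightarrow>
    (\<forall>\<phi>\<in>A. \<forall>p\<in>W \<inter> cdom (ch r \<phi>). nondeg Ir (\<lambda>a b. - ext_d1 \<theta> (ch r \<phi>) p a b))"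
  unfolding has_rank_def ball_atlas card_Ir[symmetric] matrix_rank_full[OF finite_jet_idx] nondeg_uminus ..

text \<open>The coordinate vectors of order \<open>\<delta> \<ge> k\<close> span the image of the \<open>k\<close>-th power of the tangent structure.\<close>

lemma semi_basic_iff:
  "semi_basic A r k W \<theta> \<longleftrightarrow> one_form Ir Ar W \<theta> \<and>
    (\<forall>\<phi>\<in>A. \<forall>v\<in>chart_dom r \<phi> W. \<forall>\<delta> i. k \<le> \<delta> \<longrightarrow> \<delta> \<le> r \<longrightarrow> loc r \<phi> \<theta> v (\<delta>, i) = 0)"
proof -
  have "(\<forall>w. (\<Sum>b\<in>Ir. t b * (tangent_J r ^^ k) w b) = 0) \<longleftrightarrow> (\<forall>\<delta> i. k \<le> \<delta> \<longrightarrow> \<delta> \<le> r \<longrightarrow> t (\<delta>, i) = 0)"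
    (is "?l \<longleftrightarrow> ?r") for t :: "nat \<times> 'n \<Rightarrow> real"
  proof
    assume l: ?l
    show ?r
    proof (intro allI impI)
      fix \<delta> and i :: 'n assume \<delta>: "k \<le> \<delta>" "\<delta> \<le> r"
      have "(\<Sum>b\<in>Ir. t b * (tangent_J r ^^ k) (\<lambda>c. if c = (\<delta> - k, i) then 1 else 0) b) =
         (\<Sum>b\<in>Ir. if b = (\<delta>, i) then t b else 0)"
        using \<delta> by (intro sum.cong refl) (auto simp: tangent_J_funpow jet_idx_def split: if_splits)
      also have "\<dots> = t (\<delta>, i)" using \<delta> by (subst sum.delta[OF finite_jet_idx]) auto
      finally show "t (\<delta>, i) = 0" using l by simp
    qed
  next
    assume ?r
    then show ?l by (auto intro!: sum.neutral simp: tangent_J_funpow jet_idx_def)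
  qed
  then show ?thesis
    unfolding semi_basic_def ball_atlas loc_def by (auto simp: ball_chart)
qed

end

section \<open>Geodesics and the Euler-Lagrange equations\<close>

text \<open>The complement of a coordinate hyperplane is dense.\<close>

lemma (in coord_domain) zero_by_density:
  assumes f: "continuous_on V (f :: _ \<Rightarrow> real)" and b: "b \<in> I"
    and z: "\<And>v. v \<in> V \<Longrightarrow> v b \<noteq> 0 \<Longrightarrow> f v = 0" and v: "v \<in> V"
  shows "f v = 0"
proof (rule ccontr)
  assume ne: "f v \<noteq> 0"
  then have vb: "v b = 0" using z v by auto
  obtain d where d: "d > 0" "cube I v d \<subseteq> V" "\<And>w. w \<in> cube I v d \<Longrightarrow> \<bar>f w - f v\<bar> < \<bar>f v\<bar>"
    using cont_cube[OF f v, of "\<bar>f v\<bar>"] ne by auto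
  define w where "w = v(b := d / 2)"
  have w: "w \<in> cube I v d" using d(1) vb dom_coord[OF v] b by (auto simp: w_def cube_def coord_space_def)
  then have "f w = 0" using z d by (auto simp: w_def)
  then show False using d(3)[OF w] by simp
qed

context mfd begin

lemma param_image_open:
  assumes \<phi>: "\<phi> \<in> A" and V: "coord_domain (jet_idx r) V" and sub: "V \<subseteq> over r (img \<phi>)"
  shows "open_set (jet_idx r) (jet_atlas A r) (param (ch r \<phi>) ` V)"
    and "\<psi> \<in> A \<Longrightarrow> chart_dom r \<psi> (param (ch r \<phi>) ` V) = {w \<in> over r (ovl \<psi> \<phi>). jet_transition r \<psi> \<phi> w \<in> V}"
proof -
  show L: "chart_dom r \<psi> (param (ch r \<phi>) ` V) = {w \<in> over r (ovl \<psi> \<phi>). jet_transition r \<psi> \<phi> w \<in> V}" if \<psi>: "\<psi> \<in> A" for \<psi>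
  proof (intro equalityI subsetI)
    fix w assume w: "w \<in> chart_dom r \<psi> (param (ch r \<phi>) ` V)"
    then obtain v where v: "v \<in> V" "param (ch r \<psi>) w = param (ch r \<phi>) v" and wi: "w \<in> over r (img \<psi>)"
      unfolding chart_dom_iff[OF \<psi>] by blast
    have vi: "v \<in> over r (img \<phi>)" using v sub by auto
    have "w \<in> chart_dom r \<psi> (UNIV \<inter> cdom (ch r \<phi>))"
      unfolding chart_dom_iff[OF \<psi>] using wi v(2) coords_param_jet(2)[OF \<phi> vi] by simp
    then have wo: "w \<in> over r (ovl \<psi> \<phi>)" unfolding chart_dom_overlap[OF \<psi> \<phi>] by simp
    then show "w \<in> {w \<in> over r (ovl \<psi> \<phi>). jet_transition r \<psi> \<phi> w \<in> V}"
      using jet_transition_param(1)[OF \<psi> \<phi> wo] v coords_param_jet(1)[OF \<phi> vi] by simp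
  next
    fix w assume w: "w \<in> {w \<in> over r (ovl \<psi> \<phi>). jet_transition r \<psi> \<phi> w \<in> V}"
    then have wo: "w \<in> over r (ovl \<psi> \<phi>)" and t: "jet_transition r \<psi> \<phi> w \<in> V" by auto
    have "w \<in> over r (img \<psi>)" using wo by (simp add: over_def ovl_iff[OF \<psi>])
    moreover have "param (ch r \<psi>) w \<in> param (ch r \<phi>) ` V"
      using jet_transition_param(3)[OF \<psi> \<phi> wo] t by (intro image_eqI[of _ _ "jet_transition r \<psi> \<phi> w"]) auto
    ultimately show "w \<in> chart_dom r \<psi> (param (ch r \<phi>) ` V)" by (simp add: chart_dom_iff[OF \<psi>])
  qed
  show "open_set (jet_idx r) (jet_atlas A r) (param (ch r \<phi>) ` V)"
    unfolding open_set_iff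
  proof (intro conjI ballI)
    show "param (ch r \<phi>) ` V \<subseteq> TJ A r"
    proof (intro image_subsetI)
      fix v assume "v \<in> V"
      then have "v \<in> over r (img \<phi>)" using sub by auto
      from coords_param_jet(2)[OF \<phi> this] show "param (ch r \<phi>) v \<in> TJ A r" by (simp add: cdom_jet_chart)
    qed
    fix \<psi> assume \<psi>: "\<psi> \<in> A"
    interpret o: coord_domain "jet_idx r" "over r (ovl \<psi> \<phi>)" by (intro coord_domain_over open_ovl \<phi> \<psi>)
    have c: "continuous_on (over r (ovl \<psi> \<phi>)) (jet_transition r \<psi> \<phi>)"
      by (intro continuous_on_coordinatewise_then_product o.smooth_continuous jet_transition_smooth \<phi> \<psi>)
    have "openin (top_of_set (over r (ovl \<psi> \<phi>))) (over r (ovl \<psi> \<phi>) \<inter> jet_transition r \<psi> \<phi> -` V)"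
    proof (rule continuous_openin_preimage[OF c])
      show "jet_transition r \<psi> \<phi> \<in> over r (ovl \<psi> \<phi>) \<rightarrow> coord_space (jet_idx r)"
        by (auto simp: jet_transition_def coord_space_def jet_idx_def)
      show "openin (top_of_set (coord_space (jet_idx r))) V" using V by (simp add: coord_domain_def)
    qed
    then have "openin (top_of_set (coord_space (jet_idx r))) (over r (ovl \<psi> \<phi>) \<inter> jet_transition r \<psi> \<phi> -` V)"
      using o.opn openin_trans by blast
    moreover have "over r (ovl \<psi> \<phi>) \<inter> jet_transition r \<psi> \<phi> -` V = chart_dom r \<psi> (param (ch r \<phi>) ` V)"
      unfolding L[OF \<psi>] by auto
    ultimately show "coord_domain (jet_idx r) (chart_dom r \<psi> (param (ch r \<phi>) ` V))"
      using finite_jet_idx by (simp add: coord_domain_def)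
  qed
qed

lemma chart_dom_param_image:
  assumes \<phi>: "\<phi> \<in> A" and sub: "V \<subseteq> over r (img \<phi>)"
  shows "chart_dom r \<phi> (param (ch r \<phi>) ` V) = V"
proof -
  have c: "coords (ch r \<phi>) (param (ch r \<phi>) v) = v" "param (ch r \<phi>) v \<in> cdom (ch r \<phi>)" if "v \<in> V" for v
    using coords_param_jet[OF \<phi>] sub that by auto
  have "param (ch r \<phi>) ` V \<inter> cdom (ch r \<phi>) = param (ch r \<phi>) ` V" using c(2) by auto
  then show ?thesis unfolding chart_dom_def using c(1) by (simp add: image_image)
qed

lemma one_form_mono:
  assumes \<theta>: "one_form (jet_idx r) (jet_atlas A r) W \<theta>" and sub: "W' \<subseteq> W"
  shows "one_form (jet_idx r) (jet_atlas A r) W' \<theta>"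
  unfolding one_form_iff
proof
  show "local_smooth r W' \<theta>" using \<theta> sub local_smooth_mono by (auto simp: one_form_iff)
  show "covector_law r W' \<theta>"
    unfolding covector_law_def
  proof (intro ballI)
    fix \<phi> \<psi> v and a :: "nat \<times> 'n"
    assume "\<phi> \<in> A" "\<psi> \<in> A" "v \<in> chart_dom r \<phi> (W' \<inter> cdom (ch r \<psi>))" "a \<in> jet_idx r"
    moreover have "chart_dom r \<phi> (W' \<inter> cdom (ch r \<psi>)) \<subseteq> chart_dom r \<phi> (W \<inter> cdom (ch r \<psi>))"
      using sub by (intro chart_dom_mono) auto
    ultimately show "loc r \<phi> \<theta> v a = (\<Sum>b\<in>jet_idx r. loc r \<psi> \<theta> (jet_transition r \<phi> \<psi> v) b * pd a (\<lambda>w. jet_transition r \<phi> \<psi> w b) v)"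
      using \<theta> unfolding one_form_iff covector_law_def by (simp add: subset_iff)
  qed
qed

text \<open>Both forms obey the same transformation law, with the components in the chart that covers the domain
  on the right-hand side.\<close>

lemma one_form_eq_from_chart:
  assumes \<theta>: "one_form (jet_idx r) (jet_atlas A r) W \<theta>" and \<eta>: "one_form (jet_idx r) (jet_atlas A r) W \<eta>"
    and W: "open_set (jet_idx r) (jet_atlas A r) W" and \<phi>: "\<phi> \<in> A" and sub: "W \<subseteq> cdom (ch r \<phi>)"
    and eq: "\<And>v a. v \<in> chart_dom r \<phi> W \<Longrightarrow> a \<in> jet_idx r \<Longrightarrow> loc r \<phi> \<theta> v a = loc r \<phi> \<eta> v a"
    and \<psi>: "\<psi> \<in> A" and w: "w \<in> chart_dom r \<psi> W" and a: "a \<in> jet_idx r"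
  shows "loc r \<psi> \<theta> w a = loc r \<psi> \<eta> w a"
proof -
  have W': "W \<inter> cdom (ch r \<phi>) = W" using sub by auto
  have wo: "w \<in> chart_dom r \<psi> (W \<inter> cdom (ch r \<phi>))" using w W' by simp
  have t: "jet_transition r \<psi> \<phi> w \<in> chart_dom r \<phi> W"
    using coord_change.map[OF coord_change_jet_transition[OF W \<psi> \<phi>] wo] by (simp add: chart_dom_overlap[OF \<phi> \<psi>])
  have "loc r \<psi> \<theta> w a = (\<Sum>b\<in>jet_idx r. loc r \<phi> \<theta> (jet_transition r \<psi> \<phi> w) b * pd a (\<lambda>w. jet_transition r \<psi> \<phi> w b) w)"
    using \<theta> \<phi> \<psi> wo a unfolding one_form_iff covector_law_def by blast
  also have "\<dots> = (\<Sum>b\<in>jet_idx r. loc r \<phi> \<eta> (jet_transition r \<psi> \<phi> w) b * pd a (\<lambda>w. jet_transition r \<psi> \<phi> w b) w)"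
    using eq[OF t] by simp
  also have "\<dots> = loc r \<psi> \<eta> w a"
    using \<eta> \<phi> \<psi> wo a unfolding one_form_iff covector_law_def by simp
  finally show ?thesis .
qed

text \<open>The coordinates of order 1 transform linearly over the base, so their vanishing does not depend on
  the chart. This is what makes membership in the slit bundle checkable in one chart.\<close>

lemma first_order_zero:
  assumes \<phi>: "\<phi> \<in> A" and \<psi>: "\<psi> \<in> A" and v: "v \<in> over r (ovl \<phi> \<psi>)" and r: "1 \<le> r"
    and z: "\<And>i. v (1, i) = 0"
  shows "jet_transition r \<phi> \<psi> v (1, j) = 0"
proof -
  let ?F = "\<lambda>v. coords \<psi> (param \<phi> v) j"
  have "flat r v a * pd a (prolong r ?F 0) v = 0" if "a \<in> jet_idx r" for a
  proof (cases "fst a = 0")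
    case True
    then show ?thesis using z by (simp add: flat_def)
  next
    case False
    then show ?thesis
      using prolong_0[OF open_ovl[OF \<phi> \<psi>] transition_smooth[OF \<phi> \<psi>]] by (cases a) simp
  qed
  then have "deriv_along (jet_idx r) (flat r) (prolong r ?F 0) v = 0" unfolding deriv_along_def by (intro sum.neutral ballI)
  then show ?thesis
    using prolong_Suc[OF open_ovl[OF \<phi> \<psi>] transition_smooth[OF \<phi> \<psi>] v, of 0 j] r by (simp add: jet_transition_def)
qed

end

context mfd_spray begin

text \<open>The solution is restricted to the open set where the chosen coordinate of order 1 does not vanish, so
  that its lift stays in the slit bundle. The geodesic equation in the other charts is the
  transformation law of \<open>S\<close>.\<close>

lemma geodesic_through:
  assumes W: "open_set Ir Ar W" and \<phi>: "\<phi> \<in> A" and v: "v \<in> chart_dom r \<phi> W" and v1: "v (1, i) \<noteq> 0"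
  shows "\<exists>T c. geodesic A r S T c \<and> 0 \<in> T \<and> c 0 \<in> cdom \<phi> \<and> cjet r \<phi> c 0 = v"
proof -
  interpret s: spray_domain r "chart_dom r \<phi> W" "loc r \<phi> S" by (rule spray[OF W \<phi>])
  define V1 where "V1 = chart_dom r \<phi> W \<inter> {w. w (1, i) \<noteq> 0}"
  have "open {w :: nat \<times> 'n \<Rightarrow> real. w (1, i) \<noteq> 0}"
    by (intro open_Collect_neq continuous_on_coord continuous_on_const)
  then have V1: "openin (top_of_set (coord_space Ir)) V1"
    unfolding V1_def using s.opn by (rule openin_Int_open[rotated])
  have X1: "spray_domain r V1 (loc r \<phi> S)"
  proof
    show "openin (top_of_set (coord_space Ir)) V1" by (rule V1)
    fix b :: "nat \<times> 'n" assume "b \<in> Ir"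
    then show "smooth_on Ir V1 (\<lambda>v. loc r \<phi> S v b)"
      by (rule smooth_on_subset[OF s.X_smooth]) (auto simp: V1_def)
  qed (auto simp: V1_def s.X_spray finite_jet_idx)
  have sub: "V1 \<subseteq> over r (img \<phi>)" using chart_dom_over[OF \<phi>, of r W] by (auto simp: V1_def)
  have "v \<in> V1" using v v1 by (simp add: V1_def)
  from spray_curve[OF \<phi> X1 sub this] obtain h u c where h: "h > 0" and c: "smooth_curve A {-h<..<h} c"
    and u0: "u 0 = v" and cu: "\<And>t. t \<in> {-h<..<h} \<Longrightarrow> c t \<in> cdom \<phi> \<and> u t \<in> V1 \<and> cjet r \<phi> c t = u t"
    and u': "\<And>t a. t \<in> {-h<..<h} \<Longrightarrow> a \<in> Ir \<Longrightarrow> ((\<lambda>s. u s a) has_real_derivative loc r \<phi> S (u t) a) (at t)"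
    by blast
  let ?T = "{-h<..<h}"
  have uco: "u t \<in> coord_space Ir" if "t \<in> ?T" for t
    using cu[OF that] sub unfolding over_def by blast
  have r1: "1 \<le> r" using k r_def by simp
  have tr: "cjet r \<psi> c t = jet_transition r \<phi> \<psi> (u t)" "u t \<in> over r (ovl \<phi> \<psi>)"
    if t: "t \<in> ?T" and \<psi>: "\<psi> \<in> A" "c t \<in> cdom \<psi>" for t \<psi>
  proof -
    show "cjet r \<psi> c t = jet_transition r \<phi> \<psi> (u t)"
      using smooth_curve_jet_transition[OF c \<phi> \<psi>(1) t _ \<psi>(2)] cu[OF t] by simp
    show "u t \<in> over r (ovl \<phi> \<psi>)"
      using cu[OF t] coords_ovl[OF \<phi>, of "c t" \<psi>] \<psi>(2) curve_jet_coord[of r "\<lambda>s. coords \<phi> (c s)" t]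
        base_curve_jet[of r "\<lambda>s. coords \<phi> (c s)" t] by (simp add: over_def)
  qed
  have "geodesic A r S ?T c"
    unfolding geodesic_def
  proof (intro conjI ballI impI c)
    fix t assume t: "t \<in> ?T"
    show "jet_lift A r c t \<in> slit A r"
      unfolding slit_def
    proof (intro CollectI conjI ballI impI)
      show "jet_lift A r c t \<in> TJ A r" by (rule lift_in_TJ[OF c t])
      fix \<kappa> assume "\<kappa> \<in> Ar" and "jet_lift A r c t \<in> cdom \<kappa>"
      then obtain \<psi> where \<psi>: "\<psi> \<in> A" "\<kappa> = ch r \<psi>" "c t \<in> cdom \<psi>"
        using lift_cdom[OF c t] by (auto simp: jet_atlas_def)
      show "\<exists>i. coords \<kappa> (jet_lift A r c t) (1, i) \<noteq> 0"
      proof (rule ccontr)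
        assume z: "\<not> ?thesis"
        have wo: "cjet r \<psi> c t \<in> over r (ovl \<psi> \<phi>)"
          using coords_ovl[OF \<psi>(1), of "c t" \<phi>] \<psi>(3) cu[OF t] curve_jet_coord by (auto simp: over_def)
        have "cjet r \<phi> c t = jet_transition r \<psi> \<phi> (cjet r \<psi> c t)"
          using smooth_curve_jet_transition[OF c \<psi>(1) \<phi> t \<psi>(3)] cu[OF t] by blast
        then have "u t (1, i) = 0"
          using first_order_zero[OF \<psi>(1) \<phi> wo r1] z lift_coords[OF c t \<psi>(1,3), of r] cu[OF t] \<psi>(2) by simp
        then show False using cu[OF t] by (simp add: V1_def)
      qed
    qed
    fix \<kappa> a assume "\<kappa> \<in> Ar" and "jet_lift A r c t \<in> cdom \<kappa>" and a: "a \<in> Ir"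
    then obtain \<psi> where \<psi>: "\<psi> \<in> A" "\<kappa> = ch r \<psi>" "c t \<in> cdom \<psi>"
      using lift_cdom[OF c t] by (auto simp: jet_atlas_def)
    interpret o: coord_domain Ir "over r (ovl \<phi> \<psi>)" by (intro coord_domain_over open_ovl \<phi> \<psi>(1))
    note ut = tr(2)[OF t \<psi>(1,3)]
    have To: "open (?T \<inter> c -` cdom \<psi>)" by (rule curve_preimage_open[OF c \<psi>(1)])
    have "eventually (\<lambda>s. coords \<kappa> (jet_lift A r c s) a = jet_transition r \<phi> \<psi> (u s) a) (nhds t)"
      using eventually_nhds_in_open[OF To, of t] t \<psi>(3)
      by (auto elim!: eventually_mono simp: \<psi>(2) lift_coords[OF c] \<psi>(1) tr)
    then have "deriv (\<lambda>s. coords \<kappa> (jet_lift A r c s) a) t = deriv (\<lambda>s. jet_transition r \<phi> \<psi> (u s) a) t"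
      by (rule deriv_cong_ev) simp
    also have "\<dots> = (\<Sum>b\<in>Ir. pd b (\<lambda>w. jet_transition r \<phi> \<psi> w a) (u t) * loc r \<phi> S (u t) b)"
    proof (intro DERIV_imp_deriv o.chain_curve[of _ u t, OF o.smooth_C1[OF jet_transition_smooth[OF \<phi> \<psi>(1)]] ut])
      show "eventually (\<lambda>s. u s \<in> coord_space Ir) (at t)"
        unfolding eventually_at_topological using t uco by (intro exI[of _ ?T]) auto
    qed (use u' t in auto)
    also have "\<dots> = loc r \<psi> S (jet_transition r \<phi> \<psi> (u t)) a"
    proof -
      have "param (ch r \<phi>) (u t) \<in> TJ A r"
        using coords_param_jet(2)[OF \<phi>, of "u t" r] cu[OF t] sub by (auto simp: cdom_jet_chart)
      then have "u t \<in> chart_dom r \<phi> (TJ A r \<inter> cdom (ch r \<psi>))"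
        unfolding chart_dom_overlap[OF \<phi> \<psi>(1)] using ut cu[OF t] sub by (auto simp: chart_dom_iff[OF \<phi>])
      then have "loc r \<psi> S (jet_transition r \<phi> \<psi> (u t)) a = (\<Sum>b\<in>Ir. loc r \<phi> S (u t) b * pd b (\<lambda>w. jet_transition r \<phi> \<psi> w a) (u t))"
        using S_law(2) \<phi> \<psi>(1) a unfolding vector_law_def by blast
      then show ?thesis by (simp add: mult.commute)
    qed
    also have "\<dots> = S \<kappa> (jet_lift A r c t) a"
    proof -
      have "jet_lift A r c t = param (ch r \<psi>) (jet_transition r \<phi> \<psi> (u t))"
        using param_coords_jet[OF \<psi>(1), of "jet_lift A r c t" r] lift_coords[OF c t \<psi>(1,3), of r]
          lift_cdom[OF c t, of r \<psi>] \<psi>(3) tr(1)[OF t \<psi>(1,3)] by simp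
      then show ?thesis by (simp add: loc_def \<psi>(2))
    qed
    finally show "S \<kappa> (jet_lift A r c t) a = deriv (\<lambda>s. coords \<kappa> (jet_lift A r c s) a) t" ..
  qed simp
  then show ?thesis using h cu[of 0] u0 by (intro exI[of _ ?T] exI[of _ c]) auto
qed

context
  fixes W :: "'m jet set" and U :: "'m jet set" and L :: "'m jet \<Rightarrow> real"
  assumes W: "open_set Ir Ar W" and sub: "W \<subseteq> jets_over A r k U"
    and U: "open_set Ik Ak U" and L: "smooth_function Ik Ak U L"
begin

text \<open>Near \<open>t\<close> the lift of \<open>c\<close> is an integral curve of \<open>S\<close> in the coordinate domain, and along it the total time
  derivative is \<open>D\<close>.\<close>

lemma euler_lagrange_along_geodesic:
  assumes g: "geodesic A r S T c" and t: "t \<in> T" and tW: "jet_lift A r c t \<in> W"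
    and \<phi>: "\<phi> \<in> A" and ct: "c t \<in> cdom \<phi>"
  shows "(\<Sum>\<alpha>=0..k. (-1) ^ \<alpha> / fact \<alpha> * (deriv ^^ \<alpha>) (\<lambda>s. cpd (ch k \<phi>) (\<alpha>, i) L (jet_lift A k c s)) t)
    = chart_euler L \<phi> i (cjet r \<phi> c t)"
proof -
  interpret s: spray_domain r "chart_dom r \<phi> W" "loc r \<phi> S" by (rule spray[OF W \<phi>])
  interpret o: coord_domain Ir "over r (img \<phi>)" by (intro coord_domain_over open_img \<phi>)
  have c: "smooth_curve A T c" using g by (simp add: geodesic_def)
  define u where "u = cjet r \<phi> c"
  define T1 where "T1 = T \<inter> c -` cdom \<phi>"
  have T1: "open T1" unfolding T1_def by (rule curve_preimage_open[OF c \<phi>])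
  have uc: "coords (ch r \<phi>) (jet_lift A r c s) = u s" "jet_lift A r c s \<in> cdom (ch r \<phi>)"
     "jet_lift A r c s = param (ch r \<phi>) (u s)" "u s \<in> over r (img \<phi>)" if "s \<in> T1" for s
  proof -
    have s: "s \<in> T" "c s \<in> cdom \<phi>" using that by (auto simp: T1_def)
    show 1: "coords (ch r \<phi>) (jet_lift A r c s) = u s" unfolding u_def by (rule lift_coords[OF c s(1) \<phi> s(2)])
    show 2: "jet_lift A r c s \<in> cdom (ch r \<phi>)" using lift_cdom[OF c s(1)] s(2) by simp
    show "jet_lift A r c s = param (ch r \<phi>) (u s)" using param_coords_jet[OF \<phi> 2] 1 by simp
    show "u s \<in> over r (img \<phi>)" using coords_jet_in[OF 2] 1 by simp
  qed
  have ud: "((\<lambda>s. u s a) has_real_derivative loc r \<phi> S (u s) a) (at s)" if s: "s \<in> T1" and a: "a \<in> Ir" for s a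
  proof -
    have "S (ch r \<phi>) (jet_lift A r c s) a = deriv (\<lambda>s. coords (ch r \<phi>) (jet_lift A r c s) a) s"
      using g s a uc(2)[OF s] \<phi> unfolding geodesic_def T1_def by (auto simp: jet_atlas_def)
    also have "\<dots> = deriv (\<lambda>s. u s a) s"
      using eventually_nhds_in_open[OF T1 s]
      by (intro deriv_cong_ev) (auto elim!: eventually_mono simp only: uc(1))
    finally have e: "loc r \<phi> S (u s) a = deriv (\<lambda>s. u s a) s" using uc(3)[OF s] by (simp add: loc_def)
    obtain \<delta> j where aj: "a = (\<delta>, j)" "\<delta> \<le> r" using a by (cases a) auto
    have "((\<lambda>s. u s (\<delta>, j)) has_real_derivative (deriv ^^ Suc \<delta>) (\<lambda>s. coords \<phi> (c s) j) s / fact \<delta>) (at s)"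
      unfolding u_def using s aj(2)
      by (intro curve_jet_deriv smooth_curve_differentiable[OF c \<phi>]) (auto simp: T1_def)
    then show ?thesis using e DERIV_imp_deriv aj(1) by metis
  qed
  define T' where "T' = T1 \<inter> u -` chart_dom r \<phi> W"
  have "continuous_on T1 u"
  proof (rule continuous_on_coordinatewise_then_product)
    fix a show "continuous_on T1 (\<lambda>s. u s a)"
    proof (cases "a \<in> Ir")
      case True
      show ?thesis
        by (rule continuous_at_imp_continuous_on) (use ud[OF _ True] DERIV_isCont in blast)
    next
      case False
      then have "u s a = 0" for s
        using curve_jet_coord[of r "\<lambda>s. coords \<phi> (c s)" s] unfolding u_def coord_space_def by blast
      then have "(\<lambda>s. u s a) = (\<lambda>s. 0)" by blast
      then show ?thesis by (metis continuous_on_const)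
    qed
  qed
  then have "openin (top_of_set T1) T'" unfolding T'_def
    by (rule continuous_openin_preimage[OF _ _ s.opn]) (use uc(4) in \<open>auto simp: over_def\<close>)
  then have T'o: "open T'" using T1 openin_open_eq by blast
  have tT': "t \<in> T'"
  proof -
    have "t \<in> T1" using t ct by (simp add: T1_def)
    moreover from this have "u t \<in> chart_dom r \<phi> W" using uc tW by (simp add: chart_dom_iff[OF \<phi>])
    ultimately show ?thesis by (simp add: T'_def)
  qed
  have eq: "cpd (ch k \<phi>) (\<alpha>, i) L (jet_lift A k c s) = s.grad k (Lc L \<phi>) (u s) (\<alpha>, i)"
    if s: "s \<in> T'" and \<alpha>: "\<alpha> \<le> k" for s \<alpha>
  proof -
    have s1: "s \<in> T1" "s \<in> T" using s by (auto simp: T'_def T1_def)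
    have "jet_lift A k c s = param (ch k \<phi>) (trunc k (u s))"
      using proj_lift[OF c s1(2) k_le_r] proj_param[OF \<phi> uc(4)[OF s1(1)] k_le_r] uc(3)[OF s1(1)] by simp
    then have "cpd (ch k \<phi>) (\<alpha>, i) L (jet_lift A k c s) = pd (\<alpha>, i) (\<lambda>w. L (param (ch k \<phi>) w)) (trunc k (u s))"
      using cpd_param[OF \<phi> trunc_over[OF uc(4)[OF s1(1)]]] by simp
    also have "\<dots> = pd (\<alpha>, i) (Lc L \<phi>) (u s)"
      using fun_cong[OF pd_trunc[of "(\<alpha>, i)" "\<lambda>w. L (param (ch k \<phi>) w)"], of "u s"] \<alpha>
      by (simp add: Lc_def[abs_def])
    finally show ?thesis using \<alpha> by (simp add: s.grad_def)
  qed
  have sg: "s.sm (\<lambda>w. s.grad k (Lc L \<phi>) w a)" for a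
    using s.smooth_form_grad[OF Lc_smooth[OF W sub U L \<phi>] k_le_r] unfolding s.smooth_form_def by blast
  have "(deriv ^^ \<alpha>) (\<lambda>s. cpd (ch k \<phi>) (\<alpha>, i) L (jet_lift A k c s)) t =
    (s.D ^^ \<alpha>) (\<lambda>w. s.grad k (Lc L \<phi>) w (\<alpha>, i)) (u t)" if \<alpha>: "\<alpha> \<le> k" for \<alpha>
  proof -
    have "(deriv ^^ \<alpha>) (\<lambda>s. cpd (ch k \<phi>) (\<alpha>, i) L (jet_lift A k c s)) t =
      (deriv ^^ \<alpha>) (\<lambda>s. s.grad k (Lc L \<phi>) (u s) (\<alpha>, i)) t"
      using eventually_nhds_in_open[OF T'o tT'] eq \<alpha>
      by (intro higher_deriv_cong_ev) (auto elim!: eventually_mono)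
    also have "\<dots> = (s.D ^^ \<alpha>) (\<lambda>w. s.grad k (Lc L \<phi>) w (\<alpha>, i)) (u t)"
      by (rule s.integral_curve_funpow_deriv[OF T'o _ _ sg tT']) (use ud in \<open>auto simp: T'_def\<close>)
    finally show ?thesis .
  qed
  then show ?thesis unfolding s.euler_expr_def u_def by simp
qed

text \<open>Geodesics through jets with \<open>y(1) \<noteq> 0\<close> show that the Euler-Lagrange expressions vanish there, and
  by continuity they vanish on all of \<open>W\<close>. It is enough that one fixed coordinate of order 1 does not vanish.\<close>

lemma geodesics_solve_EL_iff:
  "geodesics_solve_EL A k S W L \<longleftrightarrow> (\<forall>\<phi>\<in>A. \<forall>v\<in>chart_dom r \<phi> W. \<forall>i. chart_euler L \<phi> i v = 0)"
proof
  assume E: "\<forall>\<phi>\<in>A. \<forall>v\<in>chart_dom r \<phi> W. \<forall>i. chart_euler L \<phi> i v = 0"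
  show "geodesics_solve_EL A k S W L"
    unfolding geodesics_solve_EL_def r_def[symmetric]
  proof (intro allI impI ballI)
    fix T c t assume g: "geodesic A r S T c" and t: "t \<in> T" and tW: "jet_lift A r c t \<in> W"
    have c: "smooth_curve A T c" using g by (simp add: geodesic_def)
    show "euler_lagrange_at A k L c t"
      unfolding euler_lagrange_at_def ball_atlas
    proof (intro ballI impI allI)
      fix \<phi> i assume \<phi>: "\<phi> \<in> A" and "jet_lift A k c t \<in> cdom (ch k \<phi>)"
      then have ct: "c t \<in> cdom \<phi>" using lift_cdom[OF c t] by simp
      have "cjet r \<phi> c t \<in> chart_dom r \<phi> W"
        using coords_in_chart_dom[OF tW, of r \<phi>] lift_cdom[OF c t, of r \<phi>] lift_coords[OF c t \<phi> ct, of r] ct by simp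
      then show "(\<Sum>\<alpha>=0..k. (-1) ^ \<alpha> / fact \<alpha> * (deriv ^^ \<alpha>) (\<lambda>s. cpd (ch k \<phi>) (\<alpha>, i) L (jet_lift A k c s)) t) = 0"
        unfolding euler_lagrange_along_geodesic[OF g t tW \<phi> ct] using E \<phi> by blast
    qed
  qed
next
  assume G: "geodesics_solve_EL A k S W L"
  show "\<forall>\<phi>\<in>A. \<forall>v\<in>chart_dom r \<phi> W. \<forall>i. chart_euler L \<phi> i v = 0"
  proof (intro ballI allI)
    fix \<phi> v i assume \<phi>: "\<phi> \<in> A" and v: "v \<in> chart_dom r \<phi> W"
    interpret s: spray_domain r "chart_dom r \<phi> W" "loc r \<phi> S" by (rule spray[OF W \<phi>])
    have r1: "1 \<le> r" using k r_def by simp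
    show "chart_euler L \<phi> i v = 0"
    proof (rule s.zero_by_density[OF s.smooth_continuous[OF s.euler_expr_smooth[OF s.smooth_form_grad[OF Lc_smooth[OF W sub U L \<phi>] k_le_r]]] _ _ v])
      \<comment> \<open>Any coordinate of order 1 will do.\<close>
      show "(1, undefined) \<in> Ir" using r1 by simp
      fix v assume v: "v \<in> chart_dom r \<phi> W" and ne: "v (1, undefined) \<noteq> 0"
      obtain T c where g: "geodesic A r S T c" and t: "0 \<in> T" and c0: "c 0 \<in> cdom \<phi>" and cv: "cjet r \<phi> c 0 = v"
        using geodesic_through[OF W \<phi> v ne] by blast
      have c: "smooth_curve A T c" using g by (simp add: geodesic_def)
      have l: "jet_lift A r c 0 \<in> cdom (ch r \<phi>)" using lift_cdom[OF c t] c0 by simp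
      have "jet_lift A r c 0 = param (ch r \<phi>) v"
        using param_coords_jet[OF \<phi> l] lift_coords[OF c t \<phi> c0, of r] cv by simp
      then have lW: "jet_lift A r c 0 \<in> W" using v by (simp add: chart_dom_iff[OF \<phi>])
      have "euler_lagrange_at A k L c 0"
        using G g t lW unfolding geodesics_solve_EL_def r_def[symmetric] by blast
      moreover have "jet_lift A k c 0 \<in> cdom (ch k \<phi>)" using lift_cdom[OF c t] c0 by simp
      ultimately have "(\<Sum>\<alpha>=0..k. (-1) ^ \<alpha> / fact \<alpha> * (deriv ^^ \<alpha>) (\<lambda>s. cpd (ch k \<phi>) (\<alpha>, i) L (jet_lift A k c s)) 0) = 0"
        using \<phi> unfolding euler_lagrange_at_def ball_atlas by blast
      then show "chart_euler L \<phi> i v = 0"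
        unfolding euler_lagrange_along_geodesic[OF g t lW \<phi> c0] cv .
    qed
  qed
qed

end

section \<open>From semi-basic forms to Lagrangians\<close>

lemma ext_d1_loc:
  assumes W: "open_set Ir Ar W" and \<phi>: "\<phi> \<in> A" and v: "v \<in> chart_dom r \<phi> W" and a: "a \<in> Ir" and b: "b \<in> Ir"
    and eq: "\<And>w c. w \<in> chart_dom r \<phi> W \<Longrightarrow> c \<in> Ir \<Longrightarrow> loc r \<phi> \<theta> w c = t w c"
  shows "ext_d1 \<theta> (ch r \<phi>) (param (ch r \<phi>) v) a b = pd a (\<lambda>w. t w b) v - pd b (\<lambda>w. t w a) v"
proof -
  interpret coord_domain Ir "chart_dom r \<phi> W" by (rule coord_domain_chart_dom[OF W \<phi>])
  have vo: "v \<in> over r (img \<phi>)" using v chart_dom_over[OF \<phi>] by auto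
  have "pd a (\<lambda>w. \<theta> (ch r \<phi>) (param (ch r \<phi>) w) b) v = pd a (\<lambda>w. t w b) v" if "a \<in> Ir" "b \<in> Ir" for a b
    by (rule pd_cong[OF v that(1)]) (use eq that(2) in \<open>simp add: loc_def\<close>)
  then show ?thesis using a b unfolding ext_d1_def cpd_param[OF \<phi> vo] by simp
qed

lemma symplectic_nondeg:
  "symplectic Ir Ar W \<omega> \<Longrightarrow> \<phi> \<in> A \<Longrightarrow> p \<in> W \<Longrightarrow> p \<in> cdom (ch r \<phi>) \<Longrightarrow> nondeg Ir (\<omega> (ch r \<phi>) p)"
  unfolding symplectic_def ball_atlas nondeg_def by blast

text \<open>The form \<open>\<L>\<^sub>S \<theta>\<^sub>L\<close> is closed because it equals \<open>dL\<close>, and nondegeneracy of \<open>\<omega>\<^sub>L\<close> is full rank of \<open>d\<theta>\<^sub>L\<close>.\<close>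

lemma form_of_lagrangian:
  assumes L: "regular_lagrangian A k S U L"
    and eq: "eq_on Ir Ar (jets_over A r k U) (lie Ir S (pc_one_form A k S L)) (ext_d0 (pullback A k L))"
  shows "lagrangian_form A k S (jets_over A r k U) (pc_one_form A k S L)"
proof -
  let ?W = "jets_over A r k U" and ?\<theta> = "pc_one_form A k S L"
  have U: "open_set Ik Ak U" and Ls: "smooth_function Ik Ak U L"
    and sy: "symplectic Ir Ar ?W (pc_two_form A k S L)"
    using L by (auto simp: regular_lagrangian_def r_def)
  have W: "open_set Ir Ar ?W" by (rule open_jets_over[OF U])
  note c = W order_refl U Ls
  show ?thesis
    unfolding lagrangian_form_def r_def[symmetric]
  proof (intro conjI)
    show "semi_basic A r k ?W ?\<theta>"
      unfolding semi_basic_iff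
    proof (intro conjI ballI allI impI)
      show "one_form Ir Ar ?W ?\<theta>" by (rule pc_is_one_form[OF c])
      fix \<phi> v \<delta> i assume \<phi>: "\<phi> \<in> A" and v: "v \<in> chart_dom r \<phi> ?W" and \<delta>: "k \<le> \<delta>" "\<delta> \<le> r"
      interpret s: spray_domain r "chart_dom r \<phi> ?W" "loc r \<phi> S" by (rule spray[OF W \<phi>])
      show "loc r \<phi> ?\<theta> v (\<delta>, i) = 0"
        using pc_loc[OF c \<phi> v, of "(\<delta>, i)"] s.cartan_high_zero[OF s.order_le_grad v \<delta>(1)] \<delta>(2) by simp
    qed
    show "has_rank Ir Ar ?W (ext_d1 ?\<theta>) (2 * k * CARD('n))"
      unfolding has_rank_iff
    proof (intro ballI)
      fix \<phi> p assume "\<phi> \<in> A" "p \<in> ?W \<inter> cdom (ch r \<phi>)"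
      then show "nondeg Ir (\<lambda>a b. - ext_d1 ?\<theta> (ch r \<phi>) p a b)"
        using symplectic_nondeg[OF sy] by (simp add: pc_two_form_def[abs_def])
    qed
    show "closed1 Ir Ar ?W (lie Ir S ?\<theta>)"
      unfolding closed1_def ball_atlas
    proof (intro ballI)
      fix \<phi> p and a b :: "nat \<times> 'n"
      assume \<phi>: "\<phi> \<in> A" and p: "p \<in> ?W \<inter> cdom (ch r \<phi>)" and a: "a \<in> Ir" and b: "b \<in> Ir"
      interpret coord_domain Ir "chart_dom r \<phi> ?W" by (rule coord_domain_chart_dom[OF W \<phi>])
      define v where "v = coords (ch r \<phi>) p"
      have v: "v \<in> chart_dom r \<phi> ?W" "p = param (ch r \<phi>) v"
        using p coords_in_chart_dom[of p ?W r \<phi>] param_coords_jet[OF \<phi>] by (auto simp: v_def)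
      have "ext_d1 (lie Ir S ?\<theta>) (ch r \<phi>) p a b = pd a (pd b (Lc L \<phi>)) v - pd b (pd a (Lc L \<phi>)) v"
        unfolding v(2)
      proof (rule ext_d1_loc[OF W \<phi> v(1) a b])
        fix w and c :: "nat \<times> 'n" assume w: "w \<in> chart_dom r \<phi> ?W" and c: "c \<in> Ir"
        show "loc r \<phi> (lie Ir S ?\<theta>) w c = pd c (Lc L \<phi>) w"
          using eq \<phi> w c loc_pullback[OF \<open>open_set Ir Ar ?W\<close> order_refl U Ls \<phi> w c]
          unfolding eq_on_loc[OF W order_refl U Ls] by simp
      qed
      then show "ext_d1 (lie Ir S ?\<theta>) (ch r \<phi>) p a b = 0"
        using pd_commute[OF Lc_smooth[OF c \<phi>] a b v(1)] by simp
    qed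
  qed
qed

text \<open>The components of \<open>\<theta>\<close> are replaced by zero outside the index set, where they have no meaning, since \<open>spray_lie\<close>
  and \<open>order_le\<close> refer to all orders. The Lie derivative of a semi-basic form of order \<open>k\<close> has no
  components of order greater than \<open>k\<close>.\<close>

lemma semi_basic_lie_loc:
  assumes W: "open_set Ir Ar W" and sb: "semi_basic A r k W \<theta>" and \<phi>: "\<phi> \<in> A"
  defines "t \<equiv> \<lambda>v a. if a \<in> Ir then loc r \<phi> \<theta> v a else 0"
  assumes v: "v \<in> chart_dom r \<phi> W" and a: "a \<in> Ir"
  shows "loc r \<phi> (lie Ir S \<theta>) v a = spray_domain.spray_lie r (loc r \<phi> S) t v a"
    and "k < fst a \<Longrightarrow> loc r \<phi> (lie Ir S \<theta>) v a = 0"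
    and "k \<le> \<delta> \<Longrightarrow> t v (\<delta>, i) = 0"
proof -
  interpret s: spray_domain r "chart_dom r \<phi> W" "loc r \<phi> S" by (rule spray[OF W \<phi>])
  have z: "t v (\<delta>, i) = 0" if "v \<in> chart_dom r \<phi> W" "k \<le> \<delta>" for v \<delta> i
    using sb \<phi> that unfolding semi_basic_iff by (cases "\<delta> \<le> r") (auto simp: t_def)
  show "k \<le> \<delta> \<Longrightarrow> t v (\<delta>, i) = 0" using z v by blast
  have o: "s.order_le (k - 1) t" unfolding s.order_le_def using z by auto
  have "loc r \<phi> (lie Ir S \<theta>) v a = coord_lie Ir (loc r \<phi> S) (loc r \<phi> \<theta>) v a"
    using loc_lie[OF \<phi>] chart_dom_over[OF \<phi>] v by blast
  also have "\<dots> = coord_lie Ir (loc r \<phi> S) t v a"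
    by (rule s.coord_lie_cong[OF v a]) (simp add: t_def)
  also have "\<dots> = s.spray_lie t v a" by (rule s.coord_lie_eq[OF o k_less_r v a])
  finally show 1: "loc r \<phi> (lie Ir S \<theta>) v a = s.spray_lie t v a" .
  assume ka: "k < fst a"
  have "s.order_le k (s.spray_lie t)" using s.order_le_spray_lie[OF o] k by simp
  then show "loc r \<phi> (lie Ir S \<theta>) v a = 0"
    using 1 v ka unfolding s.order_le_def by (metis prod.collapse)
qed

text \<open>In every chart \<open>\<theta>\<close> solves the equations that characterize the Poincare-Cartan form of \<open>L\<close>. The components
  of order 0 of \<open>\<L>\<^sub>S \<theta> = dL\<close> are then the Euler-Lagrange equations. For regularity, a jet over \<open>U\<close> is compared
  with one in \<open>W\<close> that has the same projection: the Hessian of \<open>L\<close> is the same at both.\<close>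

lemma lagrangian_of_form:
  assumes W: "open_set Ir Ar W" and \<theta>: "semi_basic A r k W \<theta>"
    and rank: "has_rank Ir Ar W (ext_d1 \<theta>) (2 * k * CARD('n))"
    and U: "open_set Ik Ak U" "U \<noteq> {}" and L: "smooth_function Ik Ak U L"
    and sub: "W \<subseteq> jets_over A r k U" and onto: "\<And>q. q \<in> U \<Longrightarrow> \<exists>p\<in>W. jet_proj A k p = q"
    and dL: "eq_on Ir Ar W (lie Ir S \<theta>) (ext_d0 (pullback A k L))"
  shows "eq_on Ir Ar W \<theta> (pc_one_form A k S L)" and "geodesics_solve_EL A k S W L"
    and "regular_lagrangian A k S U L"
proof -
  note c = W sub U(1) L
  have dL': "loc r \<phi> (lie Ir S \<theta>) v a = pd a (Lc L \<phi>) v" if "\<phi> \<in> A" "v \<in> chart_dom r \<phi> W" "a \<in> Ir" for \<phi> v a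
    using dL that loc_pullback[OF c that] unfolding eq_on_loc[OF c] by simp
  have eq: "loc r \<phi> \<theta> v a = chart_cartan L \<phi> v a" if \<phi>: "\<phi> \<in> A" and v: "v \<in> chart_dom r \<phi> W" and a: "a \<in> Ir" for \<phi> v a
  proof -
    interpret s: spray_domain r "chart_dom r \<phi> W" "loc r \<phi> S" by (rule spray[OF W \<phi>])
    define t where "t = (\<lambda>v a. if a \<in> Ir then loc r \<phi> \<theta> v a else 0)"
    note sl = semi_basic_lie_loc[OF W \<theta> \<phi>, folded t_def]
    have "t v (fst a, snd a) = s.cartan_form k (s.grad k (Lc L \<phi>)) v (fst a, snd a)"
    proof (rule s.cartan_form_unique[OF s.smooth_form_grad[OF Lc_smooth[OF c \<phi>] k_le_r] s.order_le_grad _ _ v])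
      fix v \<delta> i assume v: "v \<in> chart_dom r \<phi> W" and "k \<le> \<delta>"
      then show "t v (\<delta>, i) = 0" using sl(3)[OF v, of "(0, i)" \<delta> i] by (simp add: t_def)
    next
      fix v \<delta> i assume v: "v \<in> chart_dom r \<phi> W" and \<delta>: "0 < \<delta>" "\<delta> \<le> k"
      then show "s.spray_lie t v (\<delta>, i) = s.grad k (Lc L \<phi>) v (\<delta>, i)"
        using sl(1)[OF v, of "(\<delta>, i)"] dL'[OF \<phi> v, of "(\<delta>, i)"] k_le_r by (simp add: s.grad_def)
    qed
    then show ?thesis using a by (simp add: t_def)
  qed
  show eq_on: "eq_on Ir Ar W \<theta> (pc_one_form A k S L)"
    unfolding eq_on_loc[OF c] using eq pc_loc[OF c] by simp
  have "eq_on Ir Ar W (lie Ir S (pc_one_form A k S L)) (ext_d0 (pullback A k L))"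
    unfolding eq_on_loc[OF c]
  proof (intro ballI)
    fix \<phi> v and a :: "nat \<times> 'n" assume \<phi>: "\<phi> \<in> A" and v: "v \<in> chart_dom r \<phi> W" and a: "a \<in> Ir"
    interpret coord_domain Ir "chart_dom r \<phi> W" by (rule coord_domain_chart_dom[OF W \<phi>])
    have vo: "v \<in> over r (img \<phi>)" using v chart_dom_over[OF \<phi>] by auto
    have "loc r \<phi> (lie Ir S (pc_one_form A k S L)) v a = loc r \<phi> (lie Ir S \<theta>) v a"
      unfolding loc_lie[OF \<phi> vo] by (rule coord_lie_cong[OF v a]) (simp add: pc_loc[OF c \<phi>] eq[OF \<phi>])
    then show "loc r \<phi> (lie Ir S (pc_one_form A k S L)) v a = loc r \<phi> (ext_d0 (pullback A k L)) v a"
      using dL \<phi> v a unfolding eq_on_loc[OF c] by simp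
  qed
  then show "geodesics_solve_EL A k S W L"
    unfolding geodesics_solve_EL_iff[OF c] lie_equation_iff[OF c] .
  have WU: "open_set Ir Ar (jets_over A r k U)" by (rule open_jets_over[OF U(1)])
  have "symplectic Ir Ar (jets_over A r k U) (pc_two_form A k S L)"
    unfolding symplectic_iff[OF WU order_refl U(1) L]
  proof (intro ballI)
    fix \<psi> v assume \<psi>: "\<psi> \<in> A" and v: "v \<in> chart_dom r \<psi> (jets_over A r k U)"
    \<comment> \<open>Move the point within its fibre over the jets of order \<open>k\<close> into \<open>W\<close>.\<close>
    have vo: "v \<in> over r (img \<psi>)" using v chart_dom_over[OF \<psi>] by auto
    have q: "param (ch k \<psi>) (trunc k v) \<in> U"
      using v chart_dom_iff[OF \<psi>] unfolding chart_dom_jets_over[OF \<psi>] by auto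
    note tv = coords_param_jet[OF \<psi> trunc_over[OF vo, of k]]
    obtain p where p: "p \<in> W" "jet_proj A k p = param (ch k \<psi>) (trunc k v)" using onto[OF q] by blast
    have pT: "p \<in> TJ A r" using p(1) W by (auto simp: open_set_iff)
    have pc: "p \<in> cdom (ch r \<psi>)" using proj_cdom[OF pT, of k \<psi>] p(2) tv(2) by simp
    define v' where "v' = coords (ch r \<psi>) p"
    have v': "v' \<in> chart_dom r \<psi> W" unfolding v'_def by (rule coords_in_chart_dom[OF p(1) pc])
    have pv': "param (ch r \<psi>) v' = p" unfolding v'_def by (rule param_coords_jet[OF \<psi> pc])
    have tr: "trunc k v' = trunc k v"
      using proj_coords[OF \<psi> pc k_le_r] p(2) tv(1) by (simp add: v'_def)
    have "nondeg Ir (\<lambda>a b. - ext_d1 \<theta> (ch r \<psi>) p a b)"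
      using rank p(1) pc \<psi> unfolding has_rank_iff by blast
    also have "?this \<longleftrightarrow> nondeg Ir (pc_two_form A k S L (ch r \<psi>) (param (ch r \<psi>) v'))"
    proof (rule nondeg_cong)
      fix a b :: "nat \<times> 'n" assume a: "a \<in> Ir" and b: "b \<in> Ir"
      show "- ext_d1 \<theta> (ch r \<psi>) p b a = pc_two_form A k S L (ch r \<psi>) (param (ch r \<psi>) v') b a"
        unfolding two_form_loc[OF c \<psi> v' a b] pv'[symmetric] using ext_d1_loc[OF W \<psi> v' b a eq[OF \<psi>]] by simp
    qed
    finally show "nondeg UNIV (hess L \<psi> (trunc k v))"
      unfolding nondeg_loc_iff[OF c \<psi> v'] tr .
  qed
  then show "regular_lagrangian A k S U L"
    unfolding regular_lagrangian_def r_def[symmetric] using U L by simp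
qed

text \<open>The domain \<open>W'\<close> is a box around \<open>p\<close> in one chart: convex, so that the Poincare lemma applies and functions with
  vanishing derivatives in the coordinates of order greater than \<open>k\<close> do not depend on them. The projection
  of the box is the domain of \<open>L\<close>. If \<open>W\<close> consists of whole fibres (the case \<open>full\<close>), then the coordinates of order
  greater than \<open>k\<close> are left unrestricted, so that \<open>W'\<close> consists of whole fibres too. This is needed
  because a Lagrangian semispray has to satisfy its condition on all jets over the domain of \<open>L\<close>.\<close>

lemma local_lagrangian:
  assumes W: "open_set Ir Ar W" and lf: "lagrangian_form A k S W \<theta>" and p: "p \<in> W"
    and full: "full \<Longrightarrow> W = jets_over A r k U0"
  shows "\<exists>W' U L. open_set Ir Ar W' \<and> p \<in> W' \<and> W' \<subseteq> W \<and> W' \<subseteq> jets_over A r k U \<and>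
    regular_lagrangian A k S U L \<and> eq_on Ir Ar W' \<theta> (pc_one_form A k S L) \<and>
    geodesics_solve_EL A k S W' L \<and> (full \<longrightarrow> jets_over A r k U \<subseteq> W')"
proof -
  have sb: "semi_basic A r k W \<theta>" and rank: "has_rank Ir Ar W (ext_d1 \<theta>) (2 * k * CARD('n))"
    and cl: "closed1 Ir Ar W (lie Ir S \<theta>)"
    using lf unfolding lagrangian_form_def r_def[symmetric] by auto
  have one: "one_form Ir Ar W \<theta>" using sb by (simp add: semi_basic_def)
  obtain \<phi> where \<phi>: "\<phi> \<in> A" and pc: "p \<in> cdom (ch r \<phi>)"
    using TJ_chart p W unfolding open_set_iff by blast
  interpret s: spray_domain r "chart_dom r \<phi> W" "loc r \<phi> S" by (rule spray[OF W \<phi>])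
  define v0 where "v0 = coords (ch r \<phi>) p"
  have v0: "v0 \<in> chart_dom r \<phi> W" unfolding v0_def by (rule coords_in_chart_dom[OF p pc])
  obtain d where d: "d > 0" "cube Ir v0 d \<subseteq> chart_dom r \<phi> W" using s.dom_cube[OF v0] by auto

  \<comment> \<open>The box around the point, which contains whole fibres if the domain does.\<close>
  define K where "K = (if full then Ik else Ir)"
  define B where "B = {v \<in> coord_space Ir. \<forall>a\<in>K. \<bar>v a - v0 a\<bar> < d}"
  define Bk where "Bk = {w \<in> coord_space Ik. \<forall>a\<in>Ik. \<bar>w a - v0 a\<bar> < d}"
  define \<sigma> where "\<sigma> = (\<lambda>(w :: nat \<times> 'n \<Rightarrow> real) a. if fst a \<le> k then w a else v0 a)"
  have IkK: "Ik \<subseteq> K" "K \<subseteq> Ir" using k_le_r by (auto simp: K_def jet_idx_def)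
  have v0c: "v0 \<in> coord_space Ir" by (rule s.dom_coord[OF v0])
  have sig: "\<sigma> w \<in> cube Ir v0 d" if "\<And>a. a \<in> Ik \<Longrightarrow> \<bar>w a - v0 a\<bar> < d" for w
    using that v0c d(1) k_le_r by (auto simp: \<sigma>_def cube_def coord_space_def jet_idx_def)
  have cubeB: "cube Ir v0 d \<subseteq> B" using IkK by (auto simp: cube_def B_def)
  have BW: "B \<subseteq> chart_dom r \<phi> W"
  proof
    fix v assume v: "v \<in> B"
    show "v \<in> chart_dom r \<phi> W"
    proof (cases full)
      case False
      then have "v \<in> cube Ir v0 d" using v by (simp add: B_def K_def cube_def)
      then show ?thesis using d(2) by auto
    next
      case True
      have "\<sigma> v \<in> chart_dom r \<phi> W" using sig[of v] v d(2) IkK by (auto simp: B_def)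
      moreover have "trunc k (\<sigma> v) = trunc k v" by (auto simp: \<sigma>_def trunc_def)
      moreover have "base (\<sigma> v) = base v" by (auto simp: \<sigma>_def base_def)
      ultimately show ?thesis
        using v unfolding full[OF True] chart_dom_jets_over[OF \<phi>] by (simp add: over_def B_def)
    qed
  qed
  have Bo: "B \<subseteq> over r (img \<phi>)" using BW chart_dom_over[OF \<phi>] by blast
  have openB: "openin (top_of_set (coord_space I)) {v \<in> coord_space I. \<forall>a\<in>J. \<bar>v a - v0 a\<bar> < d}"
    if "finite J" for I J :: "(nat \<times> 'n) set"
  proof -
    have "open (\<Inter>a\<in>J. {v :: nat \<times> 'n \<Rightarrow> real. \<bar>v a - v0 a\<bar> < d})"
      using that by (intro open_INT ballI open_Collect_less continuous_intros continuous_on_coord) auto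
    moreover have "{v \<in> coord_space I. \<forall>a\<in>J. \<bar>v a - v0 a\<bar> < d} = coord_space I \<inter> (\<Inter>a\<in>J. {v. \<bar>v a - v0 a\<bar> < d})"
      by auto
    ultimately show ?thesis by (auto simp: openin_open)
  qed
  interpret b: coord_domain Ir B
    using openB[of K Ir] finite_subset[OF IkK(2) finite_jet_idx] finite_jet_idx
    by unfold_locales (auto simp: B_def)
  interpret bk: coord_domain Ik Bk
    using openB[of Ik Ik] finite_jet_idx by unfold_locales (auto simp: Bk_def)
  have trB: "trunc k v \<in> Bk" if "v \<in> B" for v
  proof -
    have "\<forall>a\<in>Ik. \<bar>v a - v0 a\<bar> < d" using that IkK(1) unfolding B_def by blast
    then show ?thesis by (auto simp: Bk_def trunc_def coord_space_def jet_idx_def)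
  qed
  have sigB: "\<sigma> w \<in> B" if "w \<in> Bk" for w
    using sig[of w] that cubeB by (auto simp: Bk_def)
  have trsig: "trunc k (\<sigma> w) = w" if "w \<in> Bk" for w
    using that by (auto simp: Bk_def trunc_def \<sigma>_def coord_space_def jet_idx_def fun_eq_iff)
  have Bko: "Bk \<subseteq> over k (img \<phi>)"
  proof
    fix w assume w: "w \<in> Bk"
    have "trunc k (\<sigma> w) \<in> over k (img \<phi>)" using trunc_over sigB[OF w] Bo by blast
    then show "w \<in> over k (img \<phi>)" using trsig[OF w] by simp
  qed

  \<comment> \<open>A primitive on the box.\<close>
  define \<eta> where "\<eta> = (\<lambda>a v. loc r \<phi> (lie Ir S \<theta>) v a)"
  have lie1: "one_form Ir Ar W (lie Ir S \<theta>)" by (rule one_form_lie[OF W one S_vector_field[OF W]])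
  have \<eta>s: "smooth_on Ir (chart_dom r \<phi> W) (\<eta> a)" if "a \<in> Ir" for a
    using lie1 \<phi> that unfolding one_form_iff local_smooth_def \<eta>_def by blast
  have "\<exists>P. smooth_on Ir B P \<and> (\<forall>a\<in>Ir. \<forall>v\<in>B. pd a P v = \<eta> a v)"
  proof (rule b.closed_imp_exact[where p = v0])
    fix v and t :: real assume v: "v \<in> B" and t: "0 \<le> t" "t \<le> 1"
    have "\<bar>t * (v a - v0 a)\<bar> < d" if "a \<in> K" for a
    proof -
      have "\<bar>t * (v a - v0 a)\<bar> \<le> 1 * \<bar>v a - v0 a\<bar>" unfolding abs_mult using t by (intro mult_right_mono) auto
      also have "\<dots> < d" using v that by (simp add: B_def)
      finally show ?thesis .
    qed
    then show "(\<lambda>a. v0 a + t * (v a - v0 a)) \<in> B" using v v0c by (auto simp: B_def coord_space_def)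
  next
    fix a :: "nat \<times> 'n" assume "a \<in> Ir"
    then show "smooth_on Ir B (\<eta> a)" by (rule smooth_on_subset[OF \<eta>s BW])
  next
    fix a b :: "nat \<times> 'n" and v assume a: "a \<in> Ir" and b: "b \<in> Ir" and v: "v \<in> B"
    have vW: "v \<in> chart_dom r \<phi> W" using BW v by auto
    have "param (ch r \<phi>) v \<in> W" "param (ch r \<phi>) v \<in> cdom (ch r \<phi>)"
      using vW Bo v coords_param_jet(2)[OF \<phi>] by (auto simp: chart_dom_iff[OF \<phi>])
    then have "ext_d1 (lie Ir S \<theta>) (ch r \<phi>) (param (ch r \<phi>) v) a b = 0"
      using cl \<phi> a b unfolding closed1_def ball_atlas by blast
    moreover have "ext_d1 (lie Ir S \<theta>) (ch r \<phi>) (param (ch r \<phi>) v) a b = pd a (\<eta> b) v - pd b (\<eta> a) v"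
      using ext_d1_loc[OF W \<phi> vW a b, of "lie Ir S \<theta>" "\<lambda>w c. \<eta> c w"] by (simp add: \<eta>_def)
    ultimately show "pd a (\<eta> b) v = pd b (\<eta> a) v" by simp
  qed
  then obtain P where P: "smooth_on Ir B P" and dP: "\<And>a v. a \<in> Ir \<Longrightarrow> v \<in> B \<Longrightarrow> pd a P v = \<eta> a v" by blast

  \<comment> \<open>It does not depend on the coordinates of order greater than \<open>k\<close>.\<close>
  have Pk: "P v = P (\<sigma> (trunc k v))" if v: "v \<in> B" for v
  proof -
    \<comment> \<open>Move to the point with the same coordinates up to order \<open>k\<close> and the remaining ones of \<open>v0\<close>.\<close>
    define z where "z = \<sigma> (trunc k v)"
    define seg where "seg = (\<lambda>t::real. \<lambda>a. z a + t * (v a - z a))"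
    have zB: "z \<in> B" unfolding z_def by (intro sigB trB v)
    have segB: "seg t \<in> B" if t: "t \<in> {0..1}" for t
    proof -
      have "\<bar>seg t a - v0 a\<bar> < d" if a: "a \<in> K" for a
      proof (cases "fst a \<le> k")
        case True
        then have "z a = v a" by (simp add: z_def \<sigma>_def trunc_def)
        then show ?thesis using v a by (simp add: seg_def B_def)
      next
        case False
        then have "seg t a - v0 a = t * (v a - v0 a)" by (simp add: seg_def z_def \<sigma>_def)
        then have "\<bar>seg t a - v0 a\<bar> \<le> 1 * \<bar>v a - v0 a\<bar>"
          using t by (auto simp: abs_mult intro!: mult_left_le_one_le)
        also have "\<dots> < d" using v a by (simp add: B_def)
        finally show ?thesis .
      qed
      then show ?thesis using v zB by (auto simp: B_def coord_space_def seg_def)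
    qed
    have "\<exists>e. \<forall>t\<in>{0..1}. P (seg t) = e"
    proof (rule has_field_derivative_zero_constant)
      fix t :: real assume t: "t \<in> {0..1}"
      have "((\<lambda>t. P (seg t)) has_real_derivative (\<Sum>a\<in>Ir. pd a P (seg t) * (v a - z a))) (at t within {0..1})"
      proof (rule b.chain_curve[OF b.smooth_C1[OF P], of seg t])
        show "seg t \<in> B" by (rule segB[OF t])
        show "eventually (\<lambda>s. seg s \<in> coord_space Ir) (at t within {0..1})"
          unfolding eventually_at using segB b.dom_coord by (intro exI[of _ 1]) auto
        show "((\<lambda>s. seg s a) has_real_derivative v a - z a) (at t within {0..1})" for a
          unfolding seg_def by (auto intro!: derivative_eq_intros)
      qed
      also have "(\<Sum>a\<in>Ir. pd a P (seg t) * (v a - z a)) = 0"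
      proof (intro sum.neutral ballI)
        fix a :: "nat \<times> 'n" assume a: "a \<in> Ir"
        show "pd a P (seg t) * (v a - z a) = 0"
        proof (cases "fst a \<le> k")
          case True
          then show ?thesis by (simp add: z_def \<sigma>_def trunc_def)
        next
          case False
          then show ?thesis
            using dP[OF a segB[OF t]] semi_basic_lie_loc(2)[OF W sb \<phi> _ a, of "seg t"] segB[OF t] BW
            by (auto simp: \<eta>_def)
        qed
      qed
      finally show "((\<lambda>t. P (seg t)) has_field_derivative 0) (at t within {0..1})" .
    qed simp
    then have "P (seg 1) = P (seg 0)" by auto
    moreover have "seg 1 = v" "seg 0 = z" by (auto simp: seg_def)
    ultimately show ?thesis by (simp add: z_def)
  qed

  \<comment> \<open>The Lagrangian and its domain.\<close>
  define W' where "W' = param (ch r \<phi>) ` B"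
  define U where "U = param (ch k \<phi>) ` Bk"
  define L where "L = (\<lambda>j. P (\<sigma> (coords (ch k \<phi>) j)))"
  have W': "open_set Ir Ar W'" unfolding W'_def by (rule param_image_open(1)[OF \<phi> b.coord_domain_axioms Bo])
  have U: "open_set Ik Ak U" unfolding U_def by (rule param_image_open(1)[OF \<phi> bk.coord_domain_axioms Bko])
  have ldW': "chart_dom r \<phi> W' = B" unfolding W'_def by (rule chart_dom_param_image[OF \<phi> Bo])
  have "v0 \<in> B" using cubeB cube_center[OF v0c d(1)] by blast
  then have pW': "p \<in> W'" unfolding W'_def
    using param_coords_jet[OF \<phi> pc] by (intro image_eqI[of _ _ v0]) (simp_all add: v0_def)
  have W'W: "W' \<subseteq> W" using BW by (auto simp: W'_def chart_dom_iff[OF \<phi>])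
  have W'c: "W' \<subseteq> cdom (ch r \<phi>)" using Bo coords_param_jet(2)[OF \<phi>] by (auto simp: W'_def)
  have projB: "jet_proj A k (param (ch r \<phi>) v) = param (ch k \<phi>) (trunc k v)" if "v \<in> B" for v
    using proj_param[OF \<phi> _ k_le_r] that Bo by blast
  have sub: "W' \<subseteq> jets_over A r k U"
  proof
    fix q assume q: "q \<in> W'"
    then obtain v where v: "v \<in> B" "q = param (ch r \<phi>) v" by (auto simp: W'_def)
    have "q \<in> TJ A r" using q W' by (auto simp: open_set_iff)
    then show "q \<in> jets_over A r k U"
      using projB[OF v(1)] v trB[OF v(1)] by (auto simp: jets_over_def U_def)
  qed
  have onto: "\<exists>p\<in>W'. jet_proj A k p = q" if q: "q \<in> U" for q
  proof -
    obtain w where w: "w \<in> Bk" "q = param (ch k \<phi>) w" using q by (auto simp: U_def)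
    then show ?thesis using projB[OF sigB[OF w(1)]] sigB[OF w(1)] trsig[OF w(1)]
      by (intro bexI[of _ "param (ch r \<phi>) (\<sigma> w)"]) (auto simp: W'_def)
  qed
  have U_ne: "U \<noteq> {}" using pW' sub by (auto simp: jets_over_def)
  have L: "smooth_function Ik Ak U L"
    unfolding smooth_function_def ball_atlas chart_smooth_iff
  proof
    fix \<psi> assume \<psi>: "\<psi> \<in> A"
    have e: "chart_dom k \<psi> U = {w \<in> over k (ovl \<psi> \<phi>). jet_transition k \<psi> \<phi> w \<in> Bk}"
      unfolding U_def by (rule param_image_open(2)[OF \<phi> bk.coord_domain_axioms Bko \<psi>])
    interpret o: coord_domain Ik "chart_dom k \<psi> U" by (rule coord_domain_chart_dom[OF U \<psi>])
    have 1: "smooth_on Ik Bk (\<lambda>w. P (\<sigma> w))"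
    proof (rule bk.smooth_compose[OF b.coord_domain_axioms P sigB])
      fix a show "smooth_on Ik Bk (\<lambda>v. \<sigma> v a)" by (cases "fst a \<le> k") (auto simp: \<sigma>_def)
    qed
    have "smooth_on Ik (chart_dom k \<psi> U) (\<lambda>w. P (\<sigma> (jet_transition k \<psi> \<phi> w)))"
    proof (rule o.smooth_compose[OF bk.coord_domain_axioms 1, of "jet_transition k \<psi> \<phi>"])
      fix a show "smooth_on Ik (chart_dom k \<psi> U) (\<lambda>v. jet_transition k \<psi> \<phi> v a)"
        by (rule smooth_on_subset[OF jet_transition_smooth[OF \<psi> \<phi>]]) (auto simp: e)
    qed (auto simp: e)
    then show "smooth_on Ik (chart_dom k \<psi> U) (\<lambda>v. L (param (ch k \<psi>) v))"
      by (rule o.smooth_cong) (simp add: L_def e jet_transition_param(1)[OF \<psi> \<phi>])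
  qed
  note c = W' sub U L
  have LP: "Lc L \<phi> v = P v" if v: "v \<in> B" for v
    using coords_param_jet(1)[OF \<phi>] Bko trB[OF v] Pk[OF v] by (auto simp: Lc_def L_def)
  have dL: "eq_on Ir Ar W' (lie Ir S \<theta>) (ext_d0 (pullback A k L))"
    unfolding eq_on_loc[OF c]
  proof (intro ballI)
    fix \<psi> w and a :: "nat \<times> 'n" assume \<psi>: "\<psi> \<in> A" and w: "w \<in> chart_dom r \<psi> W'" and a: "a \<in> Ir"
    show "loc r \<psi> (lie Ir S \<theta>) w a = loc r \<psi> (ext_d0 (pullback A k L)) w a"
    proof (rule one_form_eq_from_chart[OF one_form_mono[OF lie1 W'W] pullback_one_form[OF c] W' \<phi> W'c _ \<psi> w a])
      fix v and a :: "nat \<times> 'n" assume v: "v \<in> chart_dom r \<phi> W'" and a: "a \<in> Ir"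
      have vB: "v \<in> B" using v ldW' by simp
      have "pd a (Lc L \<phi>) v = pd a P v" by (rule b.pd_cong[OF vB a LP])
      then show "loc r \<phi> (lie Ir S \<theta>) v a = loc r \<phi> (ext_d0 (pullback A k L)) v a"
        using loc_pullback[OF c \<phi> v a] dP[OF a vB] by (simp add: \<eta>_def)
    qed
  qed
  have sb': "semi_basic A r k W' \<theta>"
    using sb one_form_mono[OF _ W'W] chart_dom_mono[OF W'W] unfolding semi_basic_iff by blast
  have rank': "has_rank Ir Ar W' (ext_d1 \<theta>) (2 * k * CARD('n))"
    using rank W'W unfolding has_rank_iff by blast
  note res = lagrangian_of_form[OF W' sb' rank' U U_ne L sub onto dL]
  have "jets_over A r k U \<subseteq> W'" if full
  proof
    fix q assume "q \<in> jets_over A r k U"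
    then have q: "q \<in> TJ A r" "jet_proj A k q \<in> U" by (auto simp: jets_over_def)
    then obtain w where w: "w \<in> Bk" "jet_proj A k q = param (ch k \<phi>) w" by (auto simp: U_def)
    note cw = coords_param_jet[OF \<phi> Bko[THEN subsetD, OF w(1)]]
    have qc: "q \<in> cdom (ch r \<phi>)" using proj_cdom[OF q(1), of k \<phi>] w(2) cw(2) by simp
    define v where "v = coords (ch r \<phi>) q"
    have tv: "trunc k v = w" using proj_coords[OF \<phi> qc k_le_r] w(2) cw(1) by (simp add: v_def)
    have "v \<in> coord_space Ir" using coords_jet_in[OF qc] by (simp add: v_def over_def)
    moreover have "\<bar>v a - v0 a\<bar> < d" if "a \<in> Ik" for a
    proof -
      have "v a = w a" using that by (auto simp: tv[symmetric] trunc_def jet_idx_def)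
      then show ?thesis using w(1) that by (simp add: Bk_def)
    qed
    ultimately have "v \<in> B" using \<open>full\<close> by (simp add: B_def K_def)
    then show "q \<in> W'" unfolding W'_def
      using param_coords_jet[OF \<phi> qc] by (intro image_eqI[of _ _ v]) (simp_all add: v_def)
  qed
  then show ?thesis using W' pW' W'W sub res by blast
qed

lemma lagrangian_semispray_iff:
  "lagrangian_semispray A k S \<longleftrightarrow> (\<exists>U L. regular_lagrangian A k S U L \<and>
     eq_on Ir Ar (jets_over A r k U) (lie Ir S (pc_one_form A k S L)) (ext_d0 (pullback A k L)))"
proof -
  have "geodesics_solve_EL A k S (jets_over A r k U) L \<longleftrightarrow>
    eq_on Ir Ar (jets_over A r k U) (lie Ir S (pc_one_form A k S L)) (ext_d0 (pullback A k L))"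
    if "regular_lagrangian A k S U L" for U L
  proof -
    have U: "open_set Ik Ak U" and L: "smooth_function Ik Ak U L"
      using that by (auto simp: regular_lagrangian_def)
    note c = open_jets_over[OF U] order_refl U L
    show ?thesis unfolding geodesics_solve_EL_iff[OF c] lie_equation_iff[OF c] ..
  qed
  then show ?thesis using S unfolding lagrangian_semispray_def r_def[symmetric] by blast
qed

lemma lie_iff_hamilton:
  assumes "regular_lagrangian A k S U L"
  shows "eq_on Ir Ar (jets_over A r k U) (lie Ir S (pc_one_form A k S L)) (ext_d0 (pullback A k L)) \<longleftrightarrow>
    eq_on Ir Ar (jets_over A r k U) (interior_prod Ir S (pc_two_form A k S L)) (ext_d0 (pc_energy A k S L))"
proof -
  have U: "open_set Ik Ak U" and L: "smooth_function Ik Ak U L"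
    using assms by (auto simp: regular_lagrangian_def)
  show ?thesis unfolding hamilton_equation_iff[OF open_jets_over[OF U] order_refl U L] ..
qed

text \<open>A form on all jets over \<open>U\<close> gives a Lagrangian near any of them, by the case of whole fibres in
  \<open>local_lagrangian\<close>.\<close>

lemma lagrangian_semispray_iff_form:
  "lagrangian_semispray A k S \<longleftrightarrow> (\<exists>U \<theta>. open_set Ik Ak U \<and> U \<noteq> {} \<and>
     lagrangian_form A k S (jets_over A r k U) \<theta>)"
proof
  assume "lagrangian_semispray A k S"
  then show "\<exists>U \<theta>. open_set Ik Ak U \<and> U \<noteq> {} \<and> lagrangian_form A k S (jets_over A r k U) \<theta>"
    using form_of_lagrangian unfolding lagrangian_semispray_iff by (auto simp: regular_lagrangian_def)
next
  assume "\<exists>U \<theta>. open_set Ik Ak U \<and> U \<noteq> {} \<and> lagrangian_form A k S (jets_over A r k U) \<theta>"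
  then obtain U \<theta> q where U: "open_set Ik Ak U" and q: "q \<in> U"
    and \<theta>: "lagrangian_form A k S (jets_over A r k U) \<theta>" by blast
  have "q \<in> TJ A k" using U q by (auto simp: open_set_iff)
  then obtain p where "p \<in> TJ A r" "jet_proj A k p = q" using proj_surj k_le_r by blast
  then have p: "p \<in> jets_over A r k U" using q by (simp add: jets_over_def)
  obtain W' U' L where "W' \<subseteq> jets_over A r k U'" "jets_over A r k U' \<subseteq> W'"
    "regular_lagrangian A k S U' L" "geodesics_solve_EL A k S W' L"
    using local_lagrangian[OF open_jets_over[OF U] \<theta> p, of True U] by auto
  then show "lagrangian_semispray A k S"
    using S unfolding lagrangian_semispray_def r_def[symmetric] by (metis subset_antisym)
qed

end

section \<open>The characterization of Lagrangian semisprays\<close>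

theorem theorem3p4:
  fixes A :: "('m::{t2_space,second_countable_topology}, 'n::finite) chart set"
    and k :: nat
    and S :: "('m jet, nat \<times> 'n) comps1"
  assumes "smooth_manifold A"
    and "k \<ge> 1"
    and "semispray A (2 * k - 1) S"
  shows
    "let r = 2 * k - 1; I = jet_idx r; \<A> = jet_atlas A r;
         cond1 = (\<lambda>U L. eq_on I \<A> (jets_over A r k U)
                    (lie I S (pc_one_form A k S L)) (ext_d0 (pullback A k L)));
         cond2 = (\<lambda>U L. eq_on I \<A> (jets_over A r k U)
                    (interior_prod I S (pc_two_form A k S L)) (ext_d0 (pc_energy A k S L)))
     in
       \<comment> \<open>(i)\<close>
       (lagrangian_semispray A k S \<longleftrightarrow> (\<exists>U L. regular_lagrangian A k S U L \<and> cond1 U L)) \<and>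
       (lagrangian_semispray A k S \<longleftrightarrow> (\<exists>U L. regular_lagrangian A k S U L \<and> cond2 U L)) \<and>
       (\<forall>U L. regular_lagrangian A k S U L \<longrightarrow> (cond1 U L \<longleftrightarrow> cond2 U L)) \<and>
       \<comment> \<open>(ii)\<close>
       (lagrangian_semispray A k S \<longleftrightarrow>
         (\<exists>U \<theta>. open_set (jet_idx k) (jet_atlas A k) U \<and> U \<noteq> {} \<and>
            lagrangian_form A k S (jets_over A r k U) \<theta>)) \<and>
       (\<forall>W \<theta>. open_set I \<A> W \<and> lagrangian_form A k S W \<theta> \<longrightarrow>
         (\<forall>p\<in>W. \<exists>W' U L. open_set I \<A> W' \<and> p \<in> W' \<and> W' \<subseteq> W \<and> W' \<subseteq> jets_over A r k U \<and>
            regular_lagrangian A k S U L \<and> eq_on I \<A> W' \<theta> (pc_one_form A k S L) \<and>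
            geodesics_solve_EL A k S W' L))"
proof -
  interpret mfd_spray A k S "2 * k - 1"
    using assms by unfold_locales auto
  have "\<exists>W' U L. open_set Ir Ar W' \<and> p \<in> W' \<and> W' \<subseteq> W \<and> W' \<subseteq> jets_over A (2 * k - 1) k U \<and>
      regular_lagrangian A k S U L \<and> eq_on Ir Ar W' \<theta> (pc_one_form A k S L) \<and> geodesics_solve_EL A k S W' L"
    if "open_set Ir Ar W" "lagrangian_form A k S W \<theta>" "p \<in> W" for W \<theta> p
    using local_lagrangian[OF that, of False undefined] by simp
  moreover have "lagrangian_semispray A k S \<longleftrightarrow> (\<exists>U L. regular_lagrangian A k S U L \<and>
     eq_on Ir Ar (jets_over A (2 * k - 1) k U) (interior_prod Ir S (pc_two_form A k S L)) (ext_d0 (pc_energy A k S L)))"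
    using lagrangian_semispray_iff lie_iff_hamilton by blast
  ultimately show ?thesis
    unfolding Let_def using lagrangian_semispray_iff lie_iff_hamilton lagrangian_semispray_iff_form by blast
qed

end
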